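(* Suppose that the spectral densities $S^{(N)}$ satisfy Assumptions A1, A2 and A3 stated in the context. Let $\beta\in(0,1)$. Then, for each $z\in\mathbb C\setminus\{0\}$, there exist two positive constants $c$ and $C$ and an integer $N_0$ such that for all $N\ge N_0$ and all integers $k$ with $\lfloor N^\beta\rfloor\le k\le\lfloor N/2\rfloor$ ($N_0$ being independent of $k$), $$\mathbb P\left[ s_{N-k-1}(\widehat R^{(N)}_L - zI_N) \leq C \sqrt{k} / N \right] \leq \exp(- c\, k ).$$
   Context: Notation: $M^*$ is the conjugate transpose; $\|\cdot\|$ is the spectral norm of a matrix; for $M\in\mathbb C^{N\times N}$, $s_0(M)\ge s_1(M)\ge\cdots\ge s_{N-1}(M)$ are its singular values; $\mathbb T$ is the unit circle of $\mathbb C$; $\mathcal H_+^N$ is the set of $N\times N$ Hermitian nonnegative matrices; $\mathrm{Leb}$ is Lebesgue measure. Setting: for each integer $N\ge1$, $\mathbf x^{(N)}=(\mathbf x^{(N)}_k)_{k\in\mathbb Z}$ is a centered, circularly symmetric complex Gaussian stationary process with values in $\mathbb C^N$. Let $R^{(N)}_L=\mathbb E\,\mathbf x^{(N)}_L(\mathbf x^{(N)}_0)^*$. There is an integrable function $S^{(N)}:\mathbb T\to\mathcal H^N_+$ (the spectral density) with $R^{(N)}_L=\frac1{2\pi}\int_0^{2\pi}e^{-\imath L\theta}S^{(N)}(e^{\imath\theta})\,d\theta$ for all $L\in\mathbb Z$, and it is non-trivial: $\int_0^{2\pi}p(e^{\imath\theta})^*S^{(N)}(e^{\imath\theta})p(e^{\imath\theta})\,d\theta>0$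 for each non-zero $\mathbb C^N$-valued polynomial $p$. $(n_N)_N$ is an increasing sequence of positive integers with $0<\liminf_N N/n_N\le\limsup_N N/n_N<\infty$. For a fixed integer $L\ge1$, the empirical autocovariance matrix is $$\widehat R^{(N)}_L=\frac1{n_N}\sum_{\ell=0}^{n_N-1}\mathbf x^{(N)}_{\ell+L}\,(\mathbf x^{(N)}_\ell)^*\in\mathbb C^{N\times N},$$ where the index $\ell+L$ is taken modulo $n_N$. Assumption A1: (i) for any $\varepsilon>0$ there is $h>0$ such that $\sup_N \sup_\theta\sup_{|\psi|\le h}\|S^{(N)}(e^{\imath(\theta+\psi)})-S^{(N)}(e^{\imath\theta})\|<\varepsilon$; (ii) $\sup_N\max_\theta\|S^{(N)}(e^{\imath\theta})\|<\infty$; (iii) $\inf_N s_{N-1}(R^{(N)}_0)>0$. Assumption A2: for any $\kappa\in(0,1)$ there is $\delta>0$ such that $\sup_N\mathrm{Leb}\{z\in\mathbb T: s_{N-1}(S^{(N)}(z))\le\delta\}\le\kappa$. Assumption A3: $\frac1N\int_0^{2\pi}\log s_{N-1}(S^{(N)}(e^{\imath\theta}))\,d\theta\to0$ as $N\to\infty$. *)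

theory Defs
  imports "HOL-Probability.Probability" "Jordan_Normal_Form.Schur_Decomposition"
begin

text \<open>
  The dimension \<open>N\<close> varies, so vectors and matrices are the carrier-based ones of
  \<open>Jordan_Normal_Form\<close>; the notation of \<open>HOL-Analysis\<close> for type-indexed vectors is switched off.
\<close>

no_notation vec_nth (infixl "$" 90)

type_synonym cvector = "complex Matrix.vec"
type_synonym cmatrix = "complex Matrix.mat"


section \<open>Matrices\<close>

text \<open>
  \<open>sing_val A i\<close> is \<open>s\<^sub>i(A)\<close>: the square roots of the eigenvalues of \<open>A\<^sup>* A\<close>, listed with
  algebraic multiplicity in nonincreasing order and indexed from 0. These eigenvalues are real and
  nonnegative, so taking the real part loses nothing. Only \<open>i < dim_col A\<close> is meaningful.
\<close>
definition sing_vals :: "cmatrix \<Rightarrow> real list" where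
  "sing_vals A = rev (sorted_list_of_multiset
     (image_mset (\<lambda>e. sqrt (Re e)) (proots (char_poly (mat_adjoint A * A)))))"

definition sing_val :: "cmatrix \<Rightarrow> nat \<Rightarrow> real" where
  "sing_val A i = sing_vals A ! i"

definition cvec_norm :: "cvector \<Rightarrow> real" where
  "cvec_norm v = L2_set (\<lambda>i. cmod (v $ i)) {..<dim_vec v}"

definition spectral_norm :: "cmatrix \<Rightarrow> real" where
  "spectral_norm A = (SUP v\<in>{v \<in> carrier_vec (dim_col A). cvec_norm v \<le> 1}. cvec_norm (A *\<^sub>v v))"

text \<open>\<open>qform A v\<close> is \<open>v\<^sup>* A v\<close>.\<close>
definition qform :: "cmatrix \<Rightarrow> cvector \<Rightarrow> complex" where
  "qform A v = scalar_prod (A *\<^sub>v v) (conjugate v)"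

definition hermitian_nonneg :: "nat \<Rightarrow> cmatrix set" where
  "hermitian_nonneg N =
     {A \<in> carrier_mat N N. mat_adjoint A = A \<and> (\<forall>v\<in>carrier_vec N. 0 \<le> Re (qform A v))}"


section \<open>Gaussian processes\<close>

text \<open>Degenerate (almost surely constant) variables count as Gaussian.\<close>
definition real_gaussian :: "'a measure \<Rightarrow> ('a \<Rightarrow> real) \<Rightarrow> bool" where
  "real_gaussian M Y \<longleftrightarrow> Y \<in> borel_measurable M \<and>
     ((\<exists>\<mu>. AE \<omega> in M. Y \<omega> = \<mu>) \<or>
      (\<exists>\<mu> \<sigma>. \<sigma> > 0 \<and> distributed M lborel Y (\<lambda>t. ennreal (normal_density \<mu> \<sigma> t))))"

text \<open>The law, on the product space over all times and coordinates, of a \<open>\<complex>\<^sup>N\<close>-valued process.\<close>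
definition process_law ::
  "'a measure \<Rightarrow> nat \<Rightarrow> (int \<Rightarrow> 'a \<Rightarrow> cvector) \<Rightarrow> (int \<times> nat \<Rightarrow> complex) measure" where
  "process_law M N x =
     distr M (\<Pi>\<^sub>M _ \<in> UNIV \<times> {..<N}. borel) (\<lambda>\<omega>. \<lambda>(k, i)\<in>UNIV \<times> {..<N}. x k \<omega> $ i)"

text \<open>
  Since \<open>a\<close> ranges over complex coefficients, the real parts below are exactly the finite real
  linear combinations of the real and imaginary parts of the coordinates.
\<close>
definition complex_gaussian_process ::
  "'a measure \<Rightarrow> nat \<Rightarrow> (int \<Rightarrow> 'a \<Rightarrow> cvector) \<Rightarrow> bool" where
  "complex_gaussian_process M N x \<longleftrightarrow>
     (\<forall>k. \<forall>\<omega>\<in>space M. x k \<omega> \<in> carrier_vec N) \<and>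
     (\<forall>k. \<forall>i<N. (\<lambda>\<omega>. x k \<omega> $ i) \<in> borel_measurable M) \<and>
     (\<forall>F a. finite F \<longrightarrow> F \<subseteq> UNIV \<times> {..<N} \<longrightarrow>
        real_gaussian M (\<lambda>\<omega>. Re (\<Sum>(k, i)\<in>F. a (k, i) * x k \<omega> $ i)))"

definition centered_process ::
  "'a measure \<Rightarrow> nat \<Rightarrow> (int \<Rightarrow> 'a \<Rightarrow> cvector) \<Rightarrow> bool" where
  "centered_process M N x \<longleftrightarrow> (\<forall>k. \<forall>i<N. (LINT \<omega>|M. x k \<omega> $ i) = 0)"

definition circularly_symmetric ::
  "'a measure \<Rightarrow> nat \<Rightarrow> (int \<Rightarrow> 'a \<Rightarrow> cvector) \<Rightarrow> bool" where
  "circularly_symmetric M N x \<longleftrightarrow>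
     (\<forall>\<phi>. process_law M N (\<lambda>k \<omega>. cis \<phi> \<cdot>\<^sub>v x k \<omega>) = process_law M N x)"

definition stationary_process ::
  "'a measure \<Rightarrow> nat \<Rightarrow> (int \<Rightarrow> 'a \<Rightarrow> cvector) \<Rightarrow> bool" where
  "stationary_process M N x \<longleftrightarrow>
     (\<forall>m. process_law M N (\<lambda>k. x (k + m)) = process_law M N x)"

text \<open>\<open>autocov M N x m\<close> is \<open>R\<^sub>m = E x\<^sub>m x\<^sub>0\<^sup>*\<close>.\<close>
definition autocov :: "'a measure \<Rightarrow> nat \<Rightarrow> (int \<Rightarrow> 'a \<Rightarrow> cvector) \<Rightarrow> int \<Rightarrow> cmatrix" where
  "autocov M N x m = Matrix.mat N N (\<lambda>(i, j). LINT \<omega>|M. x m \<omega> $ i * cnj (x 0 \<omega> $ j))"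

definition emp_autocov ::
  "nat \<Rightarrow> nat \<Rightarrow> (int \<Rightarrow> 'a \<Rightarrow> cvector) \<Rightarrow> nat \<Rightarrow> 'a \<Rightarrow> cmatrix" where
  "emp_autocov N n x L \<omega> = Matrix.mat N N (\<lambda>(i, j).
     1 / of_nat n * (\<Sum>l<n. x (int ((l + L) mod n)) \<omega> $ i * cnj (x (int l) \<omega> $ j)))"


section \<open>Spectral densities\<close>

definition spectral_density :: "nat \<Rightarrow> (int \<Rightarrow> cmatrix) \<Rightarrow> (complex \<Rightarrow> cmatrix) \<Rightarrow> bool" where
  "spectral_density N R S \<longleftrightarrow>
     (\<forall>z\<in>sphere 0 1. S z \<in> hermitian_nonneg N) \<and>
     (\<forall>i<N. \<forall>j<N.
        set_integrable lborel {0..2*pi} (\<lambda>\<theta>. S (cis \<theta>) $$ (i, j)) \<and>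
        (\<forall>m. R m $$ (i, j) =
           1 / (2 * pi) * (LINT \<theta>:{0..2*pi}|lborel. cis (- real_of_int m * \<theta>) * S (cis \<theta>) $$ (i, j))))"

text \<open>\<open>\<complex>\<^sup>N\<close>-valued polynomials are vectors of \<open>N\<close> polynomials.\<close>
definition nontrivial_density :: "nat \<Rightarrow> (complex \<Rightarrow> cmatrix) \<Rightarrow> bool" where
  "nontrivial_density N S \<longleftrightarrow>
     (\<forall>p \<in> carrier_vec N. p \<noteq> 0\<^sub>v N \<longrightarrow>
        (LINT \<theta>:{0..2*pi}|lborel. Re (qform (S (cis \<theta>)) (map_vec (\<lambda>q. poly q (cis \<theta>)) p))) > 0)"

text \<open>
  Suprema and infima over \<open>N \<ge> 1\<close> and over angles are taken in the extended reals, where they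
  always exist. \<open>S N\<close> and \<open>R N\<close> are the objects of dimension \<open>N\<close>.
\<close>
definition assumption_A1 :: "(nat \<Rightarrow> int \<Rightarrow> cmatrix) \<Rightarrow> (nat \<Rightarrow> complex \<Rightarrow> cmatrix) \<Rightarrow> bool" where
  "assumption_A1 R S \<longleftrightarrow>
     (\<forall>\<epsilon>>0. \<exists>h>0. (SUP N\<in>{1..}. SUP \<theta>. SUP \<psi>\<in>{-h..h}.
        ereal (spectral_norm (S N (cis (\<theta> + \<psi>)) - S N (cis \<theta>)))) < ereal \<epsilon>) \<and>
     (SUP N\<in>{1..}. SUP \<theta>. ereal (spectral_norm (S N (cis \<theta>)))) < \<infinity> \<and>
     (INF N\<in>{1..}. ereal (sing_val (R N 0) (N - 1))) > 0"

text \<open>Lebesgue measure on the unit circle is arc length.\<close>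
definition assumption_A2 :: "(nat \<Rightarrow> complex \<Rightarrow> cmatrix) \<Rightarrow> bool" where
  "assumption_A2 S \<longleftrightarrow>
     (\<forall>\<kappa>. 0 < \<kappa> \<and> \<kappa> < 1 \<longrightarrow> (\<exists>\<delta>>0. (SUP N\<in>{1..}.
        emeasure lborel {\<theta> \<in> {0..<2*pi}. sing_val (S N (cis \<theta>)) (N - 1) \<le> \<delta>}) \<le> ennreal \<kappa>))"

text \<open>
  The integral of \<open>log s\<^sub>N\<^sub>-\<^sub>1\<close> may be \<open>-\<infinity>\<close>, which the Bochner integral and the convention
  \<open>ln 0 = 0\<close> would both turn into a finite value. Hence the logarithm and the integral
  (positive part minus negative part) are extended-real valued.
\<close>
definition elog :: "real \<Rightarrow> ereal" where
  "elog t = (if t \<le> 0 then - \<infinity> else ereal (ln t))"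

definition circle_eintegral :: "(real \<Rightarrow> ereal) \<Rightarrow> ereal" where
  "circle_eintegral f =
     enn2ereal (\<integral>\<^sup>+\<theta>\<in>{0..2*pi}. e2ennreal (f \<theta>) \<partial>lborel) -
     enn2ereal (\<integral>\<^sup>+\<theta>\<in>{0..2*pi}. e2ennreal (- f \<theta>) \<partial>lborel)"

definition assumption_A3 :: "(nat \<Rightarrow> complex \<Rightarrow> cmatrix) \<Rightarrow> bool" where
  "assumption_A3 S \<longleftrightarrow>
     (\<lambda>N. ereal (1 / real N) * circle_eintegral (\<lambda>\<theta>. elog (sing_val (S N (cis \<theta>)) (N - 1))))
       \<longlonglongrightarrow> 0"

end

theory Submission
  imports Defs "HOL-Real_Asymp.Real_Asymp"
begin

text \<open>
  Put the samples into an \<open>N \<times> n\<close> matrix \<open>X\<close>, so that the empirical autocovariance is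
  \<open>X J X\<^sup>* / n\<close> with \<open>J\<close> a cyclic shift. Let \<open>A\<close> be the set of frequencies where the least singular
  value of the spectral density exceeds \<open>\<delta>\<close>; by A2 its complement has small measure. Diagonalise the
  \<open>n \<times> n\<close> Toeplitz matrix of the indicator function of \<open>A\<close> and write \<open>X\<close> in its eigenbasis. At least
  \<open>3 n / 4\<close> eigenvalues are at least \<open>1 / 2\<close>, and the columns that belong to them are sums of
  two independent parts, one of which has independent complex Gaussian entries of variance \<open>\<delta> / 2\<close>.

  If \<open>s\<^sub>N\<^sub>-\<^sub>k\<^sub>-\<^sub>1\<close> is small, a unit vector \<open>v\<close> that vanishes on the first \<open>k\<close> coordinates is almost mapped
  to zero. Off an event of probability exponentially small in \<open>n\<close>, the matrix is bounded, and \<open>J X\<^sup>* v\<close>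
  is not concentrated on the remaining columns: there are at most \<open>n / 4\<close> of them, so a net argument
  applies. Hence \<open>J X\<^sup>* v\<close> has a large entry at some good column \<open>l\<close>, and solving the near-kernel
  equation for that column puts it close to the span of \<open>N - k + 1\<close> vectors that do not involve
  column \<open>l\<close>. Conditionally on everything else, a Gaussian small ball estimate in the \<open>k - 1\<close>
  complementary directions bounds the probability by \<open>exp (- 2 (k - 1))\<close>.
\<close>

section \<open>Finite-dimensional complex inner products\<close>

text \<open>The order \<open>sqrt k / N\<close> balances two scales. With
  \<open>Y = X / sqrt n\<close>, a good column has independent parts of variance of order
  \<open>1 / n\<close>, so its distance to a fixed subspace of codimension \<open>k - 1\<close> is
  of order \<open>sqrt (k / n)\<close>. The near-kernel equation is divided by an entry of
  \<open>J Y\<^sup>* v\<close> known only to be of order \<open>1 / sqrt n\<close>, so a residual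
  \<open>t\<close> becomes an error of order \<open>t * sqrt n\<close>. The codimension comes from
  the zeros of \<open>v\<close>: they remove \<open>k\<close> columns from the equation, while one
  further vector carries the single number through which column \<open>l\<close> still enters. The
  net argument is a count of dimensions. If \<open>J Y\<^sup>* v\<close> lives on a set
  \<open>H\<close> of columns, its restriction to \<open>H\<close> determines \<open>v\<close>, and
  the coordinates in the complement \<open>G\<close> become equations. The net costs
  \<open>\<epsilon>\<close> to the power \<open>- 2 * card H\<close>, each equation gains
  \<open>\<epsilon>\<^sup>2\<close>, and \<open>card H \<le> n / 4\<close> leaves
  \<open>\<epsilon>\<close> to the power \<open>n\<close>, which beats any constant to the power
  \<open>n\<close>. The choice of \<open>l\<close> costs a factor \<open>n\<close>, harmless because
  \<open>k\<close> is at least of order \<open>N\<close> to the power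
  \<open>\<beta>\<close>.\<close>

definition l2n :: "'i set \<Rightarrow> ('i \<Rightarrow> complex) \<Rightarrow> real" where
  "l2n I v = L2_set (\<lambda>i. cmod (v i)) I"

definition cinner :: "'i set \<Rightarrow> ('i \<Rightarrow> complex) \<Rightarrow> ('i \<Rightarrow> complex) \<Rightarrow> complex" where
  "cinner I u v = (\<Sum>i\<in>I. u i * cnj (v i))"

definition orthonormal :: "'i set \<Rightarrow> 'k set \<Rightarrow> ('k \<Rightarrow> 'i \<Rightarrow> complex) \<Rightarrow> bool" where
  "orthonormal I K u \<longleftrightarrow> (\<forall>k\<in>K. \<forall>l\<in>K. cinner I (u k) (u l) = (if k = l then 1 else 0))"

lemma l2n_nonneg [simp]: "0 \<le> l2n I v"
  by (simp add: l2n_def)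

lemma l2n_sq: "(l2n I v)\<^sup>2 = (\<Sum>i\<in>I. (cmod (v i))\<^sup>2)"
  by (simp add: l2n_def L2_set_def sum_nonneg)

lemma cinner_self: "cinner I v v = of_real ((l2n I v)\<^sup>2)"
  unfolding cinner_def l2n_sq by (simp add: complex_norm_square[symmetric])

lemma l2n_cong: "(\<And>i. i \<in> I \<Longrightarrow> u i = v i) \<Longrightarrow> l2n I u = l2n I v"
  unfolding l2n_def by (rule L2_set_cong) auto

lemma cinner_cong:
  "(\<And>i. i \<in> I \<Longrightarrow> u i = u' i) \<Longrightarrow> (\<And>i. i \<in> I \<Longrightarrow> v i = v' i) \<Longrightarrow> cinner I u v = cinner I u' v'"
  unfolding cinner_def by (rule sum.cong) auto

lemma l2n_triangle: "l2n I (\<lambda>i. u i + v i) \<le> l2n I u + l2n I v"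
proof -
  have "l2n I (\<lambda>i. u i + v i) \<le> L2_set (\<lambda>i. cmod (u i) + cmod (v i)) I"
    unfolding l2n_def by (rule L2_set_mono) (auto intro: norm_triangle_ineq)
  also have "\<dots> \<le> l2n I u + l2n I v"
    unfolding l2n_def by (rule L2_set_triangle_ineq)
  finally show ?thesis .
qed

lemma l2n_scale: "l2n I (\<lambda>i. c * v i) = cmod c * l2n I v"
  unfolding l2n_def by (simp add: norm_mult L2_set_right_distrib)

lemma l2n_minus: "l2n I (\<lambda>i. - v i) = l2n I v"
  by (simp add: l2n_def)

lemma l2n_triangle_diff: "l2n I (\<lambda>i. u i - v i) \<le> l2n I u + l2n I v"
  using l2n_triangle[of I u "\<lambda>i. - v i"] by (simp add: l2n_minus)

lemma l2n_sum: "finite K \<Longrightarrow> l2n I (\<lambda>i. \<Sum>k\<in>K. u k i) \<le> (\<Sum>k\<in>K. l2n I (u k))"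
proof (induction K rule: finite_induct)
  case empty
  then show ?case by (simp add: l2n_def L2_set_def)
next
  case (insert k K)
  then have "l2n I (\<lambda>i. \<Sum>k\<in>insert k K. u k i) = l2n I (\<lambda>i. u k i + (\<Sum>k\<in>K. u k i))"
    by simp
  also have "\<dots> \<le> l2n I (u k) + l2n I (\<lambda>i. \<Sum>k\<in>K. u k i)"
    by (rule l2n_triangle)
  finally show ?case using insert by simp
qed

lemma l2n_eq_0: "finite I \<Longrightarrow> l2n I v = 0 \<longleftrightarrow> (\<forall>i\<in>I. v i = 0)"
  by (simp add: l2n_def L2_set_eq_0_iff)

lemma l2n_mono: "finite I \<Longrightarrow> J \<subseteq> I \<Longrightarrow> l2n J v \<le> l2n I v"
  by (rule power2_le_imp_le) (auto simp: l2n_sq intro!: sum_mono2)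

lemma norm_le_l2n: "finite I \<Longrightarrow> i \<in> I \<Longrightarrow> cmod (v i) \<le> l2n I v"
  unfolding l2n_def by (rule member_le_L2_set) 

lemma cmod_cinner_le: "cmod (cinner I u v) \<le> l2n I u * l2n I v"
proof -
  have "cmod (cinner I u v) \<le> (\<Sum>i\<in>I. \<bar>cmod (u i)\<bar> * \<bar>cmod (v i)\<bar>)"
    unfolding cinner_def by (rule order_trans[OF norm_sum]) (simp add: norm_mult)
  also have "\<dots> \<le> l2n I u * l2n I v"
    unfolding l2n_def by (rule L2_set_mult_ineq)
  finally show ?thesis .
qed

lemma cinner_commute: "cinner I u v = cnj (cinner I v u)"
  by (simp add: cinner_def mult.commute)

lemma cinner_sum_left: "cinner I (\<lambda>i. \<Sum>k\<in>K. c k * u k i) v = (\<Sum>k\<in>K. c k * cinner I (u k) v)"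
  unfolding cinner_def by (simp add: sum_distrib_left sum_distrib_right mult.assoc) (rule sum.swap)

lemma cinner_sum_right:
  "cinner I v (\<lambda>i. \<Sum>k\<in>K. c k * u k i) = (\<Sum>k\<in>K. cnj (c k) * cinner I v (u k))"
  by (subst cinner_commute) (simp add: cinner_sum_left cinner_commute[of I v])

lemma cinner_diff_left: "cinner I (\<lambda>i. u i - w i) v = cinner I u v - cinner I w v"
  by (simp add: cinner_def left_diff_distrib sum_subtractf)

lemma cinner_scale_left: "cinner I (\<lambda>i. c * u i) v = c * cinner I u v"
  by (simp add: cinner_def sum_distrib_left mult.assoc)

lemma cinner_scale_right: "cinner I u (\<lambda>i. c * v i) = cnj c * cinner I u v"
  by (simp add: cinner_def sum_distrib_left mult_ac)

lemma orthonormal_combination_norm: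
  assumes "finite K" "orthonormal I K u"
  shows "(l2n I (\<lambda>i. \<Sum>k\<in>K. c k * u k i))\<^sup>2 = (\<Sum>k\<in>K. (cmod (c k))\<^sup>2)"
proof -
  have "of_real ((l2n I (\<lambda>i. \<Sum>k\<in>K. c k * u k i))\<^sup>2)
      = (\<Sum>k\<in>K. c k * (\<Sum>l\<in>K. cnj (c l) * cinner I (u k) (u l)))"
    unfolding cinner_self[symmetric] cinner_sum_left cinner_sum_right by (rule refl)
  also have "\<dots> = (\<Sum>k\<in>K. c k * (\<Sum>l\<in>K. if k = l then cnj (c l) else 0))"
    using assms(2) unfolding orthonormal_def by (intro sum.cong refl arg_cong2[where f="(*)"]) auto
  also have "\<dots> = (\<Sum>k\<in>K. of_real ((cmod (c k))\<^sup>2))"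
    using assms(1) by (intro sum.cong refl) (simp add: complex_norm_square del: of_real_power)
  finally show ?thesis
    by (metis of_real_eq_iff of_real_sum)
qed

text \<open>Gaussian elimination: equation \<open>k\<close> is solved for an unknown
  \<open>i0\<close> with nonzero coefficient and substituted into the others, which costs one
  equation and one unknown. The dimension arguments below (orthogonal complements, completeness, a
  vector with prescribed zeros) rest on this count.\<close>

lemma homogeneous_system_nontrivial:
  fixes a :: "'k \<Rightarrow> 'i \<Rightarrow> 'f::field"
  assumes "finite K" "finite I" "card K < card I"
  shows "\<exists>v. (\<exists>i\<in>I. v i \<noteq> 0) \<and> (\<forall>k\<in>K. (\<Sum>i\<in>I. a k i * v i) = 0)"
  using assms
proof (induction K arbitrary: I a rule: finite_induct)
  case empty
  then have "I \<noteq> {}" by auto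
  then show ?case by (intro exI[of _ "\<lambda>_. 1"]) auto
next
  case (insert k K)
  show ?case
  proof (cases "\<forall>i\<in>I. a k i = 0")
    case True
    from insert.IH[of I a] insert obtain v where "\<exists>i\<in>I. v i \<noteq> 0" "\<forall>k\<in>K. (\<Sum>i\<in>I. a k i * v i) = 0"
      by (metis card_insert_disjoint Suc_lessD)
    with True show ?thesis by (intro exI[of _ v]) auto
  next
    case False
    then obtain i0 where i0: "i0 \<in> I" "a k i0 \<noteq> 0" by auto
    define I' where "I' = I - {i0}"
    \<comment> \<open>Coefficients of the other equations after the substitution.\<close>
    define a' where "a' k' i = a k' i - a k' i0 * a k i / a k i0" for k' i
    have "card K < card I'"
      using insert.prems insert.hyps i0 by (simp add: I'_def)
    then obtain v where v: "\<exists>i\<in>I'. v i \<noteq> 0" "\<forall>k\<in>K. (\<Sum>i\<in>I'. a' k i * v i) = 0"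
      using insert.IH[of I' a'] insert.prems by (auto simp: I'_def)
    define v' where "v' = v(i0 := - (\<Sum>i\<in>I'. a k i * v i) / a k i0)"
    have split: "(\<Sum>i\<in>I. a j i * v' i) = a j i0 * v' i0 + (\<Sum>i\<in>I'. a j i * v i)" for j
    proof -
      have "(\<Sum>i\<in>I. a j i * v' i) = a j i0 * v' i0 + (\<Sum>i\<in>I'. a j i * v' i)"
        using insert.prems(1) i0 unfolding I'_def by (simp add: sum.remove)
      moreover have "(\<Sum>i\<in>I'. a j i * v' i) = (\<Sum>i\<in>I'. a j i * v i)"
        by (rule sum.cong) (auto simp: v'_def I'_def)
      ultimately show ?thesis by simp
    qed
    have "(\<Sum>i\<in>I. a j i * v' i) = 0" if "j \<in> K" for j
    proof -
      have "0 = (\<Sum>i\<in>I'. a j i * v i - a j i0 / a k i0 * (a k i * v i))"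
      proof -
        have "(\<Sum>i\<in>I'. a j i * v i - a j i0 / a k i0 * (a k i * v i)) = (\<Sum>i\<in>I'. a' j i * v i)"
          using i0 by (intro sum.cong) (simp_all add: a'_def field_simps)
        then show ?thesis using v(2) that by simp
      qed
      also have "\<dots> = (\<Sum>i\<in>I'. a j i * v i) - a j i0 / a k i0 * (\<Sum>i\<in>I'. a k i * v i)"
        by (simp add: sum_subtractf sum_distrib_left)
      finally show ?thesis unfolding split by (simp add: v'_def)
    qed
    moreover have "(\<Sum>i\<in>I. a k i * v' i) = 0"
      using i0 unfolding split by (simp add: v'_def)
    moreover have "\<exists>i\<in>I. v' i \<noteq> 0"
      using v(1) by (auto simp: v'_def I'_def)
    ultimately show ?thesis by (intro exI[of _ v']) auto
  qed
qed

lemma unit_vector_orthogonal: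
  assumes "finite K" "finite I" "card K < card I"
  shows "\<exists>v. l2n I v = 1 \<and> (\<forall>k\<in>K. cinner I v (b k) = 0)"
proof -
  obtain v where v: "\<exists>i\<in>I. v i \<noteq> 0" "\<forall>k\<in>K. (\<Sum>i\<in>I. cnj (b k i) * v i) = 0"
    using homogeneous_system_nontrivial[OF assms, of "\<lambda>k i. cnj (b k i)"] by auto
  have nz: "l2n I v \<noteq> 0" using v(1) assms(2) by (simp add: l2n_eq_0)
  have 1: "l2n I (\<lambda>i. of_real (1 / l2n I v) * v i) = 1"
    unfolding l2n_scale using nz by (simp add: norm_divide)
  have "cinner I (\<lambda>i. of_real (1 / l2n I v) * v i) (b k) = 0" if "k \<in> K" for k
    using v(2) that unfolding cinner_scale_left by (simp add: cinner_def mult.commute)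
  with 1 show ?thesis by blast
qed

text \<open>In place of Gram-Schmidt, each new vector solves a homogeneous system: orthogonality to
  all \<open>b k\<close> and to the vectors already built. The \<open>b k\<close> may be dependent
  or zero, since only their number enters.\<close>

lemma orthonormal_orthogonal_exists:
  assumes "finite K" "finite I" "card K + m \<le> card I"
  shows "\<exists>u. orthonormal I {..<m::nat} u \<and> (\<forall>j<m. \<forall>k\<in>K. cinner I (u j) (b k) = 0)"
  using assms(3)
proof (induction m)
  case 0
  then show ?case by (auto simp: orthonormal_def)
next
  case (Suc m)
  then obtain u where u: "orthonormal I {..<m} u" "\<forall>j<m. \<forall>k\<in>K. cinner I (u j) (b k) = 0"
    by auto
  let ?b = "\<lambda>x. case x of Inl k \<Rightarrow> b k | Inr j \<Rightarrow> u j"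
  have "card (K <+> {..<m}) < card I"
    using Suc.prems assms by (simp add: card_Plus)
  from unit_vector_orthogonal[OF _ assms(2) this, of ?b] assms(1)
  obtain v where v: "l2n I v = 1" "\<forall>x\<in>K <+> {..<m}. cinner I v (?b x) = 0" by auto
  have v1: "cinner I v (b k) = 0" if "k \<in> K" for k using v(2) that by force
  have v2: "cinner I v (u j) = 0" if "j < m" for j using v(2) that by force
  have v3: "cinner I (u j) v = 0" if "j < m" for j using v2[OF that] by (metis cinner_commute complex_cnj_zero)
  have v4: "cinner I v v = 1" using v(1) by (simp add: cinner_self)
  have "orthonormal I {..<Suc m} (u(m := v))"
    using u(1) v1 v2 v3 v4 unfolding orthonormal_def by (auto simp: less_Suc_eq)
  moreover have "\<forall>j<Suc m. \<forall>k\<in>K. cinner I ((u(m := v)) j) (b k) = 0"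
    using u(2) v1 by (auto simp: less_Suc_eq)
  ultimately show ?case by blast
qed

text \<open>A nonzero vector orthogonal to all \<open>u k\<close> would, together with them, give
  \<open>card I + 1\<close> vectors with \<open>card I\<close> coordinates, hence a linear relation,
  and orthogonality kills every coefficient of it. The third claim expands a coordinate vector: the
  matrix of \<open>u\<close> is unitary, so orthonormality holds in the other index as well.\<close>

lemma orthonormal_complete:
  assumes "finite K" "finite I" "card K = card I" "orthonormal I K u"
  shows "\<And>v i. i \<in> I \<Longrightarrow> v i = (\<Sum>k\<in>K. cinner I v (u k) * u k i)"
    and "\<And>v. (l2n I v)\<^sup>2 = (\<Sum>k\<in>K. (cmod (cinner I v (u k)))\<^sup>2)"
    and "\<And>i j. i \<in> I \<Longrightarrow> j \<in> I \<Longrightarrow> (\<Sum>k\<in>K. u k i * cnj (u k j)) = (if i = j then 1 else 0)"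
proof -
  have zero: "l2n I v = 0" if orth: "\<forall>k\<in>K. cinner I v (u k) = 0" for v
  proof (rule ccontr)
    assume nz: "l2n I v \<noteq> 0"
    \<comment> \<open>\<open>None\<close> indexes the supposed extra vector.\<close>
    let ?K = "insert None (Some ` K)"
    let ?u = "\<lambda>x. case x of None \<Rightarrow> v | Some k \<Rightarrow> u k"
    have "card I < card ?K"
      using assms by (simp add: card_image)
    from homogeneous_system_nontrivial[OF assms(2) _ this, of "\<lambda>i k. ?u k i"] assms(1)
    obtain c where c: "\<exists>k\<in>?K. c k \<noteq> 0" "\<forall>i\<in>I. (\<Sum>k\<in>?K. ?u k i * c k) = 0" by auto
    have c': "(\<Sum>k\<in>?K. c k * ?u k i) = 0" if "i \<in> I" for i
      using c(2) that by (simp add: mult.commute)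
    have c0: "(\<Sum>k\<in>?K. c k * cinner I (?u k) w) = 0" for w
      unfolding cinner_sum_left[symmetric] using c' by (simp add: cinner_def)
    have split: "(\<Sum>k\<in>?K. c k * cinner I (?u k) w) = c None * cinner I v w + (\<Sum>k\<in>K. c (Some k) * cinner I (u k) w)" for w
      using assms(1) by (simp add: sum.reindex)
    have orth': "cinner I (u k) v = 0" if "k \<in> K" for k
      using orth that by (metis cinner_commute complex_cnj_zero)
    have "c None * cinner I v v = 0"
      using c0[of v] split[of v] orth' by simp
    then have "c None = 0" using nz by (simp add: cinner_self)
    moreover have "c (Some k) = 0" if k: "k \<in> K" for k
    proof -
      have "(\<Sum>l\<in>K. c (Some l) * cinner I (u l) (u k)) = (\<Sum>l\<in>K. if l = k then c (Some l) else 0)"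
        using assms(4) k by (intro sum.cong) (auto simp: orthonormal_def)
      then show ?thesis
        using c0[of "u k"] split[of "u k"] orth k assms(1) by simp
    qed
    ultimately show False using c(1) by auto
  qed
  show 1: "v i = (\<Sum>k\<in>K. cinner I v (u k) * u k i)" if "i \<in> I" for v i
  proof -
    let ?d = "\<lambda>i. v i - (\<Sum>k\<in>K. cinner I v (u k) * u k i)"
    have "cinner I ?d (u k) = 0" if k: "k \<in> K" for k
    proof -
      have "(\<Sum>l\<in>K. cinner I v (u l) * cinner I (u l) (u k)) = (\<Sum>l\<in>K. if l = k then cinner I v (u l) else 0)"
        using assms(4) k by (intro sum.cong) (auto simp: orthonormal_def)
      then show ?thesis
        using k assms(1) by (simp add: cinner_diff_left cinner_sum_left)
    qed
    then have "l2n I ?d = 0" by (intro zero) auto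
    then show ?thesis using that assms(2) by (simp add: l2n_eq_0)
  qed
  show "(l2n I v)\<^sup>2 = (\<Sum>k\<in>K. (cmod (cinner I v (u k)))\<^sup>2)" for v
    using orthonormal_combination_norm[OF assms(1,4), of "\<lambda>k. cinner I v (u k)"] 1[of _ v]
    by (metis (no_types, lifting) l2n_cong)
  show "(\<Sum>k\<in>K. u k i * cnj (u k j)) = (if i = j then 1 else 0)" if ij: "i \<in> I" "j \<in> I" for i j
  proof -
    let ?e = "\<lambda>l. if l = j then 1 else (0::complex)"
    have "cinner I ?e (u k) = cnj (u k j)" for k
      unfolding cinner_def using assms(2) ij
      by (subst sum.cong[OF refl, of _ _ "\<lambda>i. if i = j then cnj (u k i) else 0"]) auto
    then show ?thesis
      using 1[OF ij(1), of ?e] by (simp add: mult.commute)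
  qed
qed


section \<open>The spectral theorem and singular values\<close>

lemma cinner_zero_commute: "cinner I u v = 0 \<Longrightarrow> cinner I v u = 0"
  by (subst cinner_commute) simp

lemma orthonormal_Plus:
  assumes u: "orthonormal I A u" and w: "orthonormal I B w"
    and uw: "\<And>a b. a \<in> A \<Longrightarrow> b \<in> B \<Longrightarrow> cinner I (u a) (w b) = 0"
  shows "orthonormal I (A <+> B) (case_sum u w)"
  unfolding orthonormal_def
proof (intro ballI)
  fix x y assume x: "x \<in> A <+> B" and y: "y \<in> A <+> B"
  have wu: "cinner I (w b) (u a) = 0" if "a \<in> A" "b \<in> B" for a b
    using uw[OF that] by (rule cinner_zero_commute)
  show "cinner I (case_sum u w x) (case_sum u w y) = (if x = y then 1 else 0)"
  proof (cases x)
    case x1: (Inl a)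
    then have a: "a \<in> A" using x by auto
    show ?thesis
    proof (cases y)
      case y1: (Inl a')
      then have "a' \<in> A" using y by auto
      then show ?thesis using x1 y1 a u by (simp add: orthonormal_def)
    next
      case y1: (Inr b')
      then have "b' \<in> B" using y by auto
      then show ?thesis using x1 y1 uw[of a b'] a by simp
    qed
  next
    case x1: (Inr b)
    then have b: "b \<in> B" using x by auto
    show ?thesis
    proof (cases y)
      case y1: (Inl a')
      then have "a' \<in> A" using y by auto
      then show ?thesis using x1 y1 wu[of a' b] b by simp
    next
      case y1: (Inr b')
      then have "b' \<in> B" using y by auto
      then show ?thesis using x1 y1 b w by (simp add: orthonormal_def)
    qed
  qed
qed

text \<open>A root of the characteristic polynomial. It is applied to the compression of a Hermitian
  matrix to the complement of the eigenvectors found so far; that the eigenvalue is real is checked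
  there.\<close>

lemma eigenvector_exists:
  fixes a :: "nat \<Rightarrow> nat \<Rightarrow> complex"
  assumes "0 < d"
  shows "\<exists>l y. (\<exists>i<d. y i \<noteq> 0) \<and> (\<forall>i<d. (\<Sum>j<d. a i j * y j) = l * y i)"
proof -
  let ?A = "Matrix.mat d d (\<lambda>(i, j). a i j)"
  have A: "?A \<in> carrier_mat d d" by simp
  have "degree (char_poly ?A) = d" using degree_monic_char_poly[OF A] by simp
  then have "\<not> constant (poly (char_poly ?A))" using assms by (simp add: constant_degree)
  then obtain l where "poly (char_poly ?A) l = 0"
    using fundamental_theorem_of_algebra by blast
  then obtain v where v: "v \<in> carrier_vec d" "v \<noteq> 0\<^sub>v d" "?A *\<^sub>v v = l \<cdot>\<^sub>v v"
    using eigenvalue_root_char_poly[OF A] by (auto simp: eigenvalue_def eigenvector_def)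
  have "\<exists>i<d. v $ i \<noteq> 0"
    using v(1,2) by (metis carrier_vecD eq_vecI index_zero_vec(1) index_zero_vec(2))
  moreover have "(\<Sum>j<d. a i j * v $ j) = l * v $ i" if "i < d" for i
  proof -
    have "(?A *\<^sub>v v) $ i = (\<Sum>j<d. a i j * v $ j)"
      using that v(1) by (simp add: scalar_prod_def atLeast0LessThan)
    then show ?thesis using v that by simp
  qed
  ultimately show ?thesis by (intro exI[of _ l] exI[of _ "\<lambda>i. v $ i"]) auto
qed

definition mapply :: "'i set \<Rightarrow> ('j \<Rightarrow> 'i \<Rightarrow> complex) \<Rightarrow> ('i \<Rightarrow> complex) \<Rightarrow> 'j \<Rightarrow> complex" where
  "mapply I h v j = (\<Sum>i\<in>I. h j i * v i)"

lemma mapply_sum: "mapply I h (\<lambda>i. \<Sum>k\<in>K. c k * u k i) j = (\<Sum>k\<in>K. c k * mapply I h (u k) j)"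
  unfolding mapply_def by (simp add: sum_distrib_left mult_ac) (rule sum.swap)

lemma mapply_cong: "(\<And>i. i \<in> I \<Longrightarrow> v i = w i) \<Longrightarrow> mapply I h v j = mapply I h w j"
  unfolding mapply_def by (rule sum.cong) auto

lemma cinner_mapply_hermitian:
  assumes "\<And>i j. i \<in> I \<Longrightarrow> j \<in> I \<Longrightarrow> h i j = cnj (h j i)"
  shows "cinner I (mapply I h v) w = cinner I v (mapply I h w)"
proof -
  have "cinner I (mapply I h v) w = (\<Sum>i\<in>I. \<Sum>j\<in>I. h i j * v j * cnj (w i))"
    by (simp add: cinner_def mapply_def sum_distrib_right)
  also have "\<dots> = (\<Sum>j\<in>I. \<Sum>i\<in>I. h i j * v j * cnj (w i))"
    by (rule sum.swap)
  also have "\<dots> = cinner I v (mapply I h w)"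
    unfolding cinner_def mapply_def cnj_sum sum_distrib_left
  proof (intro sum.cong refl)
    fix i j assume "i \<in> I" "j \<in> I"
    then have "h j i = cnj (h i j)" by (intro assms)
    then show "h j i * v i * cnj (w j) = v i * cnj (h i j * w j)" by simp
  qed
  finally show ?thesis .
qed

text \<open>Eigenvectors are found one at a time. The orthogonal complement of those already found
  is invariant under \<open>h\<close> by symmetry, so an eigenvector of the compression to it is an
  eigenvector of \<open>h\<close> itself.\<close>

theorem hermitian_spectral:
  fixes h :: "'i \<Rightarrow> 'i \<Rightarrow> complex"
  assumes fin: "finite I" and herm: "\<And>i j. i \<in> I \<Longrightarrow> j \<in> I \<Longrightarrow> h i j = cnj (h j i)"
  shows "\<exists>u (lam::nat \<Rightarrow> real). orthonormal I {..<card I} u \<and>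
    (\<forall>k<card I. \<forall>i\<in>I. mapply I h (u k) i = of_real (lam k) * u k i)"
proof -
  have "\<exists>u (lam::nat \<Rightarrow> real). orthonormal I {..<m} u \<and>
    (\<forall>k<m. \<forall>i\<in>I. mapply I h (u k) i = of_real (lam k) * u k i)" if "m \<le> card I" for m
    using that
  proof (induction m)
    case 0
    then show ?case by (auto simp: orthonormal_def)
  next
    case (Suc m)
    then obtain u and lam :: "nat \<Rightarrow> real" where u: "orthonormal I {..<m} u"
      "\<forall>k<m. \<forall>i\<in>I. mapply I h (u k) i = of_real (lam k) * u k i" by auto
    define d where "d = card I - m"
    have d: "0 < d" "m + d = card I" using Suc.prems by (auto simp: d_def)
    obtain W where W: "orthonormal I {..<d} W" "\<forall>j<d. \<forall>k\<in>{..<m}. cinner I (W j) (u k) = 0"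
      using orthonormal_orthogonal_exists[of "{..<m}" I d u] fin d by auto
    \<comment> \<open>Matrix of the compression in the orthonormal basis \<open>W\<close> of the
      complement.\<close>
    define a where "a i j = cinner I (mapply I h (W j)) (W i)" for i j
    obtain l y where y: "\<exists>i<d. y i \<noteq> 0" "\<forall>i<d. (\<Sum>j<d. a i j * y j) = l * y i"
      using eigenvector_exists[OF d(1)] by metis
    define v where "v = (\<lambda>i. \<Sum>j<d. y j * W j i)"
    have vn: "(l2n I v)\<^sup>2 = (\<Sum>j<d. (cmod (y j))\<^sup>2)"
      unfolding v_def by (rule orthonormal_combination_norm[OF _ W(1)]) simp
    have "(\<Sum>j<d. (cmod (y j))\<^sup>2) \<noteq> 0"
      using y(1) by (subst sum_nonneg_eq_0_iff) auto
    then have nz: "l2n I v \<noteq> 0" using vn by auto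
    have vW: "cinner I v (W i) = y i" if "i < d" for i
    proof -
      have "cinner I v (W i) = (\<Sum>j<d. if j = i then y j else 0)"
        unfolding v_def cinner_sum_left using W(1) that by (intro sum.cong) (auto simp: orthonormal_def)
      then show ?thesis using that by simp
    qed
    have vu: "cinner I v (u k) = 0" if "k < m" for k
      unfolding v_def cinner_sum_left using W(2) that by (intro sum.neutral) auto
    \<comment> \<open>The residual of the eigenvalue equation is orthogonal to \<open>W\<close> by
      the choice of \<open>y\<close>, and to the old eigenvectors by symmetry. Both together form a
      complete family, so it vanishes.\<close>
    define e where "e = (\<lambda>i. mapply I h v i - l * v i)"
    have eW: "cinner I e (W i) = 0" if "i < d" for i
    proof -
      have "mapply I h v = (\<lambda>i. \<Sum>j<d. y j * mapply I h (W j) i)"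
        by (rule ext) (simp add: v_def mapply_sum)
      then have "cinner I (mapply I h v) (W i) = l * y i"
        using y(2) that by (simp add: cinner_sum_left a_def mult.commute)
      then show ?thesis unfolding e_def cinner_diff_left cinner_scale_left using vW[OF that] by simp
    qed
    have eu: "cinner I e (u k) = 0" if "k < m" for k
    proof -
      have "cinner I v (mapply I h (u k)) = cinner I v (\<lambda>i. of_real (lam k) * u k i)"
        using u(2) that by (intro cinner_cong) auto
      then have "cinner I (mapply I h v) (u k) = 0"
        by (simp add: cinner_mapply_hermitian[OF herm] cinner_scale_right vu[OF that])
      then show ?thesis unfolding e_def cinner_diff_left cinner_scale_left using vu[OF that] by simp
    qed
    let ?K = "{..<m} <+> {..<d}"
    let ?f = "case_sum u W"
    have uW: "cinner I (u k) (W j) = 0" if "k < m" "j < d" for k j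
      by (rule cinner_zero_commute) (use W(2) that in auto)
    have ortho: "orthonormal I ?K ?f"
      using orthonormal_Plus[OF u(1) W(1)] uW by simp
    have "(l2n I e)\<^sup>2 = (\<Sum>x\<in>?K. (cmod (cinner I e (?f x)))\<^sup>2)"
      using fin d(2) ortho by (intro orthonormal_complete(2)) (auto simp: card_Plus)
    also have "\<dots> = 0" using eW eu by (intro sum.neutral) auto
    finally have "l2n I e = 0" by simp
    then have Hv: "mapply I h v i = l * v i" if "i \<in> I" for i
      using that fin by (simp add: l2n_eq_0 e_def)
    \<comment> \<open>Symmetry moves \<open>h\<close> to the other factor, which gives
      \<open>l = cnj l\<close>.\<close>
    have "l * cinner I v v = cinner I (mapply I h v) v"
      by (simp add: cinner_scale_left[symmetric]) (rule cinner_cong, auto simp: Hv)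
    also have "\<dots> = cinner I v (mapply I h v)" by (rule cinner_mapply_hermitian[OF herm])
    also have "\<dots> = cnj l * cinner I v v"
      by (simp add: cinner_scale_right[symmetric]) (rule cinner_cong, auto simp: Hv)
    finally have lr: "l = of_real (Re l)"
      using nz by (simp add: cinner_self complex_eq_iff)
    define w where "w = (\<lambda>i. of_real (1 / l2n I v) * v i)"
    have w1: "cinner I w w = 1"
      using nz by (simp add: cinner_self w_def l2n_scale norm_divide del: of_real_divide)
    have wu: "cinner I w (u k) = 0" if "k < m" for k
      unfolding w_def cinner_scale_left using vu[OF that] by simp
    have uw: "cinner I (u k) w = 0" if "k < m" for k
      using wu[OF that] by (rule cinner_zero_commute)
    have Hw: "mapply I h w i = of_real (Re l) * w i" if "i \<in> I" for i
    proof -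
      have "mapply I h w i = of_real (1 / l2n I v) * mapply I h v i"
        unfolding w_def mapply_def sum_distrib_left by (simp add: mult_ac)
      then show ?thesis unfolding lr[symmetric] using Hv[OF that] by (simp add: w_def)
    qed
    have "orthonormal I {..<Suc m} (u(m := w))"
      using u(1) w1 wu uw unfolding orthonormal_def by (auto simp: less_Suc_eq)
    moreover have "\<forall>k<Suc m. \<forall>i\<in>I. mapply I h ((u(m := w)) k) i = of_real ((lam(m := Re l)) k) * (u(m := w)) k i"
    proof (intro allI impI ballI)
      fix k i assume "k < Suc m" "i \<in> I"
      then show "mapply I h ((u(m := w)) k) i = of_real ((lam(m := Re l)) k) * (u(m := w)) k i"
        using u(2) Hw by (cases "k = m") simp_all
    qed
    ultimately show ?case by blast
  qed
  from this[OF order_refl] show ?thesis .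
qed

lemma spectral_expansion:
  assumes fin: "finite I" and u: "orthonormal I {..<card I} u"
    and ev: "\<forall>k<card I. \<forall>i\<in>I. mapply I h (u k) i = of_real (lam k) * u k i"
    and ij: "i \<in> I" "j \<in> I"
  shows "h i j = (\<Sum>k<card I. of_real (lam k) * u k i * cnj (u k j))"
proof -
  have "(\<Sum>k<card I. of_real (lam k) * u k i * cnj (u k j)) = (\<Sum>k<card I. mapply I h (u k) i * cnj (u k j))"
    using ev ij by (intro sum.cong) auto
  also have "\<dots> = (\<Sum>l\<in>I. h i l * (\<Sum>k<card I. u k l * cnj (u k j)))"
    unfolding mapply_def sum_distrib_right sum_distrib_left by (subst sum.swap) (simp add: mult_ac)
  also have "\<dots> = (\<Sum>l\<in>I. if l = j then h i l else 0)"
    using orthonormal_complete(3)[OF _ fin _ u] ij by (intro sum.cong) auto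
  also have "\<dots> = h i j" using fin ij by simp
  finally show ?thesis by simp
qed

lemma spectral_quadratic:
  assumes fin: "finite I" and u: "orthonormal I {..<card I} u"
    and ev: "\<forall>k<card I. \<forall>i\<in>I. mapply I h (u k) i = of_real (lam k) * u k i"
  shows "cinner I (mapply I h v) v = of_real (\<Sum>k<card I. lam k * (cmod (cinner I v (u k)))\<^sup>2)"
proof -
  have "mapply I h v i = (\<Sum>k<card I. (of_real (lam k) * cinner I v (u k)) * u k i)" if i: "i \<in> I" for i
  proof -
    have "mapply I h v i = (\<Sum>j\<in>I. \<Sum>k<card I. of_real (lam k) * u k i * cnj (u k j) * v j)"
      unfolding mapply_def by (intro sum.cong refl) (simp add: spectral_expansion[OF assms i] sum_distrib_right)
    also have "\<dots> = (\<Sum>k<card I. \<Sum>j\<in>I. of_real (lam k) * u k i * cnj (u k j) * v j)" by (rule sum.swap)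
    also have "\<dots> = (\<Sum>k<card I. (of_real (lam k) * cinner I v (u k)) * u k i)"
      by (simp add: cinner_def sum_distrib_left sum_distrib_right mult_ac)
    finally show ?thesis .
  qed
  then have "cinner I (mapply I h v) v = cinner I (\<lambda>i. \<Sum>k<card I. (of_real (lam k) * cinner I v (u k)) * u k i) v"
    by (intro cinner_cong) auto
  also have "\<dots> = (\<Sum>k<card I. of_real (lam k) * (cinner I v (u k) * cnj (cinner I v (u k))))"
    unfolding cinner_sum_left
  proof (rule sum.cong[OF refl])
    fix k
    have "cinner I (u k) v = cnj (cinner I v (u k))" by (rule cinner_commute)
    then show "of_real (lam k) * cinner I v (u k) * cinner I (u k) v
        = of_real (lam k) * (cinner I v (u k) * cnj (cinner I v (u k)))"
      by (simp only: mult.assoc)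
  qed
  also have "\<dots> = of_real (\<Sum>k<card I. lam k * (cmod (cinner I v (u k)))\<^sup>2)"
    unfolding of_real_sum of_real_mult complex_norm_square by (rule refl)
  finally show ?thesis .
qed

text \<open>The eigenvalues are nonnegative, so their square roots can be distributed over the two
  factors. This turns a covariance kernel into coefficients of independent Gaussians.\<close>

lemma psd_kernel_factorization:
  fixes h :: "'i \<Rightarrow> 'i \<Rightarrow> complex"
  assumes fin: "finite I" and herm: "\<And>i j. i \<in> I \<Longrightarrow> j \<in> I \<Longrightarrow> h i j = cnj (h j i)"
    and psd: "\<And>v. 0 \<le> Re (cinner I (mapply I h v) v)"
  shows "\<exists>B. \<forall>i\<in>I. \<forall>j\<in>I. h i j = (\<Sum>k<card I. B k i * cnj (B k j))"
proof -
  obtain u and lam :: "nat \<Rightarrow> real" where u: "orthonormal I {..<card I} u"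
    and ev: "\<forall>k<card I. \<forall>i\<in>I. mapply I h (u k) i = of_real (lam k) * u k i"
    using hermitian_spectral[of I h, OF fin herm] by blast
  have pos: "0 \<le> lam k" if k: "k < card I" for k
  proof -
    have "cinner I (mapply I h (u k)) (u k) = cinner I (\<lambda>i. of_real (lam k) * u k i) (u k)"
      using ev k by (intro cinner_cong) auto
    also have "\<dots> = of_real (lam k)"
      using u k unfolding cinner_scale_left by (simp add: orthonormal_def)
    finally show ?thesis using psd[of "u k"] by simp
  qed
  have expand: "h i j = (\<Sum>k<card I. (of_real (sqrt (lam k)) * u k i) * cnj (of_real (sqrt (lam k)) * u k j))"
    if "i \<in> I" "j \<in> I" for i j
    unfolding spectral_expansion[OF fin u ev that]
  proof (intro sum.cong refl)
    fix k assume "k \<in> {..<card I}"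
    then have "complex_of_real (lam k) = of_real (sqrt (lam k)) * of_real (sqrt (lam k))"
      using pos by (simp flip: of_real_mult)
    then show "of_real (lam k) * u k i * cnj (u k j) =
        of_real (sqrt (lam k)) * u k i * cnj (of_real (sqrt (lam k)) * u k j)"
      by simp
  qed
  show ?thesis by (intro exI[of _ "\<lambda>k i. of_real (sqrt (lam k)) * u k i"] ballI) (rule expand)
qed

section \<open>Singular values through counts of eigenvalues\<close>

lemma sorted_nth_le_iff:
  fixes xs :: "real list"
  assumes "sorted xs" "k < length xs"
  shows "xs ! k \<le> t \<longleftrightarrow> k < length (filter (\<lambda>x. x \<le> t) xs)"
proof -
  have len: "length (filter (\<lambda>x. x \<le> t) xs) = card {i. i < length xs \<and> xs ! i \<le> t}"
    by (rule length_filter_conv_card)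
  show ?thesis
  proof
    assume "xs ! k \<le> t"
    have "xs ! i \<le> t" "i < length xs" if "i \<le> k" for i
    proof -
      show "i < length xs" using that assms(2) by simp
      have "xs ! i \<le> xs ! k" using that assms by (intro sorted_nth_mono)
      with \<open>xs ! k \<le> t\<close> show "xs ! i \<le> t" by simp
    qed
    then have "{..k} \<subseteq> {i. i < length xs \<and> xs ! i \<le> t}"
      by auto
    from card_mono[OF _ this] show "k < length (filter (\<lambda>x. x \<le> t) xs)" by (simp add: len)
  next
    assume *: "k < length (filter (\<lambda>x. x \<le> t) xs)"
    show "xs ! k \<le> t"
    proof (rule ccontr)
      assume gt: "\<not> xs ! k \<le> t"
      have "{i. i < length xs \<and> xs ! i \<le> t} \<subseteq> {..<k}"
      proof
        fix i assume i: "i \<in> {i. i < length xs \<and> xs ! i \<le> t}"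
        show "i \<in> {..<k}"
        proof (rule ccontr)
          assume "i \<notin> {..<k}"
          then have "xs ! k \<le> xs ! i" using i assms by (intro sorted_nth_mono) auto
          with i gt show False by simp
        qed
      qed
      from card_mono[OF _ this] * show False by (simp add: len)
    qed
  qed
qed


text \<open>The link between \<open>sing_val\<close>, an entry in a sorted list of roots of a
  characteristic polynomial, and an eigenbasis of \<open>A\<^sup>* A\<close>, which comes in no
  particular order. Similarity to a diagonal matrix identifies the multiset of roots, and a count
  replaces the order.\<close>

lemma sing_val_spectral:
  assumes A: "A \<in> carrier_mat N N"
  shows "\<exists>u lam. orthonormal {..<N} {..<N} u \<and> (\<forall>k<N. 0 \<le> lam k) \<and>
    (\<forall>v. (l2n {..<N} (mapply {..<N} (\<lambda>i j. A $$ (i, j)) v))\<^sup>2 = (\<Sum>k<N. lam k * (cmod (cinner {..<N} v (u k)))\<^sup>2)) \<and>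
    (\<forall>k<N. \<forall>t. sing_val A (N - k - 1) \<le> t \<longleftrightarrow> k < card {j. j < N \<and> sqrt (lam j) \<le> t})"
proof -
  let ?I = "{..<N}"
  let ?H = "mat_adjoint A * A"
  define a where "a = (\<lambda>i j. A $$ (i, j))"
  define h where "h i j = (\<Sum>l<N. cnj (a l i) * a l j)" for i j
  have adj: "mat_adjoint A \<in> carrier_mat N N" "\<And>i j. i < N \<Longrightarrow> j < N \<Longrightarrow> mat_adjoint A $$ (i, j) = cnj (A $$ (j, i))"
    using A unfolding mat_adjoint_def by (auto simp: mat_of_rows_index)
  have H: "?H \<in> carrier_mat N N" using A adj by simp
  have Hij: "?H $$ (i, j) = h i j" if "i < N" "j < N" for i j
    using A adj that by (simp add: scalar_prod_def h_def a_def atLeast0LessThan)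
  have herm: "h i j = cnj (h j i)" for i j by (simp add: h_def mult.commute)
  obtain u and lam :: "nat \<Rightarrow> real" where u: "orthonormal ?I {..<N} u"
    and ev: "\<forall>k<N. \<forall>i\<in>?I. mapply ?I h (u k) i = of_real (lam k) * u k i"
    using hermitian_spectral[of ?I h, OF finite_lessThan herm] unfolding card_lessThan by blast
  have quad: "cinner ?I (mapply ?I h v) v = of_real ((l2n ?I (mapply ?I a v))\<^sup>2)" for v
  proof -
    have "cinner ?I (mapply ?I h v) v = (\<Sum>i<N. \<Sum>j<N. \<Sum>l<N. cnj (a l i) * a l j * v j * cnj (v i))"
      by (simp add: cinner_def mapply_def h_def sum_distrib_right)
    also have "\<dots> = (\<Sum>i<N. \<Sum>l<N. \<Sum>j<N. cnj (a l i) * a l j * v j * cnj (v i))"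
      by (rule sum.cong[OF refl], rule sum.swap)
    also have "\<dots> = (\<Sum>l<N. \<Sum>i<N. \<Sum>j<N. cnj (a l i) * a l j * v j * cnj (v i))"
      by (rule sum.swap)
    also have "\<dots> = (\<Sum>l<N. \<Sum>j<N. \<Sum>i<N. cnj (a l i) * a l j * v j * cnj (v i))"
      by (rule sum.cong[OF refl], rule sum.swap)
    also have "\<dots> = cinner ?I (mapply ?I a v) (mapply ?I a v)"
      by (simp add: cinner_def mapply_def sum_product mult_ac)
    finally show ?thesis by (simp only: cinner_self)
  qed
  have norm: "(l2n ?I (mapply ?I a v))\<^sup>2 = (\<Sum>k<N. lam k * (cmod (cinner ?I v (u k)))\<^sup>2)" for v
    using spectral_quadratic[of ?I u h lam v] u ev quad[of v] by (simp del: of_real_power of_real_sum)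
  have pos: "0 \<le> lam k" if k: "k < N" for k
  proof -
    have "(\<Sum>j<N. lam j * (cmod (cinner ?I (u k) (u j)))\<^sup>2) = (\<Sum>j<N. if j = k then lam j else 0)"
      using u k by (intro sum.cong) (auto simp: orthonormal_def)
    then have "lam k = (l2n ?I (mapply ?I a (u k)))\<^sup>2" using norm[of "u k"] k by simp
    then show ?thesis by simp
  qed
  let ?P = "Matrix.mat N N (\<lambda>(i, k). u k i)" and ?Q = "Matrix.mat N N (\<lambda>(k, i). cnj (u k i))"
    and ?D = "Matrix.mat N N (\<lambda>(i, j). if i = j then complex_of_real (lam i) else 0)"
  have "similar_mat ?H ?D"
  proof (rule similar_matI)
    show "{?H, ?D, ?P, ?Q} \<subseteq> carrier_mat N N" using H by simp
    show "?P * ?Q = 1\<^sub>m N"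
      using orthonormal_complete(3)[OF _ _ _ u]
      by (intro eq_matI) (auto simp: scalar_prod_def atLeast0LessThan)
    show "?Q * ?P = 1\<^sub>m N"
      using u by (intro eq_matI)
        (auto simp: scalar_prod_def atLeast0LessThan orthonormal_def cinner_def mult.commute)
    show "?H = ?P * ?D * ?Q"
    proof (intro eq_matI)
      fix i j assume "i < dim_row (?P * ?D * ?Q)" "j < dim_col (?P * ?D * ?Q)"
      then have ij: "i < N" "j < N" by auto
      have PD: "(?P * ?D) $$ (i, k) = of_real (lam k) * u k i" if "k < N" for k
      proof -
        have "(?P * ?D) $$ (i, k) = (\<Sum>l<N. u l i * (if l = k then of_real (lam l) else 0))"
          using ij that by (simp add: scalar_prod_def atLeast0LessThan)
        also have "\<dots> = (\<Sum>l<N. if l = k then u l i * of_real (lam l) else 0)"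
          by (intro sum.cong) auto
        finally show ?thesis using that by simp
      qed
      have "(?P * ?D * ?Q) $$ (i, j) = (\<Sum>k<N. (?P * ?D) $$ (i, k) * cnj (u k j))"
      proof -
        have "(?P * ?D * ?Q) $$ (i, j) = scalar_prod (row (?P * ?D) i) (col ?Q j)"
          using ij by (subst index_mult_mat(1)) simp_all
        also have "\<dots> = (\<Sum>k<N. (?P * ?D) $$ (i, k) * cnj (u k j))"
          using ij unfolding scalar_prod_def
          by (intro sum.cong) (auto simp: atLeast0LessThan simp del: index_mult_mat(1))
        finally show ?thesis .
      qed
      also have "\<dots> = h i j"
        using spectral_expansion[of ?I u h lam i j] u ev ij PD by simp
      finally show "?H $$ (i, j) = (?P * ?D * ?Q) $$ (i, j)" using Hij ij by simp
    qed (use H in auto)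
  qed
  then have "char_poly ?H = char_poly ?D" by (rule char_poly_similar)
  also have "\<dots> = (\<Prod>e\<leftarrow>diag_mat ?D. [:- e, 1:])"
    by (rule char_poly_upper_triangular[of _ N]) auto
  also have "diag_mat ?D = map (\<lambda>k. complex_of_real (lam k)) [0..<N]"
    unfolding diag_mat_def by (intro map_cong) auto
  finally have cp: "char_poly ?H = (\<Prod>k\<leftarrow>[0..<N]. [:- complex_of_real (lam k), 1:])"
    by (simp add: o_def)
  have proots: "proots (\<Prod>k\<leftarrow>ks. [:- complex_of_real (lam k), 1:]) = mset (map (\<lambda>k. complex_of_real (lam k)) ks)" for ks :: "nat list"
  proof (induction ks)
    case (Cons k ks)
    have "(\<Prod>k\<leftarrow>ks. [:- complex_of_real (lam k), 1:]) \<noteq> 0"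
      by (auto simp: prod_list_zero_iff)
    then show ?case using Cons by (simp add: proots_mult del: mult_pCons_left)
  qed simp
  define xs where "xs = map (\<lambda>k. sqrt (lam k)) [0..<N]"
  have "sing_vals A = rev (sort xs)"
    unfolding sing_vals_def cp proots xs_def
    by (simp add: o_def sorted_list_of_multiset_mset flip: mset_map)
  \<comment> \<open>Positions from the large end become positions from the small end: index
    \<open>N - k - 1\<close> holds the \<open>k\<close>-th smallest value, counted from 0.\<close>
  then have sv: "sing_val A (N - k - 1) = sort xs ! k" if "k < N" for k
    using that unfolding sing_val_def xs_def by (simp add: rev_nth)
  have "sing_val A (N - k - 1) \<le> t \<longleftrightarrow> k < card {j. j < N \<and> sqrt (lam j) \<le> t}" if k: "k < N" for k t
  proof -
    have "length (filter (\<lambda>x. x \<le> t) (sort xs)) = length (filter (\<lambda>x. x \<le> t) xs)"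
      by (metis mset_filter mset_sort size_mset)
    also have "\<dots> = card {j. j < N \<and> sqrt (lam j) \<le> t}"
      unfolding length_filter_conv_card xs_def by (intro arg_cong[of _ _ card]) auto
    finally show ?thesis
      using sorted_nth_le_iff[of "sort xs" k t] k sv[OF k] by (simp add: xs_def)
  qed
  with u pos norm show ?thesis unfolding a_def by blast
qed

text \<open>At least \<open>k + 1\<close> right singular vectors belong to values at most
  \<open>t\<close>. Asking that \<open>k\<close> coordinates vanish is a system of \<open>k\<close>
  equations for the coefficients of their combination, so a nonzero solution remains.\<close>

lemma sing_val_le_imp_vector:
  assumes A: "A \<in> carrier_mat N N" and k: "k < N" and t: "0 \<le> t" and s: "sing_val A (N - k - 1) \<le> t"
  shows "\<exists>v. (\<exists>i<N. v i \<noteq> 0) \<and> (\<forall>i<k. v i = 0) \<and>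
    l2n {..<N} (mapply {..<N} (\<lambda>i j. A $$ (i, j)) v) \<le> t * l2n {..<N} v"
proof -
  obtain u lam where u: "orthonormal {..<N} {..<N} u" and pos: "\<forall>k<N. 0 \<le> lam k"
    and norm: "\<forall>v. (l2n {..<N} (mapply {..<N} (\<lambda>i j. A $$ (i, j)) v))\<^sup>2
      = (\<Sum>k<N. lam k * (cmod (cinner {..<N} v (u k)))\<^sup>2)"
    and sv: "\<forall>k<N. \<forall>t. sing_val A (N - k - 1) \<le> t \<longleftrightarrow> k < card {j. j < N \<and> sqrt (lam j) \<le> t}"
    using sing_val_spectral[OF A] by blast
  define T where "T = {j. j < N \<and> sqrt (lam j) \<le> t}"
  have T: "finite T" "T \<subseteq> {..<N}" "k < card T" using sv k s by (auto simp: T_def)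
  from homogeneous_system_nontrivial[OF _ T(1), of "{..<k}" "\<lambda>i j. u j i"] T(3)
  obtain c where c: "\<exists>j\<in>T. c j \<noteq> 0" "\<forall>i\<in>{..<k}. (\<Sum>j\<in>T. u j i * c j) = 0" by auto
  have uT: "orthonormal {..<N} T u" using u T(2) unfolding orthonormal_def by blast
  define v where "v = (\<lambda>i. \<Sum>j\<in>T. c j * u j i)"
  have vn: "(l2n {..<N} v)\<^sup>2 = (\<Sum>j\<in>T. (cmod (c j))\<^sup>2)"
    unfolding v_def by (rule orthonormal_combination_norm[OF T(1) uT])
  have "(\<Sum>j\<in>T. (cmod (c j))\<^sup>2) \<noteq> 0"
    using c(1) T(1) by (subst sum_nonneg_eq_0_iff) auto
  then have "l2n {..<N} v \<noteq> 0" using vn by auto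
  then have nz: "\<exists>i<N. v i \<noteq> 0" by (auto simp: l2n_eq_0)
  have v0: "\<forall>i<k. v i = 0" using c(2) by (auto simp: v_def mult.commute)
  have coeff: "cinner {..<N} v (u l) = (if l \<in> T then c l else 0)" if l: "l < N" for l
  proof -
    have "cinner {..<N} v (u l) = (\<Sum>j\<in>T. if j = l then c j else 0)"
      unfolding v_def cinner_sum_left using u T(2) l by (intro sum.cong) (auto simp: orthonormal_def)
    then show ?thesis using T(1) by simp
  qed
  have "(l2n {..<N} (mapply {..<N} (\<lambda>i j. A $$ (i, j)) v))\<^sup>2 = (\<Sum>l<N. if l \<in> T then lam l * (cmod (c l))\<^sup>2 else 0)"
    unfolding norm[rule_format] by (intro sum.cong) (auto simp: coeff)
  also have "\<dots> = (\<Sum>l\<in>T. lam l * (cmod (c l))\<^sup>2)"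
    using T by (simp add: sum.If_cases Int_absorb1)
  also have "\<dots> \<le> (\<Sum>l\<in>T. t\<^sup>2 * (cmod (c l))\<^sup>2)"
    using t pos by (intro sum_mono mult_right_mono) (auto simp: T_def sqrt_le_D)
  also have "\<dots> = (t * l2n {..<N} v)\<^sup>2"
    by (simp add: power_mult_distrib vn sum_distrib_left)
  finally have "l2n {..<N} (mapply {..<N} (\<lambda>i j. A $$ (i, j)) v) \<le> t * l2n {..<N} v"
    by (rule power2_le_imp_le) (use t in simp)
  with nz v0 show ?thesis by blast
qed

text \<open>Describes the least singular value by vectors alone, without roots or sorting. This form
  serves for the lower bound on quadratic forms and for measurability in the frequency.\<close>

lemma least_sing_val_le_iff:
  assumes A: "A \<in> carrier_mat N N" and N: "0 < N" and t: "0 \<le> t"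
  shows "sing_val A (N - 1) \<le> t \<longleftrightarrow>
    (\<exists>v. (\<exists>i<N. v i \<noteq> 0) \<and> l2n {..<N} (mapply {..<N} (\<lambda>i j. A $$ (i, j)) v) \<le> t * l2n {..<N} v)"
proof
  assume "sing_val A (N - 1) \<le> t"
  then show "\<exists>v. (\<exists>i<N. v i \<noteq> 0) \<and> l2n {..<N} (mapply {..<N} (\<lambda>i j. A $$ (i, j)) v) \<le> t * l2n {..<N} v"
    using sing_val_le_imp_vector[OF A N t] by auto
next
  assume "\<exists>v. (\<exists>i<N. v i \<noteq> 0) \<and> l2n {..<N} (mapply {..<N} (\<lambda>i j. A $$ (i, j)) v) \<le> t * l2n {..<N} v"
  then obtain v where v: "\<exists>i<N. v i \<noteq> 0"
    and le: "l2n {..<N} (mapply {..<N} (\<lambda>i j. A $$ (i, j)) v) \<le> t * l2n {..<N} v" by auto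
  obtain u lam where u: "orthonormal {..<N} {..<N} u" and pos: "\<forall>k<N. 0 \<le> lam k"
    and norm: "\<forall>v. (l2n {..<N} (mapply {..<N} (\<lambda>i j. A $$ (i, j)) v))\<^sup>2
      = (\<Sum>k<N. lam k * (cmod (cinner {..<N} v (u k)))\<^sup>2)"
    and sv: "\<forall>k<N. \<forall>t. sing_val A (N - k - 1) \<le> t \<longleftrightarrow> k < card {j. j < N \<and> sqrt (lam j) \<le> t}"
    using sing_val_spectral[OF A] by blast
  show "sing_val A (N - 1) \<le> t"
  proof (rule ccontr)
    assume "\<not> sing_val A (N - 1) \<le> t"
    then have "card {j. j < N \<and> sqrt (lam j) \<le> t} = 0" using sv[rule_format, of 0 t] N by simp
    then have "\<forall>j<N. t < sqrt (lam j)" by (auto simp: not_le)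
    then have gt: "\<forall>j<N. t\<^sup>2 < lam j"
    proof (intro allI impI)
      fix j assume j: "j < N"
      have "t\<^sup>2 < (sqrt (lam j))\<^sup>2"
        using \<open>\<forall>j<N. t < sqrt (lam j)\<close> j t by (intro power_strict_mono) auto
      then show "t\<^sup>2 < lam j" using pos j by simp
    qed
    have vv: "(l2n {..<N} v)\<^sup>2 = (\<Sum>k<N. (cmod (cinner {..<N} v (u k)))\<^sup>2)"
      using orthonormal_complete(2)[OF _ _ _ u] by simp
    have "l2n {..<N} v \<noteq> 0" using v by (auto simp: l2n_eq_0)
    then have "(\<Sum>k<N. (cmod (cinner {..<N} v (u k)))\<^sup>2) \<noteq> 0" unfolding vv[symmetric] by simp
    moreover have "(\<Sum>k<N. (cmod (cinner {..<N} v (u k)))\<^sup>2) = 0" if "\<forall>k<N. cinner {..<N} v (u k) = 0"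
      using that by (intro sum.neutral) auto
    ultimately obtain k0 where k0: "k0 < N" "cinner {..<N} v (u k0) \<noteq> 0" by blast
    have "(\<Sum>k<N. t\<^sup>2 * (cmod (cinner {..<N} v (u k)))\<^sup>2) < (\<Sum>k<N. lam k * (cmod (cinner {..<N} v (u k)))\<^sup>2)"
    proof (rule sum_strict_mono_ex1)
      show "\<forall>k\<in>{..<N}. t\<^sup>2 * (cmod (cinner {..<N} v (u k)))\<^sup>2 \<le> lam k * (cmod (cinner {..<N} v (u k)))\<^sup>2"
        using gt by (intro ballI mult_right_mono) (auto intro: less_imp_le)
      show "\<exists>k\<in>{..<N}. t\<^sup>2 * (cmod (cinner {..<N} v (u k)))\<^sup>2 < lam k * (cmod (cinner {..<N} v (u k)))\<^sup>2"
        using gt k0 by (intro bexI[of _ k0] mult_strict_right_mono) auto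
    qed simp
    then have "(t * l2n {..<N} v)\<^sup>2 < (l2n {..<N} (mapply {..<N} (\<lambda>i j. A $$ (i, j)) v))\<^sup>2"
      by (simp add: power_mult_distrib vv norm sum_distrib_left)
    moreover have "(l2n {..<N} (mapply {..<N} (\<lambda>i j. A $$ (i, j)) v))\<^sup>2 \<le> (t * l2n {..<N} v)\<^sup>2"
      using le by (rule power_mono) simp
    ultimately show False by simp
  qed
qed

text \<open>For a nonnegative Hermitian matrix the singular values are the eigenvalues: an
  eigenvector shows \<open>t < \<bar>lam k\<bar>\<close>, and nonnegativity removes the absolute
  value.\<close>

lemma psd_quadratic_lower:
  assumes A: "A \<in> carrier_mat N N" and N: "0 < N" and t: "0 \<le> t" and s: "t < sing_val A (N - 1)"
    and herm: "\<And>i j. i < N \<Longrightarrow> j < N \<Longrightarrow> A $$ (i, j) = cnj (A $$ (j, i))"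
    and psd: "\<And>v. 0 \<le> Re (cinner {..<N} (mapply {..<N} (\<lambda>i j. A $$ (i, j)) v) v)"
  shows "t * (l2n {..<N} v)\<^sup>2 \<le> Re (cinner {..<N} (mapply {..<N} (\<lambda>i j. A $$ (i, j)) v) v)"
proof -
  let ?a = "\<lambda>i j. A $$ (i, j)"
  have h: "\<And>i j. i \<in> {..<N} \<Longrightarrow> j \<in> {..<N} \<Longrightarrow> ?a i j = cnj (?a j i)"
    by (rule herm) auto
  obtain u and lam :: "nat \<Rightarrow> real" where u: "orthonormal {..<N} {..<N} u"
    and ev: "\<forall>k<N. \<forall>i\<in>{..<N}. mapply {..<N} ?a (u k) i = of_real (lam k) * u k i"
    using hermitian_spectral[of "{..<N}" ?a, OF finite_lessThan h] unfolding card_lessThan by blast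
  have lam: "t \<le> lam k" if k: "k < N" for k
  proof -
    have u1: "cinner {..<N} (u k) (u k) = 1" using u k by (simp add: orthonormal_def)
    then have "(l2n {..<N} (u k))\<^sup>2 = 1" unfolding cinner_self of_real_eq_1_iff .
    then have n1: "l2n {..<N} (u k) = 1"
      using l2n_nonneg[of "{..<N}" "u k"] by (auto simp: power2_eq_1_iff)
    then have "\<exists>i<N. u k i \<noteq> 0"
      using l2n_eq_0[of "{..<N}" "u k"] by auto
    moreover have "\<not> (\<exists>v. (\<exists>i<N. v i \<noteq> 0) \<and> l2n {..<N} (mapply {..<N} ?a v) \<le> t * l2n {..<N} v)"
      using least_sing_val_le_iff[OF A N t] s by simp
    ultimately have "\<not> l2n {..<N} (mapply {..<N} ?a (u k)) \<le> t * l2n {..<N} (u k)" by blast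
    then have "t < l2n {..<N} (mapply {..<N} ?a (u k))" using n1 by simp
    also have "l2n {..<N} (mapply {..<N} ?a (u k)) = l2n {..<N} (\<lambda>i. of_real (lam k) * u k i)"
      using ev k by (intro l2n_cong) auto
    also have "\<dots> = \<bar>lam k\<bar>" by (simp add: l2n_scale n1)
    finally have 1: "t < \<bar>lam k\<bar>" .
    have "cinner {..<N} (mapply {..<N} ?a (u k)) (u k) = cinner {..<N} (\<lambda>i. of_real (lam k) * u k i) (u k)"
      using ev k by (intro cinner_cong) auto
    then have "0 \<le> lam k" using psd[of "u k"] u1 by (simp add: cinner_scale_left)
    with 1 show ?thesis by simp
  qed
  have "t * (l2n {..<N} v)\<^sup>2 = (\<Sum>k<N. t * (cmod (cinner {..<N} v (u k)))\<^sup>2)"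
    using orthonormal_complete(2)[OF _ _ _ u, of v] by (simp add: sum_distrib_left)
  also have "\<dots> \<le> (\<Sum>k<N. lam k * (cmod (cinner {..<N} v (u k)))\<^sup>2)"
    using lam by (intro sum_mono mult_right_mono) auto
  also have "\<dots> = Re (cinner {..<N} (mapply {..<N} ?a v) v)"
  proof -
    note spectral_quadratic[of "{..<N}" u ?a lam v, OF finite_lessThan, unfolded card_lessThan, OF u ev]
    then show ?thesis by (simp only: Re_complex_of_real)
  qed
  finally show ?thesis .
qed


section \<open>Laws of finite families and their characteristic functions\<close>

text \<open>Levy's uniqueness theorem for the law of \<open>Z\<close> under the density
  \<open>f\<close>, normalised by its integral \<open>c\<close>. Weights are allowed because the
  multivariate statement below treats the other coordinates as a weight. If \<open>c = 0\<close>
  nothing can be normalised, and both sides vanish.\<close>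

lemma weighted_law_unique:
  fixes Z :: "'a \<Rightarrow> real" and Z' :: "'b \<Rightarrow> real"
  assumes "prob_space M" "prob_space M'"
    and [measurable]: "Z \<in> borel_measurable M" "f \<in> borel_measurable M"
      "Z' \<in> borel_measurable M'" "f' \<in> borel_measurable M'" "B \<in> sets borel"
    and f: "\<And>x. 0 \<le> f x" "\<And>x. f x \<le> (K::real)" and f': "\<And>x. 0 \<le> f' x" "\<And>x. f' x \<le> K"
    and eq: "\<And>s. (CLINT x|M. of_real (f x) * iexp (s * Z x)) = (CLINT x|M'. of_real (f' x) * iexp (s * Z' x))"
  shows "(LINT x|M. f x * indicat_real B (Z x)) = (LINT x|M'. f' x * indicat_real B (Z' x))"
proof -
  interpret M: prob_space M by fact
  interpret M': prob_space M' by fact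
  have int: "integrable M f" "integrable M' f'"
    using f f' by (auto intro!: M.integrable_const_bound[of _ K] M'.integrable_const_bound[of _ K])
  have int2: "integrable M (\<lambda>x. f x * indicat_real B (Z x))" "integrable M' (\<lambda>x. f' x * indicat_real B (Z' x))"
    using f f' by (auto intro!: M.integrable_const_bound[of _ K] M'.integrable_const_bound[of _ K]
        simp: abs_mult indicator_def intro: order_trans[OF f(1) f(2)] order_trans[OF f'(1) f'(2)])
  define c where "c = (LINT x|M. f x)"
  have "complex_of_real c = of_real (LINT x|M'. f' x)"
    using eq[of 0] unfolding c_def by simp
  then have c': "(LINT x|M'. f' x) = c" by simp
  have c0: "0 \<le> c" unfolding c_def using f by (intro integral_nonneg_AE) simp
  show ?thesis
  proof (cases "c = 0")
    case True
    have "(LINT x|M. f x * indicat_real B (Z x)) \<le> (LINT x|M. f x)"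
      using int int2 f by (intro integral_mono) (auto simp: indicator_def)
    moreover have "(LINT x|M'. f' x * indicat_real B (Z' x)) \<le> (LINT x|M'. f' x)"
      using int int2 f' by (intro integral_mono) (auto simp: indicator_def)
    moreover have "0 \<le> (LINT x|M. f x * indicat_real B (Z x))"
      using f by (intro integral_nonneg_AE) simp
    moreover have "0 \<le> (LINT x|M'. f' x * indicat_real B (Z' x))"
      using f' by (intro integral_nonneg_AE) simp
    ultimately show ?thesis using True c' by (simp add: c_def)
  next
    case False
    with c0 have c: "0 < c" by simp
    have law: "real_distribution (distr (density N (\<lambda>x. ennreal (g x / c))) borel Y) \<and>
      (\<forall>s. char (distr (density N (\<lambda>x. ennreal (g x / c))) borel Y) s = (CLINT x|N. of_real (g x) * iexp (s * Y x)) / of_real c) \<and>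
      measure (distr (density N (\<lambda>x. ennreal (g x / c))) borel Y) B = (LINT x|N. g x * indicat_real B (Y x)) / c"
      if [measurable]: "Y \<in> borel_measurable N" "g \<in> borel_measurable N" and g: "\<And>x. 0 \<le> g x"
        and gi: "integrable N g" and gc: "(LINT x|N. g x) = c" for N :: "'c measure" and Y g
    proof -
      let ?D = "density N (\<lambda>x. ennreal (g x / c))"
      have "emeasure ?D (space ?D) = (\<integral>\<^sup>+x. ennreal (g x / c) \<partial>N)"
        by (simp add: emeasure_density cong: nn_integral_cong)
      also have "\<dots> = ennreal (LINT x|N. g x / c)"
        using gi g c by (intro nn_integral_eq_integral) auto
      also have "\<dots> = 1" using gc c by simp
      finally interpret D: prob_space ?D by (rule prob_spaceI)
      have [measurable]: "Y \<in> borel_measurable ?D" by simp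
      have 1: "real_distribution (distr ?D borel Y)" by (rule D.real_distribution_distr) simp
      have 2: "char (distr ?D borel Y) s = (CLINT x|N. of_real (g x) * iexp (s * Y x)) / of_real c" for s
      proof -
        have "char (distr ?D borel Y) s = (CLINT x|?D. iexp (s * Y x))"
          unfolding char_def by (subst integral_distr) auto
        also have "\<dots> = (CLINT x|N. (g x / c) *\<^sub>R iexp (s * Y x))"
          using g c by (subst integral_density) auto
        also have "\<dots> = (CLINT x|N. (of_real (g x) * iexp (s * Y x)) / of_real c)"
          by (intro Bochner_Integration.integral_cong) (simp_all add: scaleR_conv_of_real)
        also have "\<dots> = (CLINT x|N. of_real (g x) * iexp (s * Y x)) / of_real c"
          by (rule integral_divide_zero)
        finally show ?thesis .
      qed
      interpret d: real_distribution "distr ?D borel Y" by fact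
      have "measure (distr ?D borel Y) B = (LINT y|distr ?D borel Y. indicat_real B y)"
        by simp
      also have "\<dots> = (LINT x|?D. indicat_real B (Y x))"
        by (subst integral_distr) auto
      also have "\<dots> = (LINT x|N. (g x / c) *\<^sub>R indicat_real B (Y x))"
        using g c by (subst integral_density) auto
      also have "\<dots> = (LINT x|N. (g x * indicat_real B (Y x)) / c)"
        by (intro Bochner_Integration.integral_cong) simp_all
      also have "\<dots> = (LINT x|N. g x * indicat_real B (Y x)) / c"
        by (rule integral_divide_zero)
      finally show ?thesis using 1 2 by blast
    qed
    note l1 = law[of Z M f, OF _ _ f(1) int(1) c_def[symmetric], simplified]
    note l2 = law[of Z' M' f', OF _ _ f'(1) int(2) c', simplified]
    have "distr (density M (\<lambda>x. ennreal (f x / c))) borel Z = distr (density M' (\<lambda>x. ennreal (f' x / c))) borel Z'"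
      using l1 l2 eq by (intro Levy_uniqueness) auto
    with l1 l2 c show ?thesis by auto
  qed
qed

text \<open>The one-dimensional theorem is applied to one coordinate at a time: in the product of
  exponentials the factor of that coordinate is exchanged for the indicator of a Borel set, while
  the remaining factors act as a weight. After all coordinates this is equality on boxes.\<close>

lemma product_law_unique:
  fixes N N' :: "('j \<Rightarrow> real) measure"
  assumes fin: "finite J" and prob: "prob_space N" "prob_space N'"
    and sets: "sets N = sets (PiM J (\<lambda>_. borel))" "sets N' = sets (PiM J (\<lambda>_. borel))"
    and eq: "\<And>t. (CLINT x|N. iexp (\<Sum>j\<in>J. t j * x j)) = (CLINT x|N'. iexp (\<Sum>j\<in>J. t j * x j))"
  shows "N = N'"
proof -
  define good where "good K \<longleftrightarrow> prob_space K \<and> sets K = sets (PiM J (\<lambda>_. borel))" for K :: "('j \<Rightarrow> real) measure"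
  have good: "good N" "good N'" using prob sets by (auto simp: good_def)
  have comp [measurable]: "(\<lambda>x. x j) \<in> borel_measurable K" if "good K" "j \<in> J" for K j
    using that unfolding good_def by (subst measurable_cong_sets[of _ "PiM J (\<lambda>_. borel)" _ borel]) auto
  have summ: "(\<lambda>x. \<Sum>j\<in>R. t j * x j) \<in> borel_measurable K" if "good K" "R \<subseteq> J" for K R t
    using that by (intro borel_measurable_sum borel_measurable_times comp) auto
  define F where "F A B x = (\<Prod>j\<in>A. indicat_real (B j) (x j))" for A and B :: "'j \<Rightarrow> real set" and x
  have F01: "0 \<le> F A B x" "F A B x \<le> 1" for A B x
    unfolding F_def by (auto intro!: prod_nonneg prod_le_1)
  have Fm: "F A B \<in> borel_measurable K" if "good K" "A \<subseteq> J" "\<And>j. j \<in> A \<Longrightarrow> B j \<in> sets borel" for K A B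
    unfolding F_def
  proof (rule borel_measurable_prod)
    fix j assume "j \<in> A"
    then show "(\<lambda>x. indicat_real (B j) (x j)) \<in> borel_measurable K"
      using that by (intro measurable_compose[OF comp[OF \<open>good K\<close>, of j]]) auto
  qed
  have bint: "integrable K h" if "good K" "h \<in> borel_measurable K" "\<And>x. norm (h x) \<le> 1"
    for K and h :: "_ \<Rightarrow> 'f::{banach,second_countable_topology}"
  proof -
    interpret prob_space K using that by (simp add: good_def)
    show ?thesis using that by (intro integrable_const_bound[of _ 1]) auto
  qed
  have bintr: "integrable K h" if "good K" "h \<in> borel_measurable K" "\<And>x. \<bar>h x\<bar> \<le> (1::real)" for K h
    using bint[of K h] that by simp
  have bintc: "integrable K h" if "good K" "h \<in> borel_measurable K" "\<And>x. cmod (h x) \<le> 1" for K h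
    using that unfolding good_def by (intro finite_measure.integrable_const_bound[of _ _ 1] prob_space.finite_measure) auto
  \<comment> \<open>\<open>A\<close> holds the coordinates already exchanged for indicators; those
    in \<open>J - A\<close> still carry exponentials.\<close>
  have main: "A \<subseteq> J \<Longrightarrow> (\<forall>j\<in>A. B j \<in> sets borel) \<Longrightarrow>
    (CLINT x|N. of_real (F A B x) * iexp (\<Sum>j\<in>J - A. t j * x j)) =
    (CLINT x|N'. of_real (F A B x) * iexp (\<Sum>j\<in>J - A. t j * x j))"
    if "finite A" for A B t
    using that
  proof (induction A arbitrary: B t rule: finite_induct)
    case empty
    show ?case using eq[of t] by (simp add: F_def)
  next
    case (insert a A)
    define R where "R = J - insert a A"
    have R: "J - A = insert a R" "a \<notin> R" "finite R" "R \<subseteq> J" using insert fin by (auto simp: R_def)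
    have aJ: "a \<in> J" "A \<subseteq> J" using insert by auto
    have BA: "\<And>j. j \<in> A \<Longrightarrow> B j \<in> sets borel" and Ba [measurable]: "B a \<in> sets borel"
      using insert by auto
    define \<theta> where "\<theta> t x = (\<Sum>j\<in>R. t j * x j)" for t and x :: "'j \<Rightarrow> real"
    have th: "\<theta> t \<in> borel_measurable K" if "good K" for K t
      unfolding \<theta>_def using that R by (intro summ)
    have ca: "(\<lambda>x. x a) \<in> borel_measurable K" if "good K" for K
      using that aJ by (intro comp)
    note FmA = Fm[OF _ aJ(2) BA]
    define E where "E K s t = (CLINT x|K. of_real (F A B x) * iexp (s * x a + \<theta> t x))" for K s t
    have IH: "E N s t = E N' s t" for s t
    proof -
      have "(\<Sum>j\<in>J - A. (t(a := s)) j * x j) = s * x a + \<theta> t x" for x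
      proof -
        have "(\<Sum>j\<in>R. (t(a := s)) j * x j) = \<theta> t x"
          unfolding \<theta>_def using R(2) by (intro sum.cong) auto
        then show ?thesis using R by simp
      qed
      then show ?thesis
        using insert.IH[of B "t(a := s)"] insert.prems unfolding E_def by simp
    qed
    have prodexp: "iexp (s + u) = iexp s * iexp u" for s u :: real
      by (simp add: exp_add[symmetric] algebra_simps)
    have Eint: "integrable K (\<lambda>x. of_real (F A B x) * iexp (s * x a + \<theta> t x))" if K: "good K" for K s t
    proof (rule bintc[OF K])
      note [measurable] = FmA[OF K] th[OF K] ca[OF K]
      show "(\<lambda>x. of_real (F A B x) * iexp (s * x a + \<theta> t x)) \<in> borel_measurable K" by measurable
      show "cmod (of_real (F A B x) * iexp (s * x a + \<theta> t x)) \<le> 1" for x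
        using F01[of A B x] by (simp add: norm_mult)
    qed
    have Rint: "integrable K (\<lambda>x. F A B x * indicat_real (B a) (x a) * h (\<theta> t x))"
      if K: "good K" and [measurable]: "h \<in> borel_measurable borel" and h: "\<And>y. \<bar>h y\<bar> \<le> (1::real)" for K t h
    proof (rule bintr[OF K])
      note [measurable] = FmA[OF K] th[OF K] ca[OF K]
      show "(\<lambda>x. F A B x * indicat_real (B a) (x a) * h (\<theta> t x)) \<in> borel_measurable K" by measurable
      show "\<bar>F A B x * indicat_real (B a) (x a) * h (\<theta> t x)\<bar> \<le> 1" for x
        using F01[of A B x] h[of "\<theta> t x"] by (auto simp: abs_mult indicator_def intro!: mult_le_one)
    qed
    \<comment> \<open>Weights must be nonnegative for Levy's theorem, hence the shift by 1.\<close>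
    have W: "(LINT x|N. F A B x * (1 + h (\<theta> t x)) * indicat_real (B a) (x a)) =
      (LINT x|N'. F A B x * (1 + h (\<theta> t x)) * indicat_real (B a) (x a))"
      if hm [measurable]: "h \<in> borel_measurable borel" and h: "\<And>y. \<bar>h y\<bar> \<le> (1::real)"
        and hexp: "\<And>y. complex_of_real (h y) = p * iexp y + q * iexp (- y)" for h p q t
    proof (rule weighted_law_unique[where K = 2])
      note [measurable] = FmA[OF good(1)] th[OF good(1)] ca[OF good(1)] FmA[OF good(2)] th[OF good(2)] ca[OF good(2)]
      show "(\<lambda>x. x a) \<in> borel_measurable N" "(\<lambda>x. F A B x * (1 + h (\<theta> t x))) \<in> borel_measurable N"
        "(\<lambda>x. x a) \<in> borel_measurable N'" "(\<lambda>x. F A B x * (1 + h (\<theta> t x))) \<in> borel_measurable N'"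
        by measurable
      have h1: "- 1 \<le> h y" "h y \<le> 1" for y using h[of y] by (auto simp: abs_le_iff)
      show b: "0 \<le> F A B x * (1 + h (\<theta> t x))" for x
        using F01[of A B x] h1[of "\<theta> t x"] by (intro mult_nonneg_nonneg) auto
      show b2: "F A B x * (1 + h (\<theta> t x)) \<le> 2" for x
      proof -
        have "F A B x * (1 + h (\<theta> t x)) \<le> 1 * 2"
          using F01[of A B x] h1[of "\<theta> t x"] by (intro mult_mono) auto
        then show ?thesis by simp
      qed
      show "0 \<le> F A B x * (1 + h (\<theta> t x))" "F A B x * (1 + h (\<theta> t x)) \<le> 2" for x by (rule b b2)+
      fix s
      have expand: "(CLINT x|K. of_real (F A B x * (1 + h (\<theta> t x))) * iexp (s * x a)) =
         E K s (\<lambda>_. 0) + p * E K s t + q * E K s (\<lambda>j. - t j)" if K: "good K" for K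
      proof -
        note i = Eint[OF K]
        have "(CLINT x|K. of_real (F A B x * (1 + h (\<theta> t x))) * iexp (s * x a)) =
          (CLINT x|K. of_real (F A B x) * iexp (s * x a + \<theta> (\<lambda>_. 0) x)
            + p * (of_real (F A B x) * iexp (s * x a + \<theta> t x))
            + q * (of_real (F A B x) * iexp (s * x a + \<theta> (\<lambda>j. - t j) x)))"
        proof (intro Bochner_Integration.integral_cong refl)
          fix x
          have neg: "\<theta> (\<lambda>j. - t j) x = - \<theta> t x" "\<theta> (\<lambda>_. 0) x = 0"
            by (simp_all add: \<theta>_def sum_negf)
          show "of_real (F A B x * (1 + h (\<theta> t x))) * iexp (s * x a) =
            of_real (F A B x) * iexp (s * x a + \<theta> (\<lambda>_. 0) x)
            + p * (of_real (F A B x) * iexp (s * x a + \<theta> t x))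
            + q * (of_real (F A B x) * iexp (s * x a + \<theta> (\<lambda>j. - t j) x))"
            unfolding neg prodexp
            unfolding of_real_mult of_real_add hexp by (simp add: algebra_simps)
        qed
        also have "\<dots> = E K s (\<lambda>_. 0) + p * E K s t + q * E K s (\<lambda>j. - t j)"
        proof -
          have "has_bochner_integral K (\<lambda>x. of_real (F A B x) * iexp (s * x a + \<theta> (\<lambda>_. 0) x)
            + p * (of_real (F A B x) * iexp (s * x a + \<theta> t x))
            + q * (of_real (F A B x) * iexp (s * x a + \<theta> (\<lambda>j. - t j) x)))
            (E K s (\<lambda>_. 0) + p * E K s t + q * E K s (\<lambda>j. - t j))"
            unfolding E_def
            by (intro has_bochner_integral_add has_bochner_integral_mult_right has_bochner_integral_integrable i)
          then show ?thesis by (rule has_bochner_integral_integral_eq)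
        qed
        finally show ?thesis .
      qed
      show "(CLINT x|N. of_real (F A B x * (1 + h (\<theta> t x))) * iexp (s * x a)) =
        (CLINT x|N'. of_real (F A B x * (1 + h (\<theta> t x))) * iexp (s * x a))"
        unfolding expand[OF good(1)] expand[OF good(2)] IH ..
    qed (use prob in simp_all)
    \<comment> \<open>Subtracting the instance \<open>h = 0\<close> removes the shift. Taking
      \<open>cos\<close> and \<open>sin\<close> for \<open>h\<close> then recovers the exponential
      of the remaining coordinates.\<close>
    have V: "(LINT x|N. F A B x * indicat_real (B a) (x a) * h (\<theta> t x)) =
      (LINT x|N'. F A B x * indicat_real (B a) (x a) * h (\<theta> t x))"
      if hm [measurable]: "h \<in> borel_measurable borel" and h: "\<And>y. \<bar>h y\<bar> \<le> (1::real)"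
        and hexp: "\<And>y. complex_of_real (h y) = p * iexp y + q * iexp (- y)" for h p q t
    proof -
      have split: "(LINT x|K. F A B x * (1 + h (\<theta> t x)) * indicat_real (B a) (x a)) =
        (LINT x|K. F A B x * indicat_real (B a) (x a)) + (LINT x|K. F A B x * indicat_real (B a) (x a) * h (\<theta> t x))"
        if K: "good K" for K
      proof -
        have "integrable K (\<lambda>x. F A B x * indicat_real (B a) (x a))"
          using Rint[OF K, of "\<lambda>_. 1" t] by simp
        then show ?thesis
          using Rint[OF K hm h, of t]
          by (subst Bochner_Integration.integral_add[symmetric]) (simp_all add: algebra_simps)
      qed
      have "(LINT x|N. F A B x * indicat_real (B a) (x a)) = (LINT x|N'. F A B x * indicat_real (B a) (x a))"
        using W[of "\<lambda>_. 0" 0 0 t] by simp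
      then show ?thesis using W[OF hm h hexp, of t] split[OF good(1)] split[OF good(2)] by simp
    qed
    have fin_form: "(CLINT x|K. of_real (F (insert a A) B x) * iexp (\<theta> t x)) =
       of_real (LINT x|K. F A B x * indicat_real (B a) (x a) * cos (\<theta> t x)) +
       \<i> * of_real (LINT x|K. F A B x * indicat_real (B a) (x a) * sin (\<theta> t x))"
      if K: "good K" for K
    proof -
      have i: "integrable K (\<lambda>x. F A B x * indicat_real (B a) (x a) * cos (\<theta> t x))"
        "integrable K (\<lambda>x. F A B x * indicat_real (B a) (x a) * sin (\<theta> t x))"
        using Rint[OF K, of cos t] Rint[OF K, of sin t] by auto
      have "(CLINT x|K. of_real (F (insert a A) B x) * iexp (\<theta> t x)) =
        (CLINT x|K. of_real (F A B x * indicat_real (B a) (x a) * cos (\<theta> t x)) +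
          \<i> * of_real (F A B x * indicat_real (B a) (x a) * sin (\<theta> t x)))"
      proof (intro Bochner_Integration.integral_cong refl)
        fix x
        have "F (insert a A) B x = F A B x * indicat_real (B a) (x a)"
          using insert.hyps by (simp add: F_def mult.commute)
        moreover have "iexp (\<theta> t x) = of_real (cos (\<theta> t x)) + \<i> * of_real (sin (\<theta> t x))"
          by (simp add: exp_Euler cos_of_real sin_of_real)
        ultimately show "of_real (F (insert a A) B x) * iexp (\<theta> t x) =
          of_real (F A B x * indicat_real (B a) (x a) * cos (\<theta> t x)) +
          \<i> * of_real (F A B x * indicat_real (B a) (x a) * sin (\<theta> t x))"
          by (simp add: algebra_simps)
      qed
      also have "\<dots> = of_real (LINT x|K. F A B x * indicat_real (B a) (x a) * cos (\<theta> t x)) +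
       \<i> * of_real (LINT x|K. F A B x * indicat_real (B a) (x a) * sin (\<theta> t x))"
        by (rule has_bochner_integral_integral_eq)
          (intro has_bochner_integral_add has_bochner_integral_mult_right has_bochner_integral_of_real
            has_bochner_integral_integrable i)
      finally show ?thesis .
    qed
    have cosx: "complex_of_real (cos y) = (1/2) * iexp y + (1/2) * iexp (- y)" for y
      by (simp add: cos_exp_eq cos_of_real[symmetric])
    have sinx: "complex_of_real (sin y) = (1/(2*\<i>)) * iexp y + (-1/(2*\<i>)) * iexp (- y)" for y
      by (simp add: sin_exp_eq sin_of_real[symmetric] field_simps)
    have cs: "cos \<in> borel_measurable (borel :: real measure)" "sin \<in> borel_measurable (borel :: real measure)" by simp_all
    have "(CLINT x|N. of_real (F (insert a A) B x) * iexp (\<theta> t x)) = (CLINT x|N'. of_real (F (insert a A) B x) * iexp (\<theta> t x))"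
      unfolding fin_form[OF good(1)] fin_form[OF good(2)]
        V[OF cs(1) abs_cos_le_one cosx] V[OF cs(2) abs_sin_le_one sinx] ..
    then show ?case unfolding R_def[symmetric] \<theta>_def .
  qed
  show ?thesis
  proof (rule measure_eqI_PiM_finite[OF fin sets, where A = "\<lambda>_. space (PiM J (\<lambda>_. borel))"])
    fix B assume B: "\<And>j. j \<in> J \<Longrightarrow> B j \<in> sets (borel :: real measure)"
    have val: "emeasure K (Pi\<^sub>E J B) = ennreal (LINT x|K. F J B x)" if K: "good K" for K
    proof -
      have sp: "space K = Pi\<^sub>E J (\<lambda>_. UNIV)"
        using sets_eq_imp_space_eq[of K "PiM J (\<lambda>_. borel)"] K by (simp add: good_def space_PiM)
      have "Pi\<^sub>E J B \<in> sets K"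
        using K sets_PiM_I_finite[OF fin, of B "\<lambda>_. borel"] B by (simp add: good_def)
      then have "emeasure K (Pi\<^sub>E J B) = (\<integral>\<^sup>+x. indicator (Pi\<^sub>E J B) x \<partial>K)" by simp
      also have "\<dots> = (\<integral>\<^sup>+x. ennreal (F J B x) \<partial>K)"
      proof (rule nn_integral_cong)
        fix x assume "x \<in> space K"
        then have "x \<in> Pi\<^sub>E J B \<longleftrightarrow> (\<forall>j\<in>J. x j \<in> B j)" by (auto simp: sp PiE_iff)
        then show "indicator (Pi\<^sub>E J B) x = ennreal (F J B x)"
        proof (cases "\<forall>j\<in>J. x j \<in> B j")
          case True
          then have "F J B x = 1" unfolding F_def by (intro prod.neutral) auto
          with True \<open>x \<in> Pi\<^sub>E J B \<longleftrightarrow> (\<forall>j\<in>J. x j \<in> B j)\<close> show ?thesis by simp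
        next
          case False
          then obtain j where "j \<in> J" "x j \<notin> B j" by auto
          then have "F J B x = 0" unfolding F_def using fin by (intro prod_zero bexI[of _ j]) auto
          with False \<open>x \<in> Pi\<^sub>E J B \<longleftrightarrow> (\<forall>j\<in>J. x j \<in> B j)\<close> show ?thesis by simp
        qed
      qed
      also have "\<dots> = ennreal (LINT x|K. F J B x)"
        using F01[of J B] Fm[OF K order_refl B] by (intro nn_integral_eq_integral bintr[OF K]) auto
      finally show ?thesis .
    qed
    have "complex_of_real (LINT x|N. F J B x) = of_real (LINT x|N'. F J B x)"
      using main[OF fin, of B "\<lambda>_. 0"] B by simp
    then show "emeasure N (Pi\<^sub>E J B) = emeasure N' (Pi\<^sub>E J B)"
      using val[OF good(1)] val[OF good(2)] by simp
  next
    show "range (\<lambda>_. space (PiM J (\<lambda>_. borel))) \<subseteq> prod_algebra J (\<lambda>_. borel :: real measure)"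
      using fin by (auto simp: space_PiM intro!: prod_algebraI_finite)
    show "emeasure N (space (PiM J (\<lambda>_. borel))) \<noteq> \<infinity>"
      by (simp add: finite_measure.emeasure_finite[OF prob_space.finite_measure[OF prob(1)]])
  qed auto
qed


section \<open>Standard complex Gaussian families\<close>

text \<open>Entry \<open>m\<close> of a family of independent standard complex Gaussians is read off from two real coordinates.\<close>
definition cgauss_space :: "'i set \<Rightarrow> ('i \<times> bool \<Rightarrow> real) measure" where
  "cgauss_space I = PiM (I \<times> UNIV) (\<lambda>_. std_normal_distribution)"

text \<open>The factor \<open>sqrt 2\<close> normalises the second absolute moment to 1: real and
  imaginary part have variance \<open>1 / 2\<close> each.\<close>

definition cg :: "('i \<times> bool \<Rightarrow> real) \<Rightarrow> 'i \<Rightarrow> complex" where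
  "cg h m = Complex (h (m, False) / sqrt 2) (h (m, True) / sqrt 2)"

lemma prob_space_std_normal: "prob_space std_normal_distribution"
  by (rule prob_space_normal_density) simp

lemma prob_space_cgauss_space: "prob_space (cgauss_space I)"
  unfolding cgauss_space_def by (intro prob_space_PiM prob_space_std_normal)

lemma cg_measurable [measurable]: "i \<in> I \<Longrightarrow> (\<lambda>h. cg h i) \<in> borel_measurable (cgauss_space I)"
proof -
  assume i: "i \<in> I"
  have "(\<lambda>h. h (i, b)) \<in> borel_measurable (cgauss_space I)" for b
  proof -
    have "(\<lambda>h. h (i, b)) \<in> measurable (cgauss_space I) std_normal_distribution"
      unfolding cgauss_space_def using i by (intro measurable_component_singleton) auto
    then show ?thesis by (simp cong: measurable_cong_sets)
  qed
  then show ?thesis unfolding cg_def Complex_eq by measurable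
qed

lemma product_sigma_finite_std_normal: "product_sigma_finite (\<lambda>_. std_normal_distribution)"
  unfolding product_sigma_finite_def
  using prob_space_std_normal prob_space_imp_sigma_finite by blast

lemma char_real_gaussian_family:
  assumes "finite K"
  shows "(CLINT h|PiM K (\<lambda>_. std_normal_distribution). iexp (\<Sum>j\<in>K. r j * h j)) = of_real (exp (- (\<Sum>j\<in>K. (r j)\<^sup>2) / 2))"
proof -
  interpret product_sigma_finite "\<lambda>_. std_normal_distribution" by (rule product_sigma_finite_std_normal)
  interpret std: real_distribution std_normal_distribution by (rule real_dist_normal_dist)
  have "(CLINT h|PiM K (\<lambda>_. std_normal_distribution). iexp (\<Sum>j\<in>K. r j * h j))
      = (CLINT h|PiM K (\<lambda>_. std_normal_distribution). (\<Prod>j\<in>K. iexp (r j * h j)))"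
    using assms by (simp add: exp_sum[symmetric] sum_distrib_left)
  also have "\<dots> = (\<Prod>j\<in>K. CLINT x|std_normal_distribution. iexp (r j * x))"
    using assms by (intro product_integral_prod) (auto intro!: std.integrable_iexp)
  also have "\<dots> = (\<Prod>j\<in>K. char std_normal_distribution (r j))"
    by (simp add: char_def)
  also have "\<dots> = (\<Prod>j\<in>K. of_real (exp (- ((r j)\<^sup>2) / 2)))"
    by (simp add: char_std_normal_distribution)
  also have "\<dots> = of_real (exp (\<Sum>j\<in>K. - ((r j)\<^sup>2) / 2))"
    using assms by (simp add: exp_sum)
  also have "(\<Sum>j\<in>K. - ((r j)\<^sup>2) / 2) = - (\<Sum>j\<in>K. (r j)\<^sup>2) / 2"
    by (simp add: sum_negf sum_divide_distrib)
  finally show ?thesis .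
qed

lemma Re_sum_cg:
  assumes "finite I"
  shows "Re (\<Sum>i\<in>I. d i * cg h i) =
    (\<Sum>p\<in>I \<times> UNIV. (if snd p then - Im (d (fst p)) else Re (d (fst p))) / sqrt 2 * h p)"
proof -
  have "(\<Sum>p\<in>I \<times> (UNIV :: bool set). (if snd p then - Im (d (fst p)) else Re (d (fst p))) / sqrt 2 * h p)
      = (\<Sum>i\<in>I. \<Sum>b\<in>UNIV. (if b then - Im (d i) else Re (d i)) / sqrt 2 * h (i, b))"
    using assms by (subst sum.cartesian_product) (simp add: case_prod_unfold)
  also have "\<dots> = Re (\<Sum>i\<in>I. d i * cg h i)"
    by (simp add: UNIV_bool cg_def)
  finally show ?thesis by simp
qed

lemma sum_sq_cg:
  assumes "finite I"
  shows "(\<Sum>p\<in>I \<times> (UNIV :: bool set). ((if snd p then - Im (d (fst p)) else Re (d (fst p))) / sqrt 2)\<^sup>2)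
     = (\<Sum>i\<in>I. (cmod (d i))\<^sup>2) / 2"
proof -
  have "(\<Sum>p\<in>I \<times> (UNIV :: bool set). ((if snd p then - Im (d (fst p)) else Re (d (fst p))) / sqrt 2)\<^sup>2)
      = (\<Sum>i\<in>I. \<Sum>b\<in>UNIV. ((if b then - Im (d i) else Re (d i)) / sqrt 2)\<^sup>2)"
    using assms by (subst sum.cartesian_product) (simp add: case_prod_unfold)
  also have "\<dots> = (\<Sum>i\<in>I. (cmod (d i))\<^sup>2 / 2)"
    by (intro sum.cong refl) (simp add: UNIV_bool power_divide cmod_power2 add_divide_distrib)
  finally show ?thesis by (simp add: sum_divide_distrib)
qed

text \<open>The real part has half the sum of the squared moduli as its variance, which turns the
  usual 2 in the exponent into 4.\<close>

lemma char_complex_gaussian_family: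
  assumes "finite I"
  shows "(CLINT h|cgauss_space I. iexp (Re (\<Sum>i\<in>I. d i * cg h i))) = of_real (exp (- (\<Sum>i\<in>I. (cmod (d i))\<^sup>2) / 4))"
  using char_real_gaussian_family[of "I \<times> (UNIV :: bool set)" "\<lambda>p. (if snd p then - Im (d (fst p)) else Re (d (fst p))) / sqrt 2"] assms
  unfolding cgauss_space_def Re_sum_cg[OF assms] sum_sq_cg[OF assms] by simp

text \<open>Complex coefficients make \<open>Re (\<Sum>j\<in>J. c j * Z j x)\<close> run through all
  real combinations of real and imaginary parts, so the real statement applies to these;
  \<open>\<phi>\<close> reassembles the complex numbers.\<close>

lemma complex_law_unique:
  fixes Z :: "'j \<Rightarrow> 'a \<Rightarrow> complex" and Z' :: "'j \<Rightarrow> 'b \<Rightarrow> complex"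
  assumes fin: "finite J" and prob: "prob_space M" "prob_space M'"
    and meas: "\<And>j. j \<in> J \<Longrightarrow> Z j \<in> borel_measurable M" "\<And>j. j \<in> J \<Longrightarrow> Z' j \<in> borel_measurable M'"
    and eq: "\<And>c. (CLINT x|M. iexp (Re (\<Sum>j\<in>J. c j * Z j x))) = (CLINT x|M'. iexp (Re (\<Sum>j\<in>J. c j * Z' j x)))"
  shows "distr M (PiM J (\<lambda>_. borel)) (\<lambda>x. \<lambda>j\<in>J. Z j x) = distr M' (PiM J (\<lambda>_. borel)) (\<lambda>x. \<lambda>j\<in>J. Z' j x)"
proof -
  let ?K = "J \<times> (UNIV :: bool set)"
  let ?P = "PiM ?K (\<lambda>_. borel :: real measure)"
  let ?z = "\<lambda>Y x. \<lambda>p\<in>?K. if snd p then Im (Y (fst p) x) else Re (Y (fst p) x)"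
  define \<phi> where "\<phi> y = (\<lambda>j\<in>J. Complex (y (j, False)) (y (j, True)))" for y :: "'j \<times> bool \<Rightarrow> real"
  have sums: "(\<Sum>p\<in>?K. t p * (\<lambda>p\<in>?K. if snd p then Im (Y (fst p) x) else Re (Y (fst p) x)) p)
      = Re (\<Sum>j\<in>J. Complex (t (j, False)) (- t (j, True)) * Y j x)" for t and Y :: "'j \<Rightarrow> 'c \<Rightarrow> complex" and x
  proof -
    have "(\<Sum>p\<in>?K. t p * (\<lambda>p\<in>?K. if snd p then Im (Y (fst p) x) else Re (Y (fst p) x)) p)
        = (\<Sum>p\<in>?K. t p * (if snd p then Im (Y (fst p) x) else Re (Y (fst p) x)))"
      by (intro sum.cong) auto
    also have "\<dots> = (\<Sum>j\<in>J. \<Sum>b\<in>UNIV. t (j, b) * (if b then Im (Y j x) else Re (Y j x)))"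
      using fin by (subst sum.cartesian_product) (simp add: case_prod_unfold)
    also have "\<dots> = Re (\<Sum>j\<in>J. Complex (t (j, False)) (- t (j, True)) * Y j x)"
      by (simp add: UNIV_bool)
    finally show ?thesis .
  qed
  have zm: "(\<lambda>x. \<lambda>p\<in>?K. if snd p then Im (Y (fst p) x) else Re (Y (fst p) x)) \<in> measurable L ?P"
    if "\<And>j. j \<in> J \<Longrightarrow> Y j \<in> borel_measurable L" for L :: "'c measure" and Y
  proof (rule measurable_restrict)
    fix p assume p: "p \<in> ?K"
    have [measurable]: "Y (fst p) \<in> borel_measurable L" using that[of "fst p"] p by auto
    show "(\<lambda>x. if snd p then Im (Y (fst p) x) else Re (Y (fst p) x)) \<in> borel_measurable L"
      by (cases "snd p") simp_all
  qed
  have z1: "?z Z \<in> measurable M ?P" and z2: "?z Z' \<in> measurable M' ?P"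
    by (rule zm, rule meas, assumption)+
  have \<phi>m: "\<phi> \<in> measurable ?P (PiM J (\<lambda>_. borel))"
    unfolding \<phi>_def Complex_eq
  proof (rule measurable_restrict)
    fix j assume j: "j \<in> J"
    have "(\<lambda>y. y (j, b)) \<in> borel_measurable ?P" for b
      by (rule measurable_component_singleton) (use j in auto)
    then show "(\<lambda>y. complex_of_real (y (j, False)) + \<i> * complex_of_real (y (j, True))) \<in> borel_measurable ?P"
      by simp
  qed
  have "distr M ?P (?z Z) = distr M' ?P (?z Z')"
  proof (rule product_law_unique[where J = ?K])
    fix t
    have S: "(\<lambda>x. \<Sum>p\<in>?K. t p * x p) \<in> borel_measurable ?P"
      by (intro borel_measurable_sum borel_measurable_times measurable_component_singleton) auto
    have I: "(\<lambda>x. iexp (\<Sum>p\<in>?K. t p * x p)) \<in> borel_measurable ?P"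
      using S by measurable
    show "(CLINT x|distr M ?P (?z Z). iexp (\<Sum>p\<in>?K. t p * x p)) = (CLINT x|distr M' ?P (?z Z'). iexp (\<Sum>p\<in>?K. t p * x p))"
      unfolding integral_distr[OF z1 I] integral_distr[OF z2 I] sums by (rule eq)
  next
    show "prob_space (distr M ?P (?z Z))" by (rule prob_space.prob_space_distr[OF prob(1) z1])
    show "prob_space (distr M' ?P (?z Z'))" by (rule prob_space.prob_space_distr[OF prob(2) z2])
  qed (use fin in simp_all)
  then have "distr (distr M ?P (?z Z)) (PiM J (\<lambda>_. borel)) \<phi> = distr (distr M' ?P (?z Z')) (PiM J (\<lambda>_. borel)) \<phi>"
    by simp
  moreover have comp: "\<phi> \<circ> (\<lambda>x. \<lambda>p\<in>?K. if snd p then Im (Y (fst p) x) else Re (Y (fst p) x)) = (\<lambda>x. \<lambda>j\<in>J. Y j x)"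
    for Y :: "'j \<Rightarrow> 'c \<Rightarrow> complex"
    by (auto simp: \<phi>_def fun_eq_iff restrict_def)
  ultimately show ?thesis
    unfolding distr_distr[OF \<phi>m z1] distr_distr[OF \<phi>m z2] comp by - assumption
qed

section \<open>Gaussian exponential integrals, small balls and tails\<close>

lemma nn_integral_normal_density: "0 < \<sigma> \<Longrightarrow> (\<integral>\<^sup>+x. ennreal (normal_density \<mu> \<sigma> x) \<partial>lborel) = 1"
  using prob_space.emeasure_space_1[OF prob_space_normal_density[of \<sigma> \<mu>]]
  by (simp add: emeasure_density)

text \<open>Completing the square turns the product of the two exponentials into a multiple of a
  Gaussian density. The factor left over,
  \<open>exp (- \<kappa> * a\<^sup>2 / (1 + \<kappa>))\<close>, is at most 1, so
  \<open>a = 0\<close> is the worst case.\<close>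

lemma gaussian_exp_square_le:
  assumes "0 \<le> \<kappa>"
  shows "(\<integral>\<^sup>+x. ennreal (exp (- \<kappa> * (x / sqrt 2 + a)\<^sup>2)) \<partial>std_normal_distribution) \<le> ennreal (1 / sqrt (1 + \<kappa>))"
proof -
  \<comment> \<open>Standard deviation, and below it the mean, of the Gaussian that completing the
    square produces.\<close>
  define \<sigma> where "\<sigma> = 1 / sqrt (1 + \<kappa>)"
  define \<mu> where "\<mu> = - (sqrt 2 * \<kappa> * a / (1 + \<kappa>))"
  have \<sigma>: "0 < \<sigma>" "\<sigma>\<^sup>2 = 1 / (1 + \<kappa>)" using assms by (auto simp: \<sigma>_def power_divide)
  have pw: "std_normal_density x * exp (- \<kappa> * (x / sqrt 2 + a)\<^sup>2) \<le> \<sigma> * normal_density \<mu> \<sigma> x" for x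
  proof -
    have c: "\<sigma> * (1 / sqrt (2 * pi * \<sigma>\<^sup>2)) = 1 / sqrt (2 * pi)"
      using \<sigma>(1) by (simp add: real_sqrt_mult)
    have "- x\<^sup>2 / 2 - \<kappa> * (x / sqrt 2 + a)\<^sup>2 = - ((1 + \<kappa>) * (x - \<mu>)\<^sup>2) / 2 - \<kappa> * a\<^sup>2 / (1 + \<kappa>)"
    proof -
      define Q where "Q = \<kappa>\<^sup>2 * a\<^sup>2 / (1 + \<kappa>)"
      have Q: "\<kappa> * a\<^sup>2 / (1 + \<kappa>) = \<kappa> * a\<^sup>2 - Q"
        using assms by (simp add: Q_def field_simps power2_eq_square)
      have e1: "(x / sqrt 2 + a)\<^sup>2 = x\<^sup>2 / 2 + sqrt 2 * a * x + a\<^sup>2"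
        by (simp add: power2_sum power_divide field_simps)
      have e2: "(1 + \<kappa>) * (x - \<mu>)\<^sup>2 = (1 + \<kappa>) * x\<^sup>2 + 2 * sqrt 2 * \<kappa> * a * x + 2 * Q"
      proof -
        have "(1 + \<kappa>) * (x - \<mu>)\<^sup>2 = (1 + \<kappa>) * x\<^sup>2 - 2 * x * ((1 + \<kappa>) * \<mu>) + ((1 + \<kappa>) * \<mu>)\<^sup>2 / (1 + \<kappa>)"
          using assms by (simp add: power2_eq_square field_simps)
        moreover have "(1 + \<kappa>) * \<mu> = - (sqrt 2 * \<kappa> * a)" using assms by (simp add: \<mu>_def)
        moreover have "(- (sqrt 2 * \<kappa> * a))\<^sup>2 = 2 * \<kappa>\<^sup>2 * a\<^sup>2" by (simp add: power_mult_distrib)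
        ultimately show ?thesis by (simp add: Q_def)
      qed
      show ?thesis unfolding e1 e2 Q by (simp add: algebra_simps add_divide_distrib diff_divide_distrib)
    qed
    also have "\<dots> \<le> - ((1 + \<kappa>) * (x - \<mu>)\<^sup>2) / 2" using assms by simp
    also have "\<dots> = - (x - \<mu>)\<^sup>2 / (2 * \<sigma>\<^sup>2)" using assms unfolding \<sigma>(2) by simp
    finally have ex: "exp (- x\<^sup>2 / 2) * exp (- \<kappa> * (x / sqrt 2 + a)\<^sup>2) \<le> exp (- (x - \<mu>)\<^sup>2 / (2 * \<sigma>\<^sup>2))"
      by (simp add: exp_add[symmetric])
    have "std_normal_density x * exp (- \<kappa> * (x / sqrt 2 + a)\<^sup>2)
       = 1 / sqrt (2 * pi) * (exp (- x\<^sup>2 / 2) * exp (- \<kappa> * (x / sqrt 2 + a)\<^sup>2))"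
      by (simp add: normal_density_def)
    also have "\<dots> \<le> 1 / sqrt (2 * pi) * exp (- (x - \<mu>)\<^sup>2 / (2 * \<sigma>\<^sup>2))"
      using ex by (intro mult_left_mono) auto
    also have "\<dots> = \<sigma> * normal_density \<mu> \<sigma> x"
      unfolding normal_density_def c[symmetric] by simp
    finally show ?thesis .
  qed
  have "(\<integral>\<^sup>+x. ennreal (exp (- \<kappa> * (x / sqrt 2 + a)\<^sup>2)) \<partial>std_normal_distribution)
     = (\<integral>\<^sup>+x. ennreal (std_normal_density x * exp (- \<kappa> * (x / sqrt 2 + a)\<^sup>2)) \<partial>lborel)"
    by (subst nn_integral_density) (auto simp: ennreal_mult')
  also have "\<dots> \<le> (\<integral>\<^sup>+x. ennreal \<sigma> * ennreal (normal_density \<mu> \<sigma> x) \<partial>lborel)"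
    using pw \<sigma> by (intro nn_integral_mono) (simp add: ennreal_mult'[symmetric] ennreal_leI)
  also have "\<dots> = ennreal \<sigma>"
    using \<sigma> by (simp add: nn_integral_cmult nn_integral_normal_density)
  finally show ?thesis by (simp add: \<sigma>_def)
qed

lemma gaussian_mgf: "(\<integral>\<^sup>+x. ennreal (exp (s * x)) \<partial>std_normal_distribution) = ennreal (exp (s\<^sup>2 / 2))"
proof -
  have pw: "std_normal_density x * exp (s * x) = exp (s\<^sup>2 / 2) * normal_density s 1 x" for x
  proof -
    have "- x\<^sup>2 / 2 + s * x = s\<^sup>2 / 2 + - (x - s)\<^sup>2 / 2"
      by (simp add: power2_eq_square field_simps)
    then show ?thesis by (simp add: normal_density_def exp_add[symmetric])
  qed
  have "(\<integral>\<^sup>+x. ennreal (exp (s * x)) \<partial>std_normal_distribution) = (\<integral>\<^sup>+x. ennreal (std_normal_density x * exp (s * x)) \<partial>lborel)"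
    by (subst nn_integral_density) (auto simp: ennreal_mult')
  also have "\<dots> = (\<integral>\<^sup>+x. ennreal (exp (s\<^sup>2 / 2)) * ennreal (normal_density s 1 x) \<partial>lborel)"
    unfolding pw by (simp add: ennreal_mult')
  also have "\<dots> = ennreal (exp (s\<^sup>2 / 2))"
    by (simp add: nn_integral_cmult nn_integral_normal_density)
  finally show ?thesis .
qed

text \<open>Markov's inequality for an exponential of the negative sum of squares. Since
  \<open>p\<close> is orthonormal, the linear forms are again independent standard complex
  Gaussians, so the expectation splits into \<open>2 * card P\<close> real factors, each at most
  \<open>1 / sqrt (1 + \<kappa>)\<close> whatever the shift \<open>\<alpha>\<close> is. The
  parameter \<open>\<kappa>\<close> stays free because the two applications need different
  values.\<close>

lemma gaussian_small_ball:
  fixes p :: "'j \<Rightarrow> 'i \<Rightarrow> complex"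
  assumes fin: "finite I" "finite P" and ortho: "orthonormal I P p" and \<kappa>: "0 \<le> \<kappa>"
  shows "emeasure (cgauss_space I) {h\<in>space (cgauss_space I). (\<Sum>j\<in>P. (cmod ((\<Sum>i\<in>I. p j i * cg h i) + \<alpha> j))\<^sup>2) \<le> \<tau>}
    \<le> ennreal (exp (\<kappa> * \<tau>) / (1 + \<kappa>) ^ card P)"
proof -
  let ?PP = "PiM P (\<lambda>_. borel :: complex measure)"
  have law: "distr (cgauss_space I) ?PP (\<lambda>h. \<lambda>j\<in>P. \<Sum>i\<in>I. p j i * cg h i) = distr (cgauss_space P) ?PP (\<lambda>h. \<lambda>j\<in>P. cg h j)"
  proof (rule complex_law_unique[OF fin(2) prob_space_cgauss_space prob_space_cgauss_space])
    fix c
    have "(\<Sum>j\<in>P. c j * (\<Sum>i\<in>I. p j i * cg h i)) = (\<Sum>i\<in>I. (\<Sum>j\<in>P. c j * p j i) * cg h i)" for h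
      unfolding sum_distrib_left sum_distrib_right by (subst sum.swap) (simp add: mult.assoc)
    then have "(CLINT h|cgauss_space I. iexp (Re (\<Sum>j\<in>P. c j * (\<Sum>i\<in>I. p j i * cg h i))))
        = of_real (exp (- (\<Sum>i\<in>I. (cmod (\<Sum>j\<in>P. c j * p j i))\<^sup>2) / 4))"
      using char_complex_gaussian_family[OF fin(1), of "\<lambda>i. \<Sum>j\<in>P. c j * p j i"] by simp
    also have "(\<Sum>i\<in>I. (cmod (\<Sum>j\<in>P. c j * p j i))\<^sup>2) = (\<Sum>j\<in>P. (cmod (c j))\<^sup>2)"
      using orthonormal_combination_norm[OF fin(2) ortho, of c] by (simp add: l2n_sq)
    finally show "(CLINT h|cgauss_space I. iexp (Re (\<Sum>j\<in>P. c j * (\<Sum>i\<in>I. p j i * cg h i))))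
        = (CLINT h|cgauss_space P. iexp (Re (\<Sum>j\<in>P. c j * cg h j)))"
      using char_complex_gaussian_family[OF fin(2), of c] by simp
  qed auto
  define G where "G y = ennreal (exp (\<kappa> * \<tau>)) * ennreal (exp (- \<kappa> * (\<Sum>j\<in>P. (cmod (y j + \<alpha> j))\<^sup>2)))" for y
  have Gm: "G \<in> borel_measurable ?PP"
  proof -
    have [measurable]: "(\<lambda>y. y j) \<in> borel_measurable ?PP" if "j \<in> P" for j
      by (rule measurable_component_singleton) (rule that)
    show ?thesis unfolding G_def by measurable
  qed
  have m1: "(\<lambda>h. \<lambda>j\<in>P. \<Sum>i\<in>I. p j i * cg h i) \<in> measurable (cgauss_space I) ?PP"
    by (intro measurable_restrict borel_measurable_sum borel_measurable_times cg_measurable) auto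
  have m2: "(\<lambda>h. \<lambda>j\<in>P. cg h j) \<in> measurable (cgauss_space P) ?PP"
    by (intro measurable_restrict cg_measurable) auto
  let ?E = "{h\<in>space (cgauss_space I). (\<Sum>j\<in>P. (cmod ((\<Sum>i\<in>I. p j i * cg h i) + \<alpha> j))\<^sup>2) \<le> \<tau>}"
  have sE: "?E \<in> sets (cgauss_space I)"
  proof -
    have [measurable]: "(\<lambda>h. (\<Sum>i\<in>I. p j i * cg h i) + \<alpha> j) \<in> borel_measurable (cgauss_space I)" for j
      by (intro borel_measurable_add borel_measurable_sum borel_measurable_times cg_measurable) auto
    show ?thesis by measurable
  qed
  have "emeasure (cgauss_space I) ?E = (\<integral>\<^sup>+h. indicator ?E h \<partial>cgauss_space I)"
    using sE by simp
  also have "\<dots> \<le> (\<integral>\<^sup>+h. G (\<lambda>j\<in>P. \<Sum>i\<in>I. p j i * cg h i) \<partial>cgauss_space I)"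
  proof (rule nn_integral_mono)
    fix h
    have "(1::real) \<le> exp (\<kappa> * \<tau>) * exp (- \<kappa> * (\<Sum>j\<in>P. (cmod ((\<Sum>i\<in>I. p j i * cg h i) + \<alpha> j))\<^sup>2))" if "h \<in> ?E"
      using that \<kappa> by (simp add: exp_add[symmetric] mult_left_mono)
    then show "indicator ?E h \<le> G (\<lambda>j\<in>P. \<Sum>i\<in>I. p j i * cg h i)"
      unfolding G_def by (auto simp: indicator_def ennreal_mult'[symmetric] simp del: ennreal_1 simp flip: ennreal_1
          intro!: ennreal_leI split: if_splits)
  qed
  also have "\<dots> = (\<integral>\<^sup>+y. G y \<partial>distr (cgauss_space I) ?PP (\<lambda>h. \<lambda>j\<in>P. \<Sum>i\<in>I. p j i * cg h i))"
    by (rule nn_integral_distr[OF m1, symmetric]) (use Gm in simp)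
  also have "\<dots> = (\<integral>\<^sup>+h. G (\<lambda>j\<in>P. cg h j) \<partial>cgauss_space P)"
    unfolding law by (rule nn_integral_distr[OF m2]) (use Gm in simp)
  also have "\<dots> = (\<integral>\<^sup>+h. ennreal (exp (\<kappa> * \<tau>)) *
      (\<Prod>q\<in>P \<times> UNIV. ennreal (exp (- \<kappa> * (h q / sqrt 2 + (if snd q then Im (\<alpha> (fst q)) else Re (\<alpha> (fst q))))\<^sup>2))) \<partial>cgauss_space P)"
  proof (rule nn_integral_cong)
    fix h
    have "(\<Prod>q\<in>P \<times> (UNIV :: bool set). ennreal (exp (- \<kappa> * (h q / sqrt 2 + (if snd q then Im (\<alpha> (fst q)) else Re (\<alpha> (fst q))))\<^sup>2)))
       = ennreal (\<Prod>q\<in>P \<times> (UNIV :: bool set). exp (- \<kappa> * (h q / sqrt 2 + (if snd q then Im (\<alpha> (fst q)) else Re (\<alpha> (fst q))))\<^sup>2))"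
      by (rule prod_ennreal) simp
    also have "(\<Prod>q\<in>P \<times> (UNIV :: bool set). exp (- \<kappa> * (h q / sqrt 2 + (if snd q then Im (\<alpha> (fst q)) else Re (\<alpha> (fst q))))\<^sup>2))
       = exp (\<Sum>q\<in>P \<times> (UNIV :: bool set). - \<kappa> * (h q / sqrt 2 + (if snd q then Im (\<alpha> (fst q)) else Re (\<alpha> (fst q))))\<^sup>2)"
      using fin by (simp add: exp_sum)
    also have "(\<Sum>q\<in>P \<times> (UNIV :: bool set). - \<kappa> * (h q / sqrt 2 + (if snd q then Im (\<alpha> (fst q)) else Re (\<alpha> (fst q))))\<^sup>2)
       = (\<Sum>j\<in>P. \<Sum>b\<in>UNIV. - \<kappa> * (h (j, b) / sqrt 2 + (if b then Im (\<alpha> j) else Re (\<alpha> j)))\<^sup>2)"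
      using fin by (subst sum.cartesian_product) (simp add: case_prod_unfold)
    also have "\<dots> = - \<kappa> * (\<Sum>j\<in>P. (cmod (cg h j + \<alpha> j))\<^sup>2)"
      unfolding sum_distrib_left by (intro sum.cong refl) (simp add: UNIV_bool cmod_power2 cg_def distrib_left)
    finally show "G (\<lambda>j\<in>P. cg h j) = ennreal (exp (\<kappa> * \<tau>)) *
      (\<Prod>q\<in>P \<times> UNIV. ennreal (exp (- \<kappa> * (h q / sqrt 2 + (if snd q then Im (\<alpha> (fst q)) else Re (\<alpha> (fst q))))\<^sup>2)))"
      by (simp add: G_def)
  qed
  also have "\<dots> = ennreal (exp (\<kappa> * \<tau>)) *
     (\<Prod>q\<in>P \<times> UNIV. \<integral>\<^sup>+x. ennreal (exp (- \<kappa> * (x / sqrt 2 + (if snd q then Im (\<alpha> (fst q)) else Re (\<alpha> (fst q))))\<^sup>2)) \<partial>std_normal_distribution)"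
  proof -
    interpret product_sigma_finite "\<lambda>_. std_normal_distribution" by (rule product_sigma_finite_std_normal)
    have m: "(\<lambda>h. h q) \<in> borel_measurable (cgauss_space P)" if "q \<in> P \<times> UNIV" for q
    proof -
      have "(\<lambda>h. h q) \<in> measurable (cgauss_space P) std_normal_distribution"
        unfolding cgauss_space_def by (rule measurable_component_singleton) (rule that)
      then show ?thesis by (simp cong: measurable_cong_sets)
    qed
    have "(\<lambda>h. \<Prod>q\<in>P \<times> UNIV. ennreal (exp (- \<kappa> * (h q / sqrt 2 + (if snd q then Im (\<alpha> (fst q)) else Re (\<alpha> (fst q))))\<^sup>2)))
       \<in> borel_measurable (cgauss_space P)"
      using m by (intro borel_measurable_prod_ennreal) simp
    then show ?thesis
      using fin unfolding cgauss_space_def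
      by (subst nn_integral_cmult) (auto intro!: arg_cong2[where f="(*)"] product_nn_integral_prod)
  qed
  also have "\<dots> \<le> ennreal (exp (\<kappa> * \<tau>)) * (\<Prod>q\<in>P \<times> (UNIV :: bool set). ennreal (1 / sqrt (1 + \<kappa>)))"
    by (intro mult_left_mono prod_mono_ennreal gaussian_exp_square_le \<kappa>) simp
  also have "(\<Prod>q\<in>P \<times> (UNIV :: bool set). ennreal (1 / sqrt (1 + \<kappa>))) = ennreal (1 / (1 + \<kappa>) ^ card P)"
    using \<kappa> by (simp add: card_cartesian_product ennreal_power mult.commute[of "card P" 2] power_mult power_divide)
  also have "ennreal (exp (\<kappa> * \<tau>)) * ennreal (1 / (1 + \<kappa>) ^ card P) = ennreal (exp (\<kappa> * \<tau>) / (1 + \<kappa>) ^ card P)"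
    using \<kappa> by (simp add: ennreal_mult'[symmetric])
  finally show ?thesis .
qed

text \<open>Chernoff's bound. The real part has variance at most \<open>D / 2\<close>, whence the
  denominator 4.\<close>

lemma gaussian_tail:
  assumes fin: "finite I" and s: "0 \<le> s" and D: "(\<Sum>i\<in>I. (cmod (d i))\<^sup>2) \<le> D"
  shows "emeasure (cgauss_space I) {h\<in>space (cgauss_space I). \<tau> < Re (\<Sum>i\<in>I. d i * cg h i)}
    \<le> ennreal (exp (s\<^sup>2 * D / 4 - s * \<tau>))"
proof -
  interpret product_sigma_finite "\<lambda>_. std_normal_distribution" by (rule product_sigma_finite_std_normal)
  define r where "r p = (if snd p then - Im (d (fst p)) else Re (d (fst p))) / sqrt 2" for p :: "'a \<times> bool"
  let ?E = "{h\<in>space (cgauss_space I). \<tau> < Re (\<Sum>i\<in>I. d i * cg h i)}"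
  have [measurable]: "(\<lambda>h. \<Sum>i\<in>I. d i * cg h i) \<in> borel_measurable (cgauss_space I)"
    by (intro borel_measurable_sum borel_measurable_times cg_measurable) auto
  have sE: "?E \<in> sets (cgauss_space I)" by measurable
  have "emeasure (cgauss_space I) ?E = (\<integral>\<^sup>+h. indicator ?E h \<partial>cgauss_space I)"
    using sE by simp
  also have "\<dots> \<le> (\<integral>\<^sup>+h. ennreal (exp (- s * \<tau>)) * (\<Prod>p\<in>I \<times> UNIV. ennreal (exp (s * r p * h p))) \<partial>cgauss_space I)"
  proof (rule nn_integral_mono)
    fix h
    have "(\<Prod>p\<in>I \<times> UNIV. ennreal (exp (s * r p * h p))) = ennreal (\<Prod>p\<in>I \<times> UNIV. exp (s * r p * h p))"
      by (rule prod_ennreal) simp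
    also have "(\<Prod>p\<in>I \<times> UNIV. exp (s * r p * h p)) = exp (s * Re (\<Sum>i\<in>I. d i * cg h i))"
      unfolding Re_sum_cg[OF fin] r_def using fin by (simp add: exp_sum[symmetric] sum_distrib_left mult_ac)
    finally have e: "ennreal (exp (- s * \<tau>)) * (\<Prod>p\<in>I \<times> UNIV. ennreal (exp (s * r p * h p)))
        = ennreal (exp (s * (Re (\<Sum>i\<in>I. d i * cg h i) - \<tau>)))"
      by (simp add: ennreal_mult'[symmetric] exp_add[symmetric] algebra_simps)
    show "indicator ?E h \<le> ennreal (exp (- s * \<tau>)) * (\<Prod>p\<in>I \<times> UNIV. ennreal (exp (s * r p * h p)))"
    proof (cases "h \<in> ?E")
      case True
      then have "1 \<le> exp (s * (Re (\<Sum>i\<in>I. d i * cg h i) - \<tau>))" using s by simp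
      then have "ennreal 1 \<le> ennreal (exp (s * (Re (\<Sum>i\<in>I. d i * cg h i) - \<tau>)))" by (rule ennreal_leI)
      moreover have "indicator ?E h = (1 :: ennreal)" using True by (rule indicator_simps(1))
      ultimately show ?thesis unfolding e by simp
    next
      case False
      then have "indicator ?E h = (0 :: ennreal)" by (rule indicator_simps(2))
      then show ?thesis by simp
    qed
  qed
  also have "\<dots> = ennreal (exp (- s * \<tau>)) * (\<Prod>p\<in>I \<times> UNIV. \<integral>\<^sup>+x. ennreal (exp (s * r p * x)) \<partial>std_normal_distribution)"
  proof -
    have m: "(\<lambda>h. h q) \<in> borel_measurable (cgauss_space I)" if "q \<in> I \<times> UNIV" for q
    proof -
      have "(\<lambda>h. h q) \<in> measurable (cgauss_space I) std_normal_distribution"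
        unfolding cgauss_space_def by (rule measurable_component_singleton) (rule that)
      then show ?thesis by (simp cong: measurable_cong_sets)
    qed
    have "(\<lambda>h. \<Prod>p\<in>I \<times> UNIV. ennreal (exp (s * r p * h p))) \<in> borel_measurable (cgauss_space I)"
      using m by (intro borel_measurable_prod_ennreal) simp
    then show ?thesis
      using fin unfolding cgauss_space_def
      by (subst nn_integral_cmult) (auto intro!: arg_cong2[where f="(*)"] product_nn_integral_prod)
  qed
  also have "\<dots> = ennreal (exp (- s * \<tau>)) * (\<Prod>p\<in>I \<times> UNIV. ennreal (exp ((s * r p)\<^sup>2 / 2)))"
    unfolding gaussian_mgf ..
  also have "(\<Prod>p\<in>I \<times> UNIV. ennreal (exp ((s * r p)\<^sup>2 / 2))) = ennreal (\<Prod>p\<in>I \<times> UNIV. exp ((s * r p)\<^sup>2 / 2))"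
    by (rule prod_ennreal) simp
  also have "(\<Prod>p\<in>I \<times> UNIV. exp ((s * r p)\<^sup>2 / 2)) = exp (\<Sum>p\<in>I \<times> UNIV. s\<^sup>2 / 2 * (r p)\<^sup>2)"
    using fin by (simp add: exp_sum power_mult_distrib)
  also have "(\<Sum>p\<in>I \<times> UNIV. s\<^sup>2 / 2 * (r p)\<^sup>2) = s\<^sup>2 / 4 * (\<Sum>i\<in>I. (cmod (d i))\<^sup>2)"
    unfolding sum_distrib_left[symmetric] using sum_sq_cg[OF fin, of d] by (simp add: r_def)
  also have "ennreal (exp (- s * \<tau>)) * ennreal (exp (s\<^sup>2 / 4 * (\<Sum>i\<in>I. (cmod (d i))\<^sup>2)))
      = ennreal (exp (s\<^sup>2 / 4 * (\<Sum>i\<in>I. (cmod (d i))\<^sup>2) - s * \<tau>))"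
    by (simp add: ennreal_mult'[symmetric] exp_add[symmetric])
  also have "\<dots> \<le> ennreal (exp (s\<^sup>2 * D / 4 - s * \<tau>))"
    using mult_left_mono[OF D, of "s\<^sup>2 / 4"] by (intro ennreal_leI) simp
  finally show ?thesis .
qed

text \<open>Fubini: a bound valid for every value of the noise in \<open>A\<close> is a bound for
  the whole event. Conditioning on part of the noise always takes this form below.\<close>

lemma cgauss_space_section:
  assumes fin: "finite A" "finite B" "A \<inter> B = {}" and E: "E \<in> sets (cgauss_space (A \<union> B))"
    and sec: "\<And>x. x \<in> space (cgauss_space A) \<Longrightarrow>
      emeasure (cgauss_space B) {y\<in>space (cgauss_space B). merge (A \<times> UNIV) (B \<times> UNIV) (x, y) \<in> E} \<le> \<epsilon>"
  shows "emeasure (cgauss_space (A \<union> B)) E \<le> \<epsilon>"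
proof -
  interpret product_sigma_finite "\<lambda>_. std_normal_distribution" by (rule product_sigma_finite_std_normal)
  interpret A: prob_space "cgauss_space A" by (rule prob_space_cgauss_space)
  let ?A = "A \<times> (UNIV :: bool set)" and ?B = "B \<times> (UNIV :: bool set)"
  have AB: "(A \<union> B) \<times> (UNIV :: bool set) = ?A \<union> ?B" by auto
  have E': "E \<in> sets (PiM (?A \<union> ?B) (\<lambda>_. std_normal_distribution))"
    using E unfolding cgauss_space_def AB .
  have "emeasure (cgauss_space (A \<union> B)) E = (\<integral>\<^sup>+h. indicator E h \<partial>PiM (?A \<union> ?B) (\<lambda>_. std_normal_distribution))"
    using E' unfolding cgauss_space_def AB by simp
  also have "\<dots> = (\<integral>\<^sup>+x. (\<integral>\<^sup>+y. indicator E (merge ?A ?B (x, y)) \<partial>cgauss_space B) \<partial>cgauss_space A)"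
    unfolding cgauss_space_def using fin E' by (intro product_nn_integral_fold) auto
  also have "\<dots> \<le> (\<integral>\<^sup>+x. \<epsilon> \<partial>cgauss_space A)"
  proof (rule nn_integral_mono)
    fix x assume x: "x \<in> space (cgauss_space A)"
    have mm: "(\<lambda>y. merge ?A ?B (x, y)) \<in> measurable (cgauss_space B) (PiM (?A \<union> ?B) (\<lambda>_. std_normal_distribution))"
      using x unfolding cgauss_space_def
      by (intro measurable_compose[OF measurable_Pair measurable_merge]) auto
    have "(\<integral>\<^sup>+y. indicator E (merge ?A ?B (x, y)) \<partial>cgauss_space B)
        = (\<integral>\<^sup>+y. indicator {y\<in>space (cgauss_space B). merge ?A ?B (x, y) \<in> E} y \<partial>cgauss_space B)"
      by (intro nn_integral_cong) (auto simp: indicator_def)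
    also have "\<dots> = emeasure (cgauss_space B) {y\<in>space (cgauss_space B). merge ?A ?B (x, y) \<in> E}"
      using measurable_sets[OF mm E'] by (intro nn_integral_indicator) (simp add: vimage_def Int_def conj_commute)
    finally show "(\<integral>\<^sup>+y. indicator E (merge ?A ?B (x, y)) \<partial>cgauss_space B) \<le> \<epsilon>" using sec[OF x] by simp
  qed
  also have "\<dots> = \<epsilon>" by (simp add: A.emeasure_space_1)
  finally show ?thesis .
qed


section \<open>Lattice nets and operator norms\<close>

text \<open>Two geometric series with ratio \<open>exp (- 1 / r)\<close>, the term at 0 being
  counted twice; \<open>exp (1 / r) \<ge> 1 + 1 / r\<close> bounds their sum.\<close>

lemma sum_exp_abs_int_le:
  assumes r: "0 < (r::real)"
  shows "(\<Sum>z\<in>{- int m..int m}. exp (- \<bar>real_of_int z\<bar> / r)) \<le> 2 * (1 + r)"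
proof -
  define q where "q = exp (- 1 / r)"
  have q: "0 < q" "q < 1" using r by (auto simp: q_def)
  have q1: "1 / (1 - q) \<le> 1 + r"
  proof -
    have "1 + 1 / r \<le> exp (1 / r)" by (rule exp_ge_add_one_self)
    then have "q \<le> 1 / (1 + 1 / r)" using r by (simp add: q_def exp_minus field_simps)
    also have "\<dots> = r / (r + 1)" using r by (simp add: field_simps)
    finally have "1 / (r + 1) \<le> 1 - q" using r by (simp add: field_simps)
    then show ?thesis using r q by (simp add: field_simps)
  qed
  have geo: "(\<Sum>j\<in>{..m}. q ^ j) \<le> 1 + r"
  proof -
    have "(\<Sum>j\<in>{..m}. q ^ j) = (1 - q ^ Suc m) / (1 - q)"
      using q by (simp add: sum_gp0)
    also have "\<dots> \<le> 1 / (1 - q)" using q by (intro divide_right_mono) auto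
    finally show ?thesis using q1 by linarith
  qed
  have e: "exp (- (real j / r)) = q ^ j" for j
    by (simp add: q_def exp_of_nat_mult[symmetric])
  let ?f = "\<lambda>z. exp (- \<bar>real_of_int z\<bar> / r)"
  let ?A = "int ` {..m}" and ?B = "(\<lambda>j. - int j) ` {..m}"
  have "{- int m..int m} \<subseteq> ?A \<union> ?B"
  proof
    fix z assume z: "z \<in> {- int m..int m}"
    show "z \<in> ?A \<union> ?B"
    proof (cases "0 \<le> z")
      case True
      then show ?thesis using z by (intro UnI1 image_eqI[of _ _ "nat z"]) auto
    next
      case False
      then show ?thesis using z by (intro UnI2 image_eqI[of _ _ "nat (- z)"]) auto
    qed
  qed
  then have "(\<Sum>z\<in>{- int m..int m}. ?f z) \<le> (\<Sum>z\<in>?A \<union> ?B. ?f z)"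
    by (intro sum_mono2) auto
  also have "\<dots> \<le> (\<Sum>z\<in>?A. ?f z) + (\<Sum>z\<in>?B. ?f z)"
    using sum.union_inter[of ?A ?B ?f] sum_nonneg[of "?A \<inter> ?B" ?f] by simp
  also have "(\<Sum>z\<in>?A. ?f z) = (\<Sum>j\<in>{..m}. q ^ j)"
    by (subst sum.reindex) (auto simp: inj_on_def e)
  also have "(\<Sum>z\<in>?B. ?f z) = (\<Sum>j\<in>{..m}. q ^ j)"
    by (subst sum.reindex) (auto simp: inj_on_def e)
  finally show ?thesis using geo by simp
qed

text \<open>Exponential Markov inequality for counting: a lattice point of l1 norm at most
  \<open>T\<close> has weight at least 1 under \<open>exp ((T - norm) / r)\<close>, and the weights
  factor over the coordinates. The cube given by \<open>m\<close> only keeps the sums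
  finite.\<close>

lemma l1_lattice_count:
  assumes fin: "finite I" and r: "0 < (r::real)" and T: "0 \<le> T"
  shows "finite {a \<in> I \<rightarrow>\<^sub>E (UNIV :: int set). (\<Sum>i\<in>I. \<bar>real_of_int (a i)\<bar>) \<le> T}"
    and "real (card {a \<in> I \<rightarrow>\<^sub>E (UNIV :: int set). (\<Sum>i\<in>I. \<bar>real_of_int (a i)\<bar>) \<le> T})
      \<le> exp (T / r) * (2 * (1 + r)) ^ card I"
proof -
  define m where "m = nat \<lceil>T\<rceil>"
  let ?S = "{a \<in> I \<rightarrow>\<^sub>E (UNIV :: int set). (\<Sum>i\<in>I. \<bar>real_of_int (a i)\<bar>) \<le> T}"
  let ?P = "I \<rightarrow>\<^sub>E {- int m..int m}"
  have sub: "?S \<subseteq> ?P"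
  proof
    fix a assume a: "a \<in> ?S"
    have "a i \<in> {- int m..int m}" if i: "i \<in> I" for i
    proof -
      have "\<bar>real_of_int (a i)\<bar> \<le> (\<Sum>i\<in>I. \<bar>real_of_int (a i)\<bar>)"
        using fin i by (intro member_le_sum) auto
      also have "\<dots> \<le> T" using a by simp
      also have "T \<le> real m" unfolding m_def by (rule real_nat_ceiling_ge)
      finally show ?thesis by simp linarith
    qed
    then show "a \<in> ?P" using a by (auto simp: PiE_iff)
  qed
  have finP: "finite ?P" using fin by (intro finite_PiE) auto
  show finS: "finite ?S" using finite_subset[OF sub finP] .
  have "real (card ?S) = (\<Sum>a\<in>?S. 1)" by simp
  also have "\<dots> \<le> (\<Sum>a\<in>?S. exp ((T - (\<Sum>i\<in>I. \<bar>real_of_int (a i)\<bar>)) / r))"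
    using r by (intro sum_mono) auto
  also have "\<dots> \<le> (\<Sum>a\<in>?P. exp ((T - (\<Sum>i\<in>I. \<bar>real_of_int (a i)\<bar>)) / r))"
    using sub finP by (intro sum_mono2) auto
  also have "\<dots> = exp (T / r) * (\<Sum>a\<in>?P. \<Prod>i\<in>I. exp (- \<bar>real_of_int (a i)\<bar> / r))"
  proof -
    have "exp ((T - (\<Sum>i\<in>I. \<bar>real_of_int (a i)\<bar>)) / r) = exp (T / r) * (\<Prod>i\<in>I. exp (- \<bar>real_of_int (a i)\<bar> / r))" for a
      using fin by (simp add: exp_sum[symmetric] exp_add[symmetric] sum_negf sum_divide_distrib[symmetric] diff_divide_distrib)
    then show ?thesis by (simp add: sum_distrib_left)
  qed
  also have "(\<Sum>a\<in>?P. \<Prod>i\<in>I. exp (- \<bar>real_of_int (a i)\<bar> / r)) = (\<Prod>i\<in>I. \<Sum>z\<in>{- int m..int m}. exp (- \<bar>real_of_int z\<bar> / r))"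
    using fin by (intro prod_sum_PiE[symmetric]) auto
  also have "exp (T / r) * \<dots> \<le> exp (T / r) * (\<Prod>i\<in>I. 2 * (1 + r))"
    using sum_exp_abs_int_le[OF r, of m] by (intro mult_left_mono prod_mono) (auto intro: sum_nonneg)
  finally show "real (card ?S) \<le> exp (T / r) * (2 * (1 + r)) ^ card I" by simp
qed

text \<open>The net consists of the points of a lattice of mesh \<open>h\<close> in an l1 ball, and
  vectors are rounded coordinatewise. Points in an l1 ball are easily counted; passing from the
  Euclidean norm to l1 costs \<open>sqrt (2 * d)\<close>, which the mesh
  \<open>\<epsilon> / sqrt d\<close> turns into a radius linear in \<open>d\<close>. So the base of
  the power does not depend on the dimension.\<close>

lemma complex_net:
  fixes I :: "'i set"
  assumes fin: "finite I" and \<epsilon>: "0 < (\<epsilon>::real)" and R: "0 \<le> R"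
  shows "\<exists>T. finite T \<and> real (card T) \<le> (6 * (R + 2 * \<epsilon>) / \<epsilon>) ^ (2 * card I) \<and>
    (\<forall>v. l2n I v \<le> R \<longrightarrow> (\<exists>u\<in>T. l2n I (\<lambda>i. v i - u i) \<le> \<epsilon>))"
proof (cases "I = {}")
  case True
  then show ?thesis using \<epsilon> by (intro exI[of _ "{\<lambda>_. 0}"]) (auto simp: l2n_def)
next
  case False
  define d where "d = card I"
  have d: "0 < d" using False fin by (simp add: d_def card_gt_0_iff)
  define h where "h = \<epsilon> / sqrt (real d)"
  have h: "0 < h" "h\<^sup>2 = \<epsilon>\<^sup>2 / real d" using \<epsilon> d by (auto simp: h_def power_divide)
  \<comment> \<open>Parameter of the lattice count: with l1 radius \<open>2 * d * r\<close> the
    exponential factor is just \<open>exp (2 * d)\<close>.\<close>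
  define r where "r = (R + \<epsilon>) / \<epsilon>"
  have r: "0 < r" using \<epsilon> R by (simp add: r_def)
  let ?K = "I \<times> (UNIV :: bool set)"
  have K: "finite ?K" "card ?K = 2 * d" using fin by (auto simp: d_def card_cartesian_product)
  define S where "S = {a \<in> ?K \<rightarrow>\<^sub>E (UNIV :: int set). (\<Sum>p\<in>?K. \<bar>real_of_int (a p)\<bar>) \<le> real (2 * d) * r}"
  define g where "g a i = Complex (h * real_of_int (a (i, False))) (h * real_of_int (a (i, True)))" for a :: "'i \<times> bool \<Rightarrow> int" and i
  note count = l1_lattice_count[OF K(1) r, of "real (2 * d) * r", folded S_def]
  have finS: "finite S" using count(1) r by simp
  have "real (card (g ` S)) \<le> real (card S)" using card_image_le[OF finS, of g] by simp
  also have "\<dots> \<le> exp (real (2 * d)) * (2 * (1 + r)) ^ (2 * d)"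
    using count(2) r K(2) by simp
  also have "\<dots> = (exp 1 * (2 * (1 + r))) ^ (2 * d)"
    by (simp add: power_mult_distrib exp_of_nat_mult[symmetric])
  also have "\<dots> \<le> (3 * (2 * (1 + r))) ^ (2 * d)"
    using exp_le r by (intro power_mono mult_right_mono) auto
  also have "3 * (2 * (1 + r)) = 6 * (R + 2 * \<epsilon>) / \<epsilon>"
    using \<epsilon> by (simp add: r_def field_simps)
  finally have card: "real (card (g ` S)) \<le> (6 * (R + 2 * \<epsilon>) / \<epsilon>) ^ (2 * card I)" by (simp add: d_def)
  have "\<exists>u\<in>g ` S. l2n I (\<lambda>i. v i - u i) \<le> \<epsilon>" if v: "l2n I v \<le> R" for v
  proof -
    define a where "a = (\<lambda>p\<in>?K. round ((if snd p then Im (v (fst p)) else Re (v (fst p))) / h))"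
    have close: "\<bar>x - h * real_of_int (round (x / h))\<bar> \<le> h / 2" for x
    proof -
      have "\<bar>x - h * real_of_int (round (x / h))\<bar> = h * \<bar>x / h - real_of_int (round (x / h))\<bar>"
      proof -
        have "x - h * real_of_int (round (x / h)) = h * (x / h - real_of_int (round (x / h)))"
          using h by (simp add: right_diff_distrib)
        then show ?thesis using h(1) by (simp only: abs_mult abs_of_pos)
      qed
      also have "\<dots> \<le> h * (1 / 2)"
        using h of_int_round_abs_le[of "x / h"] by (intro mult_left_mono) (auto simp: abs_minus_commute)
      finally show ?thesis by simp
    qed
    have sq: "(x - h * real_of_int (round (x / h)))\<^sup>2 \<le> h\<^sup>2 / 4" for x
    proof -
      have "(x - h * real_of_int (round (x / h)))\<^sup>2 \<le> (h / 2)\<^sup>2"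
        using close[of x] h by (intro abs_le_square_iff[THEN iffD1]) simp
      then show ?thesis by (simp add: power_divide)
    qed
    have "(l2n I (\<lambda>i. v i - g a i))\<^sup>2 \<le> (\<Sum>i\<in>I. h\<^sup>2 / 2)"
      unfolding l2n_sq
    proof (intro sum_mono)
      fix i assume "i \<in> I"
      then show "(cmod (v i - g a i))\<^sup>2 \<le> h\<^sup>2 / 2"
        using sq[of "Re (v i)"] sq[of "Im (v i)"] by (simp add: cmod_power2 g_def a_def)
    qed
    also have "\<dots> \<le> \<epsilon>\<^sup>2" using d by (simp add: h d_def[symmetric])
    finally have near: "l2n I (\<lambda>i. v i - g a i) \<le> \<epsilon>"
      using \<epsilon> by (simp add: power2_le_iff_abs_le)
    have "l2n I (g a) \<le> l2n I v + l2n I (\<lambda>i. v i - g a i)"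
      using l2n_triangle_diff[of I v "\<lambda>i. v i - g a i"] by simp
    then have gn: "l2n I (g a) \<le> R + \<epsilon>" using v near by simp
    have l2: "(l2n I (g a))\<^sup>2 = h\<^sup>2 * (\<Sum>p\<in>?K. (real_of_int (a p))\<^sup>2)"
    proof -
      have "(\<Sum>p\<in>?K. (real_of_int (a p))\<^sup>2) = (\<Sum>i\<in>I. \<Sum>b\<in>UNIV. (real_of_int (a (i, b)))\<^sup>2)"
        using fin by (subst sum.cartesian_product) (simp add: case_prod_unfold)
      then show ?thesis
        by (simp add: l2n_sq cmod_power2 g_def UNIV_bool power_mult_distrib sum_distrib_left distrib_left)
    qed
    have "(\<Sum>p\<in>?K. \<bar>real_of_int (a p)\<bar>) \<le> L2_set (\<lambda>_. 1) ?K * L2_set (\<lambda>p. real_of_int (a p)) ?K"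
      using L2_set_mult_ineq[of "\<lambda>_. 1" "\<lambda>p. real_of_int (a p)" ?K] by simp
    also have "L2_set (\<lambda>_. 1) ?K = sqrt (real (2 * d))" by (simp add: L2_set_def K(2) del: card_cartesian_product)
    also have "L2_set (\<lambda>p. real_of_int (a p)) ?K = l2n I (g a) / h"
    proof -
      have "sqrt ((l2n I (g a))\<^sup>2) = sqrt (h\<^sup>2 * (\<Sum>p\<in>?K. (real_of_int (a p))\<^sup>2))" unfolding l2 ..
      then show ?thesis using h(1) by (simp add: real_sqrt_mult L2_set_def)
    qed
    also have "sqrt (real (2 * d)) * (l2n I (g a) / h) \<le> sqrt (real (2 * d)) * ((R + \<epsilon>) / h)"
      using gn h by (intro mult_left_mono divide_right_mono) auto
    also have "\<dots> = sqrt 2 * (real d * r)"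
    proof -
      have s: "sqrt (real d) * (sqrt (real d) * sqrt 2) = real d * sqrt 2"
        by (simp add: mult.assoc[symmetric])
      show ?thesis using \<epsilon> d by (simp add: h_def r_def real_sqrt_mult field_simps s)
    qed
    also have "\<dots> \<le> 2 * (real d * r)"
    proof (rule mult_right_mono)
      show "sqrt 2 \<le> (2::real)" by (simp add: real_le_lsqrt)
    qed (use r in simp)
    finally have "a \<in> S" by (simp add: S_def a_def mult.assoc)
    with near show ?thesis by blast
  qed
  with card finS show ?thesis by (intro exI[of _ "g ` S"]) auto
qed

section \<open>Operator norm bounds from nets\<close>

definition opbound :: "'i set \<Rightarrow> 'l set \<Rightarrow> ('i \<Rightarrow> 'l \<Rightarrow> complex) \<Rightarrow> real \<Rightarrow> bool" where
  "opbound I L Y K \<longleftrightarrow> (\<forall>v. l2n I (mapply L Y v) \<le> K * l2n L v)"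

text \<open>The bound for \<open>Y\<close> is tested on \<open>w = Y\<^sup>* v\<close> itself: the
  squared norm of \<open>w\<close> is the inner product of \<open>v\<close> with
  \<open>Y w\<close>.\<close>

lemma opbound_adjoint:
  assumes op: "opbound I L Y K" and K: "0 \<le> K" 
  shows "l2n L (\<lambda>l. cinner I v (\<lambda>i. Y i l)) \<le> K * l2n I v"
proof -
  define w where "w = (\<lambda>l. cinner I v (\<lambda>i. Y i l))"
  have "cinner L w w = (\<Sum>l\<in>L. \<Sum>i\<in>I. v i * cnj (Y i l) * cnj (w l))"
    unfolding cinner_def[of L] by (simp add: w_def cinner_def sum_distrib_right)
  also have "\<dots> = (\<Sum>i\<in>I. \<Sum>l\<in>L. v i * cnj (Y i l) * cnj (w l))"
    by (rule sum.swap)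
  also have "\<dots> = cinner I v (mapply L Y w)"
    by (simp add: cinner_def mapply_def sum_distrib_left mult.assoc)
  finally have "complex_of_real ((l2n L w)\<^sup>2) = cinner I v (mapply L Y w)"
    by (simp only: cinner_self)
  then have "\<bar>(l2n L w)\<^sup>2\<bar> = cmod (cinner I v (mapply L Y w))"
    by (metis norm_of_real)
  then have "(l2n L w)\<^sup>2 = cmod (cinner I v (mapply L Y w))" by simp
  also have "\<dots> \<le> l2n I v * l2n I (mapply L Y w)"
    by (rule cmod_cinner_le)
  also have "\<dots> \<le> l2n I v * (K * l2n L w)"
    using op by (intro mult_left_mono) (auto simp: opbound_def)
  finally have le: "l2n L w * l2n L w \<le> (K * l2n I v) * l2n L w"
    by (simp add: power2_eq_square mult_ac)
  have "l2n L w \<le> K * l2n I v"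
  proof (cases "l2n L w = 0")
    case False
    then have "0 < l2n L w" using l2n_nonneg[of L w] by linarith
    then show ?thesis using le by simp
  qed (use K in simp)
  then show ?thesis by (simp add: w_def)
qed

lemma mapply_diff: "mapply I h (\<lambda>i. v i - w i) = (\<lambda>j. mapply I h v j - mapply I h w j)"
  by (simp add: mapply_def fun_eq_iff right_diff_distrib sum_subtractf)

lemma mapply_scale: "mapply I h (\<lambda>i. c * v i) = (\<lambda>j. c * mapply I h v j)"
  by (simp add: mapply_def fun_eq_iff sum_distrib_left mult_ac)

lemma cinner_diff_right: "cinner I v (\<lambda>i. u i - w i) = cinner I v u - cinner I v w"
  by (simp add: cinner_def right_diff_distrib sum_subtractf)

text \<open>Let \<open>s\<close> be the supremum of the bilinear form over the unit balls. Moving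
  the first argument to a net point costs \<open>s / 4\<close>, moving the second costs
  \<open>5 / 16 * s\<close> because the first net point may have norm \<open>5 / 4\<close>. So
  \<open>s \<le> \<tau> + 9 / 16 * s\<close>, that is \<open>s \<le> 16 / 7 * \<tau>\<close>,
  rounded up to \<open>3 * \<tau>\<close>. This needs \<open>s\<close> to be finite beforehand,
  hence the crude bound \<open>bd\<close>.\<close>

lemma opbound_from_net:
  assumes fin: "finite I" "finite L"
    and TI: "\<And>u. l2n I u \<le> 1 \<Longrightarrow> \<exists>u'\<in>TI. l2n I (\<lambda>i. u i - u' i) \<le> 1 / 4"
    and TL: "\<And>v. l2n L v \<le> 1 \<Longrightarrow> \<exists>v'\<in>TL. l2n L (\<lambda>i. v i - v' i) \<le> 1 / 4"
    and net: "\<And>u v. u \<in> TI \<Longrightarrow> v \<in> TL \<Longrightarrow> Re (cinner I (mapply L Y v) u) \<le> \<tau>"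
  shows "opbound I L Y (3 * \<tau>)"
proof -
  define q where "q u v = Re (cinner I (mapply L Y v) u)" for u v
  define Q where "Q = {q u v | u v. l2n I u \<le> 1 \<and> l2n L v \<le> 1}"
  define s where "s = Sup Q"
  have qd1: "q (\<lambda>i. u i - u' i) v = q u v - q u' v" for u u' v
    by (simp add: q_def cinner_diff_right)
  have qd2: "q u (\<lambda>i. v i - v' i) = q u v - q u v'" for u v v'
    by (simp add: q_def mapply_diff cinner_diff_left)
  have qs: "q (\<lambda>i. of_real a * u i) (\<lambda>i. of_real b * v i) = a * b * q u v" for a b u v
    by (simp add: q_def mapply_scale cinner_scale_left cinner_scale_right)
  have bd: "q u v \<le> (\<Sum>l\<in>L. l2n I (\<lambda>i. Y i l))" if "l2n I u \<le> 1" "l2n L v \<le> 1" for u v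
  proof -
    have "q u v \<le> cmod (cinner I (mapply L Y v) u)" unfolding q_def by (rule complex_Re_le_cmod)
    also have "\<dots> \<le> l2n I (mapply L Y v) * l2n I u" by (rule cmod_cinner_le)
    also have "\<dots> \<le> l2n I (mapply L Y v) * 1" using that by (intro mult_left_mono) auto
    also have "l2n I (mapply L Y v) = l2n I (\<lambda>i. \<Sum>l\<in>L. v l * Y i l)"
      by (rule l2n_cong) (simp add: mapply_def mult.commute)
    also have "\<dots> \<le> (\<Sum>l\<in>L. l2n I (\<lambda>i. v l * Y i l))" by (rule l2n_sum[OF fin(2)])
    also have "\<dots> \<le> (\<Sum>l\<in>L. 1 * l2n I (\<lambda>i. Y i l))"
      unfolding l2n_scale
      using that(2) norm_le_l2n[OF fin(2), of _ v]
      by (intro sum_mono mult_right_mono) (auto intro: order_trans)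
    finally show ?thesis by simp
  qed
  have bdd: "bdd_above Q" unfolding bdd_above_def Q_def using bd by auto
  have le_s: "q u v \<le> s" if "l2n I u \<le> 1" "l2n L v \<le> 1" for u v
    unfolding s_def by (rule cSup_upper[OF _ bdd]) (use that in \<open>auto simp: Q_def\<close>)
  have z: "l2n I (\<lambda>_. 0) = 0" "l2n L (\<lambda>_. 0) = 0" by (simp_all add: l2n_def L2_set_def)
  have s0: "0 \<le> s" using le_s[of "\<lambda>_. 0" "\<lambda>_. 0"] z by (simp add: q_def mapply_def cinner_def)
  have hom: "q u v \<le> s * l2n I u * l2n L v" for u v
  proof (cases "l2n I u = 0 \<or> l2n L v = 0")
    case True
    have "q u v = 0"
    proof (cases "l2n I u = 0")
      case True
      then show ?thesis using fin by (simp add: q_def cinner_def l2n_eq_0)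
    next
      case False
      with True have "l2n L v = 0" by simp
      then have "mapply L Y v i = 0" for i using fin by (simp add: mapply_def l2n_eq_0)
      then show ?thesis by (simp add: q_def cinner_def)
    qed
    then show ?thesis using s0 by simp
  next
    case False
    then have p: "0 < l2n I u" "0 < l2n L v" using l2n_nonneg[of I u] l2n_nonneg[of L v] by linarith+
    have "q (\<lambda>i. of_real (1 / l2n I u) * u i) (\<lambda>i. of_real (1 / l2n L v) * v i) \<le> s"
    proof (rule le_s)
      show "l2n I (\<lambda>i. of_real (1 / l2n I u) * u i) \<le> 1"
        unfolding l2n_scale using p by (simp add: norm_divide)
      show "l2n L (\<lambda>i. of_real (1 / l2n L v) * v i) \<le> 1"
        unfolding l2n_scale using p by (simp add: norm_divide)
    qed
    then have "1 / l2n I u * (1 / l2n L v) * q u v \<le> s" unfolding qs .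
    then show ?thesis using p by (simp add: field_simps)
  qed
  have "q u v \<le> \<tau> + 9 / 16 * s" if uv: "l2n I u \<le> 1" "l2n L v \<le> 1" for u v
  proof -
    obtain u' where u': "u' \<in> TI" "l2n I (\<lambda>i. u i - u' i) \<le> 1 / 4" using TI[OF uv(1)] by auto
    obtain v' where v': "v' \<in> TL" "l2n L (\<lambda>i. v i - v' i) \<le> 1 / 4" using TL[OF uv(2)] by auto
    have un: "l2n I u' \<le> 5 / 4"
      using l2n_triangle_diff[of I u "\<lambda>i. u i - u' i"] uv(1) u'(2) by simp
    have "q u v = q u' v' + q (\<lambda>i. u i - u' i) v + q u' (\<lambda>i. v i - v' i)"
      by (simp add: qd1 qd2)
    also have "\<dots> \<le> \<tau> + s * (1 / 4) * 1 + s * (5 / 4) * (1 / 4)"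
    proof (intro add_mono)
      show "q u' v' \<le> \<tau>" unfolding q_def by (rule net[OF u'(1) v'(1)])
      show "q (\<lambda>i. u i - u' i) v \<le> s * (1 / 4) * 1"
        by (rule order_trans[OF hom], intro mult_mono) (use u' uv s0 in auto)
      show "q u' (\<lambda>i. v i - v' i) \<le> s * (5 / 4) * (1 / 4)"
        by (rule order_trans[OF hom], intro mult_mono) (use un v' s0 in auto)
    qed
    finally show ?thesis by simp
  qed
  then have "s \<le> \<tau> + 9 / 16 * s"
    unfolding s_def[of] using z by (intro cSup_least) (auto simp: Q_def s_def intro!: exI[of _ "\<lambda>_. 0"])
  then have s3: "s \<le> 3 * \<tau>" using s0 by linarith
  have "l2n I (mapply L Y v) \<le> 3 * \<tau> * l2n L v" for v
  proof -
    have "(l2n I (mapply L Y v))\<^sup>2 = q (mapply L Y v) v" by (simp add: q_def cinner_self)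
    also have "\<dots> \<le> s * l2n I (mapply L Y v) * l2n L v" by (rule hom)
    also have "\<dots> \<le> (3 * \<tau>) * l2n I (mapply L Y v) * l2n L v"
      using s3 by (intro mult_right_mono) auto
    finally have le: "l2n I (mapply L Y v) * l2n I (mapply L Y v) \<le> (3 * \<tau> * l2n L v) * l2n I (mapply L Y v)"
      by (simp add: power2_eq_square mult_ac)
    show ?thesis
    proof (cases "l2n I (mapply L Y v) = 0")
      case True
      then show ?thesis using s0 s3 by simp
    next
      case False
      then have "0 < l2n I (mapply L Y v)" using l2n_nonneg[of I "mapply L Y v"] by linarith
      then show ?thesis using le by simp
    qed
  qed
  then show ?thesis by (simp add: opbound_def)
qed


section \<open>Quadratic forms of a random matrix\<close>

text \<open>This is \<open>Y\<^sup>* v\<close>, and \<open>mid_vec\<close> below is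
  \<open>J Y\<^sup>* v\<close>. \<open>Y\<close> is a function of index pairs because it will be a
  point of a product measure space.\<close>

definition adj_vec :: "nat \<Rightarrow> (nat \<times> nat \<Rightarrow> complex) \<Rightarrow> (nat \<Rightarrow> complex) \<Rightarrow> nat \<Rightarrow> complex" where
  "adj_vec N Y v l = (\<Sum>i<N. cnj (Y (i, l)) * v i)"

definition mid_vec :: "nat \<Rightarrow> nat \<Rightarrow> (nat \<Rightarrow> nat \<Rightarrow> complex) \<Rightarrow> (nat \<times> nat \<Rightarrow> complex) \<Rightarrow> (nat \<Rightarrow> complex) \<Rightarrow> nat \<Rightarrow> complex" where
  "mid_vec N n J Y v j = (\<Sum>m<n. J j m * adj_vec N Y v m)"

text \<open>\<open>res_vec\<close> is \<open>(Y J Y\<^sup>* - z) v\<close>.\<close>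
definition res_vec :: "nat \<Rightarrow> nat \<Rightarrow> (nat \<Rightarrow> nat \<Rightarrow> complex) \<Rightarrow> complex \<Rightarrow> (nat \<times> nat \<Rightarrow> complex) \<Rightarrow> (nat \<Rightarrow> complex) \<Rightarrow> nat \<Rightarrow> complex" where
  "res_vec N n J z Y v i = (\<Sum>j<n. Y (i, j) * mid_vec N n J Y v j) - z * v i"

text \<open>The columns that must span column \<open>l\<close> of \<open>Y\<close> approximately when \<open>Y J Y\<^sup>* - z\<close> is nearly singular; they
  do not involve column \<open>l\<close>. The index \<open>N\<close> stands for the vector by which row \<open>l\<close> of \<open>Y\<^sup>* v\<close> enters.\<close>
definition span_vec :: "nat \<Rightarrow> nat \<Rightarrow> (nat \<Rightarrow> nat \<Rightarrow> complex) \<Rightarrow> complex \<Rightarrow> nat \<Rightarrow> (nat \<times> nat \<Rightarrow> complex) \<Rightarrow> nat \<Rightarrow> nat \<Rightarrow> complex" where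
  "span_vec N n J z l Y c r =
    (if c < N then (\<Sum>j\<in>{..<n}-{l}. \<Sum>m\<in>{..<n}-{l}. Y (r, j) * J j m * cnj (Y (c, m))) - (if r = c then z else 0)
     else (\<Sum>j\<in>{..<n}-{l}. Y (r, j) * J j l))"

text \<open>The double sum in \<open>Y J Y\<^sup>* v\<close> is split by \<open>j = l\<close> and,
  for \<open>j \<noteq> l\<close>, by \<open>m = l\<close>. The first part is the column times an
  entry of \<open>mid_vec\<close>. The second is one vector times the number
  \<open>adj_vec N Y v l\<close>. The third combines columns of a matrix free of column
  \<open>l\<close>, and the zeros of \<open>v\<close> leave \<open>N - k\<close> of them. Column
  \<open>l\<close> survives only in the coefficients.\<close>

lemma column_in_span:
  assumes l: "l < n" and k: "k \<le> N" and v: "\<And>i. i < k \<Longrightarrow> v i = 0" and r: "r < N"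
  shows "mid_vec N n J Y v l * Y (r, l) = res_vec N n J z Y v r
    - (\<Sum>c\<in>{k..N}. (if c < N then v c else adj_vec N Y v l) * span_vec N n J z l Y c r)"
proof -
  let ?L = "{..<n} - {l}"
  have split: "(\<Sum>j<n. f j) = f l + (\<Sum>j\<in>?L. f j)" for f :: "nat \<Rightarrow> complex"
    using l by (subst sum.remove[of "{..<n}" l]) auto
  have 1: "(\<Sum>j<n. Y (r, j) * mid_vec N n J Y v j) = Y (r, l) * mid_vec N n J Y v l +
    (\<Sum>j\<in>?L. Y (r, j) * (J j l * adj_vec N Y v l)) + (\<Sum>j\<in>?L. \<Sum>m\<in>?L. Y (r, j) * (J j m * adj_vec N Y v m))"
  proof -
    have "Y (r, j) * mid_vec N n J Y v j = Y (r, j) * (J j l * adj_vec N Y v l) + (\<Sum>m\<in>?L. Y (r, j) * (J j m * adj_vec N Y v m))" for j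
      unfolding mid_vec_def split[of "\<lambda>m. J j m * adj_vec N Y v m"] by (simp add: distrib_left sum_distrib_left)
    then show ?thesis unfolding split[of "\<lambda>j. Y (r, j) * mid_vec N n J Y v j"] by (simp add: sum.distrib)
  qed
  have kN: "{k..N} = insert N {k..<N}" using k by auto
  have vsum: "(\<Sum>i<N. f i * v i) = (\<Sum>i\<in>{k..<N}. f i * v i)" for f
    using v by (intro sum.mono_neutral_right) auto
  have 2: "(\<Sum>j\<in>?L. \<Sum>m\<in>?L. Y (r, j) * (J j m * adj_vec N Y v m))
     = (\<Sum>c\<in>{k..<N}. v c * (\<Sum>j\<in>?L. \<Sum>m\<in>?L. Y (r, j) * J j m * cnj (Y (c, m))))"
  proof -
    have "(\<Sum>j\<in>?L. \<Sum>m\<in>?L. Y (r, j) * (J j m * adj_vec N Y v m))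
      = (\<Sum>j\<in>?L. \<Sum>m\<in>?L. \<Sum>c\<in>{k..<N}. v c * (Y (r, j) * J j m * cnj (Y (c, m))))"
      unfolding adj_vec_def vsum sum_distrib_left by (simp add: mult_ac)
    also have "\<dots> = (\<Sum>j\<in>?L. \<Sum>c\<in>{k..<N}. \<Sum>m\<in>?L. v c * (Y (r, j) * J j m * cnj (Y (c, m))))"
      by (rule sum.cong[OF refl], rule sum.swap)
    also have "\<dots> = (\<Sum>c\<in>{k..<N}. \<Sum>j\<in>?L. \<Sum>m\<in>?L. v c * (Y (r, j) * J j m * cnj (Y (c, m))))"
      by (rule sum.swap)
    finally show ?thesis by (simp only: sum_distrib_left)
  qed
  have 3: "(\<Sum>c\<in>{k..<N}. v c * (if r = c then z else 0)) = z * v r"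
  proof (cases "r < k")
    case True
    then show ?thesis using v by (auto intro!: sum.neutral)
  next
    case False
    have "(\<Sum>c\<in>{k..<N}. v c * (if r = c then z else 0)) = (\<Sum>c\<in>{k..<N}. if r = c then z * v r else 0)"
      by (intro sum.cong) auto
    then show ?thesis using False r by simp
  qed
  have "(\<Sum>c\<in>{k..N}. (if c < N then v c else adj_vec N Y v l) * span_vec N n J z l Y c r)
     = adj_vec N Y v l * (\<Sum>j\<in>?L. Y (r, j) * J j l)
       + (\<Sum>c\<in>{k..<N}. v c * ((\<Sum>j\<in>?L. \<Sum>m\<in>?L. Y (r, j) * J j m * cnj (Y (c, m))) - (if r = c then z else 0)))"
    unfolding kN by (simp add: span_vec_def)
  also have "\<dots> = (\<Sum>j\<in>?L. Y (r, j) * (J j l * adj_vec N Y v l))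
       + (\<Sum>j\<in>?L. \<Sum>m\<in>?L. Y (r, j) * (J j m * adj_vec N Y v m)) - z * v r"
    unfolding 2 right_diff_distrib sum_subtractf 3 by (simp add: sum_distrib_left mult_ac)
  finally show ?thesis unfolding res_vec_def 1 by (simp add: algebra_simps)
qed

lemma adj_vec_eq_cinner: "adj_vec N Y v l = cinner {..<N} v (\<lambda>i. Y (i, l))"
  by (simp add: adj_vec_def cinner_def mult.commute)

lemma mid_vec_eq_mapply: "mid_vec N n J Y v = mapply {..<n} J (adj_vec N Y v)"
  by (simp add: mid_vec_def mapply_def fun_eq_iff)

section \<open>Vectors whose image is concentrated on the remaining columns\<close>

lemma orthonormal_columns_norm:
  assumes "finite L" "orthonormal I L (\<lambda>c a. J a c)"
  shows "l2n I (mapply L J w) = l2n L w"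
proof -
  have "(l2n I (mapply L J w))\<^sup>2 = (l2n L w)\<^sup>2"
    using orthonormal_combination_norm[OF assms, of w]
    by (simp add: mapply_def[abs_def] mult.commute l2n_sq[of L])
  then show ?thesis by simp
qed

lemma orthonormal_columns_adjoint:
  assumes J: "orthonormal I L (\<lambda>c a. J a c)" and L: "finite L" "l \<in> L"
  shows "cinner I (mapply L J w) (\<lambda>a. J a l) = w l"
proof -
  have "cinner I (mapply L J w) (\<lambda>a. J a l) = (\<Sum>c\<in>L. w c * cinner I (\<lambda>a. J a c) (\<lambda>a. J a l))"
    unfolding mapply_def[abs_def] cinner_sum_left[symmetric] by (simp add: mult.commute)
  also have "\<dots> = (\<Sum>c\<in>L. if c = l then w c else 0)"
    using J L by (intro sum.cong) (auto simp: orthonormal_def)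
  finally show ?thesis using L by simp
qed

text \<open>If \<open>J Y\<^sup>* v\<close> were equal to \<open>w\<close> and supported on
  \<open>H\<close>, the kernel equation would read \<open>z v = Y w\<close>. This is its solution
  for \<open>v\<close>.\<close>

definition approx_vec :: "nat set \<Rightarrow> complex \<Rightarrow> (nat \<times> nat \<Rightarrow> complex) \<Rightarrow> (nat \<Rightarrow> complex) \<Rightarrow> nat \<Rightarrow> complex" where
  "approx_vec H z Y w i = (\<Sum>l\<in>H. Y (i, l) * w l) / z"

text \<open>Normalise \<open>v\<close> and put \<open>w = J Y\<^sup>* v\<close>. Up to errors of
  order \<open>\<epsilon>\<close> this is a net point on \<open>H\<close>, extended by 0. Then
  \<open>approx_vec\<close> recovers \<open>v\<close>, and applying \<open>J\<^sup>*\<close> to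
  \<open>w\<close> recovers \<open>Y\<^sup>* v\<close>. On \<open>G\<close> the two must agree,
  which is a system of equations whose only unknown is one of finitely many net points.\<close>

lemma concentrated_imp_net_point:
  fixes K \<epsilon> :: real
  assumes J: "orthonormal {..<n} {..<n} (\<lambda>c a. J a c)"
    and op: "opbound {..<N} {..<n} (\<lambda>i l. Y (i, l)) K" and K: "0 \<le> K" and z: "z \<noteq> 0"
    and G: "G \<subseteq> {..<n}" and H: "H = {..<n} - G"
    and small: "l2n {..<N} (res_vec N n J z Y v) \<le> t * l2n {..<N} v" and nz: "l2n {..<N} v \<noteq> 0"
    and conc: "l2n G (mid_vec N n J Y v) \<le> \<epsilon> * l2n {..<N} v"
    and t: "t \<le> \<epsilon>" and \<epsilon>: "0 < \<epsilon>" "(1 + 2 * K) * \<epsilon> \<le> cmod z / 2"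
    and net: "\<And>w. l2n H w \<le> K \<Longrightarrow> \<exists>u\<in>T. l2n H (\<lambda>i. w i - u i) \<le> \<epsilon>"
  shows "\<exists>w\<in>T. 1 / 2 \<le> l2n {..<N} (approx_vec H z Y w) \<and>
    l2n G (\<lambda>l. adj_vec N Y (approx_vec H z Y w) l - (\<Sum>m\<in>H. cnj (J m l) * w m)) \<le> K * (1 + 2 * K) * \<epsilon> / cmod z + 2 * \<epsilon>"
proof -
  let ?I = "{..<N}" and ?L = "{..<n}"
  let ?Y = "\<lambda>i l. Y (i, l)"
  define a where "a = complex_of_real (1 / l2n ?I v)"
  have nv: "0 < l2n ?I v" using nz l2n_nonneg[of ?I v] by linarith
  have ca: "cmod a = 1 / l2n ?I v" using nv by (simp add: a_def norm_divide)
  define v1 where "v1 = (\<lambda>i. a * v i)"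
  have n1: "l2n ?I v1 = 1" using nv by (simp add: v1_def l2n_scale ca)
  have adj1: "adj_vec N Y v1 l = a * adj_vec N Y v l" for l
    by (simp add: adj_vec_def v1_def sum_distrib_left mult_ac)
  have mid1: "mid_vec N n J Y v1 = (\<lambda>j. a * mid_vec N n J Y v j)"
    by (simp add: mid_vec_def adj1 fun_eq_iff sum_distrib_left mult_ac)
  have res1: "res_vec N n J z Y v1 = (\<lambda>i. a * res_vec N n J z Y v i)"
    by (rule ext) (unfold res_vec_def mid1, simp add: v1_def sum_distrib_left right_diff_distrib mult_ac)
  define w where "w = mid_vec N n J Y v1"
  have wdef: "w = mapply ?L J (adj_vec N Y v1)" by (simp add: w_def mid_vec_eq_mapply)
  have r1: "l2n ?I (res_vec N n J z Y v1) \<le> \<epsilon>"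
  proof -
    have "l2n ?I (res_vec N n J z Y v1) = l2n ?I (res_vec N n J z Y v) / l2n ?I v"
      by (simp add: res1 l2n_scale ca)
    also have "\<dots> \<le> t" using small nv by (simp add: field_simps)
    finally show ?thesis using t by simp
  qed
  have wG: "l2n G w \<le> \<epsilon>"
  proof -
    have "l2n G w = l2n G (mid_vec N n J Y v) / l2n ?I v" by (simp add: w_def mid1 l2n_scale ca)
    also have "\<dots> \<le> \<epsilon>" using conc nv by (simp add: pos_divide_le_eq)
    finally show ?thesis .
  qed
  have adjK: "l2n ?L (adj_vec N Y u) \<le> K * l2n ?I u" for u
    using opbound_adjoint[OF op K, of u] by (simp add: adj_vec_eq_cinner[abs_def])
  have wn: "l2n ?L w \<le> K"
    using adjK[of v1] n1 unfolding wdef orthonormal_columns_norm[OF finite_lessThan J] by simp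
  have "l2n H w \<le> K" using l2n_mono[of ?L H w] H wn by auto
  then obtain u where u: "u \<in> T" "l2n H (\<lambda>i. w i - u i) \<le> \<epsilon>" using net by blast
  \<comment> \<open>\<open>w\<close> minus the net point extended by 0 to \<open>G\<close>. Its
    parts on \<open>G\<close> and on \<open>H\<close> have norm at most \<open>\<epsilon>\<close>
    each.\<close>
  define d where "d = (\<lambda>l. if l \<in> G then w l else w l - u l)"
  have dn: "l2n ?L d \<le> 2 * \<epsilon>"
  proof -
    have "l2n ?L d \<le> l2n ?L (\<lambda>l. if l \<in> G then w l else 0) + l2n ?L (\<lambda>l. if l \<in> G then 0 else w l - u l)"
      using l2n_triangle[of ?L "\<lambda>l. if l \<in> G then w l else 0" "\<lambda>l. if l \<in> G then 0 else w l - u l"]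
      by (simp add: d_def if_distrib cong: if_cong)
    moreover have "l2n ?L (\<lambda>l. if l \<in> G then w l else 0) = l2n G w"
    proof -
      have "(\<Sum>l<n. (cmod (if l \<in> G then w l else 0))\<^sup>2) = (\<Sum>l\<in>G. (cmod (w l))\<^sup>2)"
        using G by (intro sum.mono_neutral_cong_right) auto
      then show ?thesis by (simp add: l2n_def L2_set_def)
    qed
    moreover have "l2n ?L (\<lambda>l. if l \<in> G then 0 else w l - u l) = l2n H (\<lambda>i. w i - u i)"
    proof -
      have "(\<Sum>l<n. (cmod (if l \<in> G then 0 else w l - u l))\<^sup>2) = (\<Sum>l\<in>H. (cmod (w l - u l))\<^sup>2)"
        using H by (intro sum.mono_neutral_cong_right) auto
      then show ?thesis by (simp add: l2n_def L2_set_def)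
    qed
    ultimately show ?thesis using wG u(2) by simp
  qed
  have splitL: "(\<Sum>l<n. f l * d l) = (\<Sum>l<n. f l * w l) - (\<Sum>l\<in>H. f l * u l)" for f :: "nat \<Rightarrow> complex"
  proof -
    have "(\<Sum>l<n. f l * d l) = (\<Sum>l<n. f l * w l - (if l \<in> H then f l * u l else 0))"
      using H by (intro sum.cong) (auto simp: d_def right_diff_distrib)
    also have "\<dots> = (\<Sum>l<n. f l * w l) - (\<Sum>l\<in>H. f l * u l)"
    proof -
      have "(\<Sum>l<n. if l \<in> H then f l * u l else 0) = (\<Sum>l\<in>H. f l * u l)"
        using H by (intro sum.mono_neutral_cong_right) auto
      then show ?thesis by (simp only: sum_subtractf)
    qed
    finally show ?thesis .
  qed
  define vh where "vh = approx_vec H z Y u"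
  \<comment> \<open>The residual equation for \<open>v1\<close> minus the defining equation of
    \<open>vh\<close>.\<close>
  have diff: "z * (v1 i - vh i) = mapply ?L ?Y d i - res_vec N n J z Y v1 i" for i
    using z splitL[of "\<lambda>l. Y (i, l)"]
    by (simp add: vh_def approx_vec_def mapply_def res_vec_def w_def[symmetric] right_diff_distrib)
  have zd: "cmod z * l2n ?I (\<lambda>i. v1 i - vh i) \<le> (1 + 2 * K) * \<epsilon>"
  proof -
    have "cmod z * l2n ?I (\<lambda>i. v1 i - vh i) = l2n ?I (\<lambda>i. mapply ?L ?Y d i - res_vec N n J z Y v1 i)"
      unfolding l2n_scale[symmetric] diff ..
    also have "\<dots> \<le> l2n ?I (mapply ?L ?Y d) + l2n ?I (res_vec N n J z Y v1)"
      by (rule l2n_triangle_diff)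
    also have "\<dots> \<le> K * (2 * \<epsilon>) + \<epsilon>"
    proof (intro add_mono r1)
      have "l2n ?I (mapply ?L ?Y d) \<le> K * l2n ?L d" using op by (simp add: opbound_def)
      also have "\<dots> \<le> K * (2 * \<epsilon>)" using dn K by (intro mult_left_mono)
      finally show "l2n ?I (mapply ?L ?Y d) \<le> K * (2 * \<epsilon>)" .
    qed
    finally show ?thesis by (simp add: algebra_simps)
  qed
  have z0: "0 < cmod z" using z by simp
  have half: "l2n ?I (\<lambda>i. v1 i - vh i) \<le> 1 / 2"
  proof -
    have "cmod z * l2n ?I (\<lambda>i. v1 i - vh i) \<le> cmod z * (1 / 2)" using zd \<epsilon>(2) by simp
    then show ?thesis using z0 by simp
  qed
  have "1 \<le> l2n ?I vh + l2n ?I (\<lambda>i. v1 i - vh i)"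
    using l2n_triangle[of ?I vh "\<lambda>i. v1 i - vh i"] n1 by simp
  then have vh2: "1 / 2 \<le> l2n ?I vh" using half by simp
  have Jd: "l2n ?L (\<lambda>l. cinner ?L d (\<lambda>a. J a l)) \<le> 1 * l2n ?L d"
    by (rule opbound_adjoint) (simp_all add: opbound_def orthonormal_columns_norm[OF finite_lessThan J])
  \<comment> \<open>Since the columns of \<open>J\<close> are orthonormal, \<open>J\<^sup>*\<close>
    is a left inverse of \<open>J\<close>, and \<open>Y\<^sup>* v1\<close> is
    \<open>J\<^sup>* w\<close>.\<close>
  have eq: "adj_vec N Y vh l - (\<Sum>m\<in>H. cnj (J m l) * u m)
     = cinner ?L d (\<lambda>a. J a l) - adj_vec N Y (\<lambda>i. v1 i - vh i) l" if l: "l \<in> G" for l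
  proof -
    have "adj_vec N Y v1 l = cinner ?L w (\<lambda>a. J a l)"
      unfolding wdef by (rule orthonormal_columns_adjoint[OF J finite_lessThan, symmetric]) (use l G in auto)
    moreover have "cinner ?L d (\<lambda>a. J a l) = cinner ?L w (\<lambda>a. J a l) - (\<Sum>m\<in>H. cnj (J m l) * u m)"
      using splitL[of "\<lambda>m. cnj (J m l)"] by (simp add: cinner_def mult.commute)
    moreover have "adj_vec N Y (\<lambda>i. v1 i - vh i) l = adj_vec N Y v1 l - adj_vec N Y vh l"
      by (simp add: adj_vec_def right_diff_distrib sum_subtractf)
    ultimately show ?thesis by simp
  qed
  have "l2n G (\<lambda>l. adj_vec N Y vh l - (\<Sum>m\<in>H. cnj (J m l) * u m))
     = l2n G (\<lambda>l. cinner ?L d (\<lambda>a. J a l) - adj_vec N Y (\<lambda>i. v1 i - vh i) l)"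
    by (intro l2n_cong eq)
  also have "\<dots> \<le> l2n ?L (\<lambda>l. cinner ?L d (\<lambda>a. J a l) - adj_vec N Y (\<lambda>i. v1 i - vh i) l)"
    using G by (intro l2n_mono) auto
  also have "\<dots> \<le> l2n ?L (\<lambda>l. cinner ?L d (\<lambda>a. J a l)) + l2n ?L (adj_vec N Y (\<lambda>i. v1 i - vh i))"
    by (rule l2n_triangle_diff)
  also have "\<dots> \<le> 2 * \<epsilon> + K * ((1 + 2 * K) * \<epsilon> / cmod z)"
  proof (intro add_mono)
    show "l2n ?L (\<lambda>l. cinner ?L d (\<lambda>a. J a l)) \<le> 2 * \<epsilon>" using Jd dn by simp
    have "l2n ?I (\<lambda>i. v1 i - vh i) \<le> (1 + 2 * K) * \<epsilon> / cmod z" using zd z0 by (simp add: field_simps)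
    then show "l2n ?L (adj_vec N Y (\<lambda>i. v1 i - vh i)) \<le> K * ((1 + 2 * K) * \<epsilon> / cmod z)"
      using adjK[of "\<lambda>i. v1 i - vh i"] K by (meson mult_left_mono order_trans)
  qed
  finally show ?thesis using u(1) vh2 unfolding vh_def by (intro bexI[of _ u]) auto
qed

text \<open>Cauchy-Schwarz against the orthogonal projection \<open>s\<close> of
  \<open>v\<close>.\<close>

lemma bessel_inequality:
  assumes "finite P" "orthonormal I P p"
  shows "(\<Sum>j\<in>P. (cmod (cinner I v (p j)))\<^sup>2) \<le> (l2n I v)\<^sup>2"
proof -
  define c where "c j = cinner I v (p j)" for j
  define s where "s = (\<lambda>i. \<Sum>j\<in>P. c j * p j i)"
  have ss: "(l2n I s)\<^sup>2 = (\<Sum>j\<in>P. (cmod (c j))\<^sup>2)"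
    unfolding s_def by (rule orthonormal_combination_norm[OF assms])
  have vs: "cinner I v s = of_real (\<Sum>j\<in>P. (cmod (c j))\<^sup>2)"
    unfolding s_def cinner_sum_right c_def[symmetric] of_real_sum complex_norm_square
    by (simp add: mult.commute)
  then have "\<bar>\<Sum>j\<in>P. (cmod (c j))\<^sup>2\<bar> = cmod (cinner I v s)" by (simp only: norm_of_real)
  then have "(l2n I s)\<^sup>2 \<le> l2n I v * l2n I s"
    using cmod_cinner_le[of I v s] by (simp add: ss sum_nonneg)
  then have "l2n I s \<le> l2n I v"
    using l2n_nonneg[of I s] l2n_nonneg[of I v] unfolding power2_eq_square
    by (cases "l2n I s = 0") (auto simp: mult_le_cancel_right)
  then have "(l2n I s)\<^sup>2 \<le> (l2n I v)\<^sup>2" by (intro power_mono) auto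
  then show ?thesis unfolding ss by (simp add: c_def)
qed


section \<open>Probability bounds for a partially independent Gaussian matrix\<close>

lemma sets_small_ball:
  "{h\<in>space (cgauss_space I). (\<Sum>j\<in>P. (cmod ((\<Sum>i\<in>I. p j i * cg h i) + \<alpha> j))\<^sup>2) \<le> \<tau>} \<in> sets (cgauss_space I)"
proof -
  have [measurable]: "(\<lambda>h. (\<Sum>i\<in>I. p j i * cg h i) + \<alpha> j) \<in> borel_measurable (cgauss_space I)" for j
    by (intro borel_measurable_add borel_measurable_sum borel_measurable_times cg_measurable) auto
  show ?thesis by measurable
qed

lemma orthonormal_reindex:
  assumes "inj_on f C"
  shows "orthonormal (f ` C) P p \<longleftrightarrow> orthonormal C P (\<lambda>j q. p j (f q))"
  unfolding orthonormal_def cinner_def by (simp add: sum.reindex[OF assms])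

text \<open>Coefficients may be taken from a countable dense set. This makes closeness to a span a
  countable union of conditions, hence a measurable event.\<close>

lemma countable_dense_combination:
  fixes b :: "nat \<Rightarrow> nat \<Rightarrow> complex"
  assumes fin: "finite C" and D0: "\<And>X. open X \<Longrightarrow> X \<noteq> {} \<Longrightarrow> \<exists>d\<in>D0. d \<in> (X :: complex set)" and \<delta>: "0 < \<delta>"
  shows "\<exists>q\<in>C \<rightarrow>\<^sub>E D0. l2n I (\<lambda>r. (\<Sum>c\<in>C. q0 c * b c r) - (\<Sum>c\<in>C. q c * b c r)) < \<delta>"
proof -
  define S where "S = (\<Sum>c\<in>C. l2n I (b c))"
  have S: "0 \<le> S" unfolding S_def by (intro sum_nonneg) simp
  define \<eta> where "\<eta> = \<delta> / (1 + S)"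
  have \<eta>: "0 < \<eta>" "\<eta> * S < \<delta>" using \<delta> S by (auto simp: \<eta>_def field_simps)
  have "\<exists>d\<in>D0. d \<in> ball (q0 c) \<eta>" for c using \<eta>(1) by (intro D0) auto
  then obtain q where q: "\<And>c. q c \<in> D0" "\<And>c. q c \<in> ball (q0 c) \<eta>" by metis
  have "l2n I (\<lambda>r. (\<Sum>c\<in>C. q0 c * b c r) - (\<Sum>c\<in>C. q c * b c r)) = l2n I (\<lambda>r. \<Sum>c\<in>C. (q0 c - q c) * b c r)"
    by (simp add: left_diff_distrib sum_subtractf)
  also have "\<dots> \<le> (\<Sum>c\<in>C. l2n I (\<lambda>r. (q0 c - q c) * b c r))" by (rule l2n_sum[OF fin])
  also have "\<dots> \<le> (\<Sum>c\<in>C. \<eta> * l2n I (b c))"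
    unfolding l2n_scale using q(2) by (intro sum_mono mult_right_mono) (auto simp: dist_norm less_imp_le)
  also have "\<dots> = \<eta> * S" by (simp add: S_def sum_distrib_left)
  finally have "l2n I (\<lambda>r. (\<Sum>c\<in>C. q0 c * b c r) - (\<Sum>c\<in>C. q c * b c r)) < \<delta>" using \<eta>(2) by simp
  moreover have "(\<Sum>c\<in>C. (\<lambda>c\<in>C. q c) c * b c r) = (\<Sum>c\<in>C. q c * b c r)" for r by (rule sum.cong) auto
  ultimately show ?thesis using q(1) by (intro bexI[of _ "\<lambda>c\<in>C. q c"]) auto
qed

lemma borel_measurable_cnj [measurable]: "cnj \<in> borel_measurable borel"
  by (intro borel_measurable_continuous_onI continuous_intros)

text \<open>\<open>A m\<close> lists the coefficients of the noise variable \<open>m\<close> in all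
  matrix entries. The variable \<open>Inr q\<close> is private to the entry \<open>q\<close>, while
  the variables \<open>Inl m\<close> may couple all entries, also those in the columns
  \<open>G\<close>. So each entry of a column in \<open>G\<close> has an independent part of
  variance \<open>b\<^sup>2\<close>, and its remaining part is arbitrary.\<close>

locale gauss_model =
  fixes N n :: nat and G :: "nat set" and M0 :: "nat set" and A :: "nat + nat \<times> nat \<Rightarrow> nat \<times> nat \<Rightarrow> complex"
    and b :: real
  assumes G: "G \<subseteq> {..<n}" and M0: "finite M0" and b: "0 < b"
    and indep: "\<And>q j. q \<in> {..<N} \<times> G \<Longrightarrow> A (Inr q) j = (if j = q then of_real b else 0)"
begin

definition "IDX = Inl ` M0 \<union> Inr ` ({..<N} \<times> G)"
definition "Ent = {..<N} \<times> {..<n}"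
definition "fam h = (\<lambda>j\<in>Ent. \<Sum>m\<in>IDX. A m j * cg h m)"
abbreviation "YM \<equiv> PiM Ent (\<lambda>_. borel :: complex measure)"

lemma finite_sets: "finite G" "finite IDX" "finite Ent"
  using G M0 finite_subset[of G "{..<n}"] by (auto simp: IDX_def Ent_def)

lemma fam_measurable: "fam \<in> measurable (cgauss_space IDX) YM"
  unfolding fam_def
  by (intro measurable_restrict borel_measurable_sum borel_measurable_times cg_measurable) auto

lemma entry_measurable [measurable]: "i < N \<Longrightarrow> l < n \<Longrightarrow> (\<lambda>Y. Y (i, l)) \<in> borel_measurable YM"
  by (rule measurable_component_singleton) (simp add: Ent_def)

lemma conditional_small_ball:
  assumes C: "C \<subseteq> {..<N} \<times> G" and P: "finite P" and \<kappa>: "0 \<le> \<kappa>" and E: "E \<in> sets YM"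
    and sec: "\<And>Z. (\<forall>g. (\<lambda>j\<in>Ent. Z j + (if j \<in> C then of_real b * g j else 0)) \<notin> E) \<or>
      (\<exists>p \<alpha>. orthonormal C P p \<and> (\<forall>g. (\<lambda>j\<in>Ent. Z j + (if j \<in> C then of_real b * g j else 0)) \<in> E \<longrightarrow>
        (\<Sum>j\<in>P. (cmod ((\<Sum>q\<in>C. p j q * g q) + \<alpha> j))\<^sup>2) \<le> \<tau>))"
  shows "emeasure (cgauss_space IDX) {h\<in>space (cgauss_space IDX). fam h \<in> E} \<le> ennreal (exp (\<kappa> * \<tau>) / (1 + \<kappa>) ^ card P)"
proof -
  define B where "B = (Inr ` C :: (nat + nat \<times> nat) set)"
  define A' where "A' = IDX - B"
  have finC: "finite C" using C finite_sets by (meson finite_SigmaI finite_lessThan finite_subset)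
  have AB: "finite A'" "finite B" "A' \<inter> B = {}" "A' \<union> B = IDX"
    using finite_sets finC C by (auto simp: A'_def B_def IDX_def)
  have meas: "{h\<in>space (cgauss_space IDX). fam h \<in> E} \<in> sets (cgauss_space IDX)"
    using measurable_sets[OF fam_measurable E] by (simp add: vimage_def Int_def conj_commute)
  have "emeasure (cgauss_space (A' \<union> B)) {h\<in>space (cgauss_space IDX). fam h \<in> E}
      \<le> ennreal (exp (\<kappa> * \<tau>) / (1 + \<kappa>) ^ card P)"
  proof (rule cgauss_space_section[OF AB(1-3)])
    show "{h\<in>space (cgauss_space IDX). fam h \<in> E} \<in> sets (cgauss_space (A' \<union> B))" using meas AB(4) by simp
    fix x assume x: "x \<in> space (cgauss_space A')"
    define Z where "Z j = (\<Sum>m\<in>A'. A m j * cg x m)" for j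
    have fam_merge: "fam (merge (A' \<times> UNIV) (B \<times> UNIV) (x, y))
        = (\<lambda>j\<in>Ent. Z j + (if j \<in> C then of_real b * cg y (Inr j) else 0))" for y
    proof -
      let ?h = "merge (A' \<times> UNIV) (B \<times> UNIV) (x, y)"
      have cgA: "cg ?h m = cg x m" if "m \<in> A'" for m
        using that by (simp add: cg_def merge_def)
      have cgB: "cg ?h m = cg y m" if "m \<in> B" for m
        using that AB(3) by (auto simp: cg_def merge_def)
      have "(\<Sum>m\<in>IDX. A m j * cg ?h m) = Z j + (if j \<in> C then of_real b * cg y (Inr j) else 0)" for j
      proof -
        have "(\<Sum>m\<in>IDX. A m j * cg ?h m) = (\<Sum>m\<in>A'. A m j * cg ?h m) + (\<Sum>m\<in>B. A m j * cg ?h m)"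
          unfolding AB(4)[symmetric] by (rule sum.union_disjoint[OF AB(1-3)])
        also have "(\<Sum>m\<in>A'. A m j * cg ?h m) = Z j"
          unfolding Z_def by (intro sum.cong refl) (simp add: cgA)
        also have "(\<Sum>m\<in>B. A m j * cg ?h m) = (\<Sum>m\<in>B. A m j * cg y m)"
          by (intro sum.cong refl) (simp add: cgB)
        also have "\<dots> = (\<Sum>q\<in>C. A (Inr q) j * cg y (Inr q))"
          unfolding B_def by (simp add: sum.reindex)
        also have "\<dots> = (\<Sum>q\<in>C. if j = q then of_real b * cg y (Inr q) else 0)"
          using C by (intro sum.cong refl) (auto simp: indep)
        also have "\<dots> = (if j \<in> C then of_real b * cg y (Inr j) else 0)"
          using finC by simp
        finally show ?thesis .
      qed
      then show ?thesis by (simp add: fam_def)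
    qed
    let ?S = "{y\<in>space (cgauss_space B). merge (A' \<times> UNIV) (B \<times> UNIV) (x, y) \<in> {h\<in>space (cgauss_space IDX). fam h \<in> E}}"
    show "emeasure (cgauss_space B) ?S \<le> ennreal (exp (\<kappa> * \<tau>) / (1 + \<kappa>) ^ card P)"
      using sec[of Z]
    proof
      assume e: "\<forall>g. (\<lambda>j\<in>Ent. Z j + (if j \<in> C then of_real b * g j else 0)) \<notin> E"
      have "fam (merge (A' \<times> UNIV) (B \<times> UNIV) (x, y)) \<notin> E" for y
        unfolding fam_merge using spec[OF e, of "\<lambda>j. cg y (Inr j)"] .
      then have S0: "?S = {}" by auto
      show ?thesis unfolding S0 by simp
    next
      assume "\<exists>p \<alpha>. orthonormal C P p \<and> (\<forall>g. (\<lambda>j\<in>Ent. Z j + (if j \<in> C then of_real b * g j else 0)) \<in> E \<longrightarrow>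
        (\<Sum>j\<in>P. (cmod ((\<Sum>q\<in>C. p j q * g q) + \<alpha> j))\<^sup>2) \<le> \<tau>)"
      then obtain p \<alpha> where p: "orthonormal C P p"
        and le: "\<And>g. (\<lambda>j\<in>Ent. Z j + (if j \<in> C then of_real b * g j else 0)) \<in> E \<Longrightarrow>
          (\<Sum>j\<in>P. (cmod ((\<Sum>q\<in>C. p j q * g q) + \<alpha> j))\<^sup>2) \<le> \<tau>" by blast
      define p' where "p' = (\<lambda>j (m :: nat + nat \<times> nat). case m of Inl _ \<Rightarrow> 0 | Inr q \<Rightarrow> p j q)"
      have p'o: "orthonormal B P p'"
        unfolding B_def using p by (subst orthonormal_reindex) (auto simp: p'_def)
      have p's: "(\<Sum>m\<in>B. p' j m * cg y m) = (\<Sum>q\<in>C. p j q * cg y (Inr q))" for j y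
        unfolding B_def by (simp add: sum.reindex p'_def)
      have "?S \<subseteq> {y\<in>space (cgauss_space B). (\<Sum>j\<in>P. (cmod ((\<Sum>i\<in>B. p' j i * cg y i) + \<alpha> j))\<^sup>2) \<le> \<tau>}"
        unfolding p's using le[of "\<lambda>q. cg _ (Inr q)"] by (auto simp: fam_merge)
      then have "emeasure (cgauss_space B) ?S \<le> emeasure (cgauss_space B)
          {y\<in>space (cgauss_space B). (\<Sum>j\<in>P. (cmod ((\<Sum>i\<in>B. p' j i * cg y i) + \<alpha> j))\<^sup>2) \<le> \<tau>}"
        by (rule emeasure_mono) (rule sets_small_ball)
      also have "\<dots> \<le> ennreal (exp (\<kappa> * \<tau>) / (1 + \<kappa>) ^ card P)"
        by (rule gaussian_small_ball[OF AB(2) P p'o \<kappa>])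
      finally show ?thesis .
    qed
  qed
  then show ?thesis by (simp add: AB(4))
qed

lemma emeasure_union_le:
  assumes "finite T" "\<And>w. w \<in> T \<Longrightarrow> F w \<in> sets YM"
    "\<And>w. w \<in> T \<Longrightarrow> emeasure (cgauss_space IDX) {h\<in>space (cgauss_space IDX). fam h \<in> F w} \<le> ennreal \<epsilon>" "0 \<le> \<epsilon>"
  shows "emeasure (cgauss_space IDX) {h\<in>space (cgauss_space IDX). fam h \<in> (\<Union>w\<in>T. F w)} \<le> ennreal (real (card T) * \<epsilon>)"
proof -
  have m: "{h\<in>space (cgauss_space IDX). fam h \<in> F w} \<in> sets (cgauss_space IDX)" if "w \<in> T" for w
    using measurable_sets[OF fam_measurable assms(2)[OF that]] by (simp add: vimage_def Int_def conj_commute)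
  have "{h\<in>space (cgauss_space IDX). fam h \<in> (\<Union>w\<in>T. F w)} = (\<Union>w\<in>T. {h\<in>space (cgauss_space IDX). fam h \<in> F w})"
    by auto
  also have "emeasure (cgauss_space IDX) \<dots> \<le> (\<Sum>w\<in>T. emeasure (cgauss_space IDX) {h\<in>space (cgauss_space IDX). fam h \<in> F w})"
    using m assms(1) by (intro emeasure_subadditive_finite) auto
  also have "\<dots> \<le> (\<Sum>w\<in>T. ennreal \<epsilon>)" by (intro sum_mono assms(3))
  also have "\<dots> = ennreal (real (card T) * \<epsilon>)"
    using assms(4) by (simp add: ennreal_mult' ennreal_of_nat_eq_real_of_nat)
  finally show ?thesis .
qed

definition norm_event :: "(nat \<Rightarrow> complex) \<Rightarrow> (nat \<Rightarrow> complex) \<Rightarrow> real \<Rightarrow> (nat \<times> nat \<Rightarrow> complex) set" where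
  "norm_event u v \<tau> = {Y\<in>space YM. \<tau> < Re (cinner {..<N} (mapply {..<n} (\<lambda>i l. Y (i, l)) v) u)}"

lemma norm_event_sets: "norm_event u v \<tau> \<in> sets YM"
  unfolding norm_event_def cinner_def mapply_def by measurable

text \<open>The bilinear form is linear in the noise, with coefficients \<open>d\<close>. The
  hypothesis on \<open>D\<close> bounds the covariance of the entries as a quadratic form, and the
  squared norm of the coefficients \<open>c\<close> is at most \<open>(5 / 4) ^ 4\<close>, which is
  below 3.\<close>

lemma norm_event_bound:
  assumes D: "\<And>c. (\<Sum>m\<in>IDX. (cmod (\<Sum>j\<in>Ent. c j * A m j))\<^sup>2) \<le> D * (\<Sum>j\<in>Ent. (cmod (c j))\<^sup>2)" "0 \<le> D"
    and u: "l2n {..<N} u \<le> 5 / 4" and v: "l2n {..<n} v \<le> 5 / 4" and s: "0 \<le> s"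
  shows "emeasure (cgauss_space IDX) {h\<in>space (cgauss_space IDX). fam h \<in> norm_event u v \<tau>}
    \<le> ennreal (exp (s\<^sup>2 * (3 * D) / 4 - s * \<tau>))"
proof -
  define c where "c = (\<lambda>j. cnj (u (fst j)) * v (snd j))"
  define d where "d m = (\<Sum>j\<in>Ent. c j * A m j)" for m
  have lin: "cinner {..<N} (mapply {..<n} (\<lambda>i l. fam h (i, l)) v) u = (\<Sum>m\<in>IDX. d m * cg h m)" for h
  proof -
    have "cinner {..<N} (mapply {..<n} (\<lambda>i l. fam h (i, l)) v) u = (\<Sum>i<N. \<Sum>l<n. c (i, l) * fam h (i, l))"
      by (simp add: cinner_def mapply_def c_def sum_distrib_right sum_distrib_left mult_ac)
    also have "\<dots> = (\<Sum>j\<in>Ent. c j * fam h j)"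
      unfolding Ent_def by (subst sum.cartesian_product) (simp add: case_prod_unfold)
    also have "\<dots> = (\<Sum>j\<in>Ent. \<Sum>m\<in>IDX. c j * A m j * cg h m)"
      by (intro sum.cong refl) (simp add: fam_def sum_distrib_left mult.assoc)
    also have "\<dots> = (\<Sum>m\<in>IDX. d m * cg h m)"
      by (subst sum.swap) (simp add: d_def sum_distrib_right)
    finally show ?thesis .
  qed
  have cc: "(\<Sum>j\<in>Ent. (cmod (c j))\<^sup>2) = (l2n {..<N} u)\<^sup>2 * (l2n {..<n} v)\<^sup>2"
    unfolding Ent_def l2n_sq sum_product
    by (subst sum.cartesian_product) (simp add: c_def case_prod_unfold norm_mult power_mult_distrib)
  have "(l2n {..<N} u)\<^sup>2 * (l2n {..<n} v)\<^sup>2 \<le> (5 / 4)\<^sup>2 * (5 / 4)\<^sup>2"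
    using u v by (intro mult_mono power_mono) auto
  also have "\<dots> \<le> (3::real)" by (simp add: power2_eq_square)
  finally have c3: "(\<Sum>j\<in>Ent. (cmod (c j))\<^sup>2) \<le> 3" unfolding cc .
  have "(\<Sum>m\<in>IDX. (cmod (d m))\<^sup>2) \<le> D * (\<Sum>j\<in>Ent. (cmod (c j))\<^sup>2)"
    unfolding d_def by (rule D(1))
  also have "\<dots> \<le> D * 3" using c3 D(2) by (rule mult_left_mono)
  finally have dD: "(\<Sum>m\<in>IDX. (cmod (d m))\<^sup>2) \<le> 3 * D" by simp
  have "{h\<in>space (cgauss_space IDX). fam h \<in> norm_event u v \<tau>} = {h\<in>space (cgauss_space IDX). \<tau> < Re (\<Sum>m\<in>IDX. d m * cg h m)}"
    using measurable_space[OF fam_measurable] by (auto simp: norm_event_def lin)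
  then show ?thesis using gaussian_tail[OF finite_sets(2) s dD, of \<tau>] by simp
qed

definition net_event :: "(nat \<Rightarrow> nat \<Rightarrow> complex) \<Rightarrow> complex \<Rightarrow> (nat \<Rightarrow> complex) \<Rightarrow> real \<Rightarrow> (nat \<times> nat \<Rightarrow> complex) set" where
  "net_event J z w \<tau> = {Y\<in>space YM. 1 / 2 \<le> l2n {..<N} (approx_vec ({..<n} - G) z Y w) \<and>
    l2n G (\<lambda>l. adj_vec N Y (approx_vec ({..<n} - G) z Y w) l - (\<Sum>m\<in>{..<n} - G. cnj (J m l) * w m)) \<le> \<tau>}"

lemma net_event_sets: "net_event J z w \<tau> \<in> sets YM"
proof -
  have Gn: "l < n" if "l \<in> G" for l using that G by auto
  have [measurable]: "(\<lambda>Y. approx_vec ({..<n} - G) z Y w i) \<in> borel_measurable YM" if "i < N" for i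
    unfolding approx_vec_def using that by measurable
  have [measurable]: "(\<lambda>Y. adj_vec N Y (approx_vec ({..<n} - G) z Y w) l) \<in> borel_measurable YM" if "l \<in> G" for l
    unfolding adj_vec_def using Gn[OF that] by measurable
  show ?thesis unfolding net_event_def l2n_def L2_set_def by measurable
qed

text \<open>\<open>approx_vec\<close> uses only columns outside \<open>G\<close>, so it is a fixed
  vector \<open>vh\<close> once everything but the private noise of \<open>G\<close> is frozen. The
  \<open>card G\<close> inner products with the columns in \<open>G\<close> then have independent
  parts whose variance is \<open>b\<^sup>2\<close> times the squared norm of \<open>vh\<close>. The
  event includes that this norm is at least \<open>1 / 2\<close>, whence the factor 4.\<close>

lemma net_event_bound:
  assumes \<kappa>: "0 \<le> \<kappa>" and \<tau>: "0 \<le> \<tau>"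
  shows "emeasure (cgauss_space IDX) {h\<in>space (cgauss_space IDX). fam h \<in> net_event J z w \<tau>}
    \<le> ennreal (exp (\<kappa> * (4 * \<tau>\<^sup>2 / b\<^sup>2)) / (1 + \<kappa>) ^ card G)"
proof (rule conditional_small_ball[where C = "{..<N} \<times> G"])
  show "finite G" by (rule finite_sets)
  show "net_event J z w \<tau> \<in> sets YM" by (rule net_event_sets)
  fix Z :: "nat \<times> nat \<Rightarrow> complex"
  let ?H = "{..<n} - G"
  let ?C = "{..<N} \<times> G"
  let ?Y = "\<lambda>g. \<lambda>j\<in>Ent. Z j + (if j \<in> ?C then of_real b * g j else 0)"
  define vh where "vh = (\<lambda>i. (\<Sum>l\<in>?H. Z (i, l) * w l) / z)"
  have vhY: "approx_vec ?H z (?Y g) w i = vh i" if "i < N" for g i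
  proof -
    have "(\<Sum>l\<in>?H. ?Y g (i, l) * w l) = (\<Sum>l\<in>?H. Z (i, l) * w l)"
      using that by (intro sum.cong refl) (auto simp: Ent_def)
    then show ?thesis by (simp add: approx_vec_def vh_def)
  qed
  have vhn: "l2n {..<N} (approx_vec ?H z (?Y g) w) = l2n {..<N} vh" for g
    by (rule l2n_cong) (simp add: vhY)
  show "(\<forall>g. ?Y g \<notin> net_event J z w \<tau>) \<or>
      (\<exists>p \<alpha>. orthonormal ?C G p \<and> (\<forall>g. ?Y g \<in> net_event J z w \<tau> \<longrightarrow>
        (\<Sum>j\<in>G. (cmod ((\<Sum>q\<in>?C. p j q * g q) + \<alpha> j))\<^sup>2) \<le> 4 * \<tau>\<^sup>2 / b\<^sup>2))"
  proof (cases "1 / 2 \<le> l2n {..<N} vh")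
    case False
    then show ?thesis by (simp add: net_event_def vhn)
  next
    case True
    define V where "V = l2n {..<N} vh"
    have V: "1 / 2 \<le> V" "0 < V" using True by (auto simp: V_def)
    \<comment> \<open>The normalised \<open>vh\<close>, placed in column \<open>l\<close>; different
      columns have disjoint supports, which gives orthonormality. Conjugates appear because
      \<open>adj_vec\<close> is antilinear in the matrix.\<close>
    define p where "p = (\<lambda>(l :: nat) (q :: nat \<times> nat). if snd q = l then cnj (vh (fst q)) / of_real V else 0)"
    define e where "e l = (\<Sum>m\<in>?H. cnj (J m l) * w m)" for l
    define \<alpha> where "\<alpha> l = ((\<Sum>i<N. Z (i, l) * cnj (vh i)) - cnj (e l)) / of_real (b * V)" for l
    have sumC: "(\<Sum>q\<in>?C. p l q * g q) = (\<Sum>i<N. cnj (vh i) * g (i, l)) / of_real V" if "l \<in> G" for l and g :: "nat \<times> nat \<Rightarrow> complex"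
    proof -
      have "(\<Sum>q\<in>?C. p l q * g q) = (\<Sum>i<N. \<Sum>l'\<in>G. if l' = l then cnj (vh i) / of_real V * g (i, l) else 0)"
        by (subst sum.cartesian_product) (intro sum.cong, auto simp: p_def)
      also have "\<dots> = (\<Sum>i<N. cnj (vh i) * g (i, l)) / of_real V"
        using that finite_sets(1) by (simp add: sum_divide_distrib)
      finally show ?thesis .
    qed
    have ortho: "orthonormal ?C G p"
      unfolding orthonormal_def
    proof (intro ballI)
      fix l l' assume l: "l \<in> G" "l' \<in> G"
      have "cinner ?C (p l) (p l') = (\<Sum>i<N. cnj (vh i) * cnj (p l' (i, l))) / of_real V"
        unfolding cinner_def by (rule sumC[OF l(1)])
      also have "\<dots> = (if l = l' then (\<Sum>i<N. vh i * cnj (vh i)) / of_real (V\<^sup>2) else 0)"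
        by (auto simp: p_def sum_divide_distrib[symmetric] power2_eq_square mult.commute)
      also have "(\<Sum>i<N. vh i * cnj (vh i)) = of_real (V\<^sup>2)"
        unfolding V_def cinner_self[symmetric] cinner_def ..
      finally show "cinner ?C (p l) (p l') = (if l = l' then 1 else 0)" using V(2) by simp
    qed
    have "(\<Sum>l\<in>G. (cmod ((\<Sum>q\<in>?C. p l q * g q) + \<alpha> l))\<^sup>2) \<le> 4 * \<tau>\<^sup>2 / b\<^sup>2" if g: "?Y g \<in> net_event J z w \<tau>" for g
    proof -
      have el: "(cmod ((\<Sum>q\<in>?C. p l q * g q) + \<alpha> l))\<^sup>2 = (cmod (adj_vec N (?Y g) (approx_vec ?H z (?Y g) w) l - e l))\<^sup>2 / (b * V)\<^sup>2"
        if l: "l \<in> G" for l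
      proof -
        have "l < n" using l G by auto
        then have "adj_vec N (?Y g) (approx_vec ?H z (?Y g) w) l = (\<Sum>i<N. cnj (Z (i, l) + of_real b * g (i, l)) * vh i)"
          unfolding adj_vec_def
        proof (intro sum.cong refl)
          fix i assume i: "i \<in> {..<N}"
          have "?Y g (i, l) = Z (i, l) + of_real b * g (i, l)" using i l \<open>l < n\<close> by (simp add: Ent_def)
          then show "cnj (?Y g (i, l)) * approx_vec ?H z (?Y g) w i = cnj (Z (i, l) + of_real b * g (i, l)) * vh i"
            using vhY[of i g] i by (simp only: lessThan_iff)
        qed
        then have "cnj (adj_vec N (?Y g) (approx_vec ?H z (?Y g) w) l - e l)
          = of_real b * (\<Sum>i<N. cnj (vh i) * g (i, l)) + ((\<Sum>i<N. Z (i, l) * cnj (vh i)) - cnj (e l))"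
          by (simp add: distrib_right distrib_left sum.distrib sum_distrib_left mult_ac)
        also have "\<dots> = of_real (b * V) * ((\<Sum>q\<in>?C. p l q * g q) + \<alpha> l)"
          unfolding sumC[OF l] \<alpha>_def using b V by (simp add: field_simps)
        finally have conj: "cnj (adj_vec N (?Y g) (approx_vec ?H z (?Y g) w) l - e l) = of_real (b * V) * ((\<Sum>q\<in>?C. p l q * g q) + \<alpha> l)" .
        have "cmod (adj_vec N (?Y g) (approx_vec ?H z (?Y g) w) l - e l) = cmod (of_real (b * V) * ((\<Sum>q\<in>?C. p l q * g q) + \<alpha> l))"
          unfolding conj[symmetric] by (rule complex_mod_cnj[symmetric])
        also have "\<dots> = b * V * cmod ((\<Sum>q\<in>?C. p l q * g q) + \<alpha> l)"
          using b V by (simp only: norm_mult norm_of_real) simp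
        finally show ?thesis using b V by (simp add: power_mult_distrib)
      qed
      have "(\<Sum>l\<in>G. (cmod ((\<Sum>q\<in>?C. p l q * g q) + \<alpha> l))\<^sup>2)
         = (\<Sum>l\<in>G. (cmod (adj_vec N (?Y g) (approx_vec ?H z (?Y g) w) l - e l))\<^sup>2 / (b * V)\<^sup>2)"
        by (intro sum.cong refl el)
      also have "\<dots> = (l2n G (\<lambda>l. adj_vec N (?Y g) (approx_vec ?H z (?Y g) w) l - e l))\<^sup>2 / (b * V)\<^sup>2"
        unfolding l2n_sq by (simp only: sum_divide_distrib)
      also have "\<dots> \<le> \<tau>\<^sup>2 / (b * V)\<^sup>2"
        using g by (intro divide_right_mono power_mono) (auto simp: net_event_def e_def)
      also have "\<dots> \<le> \<tau>\<^sup>2 / (b * (1 / 2))\<^sup>2"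
        using b V by (intro divide_left_mono power_mono mult_left_mono mult_pos_pos) auto
      also have "\<dots> = 4 * \<tau>\<^sup>2 / b\<^sup>2" by (simp add: power_mult_distrib power_divide)
      finally show ?thesis .
    qed
    with ortho show ?thesis by blast
  qed
qed (use \<kappa> in auto)

definition span_event :: "(nat \<Rightarrow> nat \<Rightarrow> complex) \<Rightarrow> complex \<Rightarrow> nat \<Rightarrow> complex set \<Rightarrow> real \<Rightarrow> nat \<Rightarrow> (nat \<times> nat \<Rightarrow> complex) set" where
  "span_event J z k D0 s l = {Y\<in>space YM. \<exists>q\<in>{k..N} \<rightarrow>\<^sub>E D0.
    l2n {..<N} (\<lambda>r. Y (r, l) - (\<Sum>c\<in>{k..N}. q c * span_vec N n J z l Y c r)) < s}"

lemma span_event_sets: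
  assumes "countable D0" and l: "l < n"
  shows "span_event J z k D0 s l \<in> sets YM"
proof -
  have cD: "countable ({k..N} \<rightarrow>\<^sub>E D0)" using assms by (intro countable_PiE) auto
  have [measurable]: "(\<lambda>Y. span_vec N n J z l Y c r) \<in> borel_measurable YM" if "r < N" for c r
  proof (cases "c < N")
    case True
    then show ?thesis unfolding span_vec_def using that l by simp
  next
    case False
    then show ?thesis unfolding span_vec_def using that l by simp
  qed
  have "{Y\<in>space YM. l2n {..<N} (\<lambda>r. Y (r, l) - (\<Sum>c\<in>{k..N}. q c * span_vec N n J z l Y c r)) < s} \<in> sets YM" for q
    unfolding l2n_def L2_set_def using l by measurable
  moreover have "span_event J z k D0 s l = (\<Union>q\<in>{k..N} \<rightarrow>\<^sub>E D0.
      {Y\<in>space YM. l2n {..<N} (\<lambda>r. Y (r, l) - (\<Sum>c\<in>{k..N}. q c * span_vec N n J z l Y c r)) < s})"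
    by (auto simp: span_event_def)
  ultimately show ?thesis using cD by auto
qed

text \<open>With only the private noise of column \<open>l\<close> free, the
  \<open>N - k + 1\<close> vectors \<open>span_vec\<close> are fixed. They leave
  \<open>k - 1\<close> orthonormal directions \<open>e\<close> in which the column itself must be
  small, whatever the coefficients \<open>q\<close> are. So no union over coefficients has to be
  paid for.\<close>

lemma span_event_bound:
  assumes D0: "countable D0" and l: "l \<in> G" and k: "1 \<le> k" "k \<le> N" and \<kappa>: "0 \<le> \<kappa>"
  shows "emeasure (cgauss_space IDX) {h\<in>space (cgauss_space IDX). fam h \<in> span_event J z k D0 s l}
    \<le> ennreal (exp (\<kappa> * (s\<^sup>2 / b\<^sup>2)) / (1 + \<kappa>) ^ (k - 1))"
proof -
  have ln: "l < n" using l G by auto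
  let ?C = "{..<N} \<times> {l}"
  have "emeasure (cgauss_space IDX) {h\<in>space (cgauss_space IDX). fam h \<in> span_event J z k D0 s l}
    \<le> ennreal (exp (\<kappa> * (s\<^sup>2 / b\<^sup>2)) / (1 + \<kappa>) ^ card {..<k - 1})"
  proof (rule conditional_small_ball[where C = ?C])
    show "?C \<subseteq> {..<N} \<times> G" using l by auto
    show "span_event J z k D0 s l \<in> sets YM" by (rule span_event_sets[OF D0 ln])
    fix Z :: "nat \<times> nat \<Rightarrow> complex"
    let ?Y = "\<lambda>g. \<lambda>j\<in>Ent. Z j + (if j \<in> ?C then of_real b * g j else 0)"
    define bv where "bv = span_vec N n J z l Z"
    have bvY: "span_vec N n J z l (?Y g) c r = bv c r" if r: "r < N" for g c r
    proof (cases "c < N")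
      case True
      have "?Y g (r, j) = Z (r, j)" "?Y g (c, j) = Z (c, j)" if "j \<in> {..<n} - {l}" for j
        using that r True by (auto simp: Ent_def)
      then show ?thesis using True by (simp add: span_vec_def bv_def)
    next
      case False
      have "?Y g (r, j) = Z (r, j)" if "j \<in> {..<n} - {l}" for j
        using that r by (auto simp: Ent_def)
      then show ?thesis using False by (simp add: span_vec_def bv_def)
    qed
    obtain e where e: "orthonormal {..<N} {..<k - 1} e" "\<forall>j<k - 1. \<forall>c\<in>{k..N}. cinner {..<N} (e j) (bv c) = 0"
      using orthonormal_orthogonal_exists[of "{k..N}" "{..<N}" "k - 1" bv] k by auto
    have eb: "cinner {..<N} (bv c) (e j) = 0" if "j < k - 1" "c \<in> {k..N}" for j c
      using e(2) that by (intro cinner_zero_commute[of "{..<N}" "e j"]) auto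
    define p where "p = (\<lambda>(j :: nat) (q :: nat \<times> nat). cnj (e j (fst q)))"
    define \<alpha> where "\<alpha> j = cinner {..<N} (\<lambda>r. Z (r, l)) (e j) / of_real b" for j
    have sumC: "(\<Sum>q\<in>?C. f q) = (\<Sum>i<N. f (i, l))" for f :: "nat \<times> nat \<Rightarrow> complex"
    proof -
      have "(\<Sum>q\<in>?C. f q) = (\<Sum>i<N. \<Sum>l'\<in>{l}. f (i, l'))"
        by (subst sum.cartesian_product) (simp add: case_prod_unfold)
      then show ?thesis by simp
    qed
    have po: "orthonormal ?C {..<k - 1} p"
      unfolding orthonormal_def
    proof (intro ballI)
      fix i j assume ij: "i \<in> {..<k - 1}" "j \<in> {..<k - 1}"
      have "cinner ?C (p i) (p j) = cnj (cinner {..<N} (e i) (e j))"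
        unfolding cinner_def sumC by (simp add: p_def)
      then show "cinner ?C (p i) (p j) = (if i = j then 1 else 0)"
        using e(1) ij by (simp add: orthonormal_def)
    qed
    have ps: "(\<Sum>j\<in>{..<k - 1}. (cmod ((\<Sum>q\<in>?C. p j q * g q) + \<alpha> j))\<^sup>2) \<le> s\<^sup>2 / b\<^sup>2"
      if g: "?Y g \<in> span_event J z k D0 s l" for g
    proof -
      obtain q where q: "l2n {..<N} (\<lambda>r. ?Y g (r, l) - (\<Sum>c\<in>{k..N}. q c * span_vec N n J z l (?Y g) c r)) < s"
        using g by (auto simp: span_event_def)
      define y where "y r = Z (r, l) + of_real b * g (r, l)" for r
      have "l2n {..<N} (\<lambda>r. ?Y g (r, l) - (\<Sum>c\<in>{k..N}. q c * span_vec N n J z l (?Y g) c r))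
          = l2n {..<N} (\<lambda>r. y r - (\<Sum>c\<in>{k..N}. q c * bv c r))"
      proof (rule l2n_cong)
        fix r assume r: "r \<in> {..<N}"
        have 1: "?Y g (r, l) = y r" using r ln by (simp add: y_def Ent_def)
        have 2: "span_vec N n J z l (?Y g) c r = bv c r" for c using r by (intro bvY) simp
        show "?Y g (r, l) - (\<Sum>c\<in>{k..N}. q c * span_vec N n J z l (?Y g) c r) = y r - (\<Sum>c\<in>{k..N}. q c * bv c r)"
          unfolding 1 2 ..
      qed
      with q have ys: "l2n {..<N} (\<lambda>r. y r - (\<Sum>c\<in>{k..N}. q c * bv c r)) < s" by simp
      have inner: "cinner {..<N} (\<lambda>r. y r - (\<Sum>c\<in>{k..N}. q c * bv c r)) (e j) = of_real b * ((\<Sum>q\<in>?C. p j q * g q) + \<alpha> j)"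
        if j: "j < k - 1" for j
      proof -
        have "cinner {..<N} (\<lambda>r. y r - (\<Sum>c\<in>{k..N}. q c * bv c r)) (e j) = cinner {..<N} y (e j)"
          unfolding cinner_diff_left cinner_sum_left using eb[OF j] by simp
        also have "\<dots> = cinner {..<N} (\<lambda>r. Z (r, l)) (e j) + of_real b * (\<Sum>q\<in>?C. p j q * g q)"
          unfolding sumC by (simp add: cinner_def y_def p_def distrib_right distrib_left sum.distrib sum_distrib_left mult_ac)
        finally show ?thesis using b by (simp add: \<alpha>_def field_simps)
      qed
      have "b\<^sup>2 * (\<Sum>j\<in>{..<k - 1}. (cmod ((\<Sum>q\<in>?C. p j q * g q) + \<alpha> j))\<^sup>2)
         = (\<Sum>j\<in>{..<k - 1}. (cmod (cinner {..<N} (\<lambda>r. y r - (\<Sum>c\<in>{k..N}. q c * bv c r)) (e j)))\<^sup>2)"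
        unfolding sum_distrib_left by (intro sum.cong refl) (simp add: inner norm_mult power_mult_distrib)
      also have "\<dots> \<le> (l2n {..<N} (\<lambda>r. y r - (\<Sum>c\<in>{k..N}. q c * bv c r)))\<^sup>2"
        by (rule bessel_inequality[OF _ e(1)]) simp
      also have "\<dots> \<le> s\<^sup>2" using ys by (intro power_mono) auto
      finally show ?thesis using b by (simp add: field_simps)
    qed
    show "(\<forall>g. ?Y g \<notin> span_event J z k D0 s l) \<or>
      (\<exists>p \<alpha>. orthonormal ?C {..<k - 1} p \<and> (\<forall>g. ?Y g \<in> span_event J z k D0 s l \<longrightarrow>
        (\<Sum>j\<in>{..<k - 1}. (cmod ((\<Sum>q\<in>?C. p j q * g q) + \<alpha> j))\<^sup>2) \<le> s\<^sup>2 / b\<^sup>2))"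
      using po ps by (intro disjI2 exI[of _ p] exI[of _ \<alpha>] conjI allI impI)
  qed (use \<kappa> in auto)
  then show ?thesis by simp
qed

end


section \<open>The three causes of a small singular value and their total probability\<close>

context gauss_model
begin

text \<open>For a unit vector \<open>v\<close> there are three cases: the matrix is large; or
  \<open>J Y\<^sup>* v\<close> has norm at most \<open>\<epsilon>\<close> on \<open>G\<close>; or,
  by the pigeonhole principle, one of its entries on \<open>G\<close> has modulus at least
  \<open>\<epsilon> / sqrt n\<close>. In the last case dividing by that entry enlarges the residual
  by \<open>sqrt n / \<epsilon>\<close> at most.\<close>

lemma bad_event_cover:
  fixes \<tau> \<epsilon> t :: real
  assumes Y: "Y \<in> space YM" and J: "orthonormal {..<n} {..<n} (\<lambda>c a. J a c)" and z: "z \<noteq> 0" and \<tau>: "0 \<le> \<tau>"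
    and TI: "\<And>u. l2n {..<N} u \<le> 1 \<Longrightarrow> \<exists>u'\<in>TI. l2n {..<N} (\<lambda>i. u i - u' i) \<le> 1 / 4"
    and TL: "\<And>v. l2n {..<n} v \<le> 1 \<Longrightarrow> \<exists>v'\<in>TL. l2n {..<n} (\<lambda>i. v i - v' i) \<le> 1 / 4"
    and T: "\<And>w. l2n ({..<n} - G) w \<le> 3 * \<tau> \<Longrightarrow> \<exists>u\<in>T. l2n ({..<n} - G) (\<lambda>i. w i - u i) \<le> \<epsilon>"
    and D0: "\<And>X. open X \<Longrightarrow> X \<noteq> {} \<Longrightarrow> \<exists>d\<in>D0. d \<in> (X :: complex set)"
    and \<epsilon>: "0 < \<epsilon>" "(1 + 2 * (3 * \<tau>)) * \<epsilon> \<le> cmod z / 2" and t: "0 < t" "t \<le> \<epsilon>" and k: "k \<le> N" and n: "0 < n"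
    and v: "l2n {..<N} v \<noteq> 0" "\<And>i. i < k \<Longrightarrow> v i = 0"
    and small: "l2n {..<N} (res_vec N n J z Y v) \<le> t * l2n {..<N} v"
  shows "Y \<in> (\<Union>p\<in>TI \<times> TL. norm_event (fst p) (snd p) \<tau>) \<union>
    (\<Union>w\<in>T. net_event J z w (3 * \<tau> * (1 + 2 * (3 * \<tau>)) * \<epsilon> / cmod z + 2 * \<epsilon>)) \<union>
    (\<Union>l\<in>G. span_event J z k D0 (2 * t * sqrt (real n) / \<epsilon>) l)"
proof -
  have nv: "0 < l2n {..<N} v" using v(1) l2n_nonneg[of "{..<N}" v] by linarith
  show ?thesis
  proof (cases "Y \<in> (\<Union>p\<in>TI \<times> TL. norm_event (fst p) (snd p) \<tau>)")
    case False
    have op: "opbound {..<N} {..<n} (\<lambda>i l. Y (i, l)) (3 * \<tau>)"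
    proof (rule opbound_from_net[OF _ _ TI TL])
      fix u v assume "u \<in> TI" "v \<in> TL"
      then have "Y \<notin> norm_event u v \<tau>" using False by auto
      then show "Re (cinner {..<N} (mapply {..<n} (\<lambda>i l. Y (i, l)) v) u) \<le> \<tau>"
        using Y by (simp add: norm_event_def)
    qed auto
    show ?thesis
    proof (cases "l2n G (mid_vec N n J Y v) \<le> \<epsilon> * l2n {..<N} v")
      case True
      obtain w where "w \<in> T" "1 / 2 \<le> l2n {..<N} (approx_vec ({..<n} - G) z Y w)"
        "l2n G (\<lambda>l. adj_vec N Y (approx_vec ({..<n} - G) z Y w) l - (\<Sum>m\<in>{..<n} - G. cnj (J m l) * w m))
          \<le> 3 * \<tau> * (1 + 2 * (3 * \<tau>)) * \<epsilon> / cmod z + 2 * \<epsilon>"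
        using concentrated_imp_net_point[OF J op _ z G refl small v(1) True t(2) \<epsilon> T] \<tau> by auto
      then show ?thesis using Y by (auto simp: net_event_def)
    next
      case False
      have "\<exists>l\<in>G. \<epsilon> * l2n {..<N} v \<le> cmod (mid_vec N n J Y v l) * sqrt (real n)"
      proof (rule ccontr)
        assume "\<not> ?thesis"
        then have lt: "cmod (mid_vec N n J Y v l) * sqrt (real n) < \<epsilon> * l2n {..<N} v" if "l \<in> G" for l
          using that by (auto simp: not_le)
        have "(l2n G (mid_vec N n J Y v))\<^sup>2 * real n = (\<Sum>l\<in>G. (cmod (mid_vec N n J Y v l) * sqrt (real n))\<^sup>2)"
          by (simp add: l2n_sq sum_distrib_right power_mult_distrib)
        also have "\<dots> \<le> (\<Sum>l\<in>G. (\<epsilon> * l2n {..<N} v)\<^sup>2)"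
          using lt by (intro sum_mono power_mono) (auto intro: less_imp_le)
        also have "\<dots> \<le> real n * (\<epsilon> * l2n {..<N} v)\<^sup>2"
          using card_mono[OF finite_lessThan G] by (simp add: mult_right_mono)
        finally have "(l2n G (mid_vec N n J Y v))\<^sup>2 \<le> (\<epsilon> * l2n {..<N} v)\<^sup>2" using n by (simp add: mult.commute)
        then have "l2n G (mid_vec N n J Y v) \<le> \<epsilon> * l2n {..<N} v"
          by (rule power2_le_imp_le) (use \<epsilon> in simp)
        with False show False by simp
      qed
      then obtain l where l: "l \<in> G" "\<epsilon> * l2n {..<N} v \<le> cmod (mid_vec N n J Y v l) * sqrt (real n)" by blast
      have ln: "l < n" using l(1) G by auto
      define m where "m = mid_vec N n J Y v l"
      have m0: "0 < cmod m"
      proof -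
        have "0 < \<epsilon> * l2n {..<N} v" using \<epsilon>(1) nv by simp
        then have "0 < cmod m * sqrt (real n)" using l(2) by (simp add: m_def)
        then show ?thesis using n by (simp add: zero_less_mult_iff)
      qed
      \<comment> \<open>Coefficients of column \<open>l\<close> in the span, after division of the
        near-kernel equation by the entry \<open>m\<close>.\<close>
      define q0 where "q0 c = - (if c < N then v c else adj_vec N Y v l) / m" for c
      have yl: "Y (r, l) - (\<Sum>c\<in>{k..N}. q0 c * span_vec N n J z l Y c r) = 1 / m * res_vec N n J z Y v r"
        if r: "r < N" for r
      proof -
        have "m * Y (r, l) = res_vec N n J z Y v r
          - (\<Sum>c\<in>{k..N}. (if c < N then v c else adj_vec N Y v l) * span_vec N n J z l Y c r)"
          unfolding m_def by (rule column_in_span[OF ln k v(2) r])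
        moreover have "m * (\<Sum>c\<in>{k..N}. q0 c * span_vec N n J z l Y c r)
           = - (\<Sum>c\<in>{k..N}. (if c < N then v c else adj_vec N Y v l) * span_vec N n J z l Y c r)"
          using m0 unfolding sum_distrib_left sum_negf[symmetric]
          by (intro sum.cong) (auto simp: q0_def)
        ultimately have "m * (Y (r, l) - (\<Sum>c\<in>{k..N}. q0 c * span_vec N n J z l Y c r)) = res_vec N n J z Y v r"
          by (simp add: right_diff_distrib)
        then show ?thesis using m0 by (auto simp: field_simps)
      qed
      have "l2n {..<N} (\<lambda>r. Y (r, l) - (\<Sum>c\<in>{k..N}. q0 c * span_vec N n J z l Y c r)) = l2n {..<N} (\<lambda>r. 1 / m * res_vec N n J z Y v r)"
        by (rule l2n_cong) (simp add: yl)
      also have "\<dots> = l2n {..<N} (res_vec N n J z Y v) / cmod m"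
        by (simp only: l2n_scale norm_divide norm_one) simp
      also have "\<dots> \<le> t * l2n {..<N} v / cmod m" using small m0 by (intro divide_right_mono) auto
      also have "\<dots> \<le> t * sqrt (real n) / \<epsilon>"
      proof -
        have "t * (\<epsilon> * l2n {..<N} v) \<le> t * (cmod m * sqrt (real n))"
          using l(2) t(1) unfolding m_def by (intro mult_left_mono) auto
        then show ?thesis using m0 \<epsilon>(1) by (simp add: field_simps)
      qed
      finally have near: "l2n {..<N} (\<lambda>r. Y (r, l) - (\<Sum>c\<in>{k..N}. q0 c * span_vec N n J z l Y c r)) \<le> t * sqrt (real n) / \<epsilon>" .
      have pos: "0 < t * sqrt (real n) / \<epsilon>" using t(1) n \<epsilon>(1) by simp
      obtain q where q: "q \<in> {k..N} \<rightarrow>\<^sub>E D0"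
        "l2n {..<N} (\<lambda>r. (\<Sum>c\<in>{k..N}. q0 c * span_vec N n J z l Y c r) - (\<Sum>c\<in>{k..N}. q c * span_vec N n J z l Y c r)) < t * sqrt (real n) / \<epsilon>"
        using countable_dense_combination[OF finite_atLeastAtMost D0 pos] by blast
      \<comment> \<open>One half is for the residual, the other for passing to coefficients in
        \<open>D0\<close>. The second estimate is strict, as \<open>span_event\<close>
        requires.\<close>
      have two: "2 * t * sqrt (real n) / \<epsilon> = t * sqrt (real n) / \<epsilon> + t * sqrt (real n) / \<epsilon>" by simp
      have tri: "l2n {..<N} (\<lambda>r. Y (r, l) - (\<Sum>c\<in>{k..N}. q c * span_vec N n J z l Y c r))
        \<le> l2n {..<N} (\<lambda>r. Y (r, l) - (\<Sum>c\<in>{k..N}. q0 c * span_vec N n J z l Y c r)) +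
          l2n {..<N} (\<lambda>r. (\<Sum>c\<in>{k..N}. q0 c * span_vec N n J z l Y c r) - (\<Sum>c\<in>{k..N}. q c * span_vec N n J z l Y c r))"
        using l2n_triangle[of "{..<N}" "\<lambda>r. Y (r, l) - (\<Sum>c\<in>{k..N}. q0 c * span_vec N n J z l Y c r)"
          "\<lambda>r. (\<Sum>c\<in>{k..N}. q0 c * span_vec N n J z l Y c r) - (\<Sum>c\<in>{k..N}. q c * span_vec N n J z l Y c r)"]
        by simp
      have "l2n {..<N} (\<lambda>r. Y (r, l) - (\<Sum>c\<in>{k..N}. q c * span_vec N n J z l Y c r)) < 2 * t * sqrt (real n) / \<epsilon>"
        unfolding two using tri near q(2) by linarith
      then have "Y \<in> span_event J z k D0 (2 * t * sqrt (real n) / \<epsilon>) l"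
        using Y q(1) unfolding span_event_def by blast
      then show ?thesis using l(1) by blast
    qed
  qed blast
qed

text \<open>\<open>36\<close> is \<open>6 * (R + 2 * \<epsilon>) / \<epsilon>\<close> for
  \<open>R = 1\<close> and \<open>\<epsilon> = 1 / 4\<close>. Net points of norm above
  \<open>5 / 4\<close> are dropped, since they are farther than \<open>1 / 4\<close> from the unit
  ball.\<close>

lemma norm_net_exists:
  "\<exists>T. finite T \<and> real (card T) \<le> 36 ^ (2 * m) \<and> (\<forall>u\<in>T. l2n {..<m} u \<le> 5 / 4) \<and>
    (\<forall>v. l2n {..<m} v \<le> 1 \<longrightarrow> (\<exists>u\<in>T. l2n {..<m} (\<lambda>i. v i - u i) \<le> 1 / 4))"
proof -
  obtain T where T: "finite T" "real (card T) \<le> 36 ^ (2 * m)"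
    "\<And>v. l2n {..<m} v \<le> 1 \<Longrightarrow> \<exists>u\<in>T. l2n {..<m} (\<lambda>i. v i - u i) \<le> 1 / 4"
    using complex_net[of "{..<m}" "1 / 4" 1] by auto
  define T' where "T' = {u\<in>T. l2n {..<m} u \<le> 5 / 4}"
  have "real (card T') \<le> 36 ^ (2 * m)"
    using T(2) card_mono[OF T(1), of T'] by (simp add: T'_def)
  moreover have "\<exists>u\<in>T'. l2n {..<m} (\<lambda>i. v i - u i) \<le> 1 / 4" if v: "l2n {..<m} v \<le> 1" for v
  proof -
    obtain u where u: "u \<in> T" "l2n {..<m} (\<lambda>i. v i - u i) \<le> 1 / 4" using T(3)[OF v] by auto
    have "l2n {..<m} u \<le> 5 / 4"
      using l2n_triangle_diff[of "{..<m}" v "\<lambda>i. v i - u i"] v u(2) by simp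
    then show ?thesis using u by (auto simp: T'_def)
  qed
  ultimately show ?thesis using T(1) by (intro exI[of _ T']) (auto simp: T'_def)
qed

text \<open>A union bound over the three events of the cover. The conditions on
  \<open>\<tau>\<close>, \<open>\<epsilon>\<close> and \<open>t\<close> are what the three estimates
  require, in this order. \<open>a\<close> is the private standard deviation before the scaling by
  \<open>1 / sqrt n\<close>, and \<open>K1 / n\<close> bounds the covariance of the entries.\<close>

lemma model_bound:
  fixes K1 a \<rho> \<tau> \<epsilon> t :: real
  assumes n: "0 < n" and bdef: "b = a / sqrt (real n)" and a: "0 < a" and K1: "0 < K1"
    and D: "\<And>c. (\<Sum>m\<in>IDX. (cmod (\<Sum>j\<in>Ent. c j * A m j))\<^sup>2) \<le> K1 / real n * (\<Sum>j\<in>Ent. (cmod (c j))\<^sup>2)"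
    and \<rho>: "real N \<le> \<rho> * real n" and q: "4 * card ({..<n} - G) \<le> n" and k: "2 \<le> k" "k \<le> N"
    and J: "orthonormal {..<n} {..<n} (\<lambda>c a. J a c)" and z: "z \<noteq> 0"
    and \<tau>: "0 < \<tau>" "3 * K1 * (8 * \<rho> + 9) \<le> \<tau>\<^sup>2"
    and \<epsilon>: "0 < \<epsilon>" "\<epsilon> \<le> 1" "(1 + 2 * (3 * \<tau>)) * \<epsilon> \<le> cmod z / 2"
      "\<epsilon> * (6 * (3 * \<tau> + 2)) * exp (1 + 4 * (3 * \<tau> * (1 + 2 * (3 * \<tau>)) / cmod z + 2)\<^sup>2 / a\<^sup>2) \<le> 1"
    and t: "0 < t" "t \<le> \<epsilon>" "exp 3 * (4 * t\<^sup>2 * (real n)\<^sup>2 / (\<epsilon>\<^sup>2 * a\<^sup>2)) \<le> real (k - 1)"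
  shows "\<exists>E\<in>sets YM. (\<forall>Y\<in>space YM. (\<exists>v. l2n {..<N} v \<noteq> 0 \<and> (\<forall>i<k. v i = 0) \<and>
        l2n {..<N} (res_vec N n J z Y v) \<le> t * l2n {..<N} v) \<longrightarrow> Y \<in> E) \<and>
      emeasure (cgauss_space IDX) {h\<in>space (cgauss_space IDX). fam h \<in> E}
        \<le> ennreal (2 * exp (- real n) + real n * exp (- 2 * real (k - 1)))"
proof -
  let ?H = "{..<n} - G"
  obtain TI where TI: "finite TI" "real (card TI) \<le> 36 ^ (2 * N)" "\<And>u. u \<in> TI \<Longrightarrow> l2n {..<N} u \<le> 5 / 4"
    "\<And>v. l2n {..<N} v \<le> 1 \<Longrightarrow> \<exists>u\<in>TI. l2n {..<N} (\<lambda>i. v i - u i) \<le> 1 / 4"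
    using norm_net_exists[of N] by blast
  obtain TL where TL: "finite TL" "real (card TL) \<le> 36 ^ (2 * n)" "\<And>u. u \<in> TL \<Longrightarrow> l2n {..<n} u \<le> 5 / 4"
    "\<And>v. l2n {..<n} v \<le> 1 \<Longrightarrow> \<exists>u\<in>TL. l2n {..<n} (\<lambda>i. v i - u i) \<le> 1 / 4"
    using norm_net_exists[of n] by blast
  obtain T where T: "finite T" "real (card T) \<le> (6 * (3 * \<tau> + 2 * \<epsilon>) / \<epsilon>) ^ (2 * card ?H)"
    "\<And>w. l2n ?H w \<le> 3 * \<tau> \<Longrightarrow> \<exists>u\<in>T. l2n ?H (\<lambda>i. w i - u i) \<le> \<epsilon>"
    using complex_net[of ?H \<epsilon> "3 * \<tau>"] \<epsilon>(1) \<tau>(1) by auto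
  obtain D0 :: "complex set" where D0: "countable D0" "\<And>X. open X \<Longrightarrow> X \<noteq> {} \<Longrightarrow> \<exists>d\<in>D0. d \<in> X"
    using countable_dense_exists[where 'a = complex] by blast
  define c0 where "c0 = 3 * \<tau> * (1 + 2 * (3 * \<tau>)) / cmod z + 2"
  define \<tau>2 where "\<tau>2 = 3 * \<tau> * (1 + 2 * (3 * \<tau>)) * \<epsilon> / cmod z + 2 * \<epsilon>"
  have \<tau>2: "\<tau>2 = c0 * \<epsilon>" by (simp add: \<tau>2_def c0_def distrib_right)
  have c0: "0 \<le> c0" using \<tau>(1) by (simp add: c0_def)
  define S where "S = 2 * t * sqrt (real n) / \<epsilon>"
  define F1 where "F1 = (\<Union>p\<in>TI \<times> TL. norm_event (fst p) (snd p) \<tau>)"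
  define F2 where "F2 = (\<Union>w\<in>T. net_event J z w \<tau>2)"
  define F3 where "F3 = (\<Union>l\<in>G. span_event J z k D0 S l)"
  have Gn: "\<And>l. l \<in> G \<Longrightarrow> l < n" using G by auto
  have sets: "F1 \<in> sets YM" "F2 \<in> sets YM" "F3 \<in> sets YM"
    unfolding F1_def F2_def F3_def using TI(1) TL(1) T(1) finite_sets(1) norm_event_sets net_event_sets span_event_sets[OF D0(1) Gn]
    by (auto intro!: sets.finite_UN)
  let ?P = "\<lambda>F. emeasure (cgauss_space IDX) {h\<in>space (cgauss_space IDX). fam h \<in> F}"
  have P1: "?P F1 \<le> ennreal (exp (- real n))"
  proof -
    \<comment> \<open>Minimises the Chernoff exponent
      \<open>s\<^sup>2 * (3 * (K1 / n)) / 4 - s * \<tau>\<close>.\<close>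
    define s where "s = 2 * \<tau> * real n / (3 * K1)"
    have "?P F1 \<le> ennreal (real (card (TI \<times> TL)) * exp (s\<^sup>2 * (3 * (K1 / real n)) / 4 - s * \<tau>))"
      unfolding F1_def
    proof (rule emeasure_union_le)
      fix p assume p: "p \<in> TI \<times> TL"
      show "?P (norm_event (fst p) (snd p) \<tau>) \<le> ennreal (exp (s\<^sup>2 * (3 * (K1 / real n)) / 4 - s * \<tau>))"
        using p \<tau> K1 TI(3) TL(3) by (intro norm_event_bound[OF D]) (auto simp: s_def)
    qed (use TI TL norm_event_sets in auto)
    also have "\<dots> \<le> ennreal (exp (- real n))"
    proof (rule ennreal_leI)
      have ex: "s\<^sup>2 * (3 * (K1 / real n)) / 4 - s * \<tau> = - (\<tau>\<^sup>2 * real n / (3 * K1))"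
        using K1 n by (simp add: s_def power2_eq_square field_simps)
      \<comment> \<open>Puts the size of the nets in exponential form; \<open>(5 / 2) ^ 4\<close>
        exceeds 39.\<close>
      have "(36 :: real) \<le> exp 4"
      proof -
        have "(5 / 2 :: real) \<le> exp 1" using exp_lower_Taylor_quadratic[of "1::real"] by simp
        then have "(5 / 2 :: real) ^ 4 \<le> exp 1 ^ 4" by (intro power_mono) auto
        also have "exp 1 ^ 4 = exp (4::real)" by (simp add: exp_of_nat_mult[symmetric])
        finally show ?thesis by (simp add: power4_eq_xxxx)
      qed
      have "real (card (TI \<times> TL)) \<le> 36 ^ (2 * N) * 36 ^ (2 * n)"
        using TI(2) TL(2) by (simp add: card_cartesian_product mult_mono)
      also have "\<dots> = 36 ^ (2 * N + 2 * n)" by (simp add: power_add)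
      also have "\<dots> \<le> exp 4 ^ (2 * N + 2 * n)" using \<open>36 \<le> exp 4\<close> by (intro power_mono) auto
      also have "\<dots> = exp (8 * (real N + real n))"
        by (simp add: exp_of_nat_mult[symmetric] algebra_simps)
      also have "\<dots> \<le> exp (8 * (\<rho> * real n + real n))" using \<rho> by simp
      finally have c: "real (card (TI \<times> TL)) \<le> exp (8 * (\<rho> * real n + real n))" .
      have "real (card (TI \<times> TL)) * exp (s\<^sup>2 * (3 * (K1 / real n)) / 4 - s * \<tau>)
        \<le> exp (8 * (\<rho> * real n + real n)) * exp (- (\<tau>\<^sup>2 * real n / (3 * K1)))"
        unfolding ex using c by (intro mult_right_mono) auto
      also have "\<dots> = exp (8 * (\<rho> * real n + real n) - \<tau>\<^sup>2 / (3 * K1) * real n)"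
        by (simp add: exp_add[symmetric])
      also have "\<dots> \<le> exp (- real n)"
      proof -
        have "8 * \<rho> + 9 \<le> \<tau>\<^sup>2 / (3 * K1)" using \<tau>(2) K1 by (simp add: field_simps)
        then have "(8 * \<rho> + 9) * real n \<le> \<tau>\<^sup>2 / (3 * K1) * real n" by (rule mult_right_mono) simp
        then show ?thesis by (simp add: algebra_simps)
      qed
      finally show "real (card (TI \<times> TL)) * exp (s\<^sup>2 * (3 * (K1 / real n)) / 4 - s * \<tau>) \<le> exp (- real n)" .
    qed
    finally show ?thesis .
  qed
  have P2: "?P F2 \<le> ennreal (exp (- real n))"
  proof -
    \<comment> \<open>At this value the small ball estimate gains \<open>\<epsilon>\<^sup>2\<close>
      for every column in \<open>G\<close>. Its exponential factor remains the exponential of a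
      constant times \<open>n\<close>, because \<open>\<tau>2\<close> is proportional to
      \<open>\<epsilon>\<close>.\<close>
    define \<kappa> where "\<kappa> = 1 / \<epsilon>\<^sup>2"
    have \<kappa>0: "0 \<le> \<kappa>" by (simp add: \<kappa>_def)
    have "?P F2 \<le> ennreal (real (card T) * (exp (\<kappa> * (4 * \<tau>2\<^sup>2 / b\<^sup>2)) / (1 + \<kappa>) ^ card G))"
      unfolding F2_def using T(1) net_event_sets \<kappa>0 c0 \<epsilon>(1)
      by (intro emeasure_union_le net_event_bound) (auto simp: \<tau>2)
    also have "\<dots> \<le> ennreal (exp (- real n))"
    proof (rule ennreal_leI)
      have ex: "\<kappa> * (4 * \<tau>2\<^sup>2 / b\<^sup>2) = real n * (4 * c0\<^sup>2 / a\<^sup>2)"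
        using \<epsilon>(1) a n by (simp add: \<kappa>_def \<tau>2 bdef power_mult_distrib power_divide field_simps)
      have cG: "card G + card ?H = n"
        using card_Diff_subset[OF finite_sets(1) G] card_mono[OF finite_lessThan G] by simp
      define c2 where "c2 = 6 * (3 * \<tau> + 2)"
      have c2: "1 \<le> c2" using \<tau>(1) by (simp add: c2_def)
      have "1 / (1 + \<kappa>) \<le> 1 / \<kappa>" using \<epsilon>(1) by (intro frac_le) (auto simp: \<kappa>_def)
      then have "1 / (1 + \<kappa>) \<le> \<epsilon>\<^sup>2" by (simp add: \<kappa>_def)
      then have "(1 / (1 + \<kappa>)) ^ card G \<le> (\<epsilon>\<^sup>2) ^ card G" using \<kappa>0 by (intro power_mono) auto
      then have g: "1 / (1 + \<kappa>) ^ card G \<le> \<epsilon> ^ (2 * card G)" by (simp add: power_divide power_mult)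
      have "real (card T) \<le> (c2 / \<epsilon>) ^ (2 * card ?H)"
        using \<epsilon> \<tau>(1) by (intro order_trans[OF T(2)] power_mono divide_right_mono) (auto simp: c2_def)
      then have "real (card T) * (exp (\<kappa> * (4 * \<tau>2\<^sup>2 / b\<^sup>2)) / (1 + \<kappa>) ^ card G)
        \<le> (c2 / \<epsilon>) ^ (2 * card ?H) * (exp (real n * (4 * c0\<^sup>2 / a\<^sup>2)) * \<epsilon> ^ (2 * card G))"
        unfolding ex using g \<epsilon>(1) c2 \<kappa>0
        by (intro mult_mono) (auto simp: divide_inverse intro!: mult_left_mono)
      also have "\<dots> = c2 ^ (2 * card ?H) * \<epsilon> ^ (2 * card G - 2 * card ?H) * exp (real n * (4 * c0\<^sup>2 / a\<^sup>2))"
      proof -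
        have "\<epsilon> ^ (2 * card G) = \<epsilon> ^ (2 * card ?H) * \<epsilon> ^ (2 * card G - 2 * card ?H)"
          using cG q by (simp add: power_add[symmetric])
        then show ?thesis using \<epsilon>(1) by (simp add: power_divide)
      qed
      \<comment> \<open>From \<open>4 * card ?H \<le> n\<close> follows
        \<open>2 * card G - 2 * card ?H \<ge> n\<close>: the gain on \<open>G\<close> beats the net
        over \<open>?H\<close> by \<open>\<epsilon> ^ n\<close>.\<close>
      also have "\<dots> \<le> c2 ^ n * \<epsilon> ^ n * exp (real n * (4 * c0\<^sup>2 / a\<^sup>2))"
        using cG q c2 \<epsilon> by (intro mult_right_mono mult_mono power_increasing power_decreasing) auto
      also have "\<dots> = (\<epsilon> * c2 * exp (4 * c0\<^sup>2 / a\<^sup>2)) ^ n"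
        by (simp add: power_mult_distrib exp_of_nat_mult[symmetric] mult_ac)
      also have "\<dots> \<le> exp (- 1) ^ n"
      proof (rule power_mono)
        have "\<epsilon> * c2 * exp (4 * c0\<^sup>2 / a\<^sup>2) * exp 1 \<le> 1"
          using \<epsilon>(4) unfolding c2_def c0_def[symmetric] exp_add by (simp add: mult_ac)
        then show "\<epsilon> * c2 * exp (4 * c0\<^sup>2 / a\<^sup>2) \<le> exp (- 1)"
          by (simp add: exp_minus field_simps)
        show "0 \<le> \<epsilon> * c2 * exp (4 * c0\<^sup>2 / a\<^sup>2)" using \<epsilon>(1) c2 by simp
      qed
      also have "\<dots> = exp (- real n)" by (simp add: exp_of_nat_mult[symmetric])
      finally show "real (card T) * (exp (\<kappa> * (4 * \<tau>2\<^sup>2 / b\<^sup>2)) / (1 + \<kappa>) ^ card G) \<le> exp (- real n)" .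
    qed
    finally show ?thesis .
  qed
  have P3: "?P F3 \<le> ennreal (real n * exp (- 2 * real (k - 1)))"
  proof -
    \<comment> \<open>With \<open>\<kappa> = exp 3\<close> the denominator yields
      \<open>exp (- 3 * (k - 1))\<close>, of which the hypothesis on \<open>t\<close> gives back at
      most \<open>exp (k - 1)\<close>.\<close>
    have "?P F3 \<le> ennreal (real (card G) * (exp (exp 3 * (S\<^sup>2 / b\<^sup>2)) / (1 + exp 3) ^ (k - 1)))"
      unfolding F3_def using finite_sets(1) span_event_sets[OF D0(1) Gn] k
      by (intro emeasure_union_le span_event_bound D0) auto
    also have "\<dots> \<le> ennreal (real n * exp (- 2 * real (k - 1)))"
    proof (rule ennreal_leI, rule mult_mono)
      show "real (card G) \<le> real n" using card_mono[OF finite_lessThan G] by simp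
      have S2: "S\<^sup>2 / b\<^sup>2 = 4 * t\<^sup>2 * (real n)\<^sup>2 / (\<epsilon>\<^sup>2 * a\<^sup>2)"
        using n a \<epsilon>(1) by (simp add: S_def bdef power_mult_distrib power_divide power2_eq_square[of "real n"])
      have "exp (exp 3 * (S\<^sup>2 / b\<^sup>2)) / (1 + exp 3) ^ (k - 1) \<le> exp (real (k - 1)) / exp 3 ^ (k - 1)"
        using t(3) unfolding S2 by (intro frac_le power_mono) auto
      also have "\<dots> = exp (- 2 * real (k - 1))"
        by (simp add: exp_of_nat_mult[symmetric] exp_diff[symmetric])
      finally show "exp (exp 3 * (S\<^sup>2 / b\<^sup>2)) / (1 + exp 3) ^ (k - 1) \<le> exp (- 2 * real (k - 1))" .
    qed auto
    finally show ?thesis .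
  qed
  have m: "{h\<in>space (cgauss_space IDX). fam h \<in> F} \<in> sets (cgauss_space IDX)" if "F \<in> sets YM" for F
    using measurable_sets[OF fam_measurable that] by (simp add: vimage_def Int_def conj_commute)
  have "?P (F1 \<union> F2 \<union> F3) \<le> ?P F1 + ?P F2 + ?P F3"
  proof -
    have "{h\<in>space (cgauss_space IDX). fam h \<in> F1 \<union> F2 \<union> F3} =
      {h\<in>space (cgauss_space IDX). fam h \<in> F1} \<union> {h\<in>space (cgauss_space IDX). fam h \<in> F2} \<union> {h\<in>space (cgauss_space IDX). fam h \<in> F3}"
      by auto
    then show ?thesis
      using m[OF sets(1)] m[OF sets(2)] m[OF sets(3)]
      by (auto intro!: order_trans[OF emeasure_subadditive] add_mono emeasure_subadditive)
  qed
  also have "\<dots> \<le> ennreal (exp (- real n)) + ennreal (exp (- real n)) + ennreal (real n * exp (- 2 * real (k - 1)))"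
    by (intro add_mono P1 P2 P3)
  also have "\<dots> = ennreal (2 * exp (- real n) + real n * exp (- 2 * real (k - 1)))"
    by (simp add: ennreal_plus[symmetric] del: ennreal_plus)
  finally have bound: "?P (F1 \<union> F2 \<union> F3) \<le> ennreal (2 * exp (- real n) + real n * exp (- 2 * real (k - 1)))" .
  have cover: "Y \<in> F1 \<union> F2 \<union> F3"
    if "Y \<in> space YM" "l2n {..<N} v \<noteq> 0" "\<forall>i<k. v i = 0" "l2n {..<N} (res_vec N n J z Y v) \<le> t * l2n {..<N} v" for Y v
    unfolding F1_def F2_def F3_def \<tau>2_def S_def
    by (rule bad_event_cover[OF that(1) J z _ TI(4) TL(4) T(3) D0(2) \<epsilon>(1,3) t(1,2) k(2) n that(2) _ that(4)])
      (use \<tau>(1) that(3) in auto)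
  show ?thesis
    using cover bound sets by (intro bexI[of _ "F1 \<union> F2 \<union> F3"]) auto
qed

end


section \<open>Circularly symmetric stationary Gaussian processes\<close>

text \<open>A constant variable has no density and is treated apart. Mean zero forces it to be 0, so
  one formula, with the second moment as the variance, covers both cases.\<close>

lemma real_gaussian_centered:
  assumes "prob_space M" and W: "real_gaussian M W" and mean: "(LINT \<omega>|M. W \<omega>) = 0"
  shows "integrable M W" and "integrable M (\<lambda>\<omega>. (W \<omega>)\<^sup>2)"
    and "(CLINT \<omega>|M. iexp (W \<omega>)) = of_real (exp (- (LINT \<omega>|M. (W \<omega>)\<^sup>2) / 2))"
proof -
  interpret prob_space M by fact
  have [measurable]: "W \<in> borel_measurable M" using W by (simp add: real_gaussian_def)
  have "integrable M W \<and> integrable M (\<lambda>\<omega>. (W \<omega>)\<^sup>2) \<and>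
    (CLINT \<omega>|M. iexp (W \<omega>)) = of_real (exp (- (LINT \<omega>|M. (W \<omega>)\<^sup>2) / 2))"
  proof (cases "\<exists>\<mu>. AE \<omega> in M. W \<omega> = \<mu>")
    case True
    then obtain \<mu> where \<mu>: "AE \<omega> in M. W \<omega> = \<mu>" by blast
    have "(LINT \<omega>|M. W \<omega>) = (LINT \<omega>|M. \<mu>)" using \<mu> by (intro integral_cong_AE) auto
    then have "\<mu> = 0" using mean by (simp add: prob_space)
    with \<mu> have 0: "AE \<omega> in M. W \<omega> = 0" by simp
    have "integrable M W \<longleftrightarrow> integrable M (\<lambda>_. 0 :: real)" using 0 by (intro integrable_cong_AE) auto
    moreover have "integrable M (\<lambda>\<omega>. (W \<omega>)\<^sup>2) \<longleftrightarrow> integrable M (\<lambda>_. 0 :: real)" using 0 by (intro integrable_cong_AE) auto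
    moreover have "(LINT \<omega>|M. (W \<omega>)\<^sup>2) = (LINT \<omega>|M. 0)" using 0 by (intro integral_cong_AE) auto
    moreover have "(CLINT \<omega>|M. iexp (W \<omega>)) = (CLINT \<omega>|M. 1)" using 0 by (intro integral_cong_AE) auto
    ultimately show ?thesis by (simp add: prob_space)
  next
    case False
    then obtain \<mu> \<sigma> where s: "0 < \<sigma>" and D: "distributed M lborel W (\<lambda>t. ennreal (normal_density \<mu> \<sigma> t))"
      using W unfolding real_gaussian_def by blast
    have \<mu>: "\<mu> = 0" using normal_distributed_expectation[OF s D] mean by simp
    note D = D[unfolded \<mu>]
    have i1: "integrable M W"
      using distributed_integrable[OF D, of "\<lambda>x. x"] integrable_normal_moment[of \<sigma> 0 1] s by simp
    have i2: "integrable M (\<lambda>\<omega>. (W \<omega>)\<^sup>2)"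
      using distributed_integrable[OF D, of "\<lambda>x. x\<^sup>2"] integrable_normal_moment[of \<sigma> 0 2] s by simp
    have var: "(LINT \<omega>|M. (W \<omega>)\<^sup>2) = \<sigma>\<^sup>2"
      using normal_distributed_variance[OF s D] mean by simp
    define U where "U = (\<lambda>\<omega>. (W \<omega> - 0) / \<sigma>)"
    have DU: "distributed M lborel U std_normal_density"
      unfolding U_def using D normal_standard_normal_convert[OF s, of W 0] by simp
    have [measurable]: "U \<in> borel_measurable M" unfolding U_def by simp
    have "(CLINT \<omega>|M. iexp (W \<omega>)) = (CLINT \<omega>|M. iexp (\<sigma> * U \<omega>))"
      using s by (simp add: U_def)
    also have "\<dots> = (CLINT x|distr M lborel U. iexp (\<sigma> * x))"
      by (subst integral_distr) auto
    also have "distr M lborel U = std_normal_distribution"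
      by (rule distributed_distr_eq_density[OF DU])
    also have "(CLINT x|std_normal_distribution. iexp (\<sigma> * x)) = char std_normal_distribution \<sigma>"
      by (simp add: char_def)
    also have "\<dots> = of_real (exp (- (\<sigma>\<^sup>2) / 2))" by (simp add: char_std_normal_distribution)
    finally show ?thesis using i1 i2 var by simp
  qed
  then show "integrable M W" "integrable M (\<lambda>\<omega>. (W \<omega>)\<^sup>2)"
    "(CLINT \<omega>|M. iexp (W \<omega>)) = of_real (exp (- (LINT \<omega>|M. (W \<omega>)\<^sup>2) / 2))" by blast+
qed

locale circ_gaussian = prob_space M for M :: "'a measure" +
  fixes N :: nat and x :: "int \<Rightarrow> 'a \<Rightarrow> cvector"
  assumes gauss: "complex_gaussian_process M N x" and cent: "centered_process M N x"
    and circ: "circularly_symmetric M N x" and stat: "stationary_process M N x"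
begin

definition crd :: "int \<times> nat \<Rightarrow> 'a \<Rightarrow> complex" where
  "crd p \<omega> = x (fst p) \<omega> $ snd p"

definition lc :: "(int \<times> nat) set \<Rightarrow> (int \<times> nat \<Rightarrow> complex) \<Rightarrow> 'a \<Rightarrow> complex" where
  "lc F a \<omega> = (\<Sum>p\<in>F. a p * crd p \<omega>)"

abbreviation "idx \<equiv> UNIV \<times> {..<N} :: (int \<times> nat) set"
abbreviation "PM \<equiv> PiM idx (\<lambda>_. borel :: complex measure)"

lemma x_carrier: "\<omega> \<in> space M \<Longrightarrow> x k \<omega> \<in> carrier_vec N"
  using gauss by (simp add: complex_gaussian_process_def)

lemma crd_measurable [measurable]: "p \<in> idx \<Longrightarrow> crd p \<in> borel_measurable M"
  using gauss unfolding crd_def[abs_def] complex_gaussian_process_def by auto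

lemma lc_real_gaussian: "finite F \<Longrightarrow> F \<subseteq> idx \<Longrightarrow> real_gaussian M (\<lambda>\<omega>. Re (lc F a \<omega>))"
  using gauss unfolding complex_gaussian_process_def lc_def crd_def by (simp add: case_prod_unfold)

lemma Re_crd_real_gaussian: "p \<in> idx \<Longrightarrow> real_gaussian M (\<lambda>\<omega>. Re (a * crd p \<omega>))"
  using lc_real_gaussian[of "{p}" "\<lambda>_. a"] by (simp add: lc_def)

lemma real_gaussian_integrable:
  assumes "real_gaussian M W"
  shows "integrable M W"
proof (cases "\<exists>\<mu>. AE \<omega> in M. W \<omega> = \<mu>")
  case True
  then obtain \<mu> where \<mu>: "AE \<omega> in M. W \<omega> = \<mu>" by blast
  have "integrable M W \<longleftrightarrow> integrable M (\<lambda>_. \<mu>)"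
    using \<mu> assms by (intro integrable_cong_AE) (auto simp: real_gaussian_def)
  then show ?thesis by simp
next
  case False
  then obtain \<mu> \<sigma> where s: "0 < \<sigma>" and D: "distributed M lborel W (\<lambda>t. ennreal (normal_density \<mu> \<sigma> t))"
    using assms unfolding real_gaussian_def by blast
  show ?thesis
    using distributed_integrable[OF D, of "\<lambda>x. x"] integrable_normal_moment_nz_1[OF s, of \<mu>] by simp
qed

lemma crd_integrable: "p \<in> idx \<Longrightarrow> integrable M (crd p)"
proof -
  assume p: "p \<in> idx"
  have "integrable M (\<lambda>\<omega>. Re (crd p \<omega>))" "integrable M (\<lambda>\<omega>. Im (crd p \<omega>))"
    using real_gaussian_integrable[OF Re_crd_real_gaussian[OF p, of 1]]
      real_gaussian_integrable[OF Re_crd_real_gaussian[OF p, of "- \<i>"]] by auto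
  then have "integrable M (\<lambda>\<omega>. complex_of_real (Re (crd p \<omega>)) + \<i> * complex_of_real (Im (crd p \<omega>)))"
    by (intro Bochner_Integration.integrable_add integrable_mult_right integrable_of_real)
  then show ?thesis by (simp add: complex_eq[symmetric])
qed

lemma crd_mean: "p \<in> idx \<Longrightarrow> (CLINT \<omega>|M. crd p \<omega>) = 0"
  using cent unfolding centered_process_def crd_def by auto

lemma lc_mean: "finite F \<Longrightarrow> F \<subseteq> idx \<Longrightarrow> (LINT \<omega>|M. Re (lc F a \<omega>)) = 0"
proof -
  assume F: "finite F" "F \<subseteq> idx"
  have i: "integrable M (\<lambda>\<omega>. a p * crd p \<omega>)" if "p \<in> F" for p
    using F that by (intro integrable_mult_right crd_integrable) auto
  have "(CLINT \<omega>|M. lc F a \<omega>) = (\<Sum>p\<in>F. CLINT \<omega>|M. a p * crd p \<omega>)"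
    unfolding lc_def using i by (intro Bochner_Integration.integral_sum) auto
  also have "\<dots> = 0"
  proof (intro sum.neutral ballI)
    fix p assume "p \<in> F"
    then have "p \<in> idx" using F by auto
    then show "(CLINT \<omega>|M. a p * crd p \<omega>) = 0" by (simp add: crd_mean)
  qed
  finally have 0: "(CLINT \<omega>|M. lc F a \<omega>) = 0" .
  have "integrable M (lc F a)"
    unfolding lc_def[abs_def] using i by (intro Bochner_Integration.integrable_sum) auto
  then have "(LINT \<omega>|M. Re (lc F a \<omega>)) = Re (CLINT \<omega>|M. lc F a \<omega>)" by (rule integral_Re)
  then show ?thesis using 0 by simp
qed

lemma coordinate_map_measurable: 
  assumes "\<And>k i. i < N \<Longrightarrow> (\<lambda>\<omega>. y k \<omega> $ i) \<in> borel_measurable M"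
  shows "(\<lambda>\<omega>. \<lambda>(k, i)\<in>idx. y k \<omega> $ i) \<in> measurable M PM"
proof (rule measurable_restrict)
  fix p :: "int \<times> nat" assume "p \<in> idx"
  then show "(\<lambda>\<omega>. case p of (k, i) \<Rightarrow> y k \<omega> $ i) \<in> borel_measurable M"
    using assms by (cases p) auto
qed

lemma law_transfer:
  fixes g :: "(int \<times> nat \<Rightarrow> complex) \<Rightarrow> 'b::{banach,second_countable_topology}"
  assumes law: "process_law M N y = process_law M N x" and g: "g \<in> borel_measurable PM"
    and y: "\<And>k i. i < N \<Longrightarrow> (\<lambda>\<omega>. y k \<omega> $ i) \<in> borel_measurable M"
  shows "(LINT \<omega>|M. g (\<lambda>(k, i)\<in>idx. y k \<omega> $ i)) = (LINT \<omega>|M. g (\<lambda>(k, i)\<in>idx. x k \<omega> $ i))"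
proof -
  have x: "\<And>k i. i < N \<Longrightarrow> (\<lambda>\<omega>. x k \<omega> $ i) \<in> borel_measurable M"
    using gauss by (simp add: complex_gaussian_process_def)
  show ?thesis
    using integral_distr[OF coordinate_map_measurable[of y, OF y] g]
      integral_distr[OF coordinate_map_measurable[of x, OF x] g] law
    unfolding process_law_def by simp
qed

text \<open>A quarter turn multiplies the process by \<open>\<i>\<close> without changing its law,
  and \<open>Re (\<i> * w) = - Im w\<close>.\<close>

lemma Re_lc_rotate:
  assumes F: "finite F" "F \<subseteq> idx"
  shows "(LINT \<omega>|M. (Im (lc F a \<omega>))\<^sup>2) = (LINT \<omega>|M. (Re (lc F a \<omega>))\<^sup>2)"
proof -
  define g where "g f = (Re (\<Sum>p\<in>F. a p * f p))\<^sup>2" for f :: "int \<times> nat \<Rightarrow> complex"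
  have g: "g \<in> borel_measurable PM"
  proof -
    have [measurable]: "(\<lambda>f. \<Sum>p\<in>F. a p * f p) \<in> borel_measurable PM"
      using F(2) by (intro borel_measurable_sum borel_measurable_times measurable_component_singleton) auto
    show ?thesis unfolding g_def[abs_def] by measurable
  qed
  have x: "\<And>k i. i < N \<Longrightarrow> (\<lambda>\<omega>. x k \<omega> $ i) \<in> borel_measurable M"
    using gauss by (simp add: complex_gaussian_process_def)
  have rot: "(cis (pi / 2) \<cdot>\<^sub>v x k \<omega>) $ i = \<i> * x k \<omega> $ i" if "\<omega> \<in> space M" "i < N" for \<omega> k i
    using x_carrier[OF that(1), of k] that(2) by (simp add: cis_pi_half)
  have y: "(\<lambda>\<omega>. (cis (pi / 2) \<cdot>\<^sub>v x k \<omega>) $ i) \<in> borel_measurable M" if "i < N" for k i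
  proof -
    have "(\<lambda>\<omega>. \<i> * x k \<omega> $ i) \<in> borel_measurable M" using x[OF that] by simp
    then show ?thesis using rot that by (subst measurable_cong[where g = "\<lambda>\<omega>. \<i> * x k \<omega> $ i"]) auto
  qed
  have "process_law M N (\<lambda>k \<omega>. cis (pi / 2) \<cdot>\<^sub>v x k \<omega>) = process_law M N x"
    using circ unfolding circularly_symmetric_def by (rule spec)
  from law_transfer[OF this g y]
  have "(LINT \<omega>|M. g (\<lambda>(k, i)\<in>idx. (cis (pi / 2) \<cdot>\<^sub>v x k \<omega>) $ i)) = (LINT \<omega>|M. g (\<lambda>(k, i)\<in>idx. x k \<omega> $ i))" .
  moreover have "g (\<lambda>(k, i)\<in>idx. x k \<omega> $ i) = (Re (lc F a \<omega>))\<^sup>2" for \<omega>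
  proof -
    have "(\<Sum>p\<in>F. a p * (\<lambda>(k, i)\<in>idx. x k \<omega> $ i) p) = lc F a \<omega>"
      unfolding lc_def using F(2) by (intro sum.cong refl) (auto simp: crd_def)
    then show ?thesis by (simp add: g_def)
  qed
  moreover have "g (\<lambda>(k, i)\<in>idx. (cis (pi / 2) \<cdot>\<^sub>v x k \<omega>) $ i) = (Im (lc F a \<omega>))\<^sup>2" if "\<omega> \<in> space M" for \<omega>
  proof -
    have "(\<Sum>p\<in>F. a p * (\<lambda>(k, i)\<in>idx. (cis (pi / 2) \<cdot>\<^sub>v x k \<omega>) $ i) p) = (\<Sum>p\<in>F. \<i> * (a p * crd p \<omega>))"
      using F(2) rot[OF that] by (intro sum.cong refl) (auto simp: crd_def)
    also have "\<dots> = \<i> * lc F a \<omega>" by (simp add: lc_def sum_distrib_left)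
    finally show ?thesis by (simp add: g_def)
  qed
  ultimately show ?thesis by (simp cong: Bochner_Integration.integral_cong)
qed

lemma lc_square_integrable:
  assumes F: "finite F" "F \<subseteq> idx"
  shows "integrable M (\<lambda>\<omega>. (Re (lc F a \<omega>))\<^sup>2)" "integrable M (\<lambda>\<omega>. (Im (lc F a \<omega>))\<^sup>2)"
    "integrable M (\<lambda>\<omega>. (cmod (lc F a \<omega>))\<^sup>2)"
proof -
  have r: "integrable M (\<lambda>\<omega>. (Re (lc F b \<omega>))\<^sup>2)" for b
    by (rule real_gaussian_centered(2)[OF prob_space_axioms lc_real_gaussian[OF F] lc_mean[OF F]])
  show 1: "integrable M (\<lambda>\<omega>. (Re (lc F a \<omega>))\<^sup>2)" by (rule r)
  have "lc F (\<lambda>p. - \<i> * a p) \<omega> = - \<i> * lc F a \<omega>" for \<omega>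
    by (simp add: lc_def sum_distrib_left sum_negf mult.assoc)
  then show 2: "integrable M (\<lambda>\<omega>. (Im (lc F a \<omega>))\<^sup>2)" using r[of "\<lambda>p. - \<i> * a p"] by simp
  show "integrable M (\<lambda>\<omega>. (cmod (lc F a \<omega>))\<^sup>2)" unfolding cmod_power2 using 1 2 by simp
qed

text \<open>The real part carries half of the second absolute moment. So linear forms in the process
  have the same characteristic functions as linear forms in the standard family with equal second
  moment, and only second moments need to be matched later.\<close>

lemma lc_char:
  assumes F: "finite F" "F \<subseteq> idx"
  shows "(CLINT \<omega>|M. iexp (Re (lc F a \<omega>))) = of_real (exp (- (LINT \<omega>|M. (cmod (lc F a \<omega>))\<^sup>2) / 4))"
proof -
  have "(LINT \<omega>|M. (cmod (lc F a \<omega>))\<^sup>2) = 2 * (LINT \<omega>|M. (Re (lc F a \<omega>))\<^sup>2)"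
    unfolding cmod_power2 using lc_square_integrable[OF F, of a] Re_lc_rotate[OF F, of a] by simp
  then show ?thesis
    using real_gaussian_centered(3)[OF prob_space_axioms lc_real_gaussian[OF F] lc_mean[OF F], of a] by simp
qed

lemma crd_prod_integrable:
  assumes "p \<in> idx" "q \<in> idx"
  shows "integrable M (\<lambda>\<omega>. crd p \<omega> * cnj (crd q \<omega>))"
proof -
  have i: "integrable M (\<lambda>\<omega>. (cmod (crd r \<omega>))\<^sup>2)" if "r \<in> idx" for r
    using lc_square_integrable(3)[of "{r}" "\<lambda>_. 1"] that by (simp add: lc_def)
  have [measurable]: "crd p \<in> borel_measurable M" "crd q \<in> borel_measurable M" using assms by auto
  show ?thesis
  proof (rule Bochner_Integration.integrable_bound)
    show "integrable M (\<lambda>\<omega>. (cmod (crd p \<omega>))\<^sup>2 + (cmod (crd q \<omega>))\<^sup>2)" using i assms by simp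
    show "AE \<omega> in M. norm (crd p \<omega> * cnj (crd q \<omega>)) \<le> norm ((cmod (crd p \<omega>))\<^sup>2 + (cmod (crd q \<omega>))\<^sup>2)"
    proof (rule AE_I2)
      fix \<omega>
      have "2 * (cmod (crd p \<omega>) * cmod (crd q \<omega>)) \<le> (cmod (crd p \<omega>))\<^sup>2 + (cmod (crd q \<omega>))\<^sup>2"
        using sum_squares_bound[of "cmod (crd p \<omega>)" "cmod (crd q \<omega>)"] by simp
      moreover have "0 \<le> cmod (crd p \<omega>) * cmod (crd q \<omega>)" by simp
      ultimately have "cmod (crd p \<omega>) * cmod (crd q \<omega>) \<le> (cmod (crd p \<omega>))\<^sup>2 + (cmod (crd q \<omega>))\<^sup>2" by linarith
      then show "norm (crd p \<omega> * cnj (crd q \<omega>)) \<le> norm ((cmod (crd p \<omega>))\<^sup>2 + (cmod (crd q \<omega>))\<^sup>2)"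
        by (simp add: norm_mult)
    qed
  qed measurable
qed

lemma covariance:
  assumes ij: "i < N" "j < N"
  shows "(CLINT \<omega>|M. crd (k, i) \<omega> * cnj (crd (l, j) \<omega>)) = autocov M N x (k - l) $$ (i, j)"
proof -
  define g where "g f = f (k - l, i) * cnj (f (0, j))" for f :: "int \<times> nat \<Rightarrow> complex"
  have g: "g \<in> borel_measurable PM"
  proof -
    have [measurable]: "(\<lambda>f. f (k - l, i)) \<in> borel_measurable PM" "(\<lambda>f. f (0, j)) \<in> borel_measurable PM"
      using ij by (auto intro!: measurable_component_singleton)
    show ?thesis unfolding g_def[abs_def] by measurable
  qed
  have x: "\<And>k i. i < N \<Longrightarrow> (\<lambda>\<omega>. x k \<omega> $ i) \<in> borel_measurable M"
    using gauss by (simp add: complex_gaussian_process_def)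
  have "process_law M N (\<lambda>k. x (k + l)) = process_law M N x"
    using stat by (simp add: stationary_process_def)
  from law_transfer[OF this g] x
  have "(LINT \<omega>|M. g (\<lambda>(k, i)\<in>idx. x (k + l) \<omega> $ i)) = (LINT \<omega>|M. g (\<lambda>(k, i)\<in>idx. x k \<omega> $ i))" by blast
  then show ?thesis using ij by (simp add: g_def crd_def autocov_def)
qed

lemma lc_second_moment:
  assumes F: "finite F" "F \<subseteq> idx"
  shows "of_real (LINT \<omega>|M. (cmod (lc F a \<omega>))\<^sup>2) =
    (\<Sum>p\<in>F. \<Sum>q\<in>F. a p * cnj (a q) * autocov M N x (fst p - fst q) $$ (snd p, snd q))"
proof -
  have i: "integrable M (\<lambda>\<omega>. a p * cnj (a q) * (crd p \<omega> * cnj (crd q \<omega>)))" if "p \<in> F" "q \<in> F" for p q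
    using F that by (intro integrable_mult_right crd_prod_integrable) auto
  have "of_real (LINT \<omega>|M. (cmod (lc F a \<omega>))\<^sup>2) = (CLINT \<omega>|M. of_real ((cmod (lc F a \<omega>))\<^sup>2))"
    by (rule integral_complex_of_real[symmetric])
  also have "\<dots> = (CLINT \<omega>|M. \<Sum>p\<in>F. \<Sum>q\<in>F. a p * cnj (a q) * (crd p \<omega> * cnj (crd q \<omega>)))"
    by (intro Bochner_Integration.integral_cong refl)
      (simp only: complex_norm_square lc_def cnj_sum sum_product complex_cnj_mult mult_ac)
  also have "\<dots> = (\<Sum>p\<in>F. CLINT \<omega>|M. \<Sum>q\<in>F. a p * cnj (a q) * (crd p \<omega> * cnj (crd q \<omega>)))"
    using i by (intro Bochner_Integration.integral_sum Bochner_Integration.integrable_sum) auto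
  also have "\<dots> = (\<Sum>p\<in>F. \<Sum>q\<in>F. CLINT \<omega>|M. a p * cnj (a q) * (crd p \<omega> * cnj (crd q \<omega>)))"
    using i by (intro sum.cong refl Bochner_Integration.integral_sum) auto
  also have "\<dots> = (\<Sum>p\<in>F. \<Sum>q\<in>F. a p * cnj (a q) * autocov M N x (fst p - fst q) $$ (snd p, snd q))"
  proof (intro sum.cong refl)
    fix p q assume "p \<in> F" "q \<in> F"
    then have "snd p < N" "snd q < N" using F by auto
    from covariance[OF this, of "fst p" "fst q"]
    show "(CLINT \<omega>|M. a p * cnj (a q) * (crd p \<omega> * cnj (crd q \<omega>)))
      = a p * cnj (a q) * autocov M N x (fst p - fst q) $$ (snd p, snd q)" by simp
  qed
  finally show ?thesis .
qed

end


section \<open>Spectral representation of second moments\<close>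

text \<open>A finite measure on frequencies. The endpoints, which are one point of the circle, are
  null.\<close>

definition circle_measure :: "real measure" where
  "circle_measure = restrict_space lborel {0..2 * pi}"

lemma circle_measure_basic:
  "space circle_measure = {0..2 * pi}" "finite_measure circle_measure"
  "emeasure circle_measure (space circle_measure) = ennreal (2 * pi)"
proof -
  show sp: "space circle_measure = {0..2 * pi}" by (simp add: circle_measure_def space_restrict_space)
  show e: "emeasure circle_measure (space circle_measure) = ennreal (2 * pi)"
    unfolding sp unfolding circle_measure_def by (subst emeasure_restrict_space) auto
  show "finite_measure circle_measure" by (rule finite_measureI) (simp add: e)
qed

lemma circle_integrable:
  fixes f :: "real \<Rightarrow> 'b::{banach,second_countable_topology}"
  shows "integrable circle_measure f \<longleftrightarrow> set_integrable lborel {0..2 * pi} f"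
  unfolding circle_measure_def set_integrable_def by (rule integrable_restrict_space) simp

lemma circle_integral:
  fixes f :: "real \<Rightarrow> 'b::{banach,second_countable_topology}"
  shows "integral\<^sup>L circle_measure f = (LINT \<theta>:{0..2 * pi}|lborel. f \<theta>)"
  unfolding circle_measure_def set_lebesgue_integral_def by (rule integral_restrict_space) simp

lemma borel_measurable_circle: "f \<in> borel_measurable borel \<Longrightarrow> f \<in> borel_measurable circle_measure"
  unfolding circle_measure_def by (rule measurable_restrict_space1) simp

lemma circle_bounded_integrable:
  fixes f :: "real \<Rightarrow> 'b::{banach,second_countable_topology}"
  assumes "f \<in> borel_measurable circle_measure" "\<And>\<theta>. norm (f \<theta>) \<le> B"
  shows "integrable circle_measure f"
  using assms circle_measure_basic(2) by (intro finite_measure.integrable_const_bound[of _ _ B]) auto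

lemma cis_measurable [measurable]: "cis \<in> borel_measurable borel"
  by (intro borel_measurable_continuous_onI continuous_intros)

lemma circle_integral_cis:
  "(CLINT \<theta>|circle_measure. cis (of_int m * \<theta>)) = (if m = 0 then of_real (2 * pi) else 0)"
proof (cases "m = 0")
  case True
  have "measure circle_measure (space circle_measure) = 2 * pi"
    using circle_measure_basic(3) by (simp add: measure_def)
  then show ?thesis using True by (simp add: scaleR_conv_of_real)
next
  case False
  define F where "F = (\<lambda>\<theta>. cis (of_int m * \<theta>) / (\<i> * of_int m))"
  have "(LBINT \<theta>. indicator {0..2 * pi} \<theta> *\<^sub>R cis (of_int m * \<theta>)) = F (2 * pi) - F 0"
  proof (rule integral_FTC_atLeastAtMost)
    show "(F has_vector_derivative cis (of_int m * \<theta>)) (at \<theta> within {0..2 * pi})" for \<theta>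
    proof -
      have "((\<lambda>t. exp (\<i> * of_int m * of_real t) / (\<i> * of_int m)) has_vector_derivative
          (\<i> * of_int m) * exp (\<i> * of_int m * of_real \<theta>) / (\<i> * of_int m)) (at \<theta> within {0..2 * pi})"
        by (rule has_vector_derivative_real_field) (auto intro!: derivative_eq_intros simp: False)
      moreover have "(\<i> * of_int m) * exp (\<i> * of_int m * of_real \<theta>) / (\<i> * of_int m) = cis (of_int m * \<theta>)"
        using False by (simp add: cis_conv_exp mult.assoc)
      moreover have "(\<lambda>t. exp (\<i> * of_int m * of_real t) / (\<i> * of_int m)) = F"
        by (simp add: F_def cis_conv_exp fun_eq_iff mult.assoc)
      ultimately show ?thesis by simp
    qed
    show "continuous_on {0..2 * pi} (\<lambda>\<theta>. cis (of_int m * \<theta>))" by (intro continuous_intros)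
  qed simp
  moreover have "cis (of_int m * (2 * pi)) = 1"
    using cis_multiple_2pi[of "of_int m"] by (simp add: mult_ac)
  then have "F (2 * pi) = F 0" by (simp add: F_def)
  ultimately show ?thesis using False
    by (simp add: circle_integral set_lebesgue_integral_def)
qed

section \<open>Trigonometric polynomials and the Toeplitz matrix of a frequency set\<close>

definition trig :: "nat \<Rightarrow> (nat \<Rightarrow> complex) \<Rightarrow> real \<Rightarrow> complex" where
  "trig n w \<theta> = (\<Sum>k<n. w k * cis (- (real k * \<theta>)))"

text \<open>Fourier coefficients of the indicator of \<open>A\<close>, arranged as a Toeplitz
  matrix: the compression of multiplication by that indicator to trigonometric polynomials of length
  \<open>n\<close>.\<close>

definition toep :: "real set \<Rightarrow> nat \<Rightarrow> nat \<Rightarrow> complex" where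
  "toep A k l = 1 / (2 * pi) * (CLINT \<theta>|circle_measure. of_real (indicator A \<theta>) * cis (- ((real k - real l) * \<theta>)))"

lemma trig_measurable [measurable]: "trig n w \<in> borel_measurable borel"
  unfolding trig_def[abs_def] by measurable

lemma trig_bound: "cmod (trig n w \<theta>) \<le> (\<Sum>k<n. cmod (w k))"
  unfolding trig_def by (rule order_trans[OF norm_sum]) (simp add: norm_mult)

lemma trig_sq_integrable:
  assumes "A \<in> sets borel"
  shows "integrable circle_measure (\<lambda>\<theta>. indicator A \<theta> * (cmod (trig n w \<theta>))\<^sup>2)"
proof (rule circle_bounded_integrable)
  show "(\<lambda>\<theta>. indicator A \<theta> * (cmod (trig n w \<theta>))\<^sup>2) \<in> borel_measurable circle_measure"
  proof (rule borel_measurable_circle)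
    note [measurable] = assms
    show "(\<lambda>\<theta>. indicator A \<theta> * (cmod (trig n w \<theta>))\<^sup>2) \<in> borel_measurable borel" by measurable
  qed
  show "norm (indicator A \<theta> * (cmod (trig n w \<theta>))\<^sup>2) \<le> (\<Sum>k<n. cmod (w k))\<^sup>2" for \<theta>
    using power_mono[OF trig_bound[of n w \<theta>], of 2] by (auto simp: indicator_def intro: order_trans[OF _ zero_le_power2])
qed

text \<open>Expanding the squared modulus of the polynomial gives the Toeplitz form. The indices of
  \<open>toep\<close> are transposed because \<open>trig\<close> has negative frequencies.\<close>

lemma toep_quadratic:
  assumes A [measurable]: "A \<in> sets borel"
  shows "cinner {..<n} (mapply {..<n} (\<lambda>k l. toep A l k) w) w =
    of_real (1 / (2 * pi) * (LINT \<theta>|circle_measure. indicator A \<theta> * (cmod (trig n w \<theta>))\<^sup>2))"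
proof -
  define f where "f l k \<theta> = complex_of_real (indicator A \<theta>) * cis (- ((real l - real k) * \<theta>))" for l k \<theta>
  have fi: "integrable circle_measure (\<lambda>\<theta>. w l * cnj (w k) * f l k \<theta>)" for l k
  proof (intro integrable_mult_right circle_bounded_integrable[where B = 1])
    show "f l k \<in> borel_measurable circle_measure"
      unfolding f_def[abs_def] by (intro borel_measurable_circle) measurable
    show "norm (f l k \<theta>) \<le> 1" for \<theta> by (simp add: f_def norm_mult indicator_def)
  qed
  have "cinner {..<n} (mapply {..<n} (\<lambda>k l. toep A l k) w) w
     = (\<Sum>k<n. \<Sum>l<n. 1 / (2 * pi) * (w l * cnj (w k) * (CLINT \<theta>|circle_measure. f l k \<theta>)))"
    by (simp add: cinner_def mapply_def toep_def f_def sum_distrib_right sum_distrib_left mult_ac)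
  also have "\<dots> = 1 / (2 * pi) * (\<Sum>k<n. \<Sum>l<n. CLINT \<theta>|circle_measure. w l * cnj (w k) * f l k \<theta>)"
    by (simp add: sum_distrib_left)
  also have "(\<Sum>k<n. \<Sum>l<n. CLINT \<theta>|circle_measure. w l * cnj (w k) * f l k \<theta>)
     = (CLINT \<theta>|circle_measure. \<Sum>k<n. \<Sum>l<n. w l * cnj (w k) * f l k \<theta>)"
    by (rule has_bochner_integral_integral_eq[symmetric])
      (intro has_bochner_integral_sum has_bochner_integral_integrable fi)
  also have "\<dots> = (CLINT \<theta>|circle_measure. of_real (indicator A \<theta> * (cmod (trig n w \<theta>))\<^sup>2))"
  proof (intro Bochner_Integration.integral_cong refl)
    fix \<theta>
    have f: "f l k \<theta> = of_real (indicator A \<theta>) * (cis (- (real l * \<theta>)) * cnj (cis (- (real k * \<theta>))))" for l k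
      by (simp add: f_def cis_cnj cis_mult algebra_simps)
    have "(\<Sum>k<n. \<Sum>l<n. w l * cnj (w k) * f l k \<theta>)
       = of_real (indicator A \<theta>) * (\<Sum>k<n. \<Sum>l<n. (w l * cis (- (real l * \<theta>))) * cnj (w k * cis (- (real k * \<theta>))))"
      unfolding f by (simp add: sum_distrib_left mult_ac)
    also have "(\<Sum>k<n. \<Sum>l<n. (w l * cis (- (real l * \<theta>))) * cnj (w k * cis (- (real k * \<theta>)))) = trig n w \<theta> * cnj (trig n w \<theta>)"
      unfolding trig_def cnj_sum sum_product by (rule sum.swap)
    also have "\<dots> = of_real ((cmod (trig n w \<theta>))\<^sup>2)" by (rule complex_norm_square[symmetric])
    finally show "(\<Sum>k<n. \<Sum>l<n. w l * cnj (w k) * f l k \<theta>) = of_real (indicator A \<theta> * (cmod (trig n w \<theta>))\<^sup>2)"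
      by simp
  qed
  also have "\<dots> = of_real (LINT \<theta>|circle_measure. indicator A \<theta> * (cmod (trig n w \<theta>))\<^sup>2)"
    by (rule integral_complex_of_real)
  finally show ?thesis by simp
qed

lemma toep_UNIV: "toep UNIV k l = (if k = l then 1 else 0)"
proof -
  have "cis (- ((real k - real l) * \<theta>)) = cis (of_int (int l - int k) * \<theta>)" for \<theta>
    by (simp add: algebra_simps)
  then show ?thesis
    unfolding toep_def using circle_integral_cis[of "int l - int k"] by simp
qed

text \<open>The case \<open>A = UNIV\<close>, in which the Toeplitz matrix is the identity.\<close>

lemma trig_parseval:
  "1 / (2 * pi) * (LINT \<theta>|circle_measure. (cmod (trig n w \<theta>))\<^sup>2) = (l2n {..<n} w)\<^sup>2"
proof -
  have "complex_of_real (1 / (2 * pi) * (LINT \<theta>|circle_measure. indicator UNIV \<theta> * (cmod (trig n w \<theta>))\<^sup>2))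
     = cinner {..<n} (mapply {..<n} (\<lambda>k l. toep UNIV l k) w) w"
    by (rule toep_quadratic[symmetric]) simp
  also have "\<dots> = cinner {..<n} w w"
    by (rule cinner_cong) (auto simp: mapply_def toep_UNIV if_distrib[of "\<lambda>x. x * _"] cong: if_cong)
  also have "\<dots> = of_real ((l2n {..<n} w)\<^sup>2)" by (rule cinner_self)
  finally show ?thesis by (simp only: of_real_eq_iff) simp
qed

text \<open>\<open>1 / (4 pi)\<close> bounds the average of \<open>1 - lam\<close>, hence at most \<open>n / (2 pi) \<le> n / 4\<close> eigenvalues are below \<open>1 / 2\<close>.\<close>
lemma toep_large_eigenvalues:
  assumes A [measurable]: "A \<in> sets borel" and big: "2 * pi - 1 / 2 \<le> measure circle_measure (A \<inter> {0..2 * pi})"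
  shows "\<exists>V G. orthonormal {..<n} {..<n} V \<and> G \<subseteq> {..<n} \<and> 4 * card ({..<n} - G) \<le> n \<and>
    (\<forall>w. 1 / 2 * (\<Sum>a\<in>G. (cmod (cinner {..<n} w (V a)))\<^sup>2)
      \<le> 1 / (2 * pi) * (LINT \<theta>|circle_measure. indicator A \<theta> * (cmod (trig n w \<theta>))\<^sup>2))"
proof -
  let ?h = "\<lambda>k l. toep A l k"
  let ?q = "\<lambda>w. 1 / (2 * pi) * (LINT \<theta>|circle_measure. indicator A \<theta> * (cmod (trig n w \<theta>))\<^sup>2)"
  have herm: "?h k l = cnj (?h l k)" for k l
  proof -
    have e: "cnj (complex_of_real (indicator A \<theta>) * cis (- ((real k - real l) * \<theta>)))
       = of_real (indicator A \<theta>) * cis (- ((real l - real k) * \<theta>))" for \<theta>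
      by (simp add: cis_cnj algebra_simps)
    have "(CLINT \<theta>|circle_measure. of_real (indicator A \<theta>) * cis (- ((real l - real k) * \<theta>)))
      = cnj (CLINT \<theta>|circle_measure. of_real (indicator A \<theta>) * cis (- ((real k - real l) * \<theta>)))"
      unfolding Bochner_Integration.integral_cnj[symmetric] e ..
    then show ?thesis by (simp add: toep_def)
  qed
  obtain V and lam :: "nat \<Rightarrow> real" where V: "orthonormal {..<n} {..<n} V"
    and ev: "\<forall>k<n. \<forall>i\<in>{..<n}. mapply {..<n} ?h (V k) i = of_real (lam k) * V k i"
    using hermitian_spectral[of "{..<n}" ?h, OF finite_lessThan herm] unfolding card_lessThan by blast
  have quad: "?q w = (\<Sum>k<n. lam k * (cmod (cinner {..<n} w (V k)))\<^sup>2)" for w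
  proof -
    have "complex_of_real (?q w) = of_real (\<Sum>k<n. lam k * (cmod (cinner {..<n} w (V k)))\<^sup>2)"
      unfolding toep_quadratic[OF A, symmetric]
      using spectral_quadratic[of "{..<n}" V ?h lam w, OF finite_lessThan, unfolded card_lessThan, OF V ev] .
    then show ?thesis by (simp only: of_real_eq_iff)
  qed
  have lamq: "lam a = ?q (V a)" if a: "a < n" for a
  proof -
    have "(\<Sum>k<n. lam k * (cmod (cinner {..<n} (V a) (V k)))\<^sup>2) = (\<Sum>k<n. if k = a then lam k else 0)"
      using V a by (intro sum.cong) (auto simp: orthonormal_def)
    then show ?thesis unfolding quad using a by simp
  qed
  have lam0: "0 \<le> lam a" if "a < n" for a
    unfolding lamq[OF that] by (intro mult_nonneg_nonneg integral_nonneg_AE) auto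
  have lam1: "lam a \<le> 1" if a: "a < n" for a
  proof -
    have "?q (V a) \<le> 1 / (2 * pi) * (LINT \<theta>|circle_measure. (cmod (trig n (V a) \<theta>))\<^sup>2)"
      using trig_sq_integrable[OF A, of n "V a"] trig_sq_integrable[of UNIV n "V a"]
      by (intro mult_left_mono integral_mono) (auto simp: indicator_def)
    also have "\<dots> = (l2n {..<n} (V a))\<^sup>2" by (rule trig_parseval)
    also have "\<dots> = 1"
    proof -
      have "complex_of_real ((l2n {..<n} (V a))\<^sup>2) = 1"
        unfolding cinner_self[symmetric] using V a by (simp add: orthonormal_def)
      then show ?thesis by (simp only: of_real_eq_1_iff)
    qed
    finally show ?thesis using lamq[OF a] by simp
  qed
  \<comment> \<open>Every diagonal entry is the normalised measure of \<open>A\<close>, so the trace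
    gives the average of the eigenvalues. As none exceeds 1, an average close to 1 leaves few below
    \<open>1 / 2\<close>.\<close>
  have trace: "real n * (measure circle_measure (A \<inter> {0..2 * pi}) / (2 * pi)) = (\<Sum>a<n. lam a)"
  proof -
    have diag: "toep A k k = of_real (measure circle_measure (A \<inter> {0..2 * pi}) / (2 * pi))" for k
    proof -
      have As: "A \<inter> {0..2 * pi} \<in> sets circle_measure"
        unfolding circle_measure_def by (subst sets_restrict_space_iff) auto
      have "(CLINT \<theta>|circle_measure. complex_of_real (indicator A \<theta>)) = of_real (LINT \<theta>|circle_measure. indicator A \<theta>)"
        by (rule integral_complex_of_real)
      also have "(LINT \<theta>|circle_measure. indicator A \<theta>) = (LINT \<theta>|circle_measure. indicator (A \<inter> {0..2 * pi}) \<theta> :: real)"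
        by (intro Bochner_Integration.integral_cong) (auto simp: circle_measure_basic(1) indicator_def)
      also have "\<dots> = measure circle_measure (A \<inter> {0..2 * pi})"
        using As by (simp add: circle_measure_basic(1) Int_absorb2)
      finally show ?thesis by (simp add: toep_def)
    qed
    have "complex_of_real (real n * (measure circle_measure (A \<inter> {0..2 * pi}) / (2 * pi))) = (\<Sum>k<n. ?h k k)"
      by (simp add: diag)
    also have "\<dots> = (\<Sum>k<n. \<Sum>a<n. of_real (lam a) * V a k * cnj (V a k))"
    proof (intro sum.cong refl)
      fix k assume "k \<in> {..<n}"
      then show "?h k k = (\<Sum>a<n. of_real (lam a) * V a k * cnj (V a k))"
        using spectral_expansion[of "{..<n}" V ?h lam k k, OF finite_lessThan, unfolded card_lessThan, OF V ev] by simp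
    qed
    also have "\<dots> = (\<Sum>a<n. of_real (lam a) * cinner {..<n} (V a) (V a))"
      unfolding cinner_def by (subst sum.swap) (simp add: sum_distrib_left mult.assoc)
    also have "\<dots> = of_real (\<Sum>a<n. lam a)" using V by (simp add: orthonormal_def)
    finally show ?thesis by (simp only: of_real_eq_iff)
  qed
  define G where "G = {a. a < n \<and> 1 / 2 \<le> lam a}"
  have "real (card ({..<n} - G)) * (1 / 2) = (\<Sum>a\<in>{..<n} - G. 1 / 2)" by simp
  also have "\<dots> \<le> (\<Sum>a\<in>{..<n} - G. 1 - lam a)" by (intro sum_mono) (auto simp: G_def)
  also have "\<dots> \<le> (\<Sum>a<n. 1 - lam a)" using lam1 by (intro sum_mono2) auto
  also have "\<dots> = real n - real n * (measure circle_measure (A \<inter> {0..2 * pi}) / (2 * pi))"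
    unfolding trace by (simp add: sum_subtractf)
  also have "\<dots> \<le> real n - real n * ((2 * pi - 1 / 2) / (2 * pi))"
    using big by (intro diff_left_mono mult_left_mono divide_right_mono) auto
  also have "\<dots> = real n / (4 * pi)" by (simp add: field_simps)
  also have "\<dots> \<le> real n / 8" using pi_gt3 by (intro divide_left_mono) auto
  finally have "4 * card ({..<n} - G) \<le> n" by linarith
  moreover have "1 / 2 * (\<Sum>a\<in>G. (cmod (cinner {..<n} w (V a)))\<^sup>2) \<le> ?q w" for w
  proof -
    have "1 / 2 * (\<Sum>a\<in>G. (cmod (cinner {..<n} w (V a)))\<^sup>2) \<le> (\<Sum>a\<in>G. lam a * (cmod (cinner {..<n} w (V a)))\<^sup>2)"
      unfolding sum_distrib_left by (intro sum_mono mult_right_mono) (auto simp: G_def)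
    also have "\<dots> \<le> (\<Sum>a<n. lam a * (cmod (cinner {..<n} w (V a)))\<^sup>2)"
      using lam0 by (intro sum_mono2) (auto simp: G_def)
    finally show ?thesis unfolding quad .
  qed
  ultimately show ?thesis using V by (intro exI[of _ V] exI[of _ G]) (auto simp: G_def)
qed

section \<open>Second moments through the spectral density\<close>

context circ_gaussian
begin

definition lin :: "nat \<Rightarrow> (nat \<Rightarrow> nat \<Rightarrow> complex) \<Rightarrow> 'a \<Rightarrow> complex" where
  "lin n c \<omega> = (\<Sum>k<n. \<Sum>i<N. c i k * x (int k) \<omega> $ i)"

lemma lin_eq_lc: "lin n c = lc (int ` {..<n} \<times> {..<N}) (\<lambda>p. c (snd p) (nat (fst p)))"
proof
  fix \<omega>
  have "lc (int ` {..<n} \<times> {..<N}) (\<lambda>p. c (snd p) (nat (fst p))) \<omega>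
     = (\<Sum>k\<in>int ` {..<n}. \<Sum>i<N. c i (nat k) * x k \<omega> $ i)"
    unfolding lc_def crd_def by (subst sum.cartesian_product) (simp add: case_prod_unfold)
  then show "lin n c \<omega> = lc (int ` {..<n} \<times> {..<N}) (\<lambda>p. c (snd p) (nat (fst p))) \<omega>"
    by (simp add: lin_def sum.reindex)
qed

definition mom :: "nat \<Rightarrow> (nat \<Rightarrow> nat \<Rightarrow> complex) \<Rightarrow> real" where
  "mom n c = (LINT \<omega>|M. (cmod (lin n c \<omega>))\<^sup>2)"

lemma lin_char: "(CLINT \<omega>|M. iexp (Re (lin n c \<omega>))) = of_real (exp (- mom n c / 4))"
  unfolding mom_def lin_eq_lc by (rule lc_char) auto

lemma mom_sum: "of_real (mom n c) = (\<Sum>k<n. \<Sum>i<N. \<Sum>l<n. \<Sum>j<N.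
    c i k * cnj (c j l) * autocov M N x (int k - int l) $$ (i, j))"
proof -
  let ?F = "int ` {..<n} \<times> {..<N}"
  have conv: "(\<Sum>p\<in>?F. f p) = (\<Sum>k<n. \<Sum>i<N. f (int k, i))" for f :: "int \<times> nat \<Rightarrow> complex"
  proof -
    have "(\<Sum>p\<in>?F. f p) = (\<Sum>k\<in>int ` {..<n}. \<Sum>i<N. f (k, i))"
      by (subst sum.cartesian_product) (simp add: case_prod_unfold)
    then show ?thesis by (simp add: sum.reindex)
  qed
  have "of_real (mom n c) = (\<Sum>p\<in>?F. \<Sum>q\<in>?F. c (snd p) (nat (fst p)) * cnj (c (snd q) (nat (fst q)))
     * autocov M N x (fst p - fst q) $$ (snd p, snd q))"
    unfolding mom_def lin_eq_lc by (rule lc_second_moment) auto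
  then show ?thesis unfolding conv by simp
qed

end

text \<open>\<open>A\<close> consists of frequencies at which the density is at least
  \<open>\<delta>\<close> as a quadratic form. A measure of at least \<open>2 * pi - 1 / 2\<close>
  is what the eigenvalue count for the Toeplitz matrix asks for.\<close>

locale spectral_gaussian = circ_gaussian +
  fixes S :: "complex \<Rightarrow> cmatrix" and KS \<delta> :: real and A :: "real set"
  assumes dens: "spectral_density N (autocov M N x) S"
    and upper: "\<And>\<theta> v. Re (cinner {..<N} (mapply {..<N} (\<lambda>i j. S (cis \<theta>) $$ (i, j)) v) v) \<le> KS * (l2n {..<N} v)\<^sup>2"
    and psd: "\<And>\<theta> v. 0 \<le> Re (cinner {..<N} (mapply {..<N} (\<lambda>i j. S (cis \<theta>) $$ (i, j)) v) v)"
    and A: "A \<in> sets borel" "2 * pi - 1 / 2 \<le> measure circle_measure (A \<inter> {0..2 * pi})"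
    and lower: "\<And>\<theta> v. \<theta> \<in> A \<Longrightarrow> \<delta> * (l2n {..<N} v)\<^sup>2 \<le> Re (cinner {..<N} (mapply {..<N} (\<lambda>i j. S (cis \<theta>) $$ (i, j)) v) v)"
    and \<delta>: "0 < \<delta>" and KS: "0 < KS"
begin

text \<open>The second moment of a linear form pairs \<open>c i k\<close> with
  \<open>cnj (c j l)\<close>, so the density acts on the conjugate of the vector of
  polynomials.\<close>

definition tvec :: "nat \<Rightarrow> (nat \<Rightarrow> nat \<Rightarrow> complex) \<Rightarrow> real \<Rightarrow> nat \<Rightarrow> complex" where
  "tvec n c \<theta> i = cnj (trig n (c i) \<theta>)"

definition qS :: "nat \<Rightarrow> (nat \<Rightarrow> nat \<Rightarrow> complex) \<Rightarrow> real \<Rightarrow> complex" where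
  "qS n c \<theta> = cinner {..<N} (mapply {..<N} (\<lambda>i j. S (cis \<theta>) $$ (i, j)) (tvec n c \<theta>)) (tvec n c \<theta>)"

text \<open>Inserting the spectral representation of the autocovariances makes the second moment an
  average over frequencies of the quadratic form of the density.\<close>

lemma mom_integral:
  "integrable circle_measure (qS n c)" "of_real (mom n c) = 1 / (2 * pi) * (CLINT \<theta>|circle_measure. qS n c \<theta>)"
proof -
  define f where "f k i l j \<theta> = cis (- real_of_int (int k - int l) * \<theta>) * S (cis \<theta>) $$ (i, j)" for k i l j \<theta>
  have fi: "integrable circle_measure (f k i l j)" if "i < N" "j < N" for k i l j
  proof -
    have Si: "integrable circle_measure (\<lambda>\<theta>. S (cis \<theta>) $$ (i, j))"
      using dens that unfolding spectral_density_def circle_integrable by auto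
    then have [measurable]: "(\<lambda>\<theta>. S (cis \<theta>) $$ (i, j)) \<in> borel_measurable circle_measure" by auto
    have [measurable]: "(\<lambda>\<theta>. cis (- real_of_int (int k - int l) * \<theta>)) \<in> borel_measurable circle_measure"
      by (intro borel_measurable_circle) measurable
    have m: "(\<lambda>\<theta>. cis (- real_of_int (int k - int l) * \<theta>) * S (cis \<theta>) $$ (i, j)) \<in> borel_measurable circle_measure"
      by (rule borel_measurable_times) measurable
    show ?thesis unfolding f_def[abs_def]
      by (rule Bochner_Integration.integrable_bound[OF Si m]) (simp add: norm_mult)
  qed
  have R: "autocov M N x (int k - int l) $$ (i, j) = 1 / (2 * pi) * (CLINT \<theta>|circle_measure. f k i l j \<theta>)" if "i < N" "j < N" for k i l j
    using dens that unfolding spectral_density_def f_def circle_integral by blast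
  have q: "qS n c \<theta> = (\<Sum>k<n. \<Sum>i<N. \<Sum>l<n. \<Sum>j<N. c i k * cnj (c j l) * f k i l j \<theta>)" for \<theta>
  proof -
    have f: "f k i l j \<theta> = cis (- (real k * \<theta>)) * cnj (cis (- (real l * \<theta>))) * S (cis \<theta>) $$ (i, j)" for k i l j
      by (simp add: f_def cis_cnj cis_mult algebra_simps)
    have "qS n c \<theta> = (\<Sum>i<N. \<Sum>j<N. S (cis \<theta>) $$ (i, j) * cnj (trig n (c j) \<theta>) * trig n (c i) \<theta>)"
      by (simp add: qS_def cinner_def mapply_def tvec_def sum_distrib_right)
    also have "\<dots> = (\<Sum>i<N. \<Sum>j<N. \<Sum>k<n. \<Sum>l<n. c i k * cnj (c j l) * f k i l j \<theta>)"
    proof (intro sum.cong refl)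
      fix i j
      have t: "trig n (c i) \<theta> * cnj (trig n (c j) \<theta>)
        = (\<Sum>k<n. \<Sum>l<n. (c i k * cis (- (real k * \<theta>))) * cnj (c j l * cis (- (real l * \<theta>))))"
        unfolding trig_def cnj_sum by (rule sum_product)
      have "S (cis \<theta>) $$ (i, j) * cnj (trig n (c j) \<theta>) * trig n (c i) \<theta>
        = S (cis \<theta>) $$ (i, j) * (trig n (c i) \<theta> * cnj (trig n (c j) \<theta>))" by simp
      also have "\<dots> = (\<Sum>k<n. \<Sum>l<n. S (cis \<theta>) $$ (i, j) * ((c i k * cis (- (real k * \<theta>))) * cnj (c j l * cis (- (real l * \<theta>)))))"
        unfolding t by (simp only: sum_distrib_left)
      finally have "S (cis \<theta>) $$ (i, j) * cnj (trig n (c j) \<theta>) * trig n (c i) \<theta>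
        = (\<Sum>k<n. \<Sum>l<n. S (cis \<theta>) $$ (i, j) * ((c i k * cis (- (real k * \<theta>))) * cnj (c j l * cis (- (real l * \<theta>)))))" .
      then show "S (cis \<theta>) $$ (i, j) * cnj (trig n (c j) \<theta>) * trig n (c i) \<theta> = (\<Sum>k<n. \<Sum>l<n. c i k * cnj (c j l) * f k i l j \<theta>)"
        unfolding f by (simp add: mult_ac)
    qed
    also have "\<dots> = (\<Sum>i<N. \<Sum>k<n. \<Sum>j<N. \<Sum>l<n. c i k * cnj (c j l) * f k i l j \<theta>)"
      by (rule sum.cong[OF refl], rule sum.swap)
    also have "\<dots> = (\<Sum>k<n. \<Sum>i<N. \<Sum>j<N. \<Sum>l<n. c i k * cnj (c j l) * f k i l j \<theta>)"
      by (rule sum.swap)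
    also have "\<dots> = (\<Sum>k<n. \<Sum>i<N. \<Sum>l<n. \<Sum>j<N. c i k * cnj (c j l) * f k i l j \<theta>)"
      by (rule sum.cong[OF refl], rule sum.cong[OF refl], rule sum.swap)
    finally show ?thesis .
  qed
  have hb: "has_bochner_integral circle_measure (qS n c)
    (\<Sum>k<n. \<Sum>i<N. \<Sum>l<n. \<Sum>j<N. c i k * cnj (c j l) * (CLINT \<theta>|circle_measure. f k i l j \<theta>))"
    unfolding q[abs_def]
    by (intro has_bochner_integral_sum has_bochner_integral_mult_right has_bochner_integral_integrable fi) auto
  then show "integrable circle_measure (qS n c)" by (rule integrable.intros)
  have "of_real (mom n c) = (\<Sum>k<n. \<Sum>i<N. \<Sum>l<n. \<Sum>j<N. 1 / (2 * pi) * (c i k * cnj (c j l) * (CLINT \<theta>|circle_measure. f k i l j \<theta>)))"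
    unfolding mom_sum by (intro sum.cong refl) (simp add: R)
  also have "\<dots> = 1 / (2 * pi) * (CLINT \<theta>|circle_measure. qS n c \<theta>)"
    unfolding has_bochner_integral_integral_eq[OF hb] by (simp add: sum_distrib_left)
  finally show "of_real (mom n c) = 1 / (2 * pi) * (CLINT \<theta>|circle_measure. qS n c \<theta>)" .
qed

lemma mom_real_integral: "mom n c = 1 / (2 * pi) * (LINT \<theta>|circle_measure. Re (qS n c \<theta>))"
proof -
  have "mom n c = Re (1 / (2 * pi) * (CLINT \<theta>|circle_measure. qS n c \<theta>))"
    unfolding mom_integral(2)[symmetric] by simp
  also have "\<dots> = 1 / (2 * pi) * Re (CLINT \<theta>|circle_measure. qS n c \<theta>)"
  proof -
    have c: "1 / (2 * complex_of_real pi) = of_real (1 / (2 * pi))" by simp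
    show ?thesis unfolding c by (simp only: times_complex.sel Re_complex_of_real Im_complex_of_real mult_zero_left diff_zero)
  qed
  finally show ?thesis by (simp only: integral_Re[OF mom_integral(1)])
qed

lemma tvec_norm: "(l2n {..<N} (tvec n c \<theta>))\<^sup>2 = (\<Sum>i<N. (cmod (trig n (c i) \<theta>))\<^sup>2)"
  by (simp add: l2n_sq tvec_def)

lemma mom_upper: "mom n c \<le> KS * (\<Sum>i<N. (l2n {..<n} (c i))\<^sup>2)"
proof -
  have i: "integrable circle_measure (\<lambda>\<theta>. (cmod (trig n (c i) \<theta>))\<^sup>2)" for i
    using trig_sq_integrable[of UNIV n "c i"] by simp
  have "mom n c \<le> 1 / (2 * pi) * (LINT \<theta>|circle_measure. KS * (\<Sum>i<N. (cmod (trig n (c i) \<theta>))\<^sup>2))"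
    unfolding mom_real_integral
  proof (intro mult_left_mono integral_mono)
    show "integrable circle_measure (\<lambda>\<theta>. Re (qS n c \<theta>))" by (intro integrable_Re mom_integral(1))
    show "integrable circle_measure (\<lambda>\<theta>. KS * (\<Sum>i<N. (cmod (trig n (c i) \<theta>))\<^sup>2))"
      by (intro integrable_mult_right Bochner_Integration.integrable_sum i)
    show "Re (qS n c \<theta>) \<le> KS * (\<Sum>i<N. (cmod (trig n (c i) \<theta>))\<^sup>2)" for \<theta>
      unfolding tvec_norm[symmetric] qS_def by (rule upper)
  qed simp
  also have "\<dots> = KS * (\<Sum>i<N. 1 / (2 * pi) * (LINT \<theta>|circle_measure. (cmod (trig n (c i) \<theta>))\<^sup>2))"
    using i by (subst integral_mult_right_zero, subst Bochner_Integration.integral_sum) (auto simp: sum_distrib_left)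
  finally show ?thesis unfolding trig_parseval .
qed

text \<open>On \<open>A\<close> the density is at least \<open>\<delta>\<close>, and elsewhere it is
  nonnegative. What remains is \<open>\<delta>\<close> times the Toeplitz forms of the coefficient
  rows.\<close>

lemma mom_lower:
  "\<delta> * (\<Sum>i<N. 1 / (2 * pi) * (LINT \<theta>|circle_measure. indicator A \<theta> * (cmod (trig n (c i) \<theta>))\<^sup>2)) \<le> mom n c"
proof -
  have i: "integrable circle_measure (\<lambda>\<theta>. indicator A \<theta> * (cmod (trig n (c i) \<theta>))\<^sup>2)" for i
    by (rule trig_sq_integrable[OF A(1)])
  have "\<delta> * (\<Sum>i<N. 1 / (2 * pi) * (LINT \<theta>|circle_measure. indicator A \<theta> * (cmod (trig n (c i) \<theta>))\<^sup>2))
    = 1 / (2 * pi) * (LINT \<theta>|circle_measure. \<delta> * (\<Sum>i<N. indicator A \<theta> * (cmod (trig n (c i) \<theta>))\<^sup>2))"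
    using i by (subst integral_mult_right_zero, subst Bochner_Integration.integral_sum) (auto simp: sum_distrib_left)
  also have "\<dots> \<le> mom n c"
    unfolding mom_real_integral
  proof (intro mult_left_mono integral_mono)
    show "integrable circle_measure (\<lambda>\<theta>. Re (qS n c \<theta>))" by (intro integrable_Re mom_integral(1))
    show "integrable circle_measure (\<lambda>\<theta>. \<delta> * (\<Sum>i<N. indicator A \<theta> * (cmod (trig n (c i) \<theta>))\<^sup>2))"
      by (intro integrable_mult_right Bochner_Integration.integrable_sum i)
    show "\<delta> * (\<Sum>i<N. indicator A \<theta> * (cmod (trig n (c i) \<theta>))\<^sup>2) \<le> Re (qS n c \<theta>)" for \<theta>
    proof (cases "\<theta> \<in> A")
      case True
      then show ?thesis using lower[OF True, of "tvec n c \<theta>"] by (simp add: tvec_norm qS_def)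
    next
      case False
      then show ?thesis using psd[of \<theta> "tvec n c \<theta>"] by (simp add: qS_def)
    qed
  qed simp
  finally show ?thesis .
qed

end


section \<open>Reduction of the process to the partially independent model\<close>

text \<open>The cyclic shift, a permutation matrix, written in the basis \<open>V\<close>; both are
  unitary. In the new basis it loses its sparse form, and the later estimates use its unitarity
  instead.\<close>

lemma shift_orthonormal:
  fixes V :: "nat \<Rightarrow> nat \<Rightarrow> complex" and n L :: nat
  assumes V: "orthonormal {..<n} {..<n} V"
  shows "orthonormal {..<n} {..<n} (\<lambda>c a. \<Sum>l<n. cnj (V a ((l + L) mod n)) * V c l)"
  unfolding orthonormal_def
proof (intro ballI)
  fix b c assume bc: "b \<in> {..<n}" "c \<in> {..<n}"
  then have n: "0 < n" by auto
  let ?s = "\<lambda>l. (l + L) mod n"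
  \<comment> \<open>Injectivity of the shift: indices with equal image differ by a multiple of
    \<open>n\<close>, and both are below \<open>n\<close>.\<close>
  have le: "l' \<le> l" if "?s l = ?s l'" "l' < n" for l l'
  proof (rule ccontr)
    assume "\<not> l' \<le> l"
    then have "n dvd (l' + L) - (l + L)"
      using that(1) mod_eq_dvd_iff_nat[of "l + L" "l' + L" n] by simp
    then have "n \<le> l' - l" using \<open>\<not> l' \<le> l\<close> by (intro dvd_imp_le) auto
    then show False using that(2) \<open>\<not> l' \<le> l\<close> by simp
  qed
  have inj: "l = l'" if "?s l = ?s l'" "l < n" "l' < n" for l l'
    using le[of l l'] le[of l' l] that by simp
  have V3: "(\<Sum>a<n. cnj (V a (?s l)) * V a (?s l')) = (if l = l' then 1 else 0)" if l: "l < n" "l' < n" for l l'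
  proof -
    have "(\<Sum>a<n. V a (?s l') * cnj (V a (?s l))) = (if ?s l' = ?s l then 1 else 0)"
      using n by (intro orthonormal_complete(3)[OF _ _ _ V]) auto
    then show ?thesis using inj[of l l'] l by (auto simp: mult.commute)
  qed
  have "cinner {..<n} (\<lambda>a. \<Sum>l<n. cnj (V a (?s l)) * V b l) (\<lambda>a. \<Sum>l<n. cnj (V a (?s l)) * V c l)
     = (\<Sum>a<n. \<Sum>l<n. \<Sum>l'<n. V b l * cnj (V c l') * (cnj (V a (?s l)) * V a (?s l')))"
    by (simp add: cinner_def sum_product mult_ac)
  also have "\<dots> = (\<Sum>l<n. \<Sum>a<n. \<Sum>l'<n. V b l * cnj (V c l') * (cnj (V a (?s l)) * V a (?s l')))"
    by (rule sum.swap)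
  also have "\<dots> = (\<Sum>l<n. \<Sum>l'<n. \<Sum>a<n. V b l * cnj (V c l') * (cnj (V a (?s l)) * V a (?s l')))"
    by (rule sum.cong[OF refl], rule sum.swap)
  also have "\<dots> = (\<Sum>l<n. \<Sum>l'<n. if l' = l then V b l * cnj (V c l') else 0)"
    unfolding sum_distrib_left[symmetric] using V3 by (intro sum.cong refl) auto
  also have "\<dots> = cinner {..<n} (V b) (V c)"
    by (simp add: cinner_def)
  also have "\<dots> = (if b = c then 1 else 0)" using V bc by (simp add: orthonormal_def)
  finally show "cinner {..<n} (\<lambda>a. \<Sum>l<n. cnj (V a (?s l)) * V b l) (\<lambda>a. \<Sum>l<n. cnj (V a (?s l)) * V c l)
     = (if b = c then 1 else 0)" .
qed

context spectral_gaussian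
begin

text \<open>Entries of the sample matrix in the basis \<open>V\<close>, scaled so that the empirical
  autocovariance is \<open>Y J Y\<^sup>*\<close> without a factor in front.\<close>

definition ent :: "nat \<Rightarrow> (nat \<Rightarrow> nat \<Rightarrow> complex) \<Rightarrow> nat \<times> nat \<Rightarrow> 'a \<Rightarrow> complex" where
  "ent n V j \<omega> = 1 / of_real (sqrt (real n)) * (\<Sum>k<n. V (snd j) k * x (int k) \<omega> $ fst j)"

text \<open>A linear form with coefficients \<open>c\<close> in the entries of \<open>Y\<close>,
  rewritten as a linear form in the samples. The change of basis is unitary, so norms change only
  through the scaling.\<close>

definition coef :: "nat \<Rightarrow> (nat \<Rightarrow> nat \<Rightarrow> complex) \<Rightarrow> (nat \<times> nat \<Rightarrow> complex) \<Rightarrow> nat \<Rightarrow> nat \<Rightarrow> complex" where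
  "coef n V c i k = 1 / of_real (sqrt (real n)) * (\<Sum>a<n. c (i, a) * V a k)"

lemma sum_ent: "(\<Sum>j\<in>{..<N} \<times> {..<n}. c j * ent n V j \<omega>) = lin n (coef n V c) \<omega>"
proof -
  have "(\<Sum>j\<in>{..<N} \<times> {..<n}. c j * ent n V j \<omega>) = (\<Sum>i<N. \<Sum>a<n. c (i, a) * ent n V (i, a) \<omega>)"
    by (subst sum.cartesian_product) (simp add: case_prod_unfold)
  also have "\<dots> = (\<Sum>i<N. \<Sum>a<n. \<Sum>k<n. 1 / of_real (sqrt (real n)) * (c (i, a) * V a k) * x (int k) \<omega> $ i)"
    by (simp add: ent_def sum_distrib_left mult_ac)
  also have "\<dots> = (\<Sum>i<N. \<Sum>k<n. \<Sum>a<n. 1 / of_real (sqrt (real n)) * (c (i, a) * V a k) * x (int k) \<omega> $ i)"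
    by (rule sum.cong[OF refl], rule sum.swap)
  also have "\<dots> = (\<Sum>i<N. \<Sum>k<n. coef n V c i k * x (int k) \<omega> $ i)"
    by (simp only: coef_def sum_distrib_left sum_distrib_right)
  also have "\<dots> = lin n (coef n V c) \<omega>"
    unfolding lin_def by (rule sum.swap)
  finally show ?thesis .
qed

lemma coef_inner:
  assumes V: "orthonormal {..<n} {..<n} V" and a: "a < n"
  shows "cinner {..<n} (coef n V c i) (V a) = c (i, a) / of_real (sqrt (real n))"
proof -
  have "cinner {..<n} (coef n V c i) (V a) = 1 / of_real (sqrt (real n)) * (\<Sum>b<n. c (i, b) * cinner {..<n} (V b) (V a))"
    unfolding coef_def[abs_def] cinner_scale_left cinner_sum_left ..
  also have "(\<Sum>b<n. c (i, b) * cinner {..<n} (V b) (V a)) = (\<Sum>b<n. if b = a then c (i, b) else 0)"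
    using V a by (intro sum.cong) (auto simp: orthonormal_def)
  finally show ?thesis using a by simp
qed

lemma coef_norm:
  assumes V: "orthonormal {..<n} {..<n} V" and n: "0 < n"
  shows "(l2n {..<n} (coef n V c i))\<^sup>2 = (\<Sum>a<n. (cmod (c (i, a)))\<^sup>2) / real n"
proof -
  have "(l2n {..<n} (coef n V c i))\<^sup>2 = (\<Sum>a<n. (cmod (cinner {..<n} (coef n V c i) (V a)))\<^sup>2)"
    by (rule orthonormal_complete(2)[OF _ _ _ V]) auto
  also have "\<dots> = (\<Sum>a<n. (cmod (c (i, a)))\<^sup>2 / real n)"
    using n by (intro sum.cong refl) (simp add: coef_inner[OF V] norm_divide power_divide)
  finally show ?thesis by (simp add: sum_divide_distrib)
qed

lemma coef_mom_upper:
  assumes V: "orthonormal {..<n} {..<n} V" and n: "0 < n"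
  shows "mom n (coef n V c) \<le> KS / real n * (\<Sum>j\<in>{..<N} \<times> {..<n}. (cmod (c j))\<^sup>2)"
proof -
  have "mom n (coef n V c) \<le> KS * (\<Sum>i<N. (\<Sum>a<n. (cmod (c (i, a)))\<^sup>2) / real n)"
    using mom_upper[of n "coef n V c"] by (simp add: coef_norm[OF V n])
  also have "\<dots> = KS / real n * (\<Sum>i<N. \<Sum>a<n. (cmod (c (i, a)))\<^sup>2)"
    by (simp add: sum_divide_distrib[symmetric])
  also have "(\<Sum>i<N. \<Sum>a<n. (cmod (c (i, a)))\<^sup>2) = (\<Sum>j\<in>{..<N} \<times> {..<n}. (cmod (c j))\<^sup>2)"
    by (subst sum.cartesian_product) (simp add: case_prod_unfold)
  finally show ?thesis .
qed

text \<open>The factor \<open>1 / 2\<close> is the lower bound on the eigenvalues kept in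
  \<open>G\<close>, and \<open>1 / n\<close> comes from the scaling of the entries. This is the room
  from which private noise is split off.\<close>

lemma coef_mom_lower:
  assumes V: "orthonormal {..<n} {..<n} V" and n: "0 < n" and G: "G \<subseteq> {..<n}"
    and low: "\<And>w. 1 / 2 * (\<Sum>a\<in>G. (cmod (cinner {..<n} w (V a)))\<^sup>2)
      \<le> 1 / (2 * pi) * (LINT \<theta>|circle_measure. indicator A \<theta> * (cmod (trig n w \<theta>))\<^sup>2)"
  shows "\<delta> / (2 * real n) * (\<Sum>j\<in>{..<N} \<times> G. (cmod (c j))\<^sup>2) \<le> mom n (coef n V c)"
proof -
  have inner: "(\<Sum>a\<in>G. (cmod (cinner {..<n} (coef n V c i) (V a)))\<^sup>2) = (\<Sum>a\<in>G. (cmod (c (i, a)))\<^sup>2) / real n" for i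
  proof -
    have "(\<Sum>a\<in>G. (cmod (cinner {..<n} (coef n V c i) (V a)))\<^sup>2) = (\<Sum>a\<in>G. (cmod (c (i, a)))\<^sup>2 / real n)"
    proof (intro sum.cong refl)
      fix a assume "a \<in> G"
      then have "a < n" using G by auto
      then show "(cmod (cinner {..<n} (coef n V c i) (V a)))\<^sup>2 = (cmod (c (i, a)))\<^sup>2 / real n"
        using n by (simp add: coef_inner[OF V] norm_divide power_divide)
    qed
    then show ?thesis by (simp add: sum_divide_distrib)
  qed
  have "(\<Sum>j\<in>{..<N} \<times> G. (cmod (c j))\<^sup>2) = (\<Sum>i<N. \<Sum>a\<in>G. (cmod (c (i, a)))\<^sup>2)"
    by (subst sum.cartesian_product) (simp add: case_prod_unfold)
  then have "\<delta> / (2 * real n) * (\<Sum>j\<in>{..<N} \<times> G. (cmod (c j))\<^sup>2)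
     = \<delta> * (\<Sum>i<N. 1 / 2 * (\<Sum>a\<in>G. (cmod (cinner {..<n} (coef n V c i) (V a)))\<^sup>2))"
    unfolding inner by (simp add: sum_divide_distrib[symmetric] sum_distrib_left[symmetric])
  also have "\<dots> \<le> \<delta> * (\<Sum>i<N. 1 / (2 * pi) * (LINT \<theta>|circle_measure. indicator A \<theta> * (cmod (trig n (coef n V c i) \<theta>))\<^sup>2))"
    using \<delta> by (intro mult_left_mono sum_mono low) simp
  also have "\<dots> \<le> mom n (coef n V c)" by (rule mom_lower)
  finally show ?thesis .
qed

lemma ent_prod_integrable:
  assumes "fst j < N" "fst j' < N"
  shows "integrable M (\<lambda>\<omega>. ent n V j \<omega> * cnj (ent n V j' \<omega>))"
proof -
  have e: "ent n V j \<omega> = (\<Sum>k<n. 1 / of_real (sqrt (real n)) * V (snd j) k * crd (int k, fst j) \<omega>)" for j \<omega>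
    by (simp add: ent_def crd_def sum_distrib_left mult.assoc)
  have "integrable M (\<lambda>\<omega>. \<Sum>k<n. \<Sum>l<n. (1 / of_real (sqrt (real n)) * V (snd j) k * cnj (1 / of_real (sqrt (real n)) * V (snd j') l))
     * (crd (int k, fst j) \<omega> * cnj (crd (int l, fst j') \<omega>)))"
    using assms by (intro Bochner_Integration.integrable_sum integrable_mult_right crd_prod_integrable) auto
  then show ?thesis
    unfolding e cnj_sum sum_product complex_cnj_mult by (simp only: mult_ac)
qed

lemma mom_kernel:
  "of_real (mom n (coef n V c)) = (\<Sum>j\<in>{..<N} \<times> {..<n}. \<Sum>j'\<in>{..<N} \<times> {..<n}.
     c j * cnj (c j') * (CLINT \<omega>|M. ent n V j \<omega> * cnj (ent n V j' \<omega>)))"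
proof -
  let ?E = "{..<N} \<times> {..<n}"
  have hb: "has_bochner_integral M (\<lambda>\<omega>. \<Sum>j\<in>?E. \<Sum>j'\<in>?E. c j * cnj (c j') * (ent n V j \<omega> * cnj (ent n V j' \<omega>)))
    (\<Sum>j\<in>?E. \<Sum>j'\<in>?E. c j * cnj (c j') * (CLINT \<omega>|M. ent n V j \<omega> * cnj (ent n V j' \<omega>)))"
    by (intro has_bochner_integral_sum has_bochner_integral_mult_right has_bochner_integral_integrable ent_prod_integrable) auto
  have "of_real (mom n (coef n V c)) = (CLINT \<omega>|M. of_real ((cmod (lin n (coef n V c) \<omega>))\<^sup>2))"
    unfolding mom_def by (rule integral_complex_of_real[symmetric])
  also have "\<dots> = (CLINT \<omega>|M. \<Sum>j\<in>?E. \<Sum>j'\<in>?E. c j * cnj (c j') * (ent n V j \<omega> * cnj (ent n V j' \<omega>)))"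
    by (intro Bochner_Integration.integral_cong refl)
      (simp only: complex_norm_square sum_ent[symmetric] cnj_sum sum_product complex_cnj_mult mult_ac)
  finally show ?thesis using has_bochner_integral_integral_eq[OF hb] by simp
qed

text \<open>Subtract \<open>b\<^sup>2\<close> from the diagonal of the covariance kernel at the
  entries in the columns \<open>G\<close>. By \<open>coef_mom_lower\<close> the rest is still
  nonnegative, hence a Gram kernel of some \<open>B0\<close>. The rows of \<open>B0\<close> become
  the \<open>Inl\<close> variables, and one private variable per entry in the columns
  \<open>G\<close> restores what was subtracted.\<close>

lemma gaussian_model_exists:
  assumes V: "orthonormal {..<n} {..<n} V" and n: "0 < n" and G: "G \<subseteq> {..<n}"
    and low: "\<And>w. 1 / 2 * (\<Sum>a\<in>G. (cmod (cinner {..<n} w (V a)))\<^sup>2)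
      \<le> 1 / (2 * pi) * (LINT \<theta>|circle_measure. indicator A \<theta> * (cmod (trig n w \<theta>))\<^sup>2)"
  shows "\<exists>m0 (B :: nat + nat \<times> nat \<Rightarrow> nat \<times> nat \<Rightarrow> complex). gauss_model N n G {..<m0} B (sqrt (\<delta> / 2) / sqrt (real n)) \<and>
    (\<forall>c. (\<Sum>m\<in>gauss_model.IDX N G {..<m0}. (cmod (\<Sum>j\<in>{..<N} \<times> {..<n}. c j * B m j))\<^sup>2) = mom n (coef n V c))"
proof -
  let ?E = "{..<N} \<times> {..<n}"
  define b where "b = sqrt (\<delta> / 2) / sqrt (real n)"
  have b: "0 < b" "b\<^sup>2 = \<delta> / (2 * real n)" using \<delta> n by (auto simp: b_def power_divide)
  have finG: "finite G" using G finite_subset by auto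
  define Kc where "Kc j j' = (CLINT \<omega>|M. ent n V j \<omega> * cnj (ent n V j' \<omega>))" for j j'
  define K0 where "K0 j j' = Kc j j' - (if j = j' \<and> snd j \<in> G then of_real (b\<^sup>2) else 0)" for j j'
  have herm: "K0 j j' = cnj (K0 j' j)" for j j'
  proof -
    have "cnj (Kc j' j) = (CLINT \<omega>|M. cnj (ent n V j' \<omega> * cnj (ent n V j \<omega>)))"
      unfolding Kc_def by (rule Bochner_Integration.integral_cnj[symmetric])
    also have "\<dots> = Kc j j'" unfolding Kc_def by (simp add: mult.commute)
    finally show ?thesis by (auto simp: K0_def)
  qed
  have diag: "(\<Sum>j\<in>?E. \<Sum>j'\<in>?E. c j * cnj (c j') * (if j = j' \<and> snd j \<in> G then of_real (b\<^sup>2) else 0))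
     = of_real (b\<^sup>2 * (\<Sum>j\<in>{..<N} \<times> G. (cmod (c j))\<^sup>2))" for c
  proof -
    have "(\<Sum>j\<in>?E. \<Sum>j'\<in>?E. c j * cnj (c j') * (if j = j' \<and> snd j \<in> G then of_real (b\<^sup>2) else 0))
      = (\<Sum>j\<in>?E. \<Sum>j'\<in>?E. if j' = j then (if snd j \<in> G then of_real (b\<^sup>2 * (cmod (c j))\<^sup>2) else 0) else 0)"
      by (intro sum.cong refl) (simp add: complex_norm_square del: of_real_power)
    also have "\<dots> = (\<Sum>j\<in>?E. if snd j \<in> G then of_real (b\<^sup>2 * (cmod (c j))\<^sup>2) else 0)" by simp
    also have "\<dots> = (\<Sum>j\<in>{..<N} \<times> G. of_real (b\<^sup>2 * (cmod (c j))\<^sup>2))"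
      using G by (intro sum.mono_neutral_cong_right) auto
    finally show ?thesis by (simp add: sum_distrib_left)
  qed
  have form: "(\<Sum>j\<in>?E. \<Sum>j'\<in>?E. c j * cnj (c j') * K0 j j')
     = of_real (mom n (coef n V c) - b\<^sup>2 * (\<Sum>j\<in>{..<N} \<times> G. (cmod (c j))\<^sup>2))" for c
    unfolding K0_def right_diff_distrib sum_subtractf diag of_real_diff mom_kernel Kc_def ..
  \<comment> \<open>The moment form pairs \<open>c j\<close> with \<open>cnj (c j')\<close>, the
    matrix form pairs \<open>cnj (w j)\<close> with \<open>w j'\<close>; so it is evaluated at the
    conjugate of \<open>w\<close>.\<close>
  have psd0: "0 \<le> Re (cinner ?E (mapply ?E K0 w) w)" for w
  proof -
    have "cinner ?E (mapply ?E K0 w) w = (\<Sum>j\<in>?E. \<Sum>j'\<in>?E. cnj (w j) * cnj (cnj (w j')) * K0 j j')"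
      by (simp add: cinner_def mapply_def sum_distrib_right sum_distrib_left mult_ac)
    also have "\<dots> = of_real (mom n (coef n V (\<lambda>j. cnj (w j))) - b\<^sup>2 * (\<Sum>j\<in>{..<N} \<times> G. (cmod (cnj (w j)))\<^sup>2))"
      by (rule form)
    finally show ?thesis
      using coef_mom_lower[OF V n G low, of "\<lambda>j. cnj (w j)"] b(2) by simp
  qed
  have "\<exists>B0. \<forall>j\<in>?E. \<forall>j'\<in>?E. K0 j j' = (\<Sum>m<card ?E. B0 m j * cnj (B0 m j'))"
    by (rule psd_kernel_factorization[OF _ herm psd0]) simp
  then obtain B0 where B0: "\<forall>j\<in>?E. \<forall>j'\<in>?E. K0 j j' = (\<Sum>m<card ?E. B0 m j * cnj (B0 m j'))" by blast
  define B where "B = case_sum B0 (\<lambda>q j. if j = q then complex_of_real b else 0)"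
  define m0 where "m0 = card ?E"
  interpret gm: gauss_model N n G "{..<m0}" B b
    by unfold_locales (use G b in \<open>auto simp: B_def\<close>)
  have "(\<Sum>m\<in>gm.IDX. (cmod (\<Sum>j\<in>?E. c j * B m j))\<^sup>2) = mom n (coef n V c)" for c
  proof -
    have "(\<Sum>m\<in>gm.IDX. (cmod (\<Sum>j\<in>?E. c j * B m j))\<^sup>2)
      = (\<Sum>m<m0. (cmod (\<Sum>j\<in>?E. c j * B0 m j))\<^sup>2) + (\<Sum>q\<in>{..<N} \<times> G. (cmod (\<Sum>j\<in>?E. c j * (if j = q then complex_of_real b else 0)))\<^sup>2)"
      unfolding gm.IDX_def using finG
      by (subst sum.union_disjoint) (auto simp: sum.reindex B_def)
    also have "(\<Sum>q\<in>{..<N} \<times> G. (cmod (\<Sum>j\<in>?E. c j * (if j = q then complex_of_real b else 0)))\<^sup>2)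
      = b\<^sup>2 * (\<Sum>j\<in>{..<N} \<times> G. (cmod (c j))\<^sup>2)"
      unfolding sum_distrib_left
    proof (intro sum.cong refl)
      fix q assume q: "q \<in> {..<N} \<times> G"
      have "(\<Sum>j\<in>?E. c j * (if j = q then complex_of_real b else 0)) = (\<Sum>j\<in>?E. if j = q then c j * of_real b else 0)"
        by (intro sum.cong) auto
      also have "\<dots> = c q * of_real b" using q G by auto
      finally show "(cmod (\<Sum>j\<in>?E. c j * (if j = q then complex_of_real b else 0)))\<^sup>2 = b\<^sup>2 * (cmod (c q))\<^sup>2"
        by (simp add: norm_mult power_mult_distrib mult.commute)
    qed
    also have "(\<Sum>m<m0. (cmod (\<Sum>j\<in>?E. c j * B0 m j))\<^sup>2) = mom n (coef n V c) - b\<^sup>2 * (\<Sum>j\<in>{..<N} \<times> G. (cmod (c j))\<^sup>2)"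
    proof -
      have "complex_of_real (\<Sum>m<m0. (cmod (\<Sum>j\<in>?E. c j * B0 m j))\<^sup>2)
         = (\<Sum>m<m0. \<Sum>j\<in>?E. \<Sum>j'\<in>?E. c j * cnj (c j') * (B0 m j * cnj (B0 m j')))"
        unfolding of_real_sum by (simp only: complex_norm_square cnj_sum sum_product complex_cnj_mult mult_ac)
      also have "\<dots> = (\<Sum>j\<in>?E. \<Sum>m<m0. \<Sum>j'\<in>?E. c j * cnj (c j') * (B0 m j * cnj (B0 m j')))"
        by (rule sum.swap)
      also have "\<dots> = (\<Sum>j\<in>?E. \<Sum>j'\<in>?E. \<Sum>m<m0. c j * cnj (c j') * (B0 m j * cnj (B0 m j')))"
        by (rule sum.cong[OF refl], rule sum.swap)
      also have "\<dots> = (\<Sum>j\<in>?E. \<Sum>j'\<in>?E. c j * cnj (c j') * K0 j j')"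
      proof (intro sum.cong refl)
        fix j j' assume "j \<in> ?E" "j' \<in> ?E"
        then have "K0 j j' = (\<Sum>m<m0. B0 m j * cnj (B0 m j'))" using B0 unfolding m0_def by blast
        then show "(\<Sum>m<m0. c j * cnj (c j') * (B0 m j * cnj (B0 m j'))) = c j * cnj (c j') * K0 j j'"
          by (simp add: sum_distrib_left)
      qed
      finally show ?thesis unfolding form by (simp only: of_real_eq_iff)
    qed
    finally show ?thesis by simp
  qed
  then show ?thesis using gm.gauss_model_axioms unfolding b_def by blast
qed

lemma process_value:
  assumes V: "orthonormal {..<n} {..<n} V" and n: "0 < n" and l: "l < n"
  shows "(\<Sum>a<n. ent n V (i, a) \<omega> * cnj (V a l)) = x (int l) \<omega> $ i / of_real (sqrt (real n))"
proof -
  have "(\<Sum>a<n. ent n V (i, a) \<omega> * cnj (V a l))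
    = (\<Sum>a<n. \<Sum>k<n. 1 / of_real (sqrt (real n)) * x (int k) \<omega> $ i * (V a k * cnj (V a l)))"
    by (simp add: ent_def sum_distrib_left sum_distrib_right mult_ac)
  also have "\<dots> = (\<Sum>k<n. 1 / of_real (sqrt (real n)) * x (int k) \<omega> $ i * (\<Sum>a<n. V a k * cnj (V a l)))"
    unfolding sum_distrib_left by (rule sum.swap)
  also have "\<dots> = (\<Sum>k<n. if k = l then 1 / of_real (sqrt (real n)) * x (int k) \<omega> $ i else 0)"
    using l orthonormal_complete(3)[OF _ _ _ V] by (intro sum.cong) auto
  finally show ?thesis using l by simp
qed

text \<open>Undoing the change of basis on the two sides of \<open>J\<close> returns the shifted and
  the unshifted samples, and the two factors \<open>1 / sqrt n\<close> make up the
  \<open>1 / n\<close> of the empirical autocovariance.\<close>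

lemma emp_autocov_res_vec:
  fixes V :: "nat \<Rightarrow> nat \<Rightarrow> complex" and n L i :: nat
  assumes V: "orthonormal {..<n} {..<n} V" and n: "0 < n" and i: "i < N"
  defines "J \<equiv> \<lambda>a c. \<Sum>l<n. cnj (V a ((l + L) mod n)) * V c l"
  shows "mapply {..<N} (\<lambda>i j. (emp_autocov N n x L \<omega> - z \<cdot>\<^sub>m 1\<^sub>m N) $$ (i, j)) v i =
    res_vec N n J z (\<lambda>j\<in>{..<N} \<times> {..<n}. ent n V j \<omega>) v i"
proof -
  let ?Y = "\<lambda>j\<in>{..<N} \<times> {..<n}. ent n V j \<omega>"
  let ?r = "complex_of_real (sqrt (real n))"
  have "?r * ?r = of_real (sqrt (real n) * sqrt (real n))" by (rule of_real_mult[symmetric])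
  then have r: "?r * ?r = of_nat n" by simp
  have adj: "(\<Sum>c<n. V c l * adj_vec N ?Y v c) = (\<Sum>j<N. cnj (x (int l) \<omega> $ j) * v j) / ?r" if l: "l < n" for l
  proof -
    have "(\<Sum>c<n. V c l * adj_vec N ?Y v c) = (\<Sum>c<n. \<Sum>j<N. v j * cnj (ent n V (j, c) \<omega> * cnj (V c l)))"
      by (simp add: adj_vec_def sum_distrib_left mult_ac)
    also have "\<dots> = (\<Sum>j<N. v j * cnj (\<Sum>c<n. ent n V (j, c) \<omega> * cnj (V c l)))"
      unfolding cnj_sum sum_distrib_left by (rule sum.swap)
    also have "\<dots> = (\<Sum>j<N. v j * cnj (x (int l) \<omega> $ j / ?r))"
      unfolding process_value[OF V n l] ..
    finally show ?thesis by (simp add: sum_divide_distrib mult.commute)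
  qed
  have "(\<Sum>a<n. ?Y (i, a) * mid_vec N n J ?Y v a) = (\<Sum>a<n. ent n V (i, a) \<omega> * mid_vec N n J ?Y v a)"
    using i by (intro sum.cong) auto
  also have "\<dots> = (\<Sum>a<n. \<Sum>c<n. \<Sum>l<n. (ent n V (i, a) \<omega> * cnj (V a ((l + L) mod n))) * (V c l * adj_vec N ?Y v c))"
    by (simp add: mid_vec_def J_def sum_distrib_left sum_distrib_right mult_ac)
  also have "\<dots> = (\<Sum>a<n. \<Sum>l<n. \<Sum>c<n. (ent n V (i, a) \<omega> * cnj (V a ((l + L) mod n))) * (V c l * adj_vec N ?Y v c))"
    by (rule sum.cong[OF refl], rule sum.swap)
  also have "\<dots> = (\<Sum>l<n. \<Sum>a<n. \<Sum>c<n. (ent n V (i, a) \<omega> * cnj (V a ((l + L) mod n))) * (V c l * adj_vec N ?Y v c))"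
    by (rule sum.swap)
  also have "\<dots> = (\<Sum>l<n. (\<Sum>a<n. ent n V (i, a) \<omega> * cnj (V a ((l + L) mod n))) * (\<Sum>c<n. V c l * adj_vec N ?Y v c))"
    by (simp only: sum_product)
  also have "\<dots> = (\<Sum>l<n. x (int ((l + L) mod n)) \<omega> $ i / ?r * ((\<Sum>j<N. cnj (x (int l) \<omega> $ j) * v j) / ?r))"
  proof (intro sum.cong refl)
    fix l assume "l \<in> {..<n}"
    then have l: "l < n" "(l + L) mod n < n" using n by auto
    show "(\<Sum>a<n. ent n V (i, a) \<omega> * cnj (V a ((l + L) mod n))) * (\<Sum>c<n. V c l * adj_vec N ?Y v c)
      = x (int ((l + L) mod n)) \<omega> $ i / ?r * ((\<Sum>j<N. cnj (x (int l) \<omega> $ j) * v j) / ?r)"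
      unfolding process_value[OF V n l(2)] adj[OF l(1)] ..
  qed
  also have "\<dots> = (\<Sum>l<n. \<Sum>j<N. 1 / of_nat n * (x (int ((l + L) mod n)) \<omega> $ i * cnj (x (int l) \<omega> $ j)) * v j)"
    unfolding times_divide_times_eq r by (simp add: sum_distrib_left sum_divide_distrib mult_ac)
  also have "\<dots> = (\<Sum>j<N. \<Sum>l<n. 1 / of_nat n * (x (int ((l + L) mod n)) \<omega> $ i * cnj (x (int l) \<omega> $ j)) * v j)"
    by (rule sum.swap)
  also have "\<dots> = (\<Sum>j<N. emp_autocov N n x L \<omega> $$ (i, j) * v j)"
    using i by (simp add: emp_autocov_def sum_distrib_left sum_distrib_right)
  finally have main: "(\<Sum>a<n. ?Y (i, a) * mid_vec N n J ?Y v a) = (\<Sum>j<N. emp_autocov N n x L \<omega> $$ (i, j) * v j)" .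
  have "mapply {..<N} (\<lambda>i j. (emp_autocov N n x L \<omega> - z \<cdot>\<^sub>m 1\<^sub>m N) $$ (i, j)) v i
    = (\<Sum>j<N. emp_autocov N n x L \<omega> $$ (i, j) * v j - (if i = j then z * v j else 0))"
    unfolding mapply_def using i by (intro sum.cong) (auto simp: emp_autocov_def left_diff_distrib)
  also have "\<dots> = (\<Sum>j<N. emp_autocov N n x L \<omega> $$ (i, j) * v j) - z * v i"
    using i by (simp add: sum_subtractf)
  finally show ?thesis unfolding res_vec_def main .
qed

text \<open>The model and the process give matrices whose linear forms have the same characteristic
  functions, so the two matrices have the same law and the bound carries over.\<close>

lemma small_sing_val_bound:
  fixes \<rho> \<tau> \<epsilon> t :: real and n k L :: nat
  assumes n: "0 < n" and \<rho>: "real N \<le> \<rho> * real n" and k: "2 \<le> k" "k < N" and z: "z \<noteq> 0"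
    and \<tau>: "0 < \<tau>" "3 * KS * (8 * \<rho> + 9) \<le> \<tau>\<^sup>2"
    and \<epsilon>: "0 < \<epsilon>" "\<epsilon> \<le> 1" "(1 + 2 * (3 * \<tau>)) * \<epsilon> \<le> cmod z / 2"
      "\<epsilon> * (6 * (3 * \<tau> + 2)) * exp (1 + 4 * (3 * \<tau> * (1 + 2 * (3 * \<tau>)) / cmod z + 2)\<^sup>2 / (\<delta> / 2)) \<le> 1"
    and t: "0 < t" "t \<le> \<epsilon>" "exp 3 * (4 * t\<^sup>2 * (real n)\<^sup>2 / (\<epsilon>\<^sup>2 * (\<delta> / 2))) \<le> real (k - 1)"
  shows "measure M {\<omega>\<in>space M. sing_val (emp_autocov N n x L \<omega> - z \<cdot>\<^sub>m 1\<^sub>m N) (N - k - 1) \<le> t}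
    \<le> 2 * exp (- real n) + real n * exp (- 2 * real (k - 1))"
proof -
  let ?E = "{..<N} \<times> {..<n}"
  obtain V G where V: "orthonormal {..<n} {..<n} V" and G: "G \<subseteq> {..<n}" and Gc: "4 * card ({..<n} - G) \<le> n"
    and low: "\<And>w. 1 / 2 * (\<Sum>a\<in>G. (cmod (cinner {..<n} w (V a)))\<^sup>2)
      \<le> 1 / (2 * pi) * (LINT \<theta>|circle_measure. indicator A \<theta> * (cmod (trig n w \<theta>))\<^sup>2)"
    using toep_large_eigenvalues[OF A, of n] by blast
  obtain m0 B where gm: "gauss_model N n G {..<m0} B (sqrt (\<delta> / 2) / sqrt (real n))"
    and mom: "\<And>c. (\<Sum>m\<in>gauss_model.IDX N G {..<m0}. (cmod (\<Sum>j\<in>?E. c j * B m j))\<^sup>2) = mom n (coef n V c)"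
    using gaussian_model_exists[OF V n G low] by blast
  interpret gm: gauss_model N n G "{..<m0}" B "sqrt (\<delta> / 2) / sqrt (real n)" by (rule gm)
  have Ent: "gm.Ent = ?E" by (simp add: gm.Ent_def)
  define J where "J = (\<lambda>a c. \<Sum>l<n. cnj (V a ((l + L) mod n)) * V c l)"
  have J: "orthonormal {..<n} {..<n} (\<lambda>c a. J a c)"
    unfolding J_def by (rule shift_orthonormal[OF V])
  have s2: "(sqrt (\<delta> / 2))\<^sup>2 = \<delta> / 2" using \<delta> by simp
  have a: "0 < sqrt (\<delta> / 2)" using \<delta> by simp
  have Dm: "(\<Sum>m\<in>gm.IDX. (cmod (\<Sum>j\<in>gm.Ent. c j * B m j))\<^sup>2) \<le> KS / real n * (\<Sum>j\<in>gm.Ent. (cmod (c j))\<^sup>2)" for c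
    unfolding Ent mom by (rule coef_mom_upper[OF V n])
  have e4: "\<epsilon> * (6 * (3 * \<tau> + 2)) * exp (1 + 4 * (3 * \<tau> * (1 + 2 * (3 * \<tau>)) / cmod z + 2)\<^sup>2 / (sqrt (\<delta> / 2))\<^sup>2) \<le> 1"
    unfolding s2 by (rule \<epsilon>(4))
  have t3: "exp 3 * (4 * t\<^sup>2 * (real n)\<^sup>2 / (\<epsilon>\<^sup>2 * (sqrt (\<delta> / 2))\<^sup>2)) \<le> real (k - 1)"
    unfolding s2 by (rule t(3))
  have "\<exists>F\<in>sets gm.YM. (\<forall>Y\<in>space gm.YM. (\<exists>v. l2n {..<N} v \<noteq> 0 \<and> (\<forall>i<k. v i = 0) \<and>
        l2n {..<N} (res_vec N n J z Y v) \<le> t * l2n {..<N} v) \<longrightarrow> Y \<in> F) \<and>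
      emeasure (cgauss_space gm.IDX) {h\<in>space (cgauss_space gm.IDX). gm.fam h \<in> F}
        \<le> ennreal (2 * exp (- real n) + real n * exp (- 2 * real (k - 1)))"
    by (rule gm.model_bound[OF n refl a KS Dm \<rho> Gc k(1) less_imp_le[OF k(2)] J z \<tau> \<epsilon>(1-3) e4 t(1,2) t3])
  then obtain F where F: "F \<in> sets gm.YM"
    "\<And>Y v. Y \<in> space gm.YM \<Longrightarrow> l2n {..<N} v \<noteq> 0 \<Longrightarrow> (\<forall>i<k. v i = 0) \<Longrightarrow>
        l2n {..<N} (res_vec N n J z Y v) \<le> t * l2n {..<N} v \<Longrightarrow> Y \<in> F"
    "emeasure (cgauss_space gm.IDX) {h\<in>space (cgauss_space gm.IDX). gm.fam h \<in> F}
        \<le> ennreal (2 * exp (- real n) + real n * exp (- 2 * real (k - 1)))" by blast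
  define Yt where "Yt = (\<lambda>\<omega>. \<lambda>j\<in>?E. ent n V j \<omega>)"
  have em: "ent n V j \<in> borel_measurable M" if "j \<in> ?E" for j
  proof -
    have "(\<lambda>\<omega>. x (int l) \<omega> $ fst j) \<in> borel_measurable M" for l
      using gauss that unfolding complex_gaussian_process_def by auto
    then show ?thesis unfolding ent_def[abs_def] by simp
  qed
  have law: "distr M (PiM ?E (\<lambda>_. borel)) Yt = distr (cgauss_space gm.IDX) (PiM ?E (\<lambda>_. borel)) gm.fam"
    unfolding Yt_def gm.fam_def Ent
  proof (rule complex_law_unique[OF _ prob_space_axioms prob_space_cgauss_space])
    fix c
    have "(\<Sum>j\<in>?E. c j * (\<Sum>m\<in>gm.IDX. B m j * cg h m)) = (\<Sum>m\<in>gm.IDX. (\<Sum>j\<in>?E. c j * B m j) * cg h m)" for h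
      unfolding sum_distrib_left sum_distrib_right by (subst sum.swap) (simp add: mult.assoc)
    then have "(CLINT h|cgauss_space gm.IDX. iexp (Re (\<Sum>j\<in>?E. c j * (\<Sum>m\<in>gm.IDX. B m j * cg h m)))) = of_real (exp (- mom n (coef n V c) / 4))"
      using char_complex_gaussian_family[OF gm.finite_sets(2), of "\<lambda>m. \<Sum>j\<in>?E. c j * B m j"] by (simp add: mom)
    then show "(CLINT \<omega>|M. iexp (Re (\<Sum>j\<in>?E. c j * ent n V j \<omega>)))
      = (CLINT h|cgauss_space gm.IDX. iexp (Re (\<Sum>j\<in>?E. c j * (\<Sum>m\<in>gm.IDX. B m j * cg h m))))"
      unfolding sum_ent lin_char by simp
  qed (auto intro!: em)
  have Ym: "Yt \<in> measurable M gm.YM"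
    unfolding Yt_def Ent by (rule measurable_restrict) (rule em)
  \<comment> \<open>An inclusion into the measurable event suffices: monotonicity of the measure
    asks for measurability of the larger set only.\<close>
  have sub: "{\<omega>\<in>space M. sing_val (emp_autocov N n x L \<omega> - z \<cdot>\<^sub>m 1\<^sub>m N) (N - k - 1) \<le> t} \<subseteq> {\<omega>\<in>space M. Yt \<omega> \<in> F}"
  proof safe
    fix \<omega> assume \<omega>: "\<omega> \<in> space M" and s: "sing_val (emp_autocov N n x L \<omega> - z \<cdot>\<^sub>m 1\<^sub>m N) (N - k - 1) \<le> t"
    have c: "emp_autocov N n x L \<omega> - z \<cdot>\<^sub>m 1\<^sub>m N \<in> carrier_mat N N" by (auto simp: emp_autocov_def)
    obtain v where v: "\<exists>i<N. v i \<noteq> 0" "\<forall>i<k. v i = 0"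
      "l2n {..<N} (mapply {..<N} (\<lambda>i j. (emp_autocov N n x L \<omega> - z \<cdot>\<^sub>m 1\<^sub>m N) $$ (i, j)) v) \<le> t * l2n {..<N} v"
      using sing_val_le_imp_vector[OF c k(2) _ s] t(1) by auto
    have "l2n {..<N} (mapply {..<N} (\<lambda>i j. (emp_autocov N n x L \<omega> - z \<cdot>\<^sub>m 1\<^sub>m N) $$ (i, j)) v)
       = l2n {..<N} (res_vec N n J z (Yt \<omega>) v)"
      unfolding J_def Yt_def using emp_autocov_res_vec[OF V n] by (intro l2n_cong) simp
    then have "l2n {..<N} (res_vec N n J z (Yt \<omega>) v) \<le> t * l2n {..<N} v" using v(3) by simp
    moreover have "l2n {..<N} v \<noteq> 0" using v(1) by (auto simp: l2n_eq_0)
    moreover have "Yt \<omega> \<in> space gm.YM" using measurable_space[OF Ym \<omega>] .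
    ultimately show "Yt \<omega> \<in> F" using F(2) v(2) by blast
  qed
  have Yv: "{\<omega>\<in>space M. Yt \<omega> \<in> F} = Yt -` F \<inter> space M" by blast
  have fv: "{h\<in>space (cgauss_space gm.IDX). gm.fam h \<in> F} = gm.fam -` F \<inter> space (cgauss_space gm.IDX)" by blast
  have FM: "{\<omega>\<in>space M. Yt \<omega> \<in> F} \<in> sets M"
    unfolding Yv by (rule measurable_sets[OF Ym F(1)])
  have "emeasure M {\<omega>\<in>space M. Yt \<omega> \<in> F} = emeasure (distr M gm.YM Yt) F"
    unfolding Yv by (rule emeasure_distr[OF Ym F(1), symmetric])
  also have "\<dots> = emeasure (distr (cgauss_space gm.IDX) gm.YM gm.fam) F"
    unfolding Ent law ..
  also have "\<dots> = emeasure (cgauss_space gm.IDX) {h\<in>space (cgauss_space gm.IDX). gm.fam h \<in> F}"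
    unfolding fv by (rule emeasure_distr[OF gm.fam_measurable F(1)])
  finally have "emeasure M {\<omega>\<in>space M. Yt \<omega> \<in> F} \<le> ennreal (2 * exp (- real n) + real n * exp (- 2 * real (k - 1)))"
    using F(3) by (rule ord_eq_le_trans)
  then have "ennreal (measure M {\<omega>\<in>space M. Yt \<omega> \<in> F}) \<le> ennreal (2 * exp (- real n) + real n * exp (- 2 * real (k - 1)))"
    by (simp only: emeasure_eq_measure)
  then have le: "measure M {\<omega>\<in>space M. Yt \<omega> \<in> F} \<le> 2 * exp (- real n) + real n * exp (- 2 * real (k - 1))"
    by (rule ennreal_le_iff[THEN iffD1, rotated]) (intro add_nonneg_nonneg mult_nonneg_nonneg exp_ge_zero; simp)
  show ?thesis
    by (rule order.trans[OF finite_measure_mono[OF sub FM] le])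
qed

end


section \<open>Spectral densities with few small singular values\<close>

text \<open>Far from sharp; it supplies finiteness of suprema and continuity in the vector, where
  the size of the constant is irrelevant.\<close>

lemma mapply_crude_bound:
  assumes "finite I" "finite J"
  shows "l2n J (mapply I h v) \<le> (\<Sum>j\<in>J. \<Sum>i\<in>I. cmod (h j i)) * l2n I v"
proof -
  have "l2n J (mapply I h v) \<le> (\<Sum>j\<in>J. cmod (mapply I h v j))"
    unfolding l2n_def by (rule L2_set_le_sum) simp
  also have "\<dots> \<le> (\<Sum>j\<in>J. \<Sum>i\<in>I. cmod (h j i) * l2n I v)"
  proof (intro sum_mono)
    fix j
    have "cmod (mapply I h v j) \<le> (\<Sum>i\<in>I. cmod (h j i * v i))"
      unfolding mapply_def by (rule norm_sum)
    also have "\<dots> \<le> (\<Sum>i\<in>I. cmod (h j i) * l2n I v)"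
      unfolding norm_mult by (intro sum_mono mult_left_mono norm_le_l2n assms) auto
    finally show "cmod (mapply I h v j) \<le> (\<Sum>i\<in>I. cmod (h j i) * l2n I v)" .
  qed
  also have "\<dots> = (\<Sum>j\<in>J. \<Sum>i\<in>I. cmod (h j i)) * l2n I v"
    by (simp add: sum_distrib_right)
  finally show ?thesis .
qed

lemma mult_mat_vec_mapply:
  assumes "B \<in> carrier_mat N N" "i < N"
  shows "(B *\<^sub>v Matrix.vec N v) $ i = mapply {..<N} (\<lambda>i j. B $$ (i, j)) v i"
  using assms by (simp add: mapply_def scalar_prod_def atLeast0LessThan)

lemma spectral_norm_bound:
  assumes B: "B \<in> carrier_mat N N" and K: "spectral_norm B \<le> K"
  shows "l2n {..<N} (mapply {..<N} (\<lambda>i j. B $$ (i, j)) v) \<le> K * l2n {..<N} v"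
proof (cases "l2n {..<N} v = 0")
  case True
  have "l2n {..<N} (mapply {..<N} (\<lambda>i j. B $$ (i, j)) v) \<le> (\<Sum>j<N. \<Sum>i<N. cmod (B $$ (j, i))) * l2n {..<N} v"
    by (rule mapply_crude_bound) auto
  then show ?thesis using True by simp
next
  case False
  let ?h = "\<lambda>i j. B $$ (i, j)"
  let ?U = "{v \<in> carrier_vec (dim_col B). cvec_norm v \<le> 1}"
  have dims: "dim_row B = N" "dim_col B = N" using B by auto
  have norm_eq: "cvec_norm (B *\<^sub>v w) = l2n {..<N} (mapply {..<N} ?h (\<lambda>i. w $ i))" if "w \<in> carrier_vec N" for w
  proof -
    have w: "w = Matrix.vec N (\<lambda>i. w $ i)" using that by auto
    have "(B *\<^sub>v w) $ i = mapply {..<N} ?h (\<lambda>i. w $ i) i" if "i < N" for i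
      by (subst w) (rule mult_mat_vec_mapply[OF B that])
    then show ?thesis unfolding cvec_norm_def l2n_def using dims by (intro L2_set_cong) auto
  qed
  have norm_vec: "cvec_norm w = l2n {..<N} (\<lambda>i. w $ i)" if "w \<in> carrier_vec N" for w
    using that by (simp add: cvec_norm_def l2n_def)
  \<comment> \<open>\<open>spectral_norm\<close> is a supremum of reals, so it dominates its members
    only once they are known to be bounded.\<close>
  have bdd: "bdd_above ((\<lambda>v. cvec_norm (B *\<^sub>v v)) ` ?U)"
  proof (rule bdd_aboveI2)
    fix w assume w: "w \<in> ?U"
    then have wN: "w \<in> carrier_vec N" and w1: "l2n {..<N} (\<lambda>i. w $ i) \<le> 1"
      using dims by (auto simp: norm_vec[symmetric])
    have "cvec_norm (B *\<^sub>v w) \<le> (\<Sum>j<N. \<Sum>i<N. cmod (?h j i)) * l2n {..<N} (\<lambda>i. w $ i)"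
      unfolding norm_eq[OF wN] by (rule mapply_crude_bound) auto
    also have "\<dots> \<le> (\<Sum>j<N. \<Sum>i<N. cmod (?h j i)) * 1"
      by (intro mult_left_mono w1 sum_nonneg) auto
    finally show "cvec_norm (B *\<^sub>v w) \<le> (\<Sum>j<N. \<Sum>i<N. cmod (?h j i)) * 1" .
  qed
  define r where "r = l2n {..<N} v"
  have r: "0 < r" using False by (simp add: r_def less_le)
  define w where "w = Matrix.vec N (\<lambda>i. of_real (1 / r) * v i)"
  have wN: "w \<in> carrier_vec N" by (simp add: w_def)
  have wi: "l2n {..<N} (\<lambda>i. w $ i) = l2n {..<N} (\<lambda>i. of_real (1 / r) * v i)"
    by (rule l2n_cong) (simp add: w_def)
  have "l2n {..<N} (\<lambda>i. w $ i) = 1"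
    unfolding wi l2n_scale r_def[symmetric] norm_of_real using r by simp
  then have "w \<in> ?U" using wN dims by (simp add: norm_vec[OF wN])
  then have "cvec_norm (B *\<^sub>v w) \<le> spectral_norm B"
    unfolding spectral_norm_def by (rule cSUP_upper[OF _ bdd])
  then have "l2n {..<N} (mapply {..<N} ?h (\<lambda>i. w $ i)) \<le> K" using K norm_eq[OF wN] by simp
  moreover have "l2n {..<N} (mapply {..<N} ?h (\<lambda>i. w $ i)) = l2n {..<N} (mapply {..<N} ?h (\<lambda>i. of_real (1 / r) * v i))"
    by (intro l2n_cong mapply_cong) (simp add: w_def)
  moreover have "\<dots> = l2n {..<N} (mapply {..<N} ?h v) / r"
    unfolding mapply_scale l2n_scale norm_of_real using r by simp
  ultimately have "l2n {..<N} (mapply {..<N} ?h v) / r \<le> K" by simp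
  then show ?thesis unfolding r_def[symmetric] using r by (simp add: pos_divide_le_eq)
qed

lemma hermitian_nonneg_entries:
  assumes B: "B \<in> hermitian_nonneg N"
  shows "i < N \<Longrightarrow> j < N \<Longrightarrow> B $$ (i, j) = cnj (B $$ (j, i))"
    and "0 \<le> Re (cinner {..<N} (mapply {..<N} (\<lambda>i j. B $$ (i, j)) v) v)"
proof -
  have c: "B \<in> carrier_mat N N" and h: "mat_adjoint B = B"
    and q: "\<And>v. v \<in> carrier_vec N \<Longrightarrow> 0 \<le> Re (qform B v)"
    using B by (auto simp: hermitian_nonneg_def)
  show "B $$ (i, j) = cnj (B $$ (j, i))" if ij: "i < N" "j < N"
  proof -
    have "mat_adjoint B $$ (i, j) = cnj (B $$ (j, i))"
      using ij c by (simp add: mat_adjoint_def mat_of_rows_def)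
    then show ?thesis by (simp only: h)
  qed
  have "qform B (Matrix.vec N v) = cinner {..<N} (mapply {..<N} (\<lambda>i j. B $$ (i, j)) v) v"
  proof -
    have "qform B (Matrix.vec N v) = (\<Sum>i<N. (B *\<^sub>v Matrix.vec N v) $ i * cnj (v i))"
      using c by (simp add: qform_def scalar_prod_def atLeast0LessThan)
    also have "\<dots> = cinner {..<N} (mapply {..<N} (\<lambda>i j. B $$ (i, j)) v) v"
      unfolding cinner_def by (intro sum.cong refl) (simp add: mult_mat_vec_mapply[OF c] del: index_mult_mat_vec)
    finally show ?thesis .
  qed
  then show "0 \<le> Re (cinner {..<N} (mapply {..<N} (\<lambda>i j. B $$ (i, j)) v) v)"
    using q[of "Matrix.vec N v"] by simp
qed

text \<open>The infimum of the Rayleigh quotients may be taken over a countable union of finite nets.\<close>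
lemma rayleigh_sublevel_measurable:
  fixes F :: "real \<Rightarrow> nat \<Rightarrow> nat \<Rightarrow> complex" and \<delta> :: real
  assumes meas: "\<And>i j. i < N \<Longrightarrow> j < N \<Longrightarrow> (\<lambda>\<theta>. F \<theta> i j) \<in> borel_measurable borel" and \<delta>: "0 \<le> \<delta>"
    and s: "\<And>\<theta> t. 0 \<le> t \<Longrightarrow> s \<theta> \<le> t \<longleftrightarrow>
      (\<exists>v. (\<exists>i<N. v i \<noteq> 0) \<and> l2n {..<N} (mapply {..<N} (F \<theta>) v) \<le> t * l2n {..<N} v)"
  shows "{\<theta>. s \<theta> \<le> \<delta>} \<in> sets borel"
proof -
  define net where "net m T \<longleftrightarrow> finite T \<and> (\<forall>v. l2n {..<N} v \<le> 1 \<longrightarrow> (\<exists>u\<in>T. l2n {..<N} (\<lambda>i. v i - u i) \<le> 1 / real (Suc m)))" for m T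
  have "\<exists>T. net m T" for m
  proof -
    have e: "0 < 1 / real (Suc m)" by simp
    obtain T where "finite T" "\<forall>v. l2n {..<N} v \<le> 1 \<longrightarrow> (\<exists>u\<in>T. l2n {..<N} (\<lambda>i. v i - u i) \<le> 1 / real (Suc m))"
      using complex_net[OF finite_lessThan[of N] e zero_le_one] by blast
    then have "net m T" unfolding net_def by blast
    then show ?thesis ..
  qed
  then have "\<exists>T. \<forall>m. net m (T m)" by (intro choice allI)
  then obtain T where nT: "\<And>m. net m (T m)" by blast
  have T: "finite (T m)" "l2n {..<N} v \<le> 1 \<Longrightarrow> \<exists>u\<in>T m. l2n {..<N} (\<lambda>i. v i - u i) \<le> 1 / real (Suc m)" for m v
    using nT[of m] unfolding net_def by blast+
  define D where "D = (\<Union>m. T m)"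
  have D: "countable D" unfolding D_def by (rule countable_UN) (simp_all add: countable_finite T(1))
  \<comment> \<open>Levels decreasing to \<open>\<delta>\<close>: the closed condition at level
    \<open>\<delta>\<close> for some vector is equivalent to the strict condition at every level
    \<open>d p\<close> for some net point.\<close>
  define d where "d p = \<delta> + 1 / real (Suc p)" for p
  have eq: "{\<theta>. s \<theta> \<le> \<delta>} = (\<Inter>p. \<Union>u\<in>D. {\<theta>\<in>space borel. l2n {..<N} (mapply {..<N} (F \<theta>) u) < d p * l2n {..<N} u})"
  proof (intro equalityI subsetI)
    fix \<theta> assume "\<theta> \<in> {\<theta>. s \<theta> \<le> \<delta>}"
    then have "s \<theta> \<le> \<delta>" by simp
    then obtain v where v: "\<exists>i<N. v i \<noteq> 0" "l2n {..<N} (mapply {..<N} (F \<theta>) v) \<le> \<delta> * l2n {..<N} v"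
      using s[OF \<delta>] by blast
    define r where "r = l2n {..<N} v"
    have "r \<noteq> 0" using v(1) by (auto simp: r_def l2n_eq_0)
    then have r: "0 < r" by (simp add: r_def less_le)
    define w where "w = (\<lambda>i. of_real (1 / r) * v i)"
    have w1: "l2n {..<N} w = 1" unfolding w_def l2n_scale r_def[symmetric] norm_of_real using r by simp
    have w2: "l2n {..<N} (mapply {..<N} (F \<theta>) w) \<le> \<delta>"
      unfolding w_def mapply_scale l2n_scale norm_of_real using v(2) r by (simp add: r_def[symmetric] pos_divide_le_eq)
    have "\<exists>u\<in>D. l2n {..<N} (mapply {..<N} (F \<theta>) u) < d p * l2n {..<N} u" for p
    proof -
      define B where "B = (\<Sum>i<N. \<Sum>j<N. cmod (F \<theta> i j))"
      have B: "0 \<le> B" unfolding B_def by (intro sum_nonneg) auto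
      have dp: "0 < d p" using \<delta> by (simp add: d_def add_nonneg_pos)
      \<comment> \<open>Replacing \<open>w\<close> by a net point at distance
        \<open>1 / (m + 1)\<close> loses at most \<open>(B + d p) / (m + 1)\<close>, which has to
        stay below the slack \<open>1 / (p + 1)\<close>.\<close>
      obtain m where m: "(B + d p) * real (Suc p) < real m" using reals_Archimedean2 by blast
      obtain u where u: "u \<in> T m" "l2n {..<N} (\<lambda>i. w i - u i) \<le> 1 / real (Suc m)"
        using T(2)[of w m] w1 by auto
      have Fu: "l2n {..<N} (mapply {..<N} (F \<theta>) u) \<le> \<delta> + B * (1 / real (Suc m))"
      proof -
        have "mapply {..<N} (F \<theta>) u = (\<lambda>i. mapply {..<N} (F \<theta>) w i - mapply {..<N} (F \<theta>) (\<lambda>i. w i - u i) i)"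
          unfolding mapply_diff by simp
        then have "l2n {..<N} (mapply {..<N} (F \<theta>) u)
           \<le> l2n {..<N} (mapply {..<N} (F \<theta>) w) + l2n {..<N} (mapply {..<N} (F \<theta>) (\<lambda>i. w i - u i))"
          by (simp only:) (rule l2n_triangle_diff)
        also have "\<dots> \<le> \<delta> + B * l2n {..<N} (\<lambda>i. w i - u i)"
          unfolding B_def by (intro add_mono w2 mapply_crude_bound) auto
        also have "\<dots> \<le> \<delta> + B * (1 / real (Suc m))"
          by (intro add_left_mono mult_left_mono u(2) B)
        finally show ?thesis .
      qed
      have lu: "1 - 1 / real (Suc m) \<le> l2n {..<N} u"
        using l2n_triangle[of "{..<N}" "\<lambda>i. w i - u i" u] u(2) w1 by simp
      have "(B + d p) * (1 / real (Suc m)) < 1 / real (Suc p)"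
      proof -
        have "(B + d p) * real (Suc p) < real (Suc m)" using m by simp
        then show ?thesis by (simp add: field_simps)
      qed
      then have "\<delta> + B * (1 / real (Suc m)) < d p * (1 - 1 / real (Suc m))"
        by (simp add: d_def algebra_simps)
      also have "\<dots> \<le> d p * l2n {..<N} u" using lu dp by (intro mult_left_mono) auto
      finally have "l2n {..<N} (mapply {..<N} (F \<theta>) u) < d p * l2n {..<N} u" using Fu by (rule order.strict_trans1[rotated])
      moreover have "u \<in> D" using u(1) by (auto simp: D_def)
      ultimately show ?thesis by blast
    qed
    then show "\<theta> \<in> (\<Inter>p. \<Union>u\<in>D. {\<theta>\<in>space borel. l2n {..<N} (mapply {..<N} (F \<theta>) u) < d p * l2n {..<N} u})"
      by auto
  next
    fix \<theta> assume \<theta>: "\<theta> \<in> (\<Inter>p. \<Union>u\<in>D. {\<theta>\<in>space borel. l2n {..<N} (mapply {..<N} (F \<theta>) u) < d p * l2n {..<N} u})"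
    have le: "s \<theta> \<le> d p" for p
    proof -
      obtain u where u: "l2n {..<N} (mapply {..<N} (F \<theta>) u) < d p * l2n {..<N} u" using \<theta> by blast
      have "l2n {..<N} u \<noteq> 0"
      proof
        assume "l2n {..<N} u = 0"
        then show False using u l2n_nonneg[of "{..<N}" "mapply {..<N} (F \<theta>) u"] by simp
      qed
      then have "\<exists>i<N. u i \<noteq> 0" by (auto simp: l2n_eq_0)
      moreover have "0 \<le> d p" using \<delta> by (simp add: d_def)
      ultimately show ?thesis using s[of "d p" \<theta>] u by (meson less_imp_le)
    qed
    have "s \<theta> \<le> \<delta>"
    proof (rule ccontr)
      assume "\<not> s \<theta> \<le> \<delta>"
      then obtain p where "inverse (real (Suc p)) < s \<theta> - \<delta>" using reals_Archimedean[of "s \<theta> - \<delta>"] by auto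
      then show False using le[of p] by (simp add: d_def inverse_eq_divide)
    qed
    then show "\<theta> \<in> {\<theta>. s \<theta> \<le> \<delta>}" by simp
  qed
  have "(\<lambda>\<theta>. cmod (mapply {..<N} (F \<theta>) u i)) \<in> borel_measurable borel" if "i \<in> {..<N}" for u i
    unfolding mapply_def by (intro measurable_compose[OF _ borel_measurable_norm] borel_measurable_sum borel_measurable_times meas) (use that in auto)
  note mm = this
  have "(\<lambda>\<theta>. l2n {..<N} (mapply {..<N} (F \<theta>) u)) \<in> borel_measurable borel" for u
    unfolding l2n_def L2_set_def
    by (intro measurable_compose[OF _ borel_measurable_sqrt] borel_measurable_sum borel_measurable_power mm)
  then have "{\<theta>\<in>space borel. l2n {..<N} (mapply {..<N} (F \<theta>) u) < d p * l2n {..<N} u} \<in> sets borel" for p u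
    by (intro borel_measurable_less) auto
  then show ?thesis unfolding eq
    by (intro sets.countable_INT'' sets.countable_UN' D) auto
qed

text \<open>\<open>emeasure\<close> is 0 on sets that are not measurable, so the bound in A2 says
  something about the size of the exceptional set, and of its complement, only once this is
  known.\<close>

lemma least_sing_val_sublevel_measurable:
  assumes S: "spectral_density N R S" and N: "1 \<le> N" and \<delta>: "0 \<le> \<delta>"
  shows "{\<theta>\<in>{0..<2 * pi}. sing_val (S (cis \<theta>)) (N - 1) \<le> \<delta>} \<in> sets borel"
proof -
  \<comment> \<open>Integrability of the entries is given on the interval only. The cut-off entries
    are measurable on the whole line and agree with the original ones on
    \<open>{0..<2 * pi}\<close>.\<close>
  define F where "F \<theta> i j = indicator {0..2 * pi} \<theta> *\<^sub>R S (cis \<theta>) $$ (i, j)" for \<theta> i j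
  have meas: "(\<lambda>\<theta>. F \<theta> i j) \<in> borel_measurable borel" if "i < N" "j < N" for i j
  proof -
    have "set_integrable lborel {0..2 * pi} (\<lambda>\<theta>. S (cis \<theta>) $$ (i, j))"
      using S that by (simp add: spectral_density_def)
    then have "(\<lambda>\<theta>. F \<theta> i j) \<in> borel_measurable lborel"
      unfolding set_integrable_def F_def by (rule borel_measurable_integrable)
    then show ?thesis by simp
  qed
  define s where "s \<theta> = sing_val (Matrix.mat N N (\<lambda>(i, j). F \<theta> i j)) (N - 1)" for \<theta>
  have "{\<theta>. s \<theta> \<le> \<delta>} \<in> sets borel"
  proof (rule rayleigh_sublevel_measurable[OF meas \<delta>])
    fix \<theta> t :: real assume t: "0 \<le> t"
    have "l2n {..<N} (mapply {..<N} (\<lambda>i j. Matrix.mat N N (\<lambda>(i, j). F \<theta> i j) $$ (i, j)) v) = l2n {..<N} (mapply {..<N} (F \<theta>) v)" for v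
      by (intro l2n_cong) (simp add: mapply_def)
    then show "s \<theta> \<le> t \<longleftrightarrow> (\<exists>v. (\<exists>i<N. v i \<noteq> 0) \<and> l2n {..<N} (mapply {..<N} (F \<theta>) v) \<le> t * l2n {..<N} v)"
      unfolding s_def using least_sing_val_le_iff[of "Matrix.mat N N (\<lambda>(i, j). F \<theta> i j)" N t] N t by simp
  qed
  moreover have "s \<theta> = sing_val (S (cis \<theta>)) (N - 1)" if "\<theta> \<in> {0..<2 * pi}" for \<theta>
  proof -
    have "S (cis \<theta>) \<in> carrier_mat N N" using S by (auto simp: spectral_density_def hermitian_nonneg_def)
    then have "Matrix.mat N N (\<lambda>(i, j). F \<theta> i j) = S (cis \<theta>)"
      using that by (intro eq_matI) (auto simp: F_def)
    then show ?thesis by (simp add: s_def)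
  qed
  then have "{\<theta>\<in>{0..<2 * pi}. sing_val (S (cis \<theta>)) (N - 1) \<le> \<delta>} = {0..<2 * pi} \<inter> {\<theta>. s \<theta> \<le> \<delta>}" by auto
  ultimately show ?thesis by auto
qed

lemma spectral_gaussian_exists:
  assumes cg: "circ_gaussian M N x" and S: "spectral_density N (autocov M N x) S" and N: "1 \<le> N"
    and K: "0 < K" "\<And>\<theta>. spectral_norm (S (cis \<theta>)) \<le> K" and \<delta>: "0 < \<delta>"
    and small: "emeasure lborel {\<theta>\<in>{0..<2 * pi}. sing_val (S (cis \<theta>)) (N - 1) \<le> \<delta>} \<le> ennreal (1 / 2)"
  shows "\<exists>A. spectral_gaussian M N x S K \<delta> A"
proof -
  have herm: "S (cis \<theta>) \<in> hermitian_nonneg N" for \<theta> using S by (simp add: spectral_density_def)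
  then have c: "S (cis \<theta>) \<in> carrier_mat N N" for \<theta> by (simp add: hermitian_nonneg_def)
  define B where "B = {\<theta>\<in>{0..<2 * pi}. sing_val (S (cis \<theta>)) (N - 1) \<le> \<delta>}"
  have B: "B \<in> sets borel" unfolding B_def using least_sing_val_sublevel_measurable[OF S N] \<delta> by simp
  define A where "A = {0..<2 * pi} - B"
  have A: "A \<in> sets borel" using B by (simp add: A_def)
  have "measure lborel A = measure lborel {0..<2 * pi} - measure lborel B"
    unfolding A_def using B by (intro measure_Diff) (auto simp: B_def)
  moreover have "measure lborel B \<le> 1 / 2"
    unfolding measure_def using small by (intro enn2real_leI) (auto simp: B_def)
  moreover have "measure circle_measure (A \<inter> {0..2 * pi}) = measure lborel A"
  proof -
    have "A \<inter> {0..2 * pi} = A" by (auto simp: A_def)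
    then show ?thesis unfolding circle_measure_def
      by (subst measure_restrict_space) (auto simp: A_def)
  qed
  ultimately have big: "2 * pi - 1 / 2 \<le> measure circle_measure (A \<inter> {0..2 * pi})" by simp
  have "spectral_gaussian M N x S K \<delta> A"
  proof (intro spectral_gaussian.intro spectral_gaussian_axioms.intro cg S A big \<delta> K(1) hermitian_nonneg_entries(2)[OF herm])
    fix \<theta> v
    let ?h = "\<lambda>i j. S (cis \<theta>) $$ (i, j)"
    have "Re (cinner {..<N} (mapply {..<N} ?h v) v) \<le> cmod (cinner {..<N} (mapply {..<N} ?h v) v)"
      by (rule complex_Re_le_cmod)
    also have "\<dots> \<le> l2n {..<N} (mapply {..<N} ?h v) * l2n {..<N} v" by (rule cmod_cinner_le)
    also have "\<dots> \<le> K * l2n {..<N} v * l2n {..<N} v"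
      by (intro mult_right_mono spectral_norm_bound c K(2)) simp
    finally show "Re (cinner {..<N} (mapply {..<N} ?h v) v) \<le> K * (l2n {..<N} v)\<^sup>2"
      by (simp add: power2_eq_square mult.assoc)
  next
    fix \<theta> v assume "\<theta> \<in> A"
    then have "\<delta> < sing_val (S (cis \<theta>)) (N - 1)" by (auto simp: A_def B_def)
    then show "\<delta> * (l2n {..<N} v)\<^sup>2 \<le> Re (cinner {..<N} (mapply {..<N} (\<lambda>i j. S (cis \<theta>) $$ (i, j)) v) v)"
      using N \<delta> by (intro psd_quadratic_lower[OF c] hermitian_nonneg_entries[OF herm]) auto
  qed
  then show ?thesis ..
qed

section \<open>Choice of constants\<close>

text \<open>The choice of \<open>c\<close> makes both \<open>exp (- n)\<close> and
  \<open>exp (- k)\<close> at most \<open>exp (- 2 * c * k)\<close>: the former by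
  \<open>2 * k \<le> N \<le> \<rho>2 * n\<close>, the latter by \<open>c \<le> 1 / 2\<close>. One of
  the two factors \<open>exp (- c * k)\<close> is kept, the other absorbs the constants, since
  \<open>k\<close> grows at least like a power of \<open>N\<close>.\<close>

lemma tail_absorbed:
  fixes \<beta> \<rho>1 \<rho>2 :: real
  assumes pos: "0 < \<beta>" "0 < \<rho>1" "0 < \<rho>2"
  obtains c where "0 < c" "\<forall>\<^sub>F N in sequentially. \<forall>k n :: nat. real N powr \<beta> - 1 \<le> real k \<and> real k \<le> real N / 2 \<and>
      \<rho>1 * real n \<le> real N \<and> real N \<le> \<rho>2 * real n \<longrightarrow>
      2 \<le> k \<and> k < N \<and> 2 * exp (- real n) + real n * exp (- 2 * real (k - 1)) \<le> exp (- c * real k)"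
proof -
  define c where "c = min (1 / 2) (1 / \<rho>2)"
  have c: "0 < c" "c \<le> 1 / 2" "c \<le> 1 / \<rho>2" using pos by (auto simp: c_def)
  \<comment> \<open>The three asymptotic facts provide, in turn, \<open>2 \<le> k\<close>, the
    absorption of a factor 4 by \<open>exp (- c * k)\<close>, and that of the factor
    \<open>n\<close> by \<open>exp (2 - k)\<close>.\<close>
  have "\<forall>\<^sub>F N in sequentially. 3 \<le> real N powr \<beta>" using pos by real_asymp
  moreover have "\<forall>\<^sub>F N in sequentially. exp (- c * (real N powr \<beta> - 1)) \<le> 1 / 4" using pos c by real_asymp
  moreover have "\<forall>\<^sub>F N in sequentially. real N / \<rho>1 * exp (3 - real N powr \<beta>) \<le> 2" using pos by real_asymp
  ultimately have "\<forall>\<^sub>F N in sequentially. \<forall>k n :: nat. real N powr \<beta> - 1 \<le> real k \<and> real k \<le> real N / 2 \<and>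
      \<rho>1 * real n \<le> real N \<and> real N \<le> \<rho>2 * real n \<longrightarrow>
      2 \<le> k \<and> k < N \<and> 2 * exp (- real n) + real n * exp (- 2 * real (k - 1)) \<le> exp (- c * real k)"
  proof eventually_elim
    case (elim N)
    show ?case
    proof (intro allI impI)
      fix k n :: nat
      assume H: "real N powr \<beta> - 1 \<le> real k \<and> real k \<le> real N / 2 \<and> \<rho>1 * real n \<le> real N \<and> real N \<le> \<rho>2 * real n"
      have "2 \<le> real k" using H elim(1) by linarith
      then have k: "2 \<le> k" by simp
      have "k < N" using H \<open>2 \<le> real k\<close> by linarith
      have "c * (2 * real k) \<le> 1 / \<rho>2 * real N" using H c pos by (intro mult_mono) auto
      also have "\<dots> \<le> real n" using H pos by (simp add: field_simps)
      finally have n: "exp (- real n) \<le> exp (- c * real k) * exp (- c * real k)"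
        by (simp flip: exp_add)
      have "- c * real k \<le> - c * (real N powr \<beta> - 1)" using H c by (intro mult_left_mono_neg) auto
      then have q: "exp (- c * real k) \<le> 1 / 4" using elim(2) by (meson exp_le_cancel_iff order.trans)
      have "real n \<le> real N / \<rho>1" using H pos by (simp add: field_simps)
      moreover have "exp (2 - real k) \<le> exp (3 - real N powr \<beta>)" using H by simp
      ultimately have "real n * exp (2 - real k) \<le> real N / \<rho>1 * exp (3 - real N powr \<beta>)"
        by (intro mult_mono) (use pos in auto)
      then have ne: "real n * exp (2 - real k) \<le> 2" using elim(3) by linarith
      have ck: "exp (- real k) \<le> exp (- c * real k) * exp (- c * real k)"
      proof -
        have "c * real k \<le> 1 / 2 * real k" using c by (intro mult_right_mono) auto
        then show ?thesis by (simp flip: exp_add)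
      qed
      \<comment> \<open>About half of the exponent is spent on the factor \<open>n\<close>.\<close>
      have "- 2 * real (k - 1) = (2 - real k) + (- real k)" using k by (simp add: of_nat_diff)
      then have "real n * exp (- 2 * real (k - 1)) = real n * exp (2 - real k) * exp (- real k)"
        by (simp only: exp_add mult.assoc)
      also have "\<dots> \<le> 2 * (exp (- c * real k) * exp (- c * real k))"
        using ne ck by (intro mult_mono) auto
      finally have "2 * exp (- real n) + real n * exp (- 2 * real (k - 1)) \<le> 4 * (exp (- c * real k) * exp (- c * real k))"
        using n by linarith
      also have "\<dots> \<le> 4 * (1 / 4 * exp (- c * real k))"
        using q by (intro mult_left_mono mult_right_mono) auto
      finally show "2 \<le> k \<and> k < N \<and> 2 * exp (- real n) + real n * exp (- 2 * real (k - 1)) \<le> exp (- c * real k)"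
        using k \<open>k < N\<close> by simp
    qed
  qed
  then show thesis by (rule that[OF c(1)])
qed

text \<open>The order of the choices matters: \<open>\<tau>\<close> is fixed by the size of the norm
  nets, then \<open>\<epsilon>\<close> by \<open>\<tau>\<close> and the net over the remaining
  columns, then \<open>C\<close> by \<open>\<epsilon>\<close> and the small ball estimate. None of
  them depends on \<open>N\<close>, \<open>n\<close> or \<open>k\<close>.\<close>

lemma threshold_constants:
  fixes K \<rho> \<rho>1 \<delta> r :: real
  assumes pos: "0 < K" "0 < \<rho>" "0 < \<rho>1" "0 < \<delta>" "0 < r"
  obtains \<tau> \<epsilon> C :: real where "0 < \<tau>" "3 * K * (8 * \<rho> + 9) \<le> \<tau>\<^sup>2"
    "0 < \<epsilon>" "\<epsilon> \<le> 1" "(1 + 2 * (3 * \<tau>)) * \<epsilon> \<le> r / 2"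
    "\<epsilon> * (6 * (3 * \<tau> + 2)) * exp (1 + 4 * (3 * \<tau> * (1 + 2 * (3 * \<tau>)) / r + 2)\<^sup>2 / (\<delta> / 2)) \<le> 1"
    "0 < C"
    "\<forall>N n k :: nat. 2 \<le> k \<longrightarrow> k < N \<longrightarrow> \<rho>1 * real n \<le> real N \<longrightarrow>
      0 < C * sqrt (real k) / real N \<and> C * sqrt (real k) / real N \<le> \<epsilon> \<and>
      exp 3 * (4 * (C * sqrt (real k) / real N)\<^sup>2 * (real n)\<^sup>2 / (\<epsilon>\<^sup>2 * (\<delta> / 2))) \<le> real (k - 1)"
proof -
  define \<tau> where "\<tau> = sqrt (3 * K * (8 * \<rho> + 9))"
  have t0: "0 < 3 * K * (8 * \<rho> + 9)" using pos by simp
  then have \<tau>: "0 < \<tau>" "3 * K * (8 * \<rho> + 9) \<le> \<tau>\<^sup>2" by (auto simp: \<tau>_def)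
  define Q where "Q = 6 * (3 * \<tau> + 2) * exp (1 + 4 * (3 * \<tau> * (1 + 2 * (3 * \<tau>)) / r + 2)\<^sup>2 / (\<delta> / 2))"
  have Q: "0 < Q" unfolding Q_def using \<tau> by (intro mult_pos_pos exp_gt_zero) auto
  define \<epsilon> where "\<epsilon> = min 1 (min (r / 2 / (1 + 2 * (3 * \<tau>))) (1 / Q))"
  have p: "0 < 1 + 2 * (3 * \<tau>)" using \<tau> by simp
  have e0: "0 < \<epsilon>" "\<epsilon> \<le> 1" "\<epsilon> \<le> r / 2 / (1 + 2 * (3 * \<tau>))" "\<epsilon> \<le> 1 / Q" using pos p Q by (auto simp: \<epsilon>_def)
  have e1: "(1 + 2 * (3 * \<tau>)) * \<epsilon> \<le> r / 2" by (subst mult.commute) (rule e0(3)[unfolded pos_le_divide_eq[OF p]])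
  have "\<epsilon> * Q \<le> 1" using e0(4) Q by (simp add: pos_le_divide_eq)
  then have e2: "\<epsilon> * (6 * (3 * \<tau> + 2)) * exp (1 + 4 * (3 * \<tau> * (1 + 2 * (3 * \<tau>)) / r + 2)\<^sup>2 / (\<delta> / 2)) \<le> 1"
    by (simp only: Q_def mult.assoc)
  \<comment> \<open>With \<open>n / N \<le> 1 / \<rho>1\<close> and
    \<open>k \<le> 2 * (k - 1)\<close>, the last condition for the threshold
    \<open>C * sqrt k / N\<close> follows from \<open>C\<^sup>2 \<le> W\<close>.\<close>
  define W where "W = \<rho>1\<^sup>2 * \<epsilon>\<^sup>2 * \<delta> / (16 * exp 3)"
  have W: "0 < W" using pos e0 by (simp add: W_def)
  define C where "C = min \<epsilon> (sqrt W)"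
  have C: "0 < C" "C \<le> \<epsilon>" using e0 W by (auto simp: C_def)
  have "C\<^sup>2 \<le> (sqrt W)\<^sup>2" using C(1) by (intro power_mono) (auto simp: C_def)
  then have CW: "C\<^sup>2 \<le> W" using W by simp
  have t: "0 < C * sqrt (real k) / real N \<and> C * sqrt (real k) / real N \<le> \<epsilon> \<and>
      exp 3 * (4 * (C * sqrt (real k) / real N)\<^sup>2 * (real n)\<^sup>2 / (\<epsilon>\<^sup>2 * (\<delta> / 2))) \<le> real (k - 1)"
    if k: "2 \<le> k" "k < N" and n: "\<rho>1 * real n \<le> real N" for N n k :: nat
  proof (intro conjI)
    have N: "0 < real N" using k by simp
    show "0 < C * sqrt (real k) / real N" using C k N by simp
    have "sqrt (real k) \<le> real N"
    proof -
      have "sqrt (real k) \<le> sqrt ((real k)\<^sup>2)" using k by (intro real_sqrt_le_mono) (simp add: power2_eq_square)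
      then show ?thesis using k by simp
    qed
    then have "C * sqrt (real k) \<le> \<epsilon> * real N" using C e0 by (intro mult_mono) auto
    then show "C * sqrt (real k) / real N \<le> \<epsilon>" using N by (simp add: pos_divide_le_eq)
    have "(\<rho>1 * real n)\<^sup>2 \<le> (real N)\<^sup>2" using n pos by (intro power_mono) auto
    then have nN: "(real n)\<^sup>2 / (real N)\<^sup>2 \<le> 1 / \<rho>1\<^sup>2"
      using N pos by (simp add: power_mult_distrib field_simps)
    have kk: "real k \<le> 2 * real (k - 1)" using k by (simp add: of_nat_diff)
    have "(C * sqrt (real k) / real N)\<^sup>2 * (real n)\<^sup>2 = C\<^sup>2 * real k * ((real n)\<^sup>2 / (real N)\<^sup>2)"
      by (simp add: power_mult_distrib power_divide)
    also have "\<dots> \<le> W * (2 * real (k - 1)) * (1 / \<rho>1\<^sup>2)"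
      using CW W kk nN by (intro mult_mono) auto
    also have "\<dots> = real (k - 1) * (\<epsilon>\<^sup>2 * \<delta> / (8 * exp 3))"
      using pos by (simp add: W_def field_simps)
    finally have main: "(C * sqrt (real k) / real N)\<^sup>2 * (real n)\<^sup>2 \<le> real (k - 1) * (\<epsilon>\<^sup>2 * \<delta> / (8 * exp 3))" .
    have "exp 3 * (4 * (C * sqrt (real k) / real N)\<^sup>2 * (real n)\<^sup>2 / (\<epsilon>\<^sup>2 * (\<delta> / 2)))
      = 8 * exp 3 / (\<epsilon>\<^sup>2 * \<delta>) * ((C * sqrt (real k) / real N)\<^sup>2 * (real n)\<^sup>2)" by simp
    also have "\<dots> \<le> 8 * exp 3 / (\<epsilon>\<^sup>2 * \<delta>) * (real (k - 1) * (\<epsilon>\<^sup>2 * \<delta> / (8 * exp 3)))"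
      using main pos e0 by (intro mult_left_mono) auto
    also have "\<dots> = real (k - 1)" using pos e0 by simp
    finally show "exp 3 * (4 * (C * sqrt (real k) / real N)\<^sup>2 * (real n)\<^sup>2 / (\<epsilon>\<^sup>2 * (\<delta> / 2))) \<le> real (k - 1)" .
  qed
  show thesis by (rule that[OF \<tau> e0(1,2) e1 e2 C(1)], intro allI impI, rule t)
qed

theorem theorem2:
  fixes M :: "nat \<Rightarrow> 'a measure"
    and x :: "nat \<Rightarrow> int \<Rightarrow> 'a \<Rightarrow> cvector"
    and S :: "nat \<Rightarrow> complex \<Rightarrow> cmatrix"
    and n :: "nat \<Rightarrow> nat"
    and L :: nat
    and \<beta> :: real
    and z :: complex
  assumes prob: "\<And>N. N \<ge> 1 \<Longrightarrow> prob_space (M N)"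
    and gaussian: "\<And>N. N \<ge> 1 \<Longrightarrow> complex_gaussian_process (M N) N (x N)"
    and centered: "\<And>N. N \<ge> 1 \<Longrightarrow> centered_process (M N) N (x N)"
    and circular: "\<And>N. N \<ge> 1 \<Longrightarrow> circularly_symmetric (M N) N (x N)"
    and stationary: "\<And>N. N \<ge> 1 \<Longrightarrow> stationary_process (M N) N (x N)"
    and density: "\<And>N. N \<ge> 1 \<Longrightarrow> spectral_density N (autocov (M N) N (x N)) (S N)"
    and nontrivial: "\<And>N. N \<ge> 1 \<Longrightarrow> nontrivial_density N (S N)"
    and n_pos: "\<And>N. N \<ge> 1 \<Longrightarrow> n N > 0"
    and n_mono: "mono_on {1..} n"
    and ratio_inf: "0 < liminf (\<lambda>N. ereal (real N / real (n N)))"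
    and ratio_sup: "limsup (\<lambda>N. ereal (real N / real (n N))) < \<infinity>"
    and L: "L \<ge> 1"
    and A1: "assumption_A1 (\<lambda>N. autocov (M N) N (x N)) S"
    and A2: "assumption_A2 S"
    and A3: "assumption_A3 S"
    and \<beta>: "0 < \<beta>" "\<beta> < 1"
    and z: "z \<noteq> 0"
  shows "\<exists>c>0. \<exists>C>0. \<exists>N0. \<forall>N\<ge>N0. \<forall>k::nat.
           \<lfloor>real N powr \<beta>\<rfloor> \<le> int k \<and> int k \<le> \<lfloor>real N / 2\<rfloor> \<longrightarrow>
           measure (M N) {\<omega> \<in> space (M N).
             sing_val (emp_autocov N (n N) (x N) L \<omega> - z \<cdot>\<^sub>m 1\<^sub>m N) (N - k - 1)
               \<le> C * sqrt (real k) / real N}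
           \<le> exp (- c * real k)"
proof -
  obtain \<rho>1 where \<rho>1: "0 < ereal \<rho>1" "ereal \<rho>1 < liminf (\<lambda>N. ereal (real N / real (n N)))"
    using ereal_dense2[OF ratio_inf] by blast
  have ev1: "\<forall>\<^sub>F N in sequentially. \<rho>1 < real N / real (n N)"
    using less_LiminfD[OF \<rho>1(2)] by simp
  obtain \<rho>0 :: nat where "limsup (\<lambda>N. ereal (real N / real (n N))) < ereal (real \<rho>0)"
    using less_PInf_Ex_of_nat[THEN iffD1, OF less_imp_neq[OF ratio_sup]] by blast
  then have "\<forall>\<^sub>F N in sequentially. ereal (real N / real (n N)) < ereal (real \<rho>0)" by (rule Limsup_lessD)
  then have ev2: "\<forall>\<^sub>F N in sequentially. real N / real (n N) < real \<rho>0 + 1"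
    by eventually_elim simp
  \<comment> \<open>Adding 1 makes positivity evident.\<close>
  define \<rho>2 where "\<rho>2 = real \<rho>0 + 1"
  have "(SUP N\<in>{1..}. SUP \<theta>. ereal (spectral_norm (S N (cis \<theta>)))) < \<infinity>"
    using A1 by (simp add: assumption_A1_def)
  note fin = this
  obtain K0 :: nat where K0: "(SUP N\<in>{1..}. SUP \<theta>. ereal (spectral_norm (S N (cis \<theta>)))) < ereal (real K0)"
    using less_PInf_Ex_of_nat[THEN iffD1, OF less_imp_neq[OF fin]] by blast
  define K where "K = real K0 + 1"
  have K: "spectral_norm (S N (cis \<theta>)) \<le> K" if "1 \<le> N" for N \<theta>
  proof -
    have "ereal (spectral_norm (S N (cis \<theta>))) \<le> (SUP \<theta>. ereal (spectral_norm (S N (cis \<theta>))))"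
      by (rule SUP_upper) simp
    also have "\<dots> \<le> (SUP N\<in>{1..}. SUP \<theta>. ereal (spectral_norm (S N (cis \<theta>))))"
      using that by (intro SUP_upper) simp
    also have "\<dots> < ereal (real K0)" by (rule K0)
    finally show ?thesis by (simp add: K_def)
  qed
  \<comment> \<open>A2 at \<open>\<kappa> = 1 / 2\<close>: an exceptional set of this length leaves
    at most \<open>n / 4\<close> small eigenvalues of the Toeplitz matrix.\<close>
  have "\<exists>\<delta>>0. (SUP N\<in>{1..}. emeasure lborel {\<theta> \<in> {0..<2*pi}. sing_val (S N (cis \<theta>)) (N - 1) \<le> \<delta>}) \<le> ennreal (1 / 2)"
    using A2[unfolded assumption_A2_def, rule_format, of "1 / 2"] by simp
  then obtain \<delta> where \<delta>: "0 < \<delta>"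
    and SUP: "(SUP N\<in>{1..}. emeasure lborel {\<theta> \<in> {0..<2*pi}. sing_val (S N (cis \<theta>)) (N - 1) \<le> \<delta>}) \<le> ennreal (1 / 2)"
    by blast
  have small: "emeasure lborel {\<theta> \<in> {0..<2*pi}. sing_val (S N (cis \<theta>)) (N - 1) \<le> \<delta>} \<le> ennreal (1 / 2)" if "1 \<le> N" for N
    by (rule order.trans[OF SUP_upper SUP]) (use that in simp)
  have pos: "0 < \<rho>1" "0 < \<rho>2" "0 < K" using \<rho>1(1) by (auto simp: \<rho>2_def K_def)
  have z0: "0 < cmod z" using z by simp
  obtain \<tau> \<epsilon> C where \<tau>: "0 < \<tau>" "3 * K * (8 * \<rho>2 + 9) \<le> \<tau>\<^sup>2"
    and \<epsilon>: "0 < \<epsilon>" "\<epsilon> \<le> 1" "(1 + 2 * (3 * \<tau>)) * \<epsilon> \<le> cmod z / 2"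
      "\<epsilon> * (6 * (3 * \<tau> + 2)) * exp (1 + 4 * (3 * \<tau> * (1 + 2 * (3 * \<tau>)) / cmod z + 2)\<^sup>2 / (\<delta> / 2)) \<le> 1"
    and C: "0 < C"
    and t: "\<forall>N n k :: nat. 2 \<le> k \<longrightarrow> k < N \<longrightarrow> \<rho>1 * real n \<le> real N \<longrightarrow>
      0 < C * sqrt (real k) / real N \<and> C * sqrt (real k) / real N \<le> \<epsilon> \<and>
      exp 3 * (4 * (C * sqrt (real k) / real N)\<^sup>2 * (real n)\<^sup>2 / (\<epsilon>\<^sup>2 * (\<delta> / 2))) \<le> real (k - 1)"
    by (rule threshold_constants[OF pos(3,2,1) \<delta> z0])
  obtain c where c: "0 < c" and tail: "\<forall>\<^sub>F N in sequentially. \<forall>k n :: nat. real N powr \<beta> - 1 \<le> real k \<and> real k \<le> real N / 2 \<and>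
      \<rho>1 * real n \<le> real N \<and> real N \<le> \<rho>2 * real n \<longrightarrow>
      2 \<le> k \<and> k < N \<and> 2 * exp (- real n) + real n * exp (- 2 * real (k - 1)) \<le> exp (- c * real k)"
    by (rule tail_absorbed[OF \<beta>(1) pos(1,2)])
  have "\<forall>\<^sub>F N in sequentially. \<forall>k::nat. \<lfloor>real N powr \<beta>\<rfloor> \<le> int k \<and> int k \<le> \<lfloor>real N / 2\<rfloor> \<longrightarrow>
      measure (M N) {\<omega> \<in> space (M N). sing_val (emp_autocov N (n N) (x N) L \<omega> - z \<cdot>\<^sub>m 1\<^sub>m N) (N - k - 1)
        \<le> C * sqrt (real k) / real N} \<le> exp (- c * real k)"
    using ev1 ev2 tail eventually_ge_at_top[of 1]
  proof eventually_elim
    case (elim N)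
    show ?case
    proof (intro allI impI)
      fix k :: nat assume k: "\<lfloor>real N powr \<beta>\<rfloor> \<le> int k \<and> int k \<le> \<lfloor>real N / 2\<rfloor>"
      have n: "0 < n N" using n_pos elim(4) by simp
      have r: "\<rho>1 * real (n N) \<le> real N" "real N \<le> \<rho>2 * real (n N)"
        using elim(1,2) n by (auto simp: \<rho>2_def pos_less_divide_eq pos_divide_less_eq)
      \<comment> \<open>The lower floor costs 1, the upper one nothing.\<close>
      have "real N powr \<beta> - 1 \<le> real k" "real k \<le> real N / 2" using k by linarith+
      then have kk: "2 \<le> k" "k < N"
        and fin: "2 * exp (- real (n N)) + real (n N) * exp (- 2 * real (k - 1)) \<le> exp (- c * real k)"
        using elim(3) r by blast+
      have "circ_gaussian (M N) N (x N)"
        using elim(4) by (intro circ_gaussian.intro circ_gaussian_axioms.intro prob gaussian centered circular stationary)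
      then obtain A where "spectral_gaussian (M N) N (x N) (S N) K \<delta> A"
        using spectral_gaussian_exists[OF _ density[OF elim(4)] elim(4) pos(3) K[OF elim(4)] \<delta> small[OF elim(4)]] by blast
      from spectral_gaussian.small_sing_val_bound[OF this n r(2) kk z \<tau> \<epsilon>, of "C * sqrt (real k) / real N" L]
      show "measure (M N) {\<omega> \<in> space (M N). sing_val (emp_autocov N (n N) (x N) L \<omega> - z \<cdot>\<^sub>m 1\<^sub>m N) (N - k - 1)
        \<le> C * sqrt (real k) / real N} \<le> exp (- c * real k)"
        using t[rule_format, OF kk r(1)] fin by linarith
    qed
  qed
  then obtain N0 where "\<forall>N\<ge>N0. \<forall>k::nat. \<lfloor>real N powr \<beta>\<rfloor> \<le> int k \<and> int k \<le> \<lfloor>real N / 2\<rfloor> \<longrightarrow>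
      measure (M N) {\<omega> \<in> space (M N). sing_val (emp_autocov N (n N) (x N) L \<omega> - z \<cdot>\<^sub>m 1\<^sub>m N) (N - k - 1)
        \<le> C * sqrt (real k) / real N} \<le> exp (- c * real k)"
    unfolding eventually_sequentially by blast
  then show ?thesis using c C by blast
qed

end
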